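(* Let $(\mu,\nu,\{\omega^r\}_{r\in[0,h]},x,v)$ be an impulse process. Then there exists a sequence of strict sense processes $(u_i,x_i,v_i)$ such that $$(du_i,\ |du_i|=dv_i)\rightharpoonup^*(\mu,\nu),\qquad dx_i\rightharpoonup^*dx,\qquad (x_i,v_i)(t)\to(x,v)(t)\quad\text{for all } t\in E,$$ where $E$ is a full measure subset of $[0,T]$ which contains $0$ and $T$.
   Context: **Standing assumptions.** $N,M\in\mathbb N$, $N\ge1$, $N\ge M$, $h>0$, $T:=Nh$. $\mathcal K\subseteq\mathbb R^m$ is a closed cone, $\check x_0\in\mathbb R^n$; $f,g_1,\dots,g_m:\mathbb R\times(\mathbb R^n)^{M+1}\to\mathbb R^n$ are bounded and of class $C^1$; $\xi_0\in C([-Mh,0],\mathbb R^n)$. **Notation.** $]a,b[$, $[a,b[$, $]a,b]$ denote open/half-open intervals. $\{z(t-kh)\}_k:=(z(t),z(t-h),\dots,z(t-Mh))$ and $\{z_{l-k}\}_k:=(z_l,z_{l-1},\dots,z_{l-M})$. For $w\in\mathbb R^m$, $\|w\|:=\sum_{j=1}^m|w^j|$. $z^-(t),z^+(t)$ are the left and right limits of $z$ at $t$. $C^*([0,T],\mathbb R^m)$ is the set of finite regular $\mathbb R^m$-valued Borel measures on $[0,T]$; $C^\oplus([0,T])$ the set of finite regular nonnegative Borel measures; $C^*_{\mathcal K}([0,T])$ the set of $\mu\in C^*([0,T],\mathbb R^m)$ with range contained in $\mathcal K$. $|\mu|:=\sum_{j=1}^m(\mu^j_++\mu^j_-)$ (Jordan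 decompositions of components); $\mu^c$ is the continuous (atomless) component of $\mu$. $\mu_i\rightharpoonup^*\mu$ means $\int_{[0,T]}\psi\,d\mu_i^j\to\int_{[0,T]}\psi\,d\mu^j$ for all $\psi\in C([0,T],\mathbb R)$ and each component $j$. For a function $z$ of bounded variation on $[0,T]$, right continuous on $]0,T[$, $dz$ is the Borel measure on $[0,T]$ with $dz([0,t])=z(t)-z(0)$ for $t\in]0,T]$. For $\mu\in C^*_{\mathcal K}([0,T])$, $$\mathcal V_c(\mu):=\{\nu\in C^\oplus([0,T]):\ \nu^c=|\mu^c|,\ \exists(\mu_i)\subset C^*_{\mathcal K}([0,T])\text{ with }(\mu_i,|\mu_i|)\rightharpoonup^*(\mu,\nu)\}.$$ **Impulse control.** An impulse control $(\mu,\nu,\{\omega^r\}_{r\in[0,h]})$ consists of $\mu\in C^*_{\mathcal K}([0,T])$, $\nu\in\mathcal V_c(\mu)$ and essentially bounded measurable functions $\omega^r=(\omega^r_1,\dots,\omega^r_N):[0,1]\to\mathcal K^N$, $r\in[0,h]$, such that (with the convention $\omega^h_0\equiv0$, $\omega^0_{N+1}\equiv0$): (1) for each $r\in[0,h]$, $\sum_{l=1}^N\|\omega^r_l(s)\|=\sum_{l=1}^N\int_0^1\|\omega^r_l(s')\|ds'$ for a.e. $s\in[0,1]$; (2) $\int_0^1\|\omega^r_l(s)\|ds=\nu(\{r+(l-1)h\})$ and $\int_0^1\omega^r_l(s)ds=\mu(\{r+(l-1)h\})$ for $r\in]0,h[$, $l=1,\dots,N$; (3) $\int_0^1[\|\omega^h_l(s)\|+\|\omega^0_{l+1}(s)\|]ds=\nu(\{lh\})$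 and $\int_0^1[\omega^h_l(s)+\omega^0_{l+1}(s)]ds=\mu(\{lh\})$ for $l=0,\dots,N$. **Impulse solution/process.** $(x,v)\in BV([-Mh,T],\mathbb R^n)\times BV([0,T],\mathbb R)$ is an impulse solution associated with the impulse control, and $(\mu,\nu,\{\omega^r\}_{r\in[0,h]},x,v)$ is an impulse process, if $x=\xi_0$ on $[-Mh,0[$, $(x,v)(0)=(\check x_0,0)$, $(x,v)((l-1)h)=(\zeta^0_l,\theta^0_l)(1)$ for $l=2,\dots,N+1$ (for $l=N+1$ using $\omega_{N+1}^0\equiv0$, i.e. $(x,v)(T)=(\zeta_N^h,\theta_N^h)(1)$), and for $l=1,\dots,N$, $t\in](l-1)h,lh[$: $$x(t)=\zeta_l^0(1)+\int_{(l-1)h}^tf(t',\{x(t'-kh)\}_k)dt'+\sum_{j=1}^m\int_{[(l-1)h,t]}g_j(t',\{x(t'-kh)\}_k)\,d(\mu^c)^j(t')+\sum_{r\in]0,t-(l-1)h]}\big(\zeta_l^r(1)-x^-(r+(l-1)h)\big),$$ $$v(t)=\theta_l^0(1)+\int_{[(l-1)h,t]}d\nu^c(t')+\sum_{r\in]0,t-(l-1)h]}\big(\theta_l^r(1)-v^-(r+(l-1)h)\big).$$ Here for $r\in[0,h]$, $\zeta_l^r:[0,1]\to\mathbb R^n$ solves $\frac{d\zeta_l^r}{ds}(s)=\sum_{j=1}^mg_j(r+(l-1)h,\{\zeta^r_{l-k}(s)\}_k)(\omega_l^r)^j(s)$ a.e., with $\zeta_l^r(0)=x^-(r+(l-1)h)$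 if $r\in]0,h]$, $\zeta_l^0(0)=\zeta_{l-1}^h(1)$; and $\theta_l^r(s)=\theta_l^r(0)+\int_0^s\|\omega_l^r(s')\|ds'$, with $\theta_l^r(0)=v^-(r+(l-1)h)$ if $r\in]0,h]$, $\theta_l^0(0)=\theta_{l-1}^h(1)$. By convention $\theta^r_0\equiv0$; $\zeta_0^r(s)=\xi_0(r-h)$ if $s\in[0,1[$ or $r\in[0,h[$, and $\zeta_0^h(1)=\check x_0$; $\zeta^r_{-a}\equiv\xi_0(r-(a+1)h)$ for $a=1,\dots,M-1$. **Strict sense processes.** A strict sense control is $u\in W^{1,1}([0,T],\mathbb R^m)$ with $u(0)=0$ and $du$ ranging in $\mathcal K$; it is identified with the impulse control $(du,|du|,\{\omega^r\equiv0\}_{r\in[0,h]})$. The corresponding impulse process is written $(u,x,v)$ and called a strict sense process; then $(x,v)$ is the classical $W^{1,1}$ solution on $[0,T]$ of $\frac{dx}{dt}(t)=f(t,\{x(t-kh)\}_k)+\sum_{j=1}^mg_j(t,\{x(t-kh)\}_k)\frac{du^j}{dt}(t)$, $\frac{dv}{dt}(t)=\sum_{j=1}^m|\frac{du^j}{dt}(t)|$, $(x,v)(0)=(\check x_0,0)$, $x=\xi_0$ on $[-Mh,0[$.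
   Formalization: For strict sense controls, "du ranging in K" is taken as du/dt ∈ K a.e., which is equivalent to du(A) ∈ K for all Borel A when the cone K is convex; with the literal set-wise condition the claim fails for some non-convex closed cones K. *)

theory Defs
  imports "HOL-Analysis.Analysis"
begin

section \<open>Borel measures on $[0,T]$\<close>

abbreviation borel_upto :: "real \<Rightarrow> real measure" where
  "borel_upto T \<equiv> restrict_space borel {0..T}"

text \<open>
  The library has no signed or vector measures. They are rendered as set functions of which only
  the values on the Borel subsets of \<open>[0,T]\<close> are relevant. Regularity needs no separate clause,
  here and in \<open>nonneg_measures\<close>: every finite Borel measure on the compact metric space \<open>[0,T]\<close>
  is regular.
\<close>

definition vector_measures :: "real \<Rightarrow> (real set \<Rightarrow> 'a::real_normed_vector) set" where
  "vector_measures T =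
    {\<mu>. \<forall>A :: nat \<Rightarrow> real set. range A \<subseteq> sets (borel_upto T) \<longrightarrow> disjoint_family A \<longrightarrow>
          (\<lambda>i. \<mu> (A i)) sums \<mu> (\<Union>i. A i)}"

definition vector_measures_in :: "'a::real_normed_vector set \<Rightarrow> real \<Rightarrow> (real set \<Rightarrow> 'a) set" where
  "vector_measures_in K T = {\<mu> \<in> vector_measures T. \<forall>A \<in> sets (borel_upto T). \<mu> A \<in> K}"

definition nonneg_measures :: "real \<Rightarrow> real measure set" where
  "nonneg_measures T = {\<nu>. sets \<nu> = sets (borel_upto T) \<and> finite_measure \<nu>}"

text \<open>
  The positive part of the Jordan decomposition of a signed measure \<open>\<alpha>\<close>, given by
  \<open>\<alpha>\<^sub>+(A) = sup {\<alpha>(B) | B \<subseteq> A}\<close>; the negative part of \<open>\<alpha>\<close> is the positive part of \<open>-\<alpha>\<close>.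
  The truncation of negative values by \<^const>\<open>ennreal\<close> is harmless, since \<open>B = {}\<close> is admitted.
\<close>

definition jordan_pos :: "real \<Rightarrow> (real set \<Rightarrow> real) \<Rightarrow> real measure" where
  "jordan_pos T \<alpha> =
    measure_of {0..T} (sets (borel_upto T))
      (\<lambda>A. SUP B \<in> {B \<in> sets (borel_upto T). B \<subseteq> A}. ennreal (\<alpha> B))"

definition jordan_neg :: "real \<Rightarrow> (real set \<Rightarrow> real) \<Rightarrow> real measure" where
  "jordan_neg T \<alpha> = jordan_pos T (\<lambda>A. - \<alpha> A)"

definition signed_integral ::
    "real \<Rightarrow> (real set \<Rightarrow> real) \<Rightarrow> real set \<Rightarrow> (real \<Rightarrow> 'a::{banach, second_countable_topology}) \<Rightarrow> 'a" where
  "signed_integral T \<alpha> A \<phi> =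
    (LINT t:A|jordan_pos T \<alpha>. \<phi> t) - (LINT t:A|jordan_neg T \<alpha>. \<phi> t)"

definition total_variation :: "real \<Rightarrow> (real set \<Rightarrow> real ^ 'm) \<Rightarrow> real measure" where
  "total_variation T \<mu> =
    measure_of {0..T} (sets (borel_upto T))
      (\<lambda>A. \<Sum>j\<in>UNIV. emeasure (jordan_pos T (\<lambda>B. \<mu> B $ j)) A + emeasure (jordan_neg T (\<lambda>B. \<mu> B $ j)) A)"

text \<open>The atomless components; a finite measure has at most countably many atoms, so that
  removing them from a Borel set leaves a Borel set.\<close>

definition vector_continuous_part :: "(real set \<Rightarrow> 'a::real_normed_vector) \<Rightarrow> real set \<Rightarrow> 'a" where
  "vector_continuous_part \<mu> = (\<lambda>A. \<mu> (A - {t. \<mu> {t} \<noteq> 0}))"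

definition continuous_part :: "real measure \<Rightarrow> real measure" where
  "continuous_part \<nu> = density \<nu> (indicator {t. emeasure \<nu> {t} = 0})"

definition vector_weak_star ::
    "real \<Rightarrow> (nat \<Rightarrow> real set \<Rightarrow> real ^ 'm) \<Rightarrow> (real set \<Rightarrow> real ^ 'm) \<Rightarrow> bool" where
  "vector_weak_star T \<mu>s \<mu> \<longleftrightarrow>
    (\<forall>\<psi> :: real \<Rightarrow> real. continuous_on {0..T} \<psi> \<longrightarrow>
      (\<forall>j. (\<lambda>i. signed_integral T (\<lambda>A. \<mu>s i A $ j) {0..T} \<psi>)
             \<longlonglongrightarrow> signed_integral T (\<lambda>A. \<mu> A $ j) {0..T} \<psi>))"

definition weak_star :: "real \<Rightarrow> (nat \<Rightarrow> real measure) \<Rightarrow> real measure \<Rightarrow> bool" where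
  "weak_star T \<nu>s \<nu> \<longleftrightarrow>
    (\<forall>\<psi> :: real \<Rightarrow> real. continuous_on {0..T} \<psi> \<longrightarrow>
      (\<lambda>i. LINT t:{0..T}|\<nu>s i. \<psi> t) \<longlonglongrightarrow> (LINT t:{0..T}|\<nu>. \<psi> t))"

definition V\<^sub>c :: "(real ^ 'm) set \<Rightarrow> real \<Rightarrow> (real set \<Rightarrow> real ^ 'm) \<Rightarrow> real measure set" where
  "V\<^sub>c K T \<mu> =
    {\<nu> \<in> nonneg_measures T.
       continuous_part \<nu> = total_variation T (vector_continuous_part \<mu>) \<and>
       (\<exists>\<mu>s. (\<forall>i. \<mu>s i \<in> vector_measures_in K T) \<and>
             vector_weak_star T \<mu>s \<mu> \<and> weak_star T (\<lambda>i. total_variation T (\<mu>s i)) \<nu>)}"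


section \<open>Functions of bounded variation and of class $W^{1,1}$\<close>

definition bounded_variation_on :: "real \<Rightarrow> real \<Rightarrow> (real \<Rightarrow> 'a::real_normed_vector) \<Rightarrow> bool" where
  "bounded_variation_on a b z \<longleftrightarrow>
    (\<exists>C. \<forall>(n::nat) (p :: nat \<Rightarrow> real). mono p \<longrightarrow> range p \<subseteq> {a..b} \<longrightarrow>
       (\<Sum>i<n. norm (z (p (Suc i)) - z (p i))) \<le> C)"

text \<open>The measure \<open>dz\<close>. For \<open>z\<close> of bounded variation on \<open>[0,T]\<close> and right continuous on \<open>]0,T[\<close>
  the choice is unique on the Borel subsets of \<open>[0,T]\<close>.\<close>

definition stieltjes :: "real \<Rightarrow> (real \<Rightarrow> 'a::real_normed_vector) \<Rightarrow> real set \<Rightarrow> 'a" where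
  "stieltjes T z = (SOME \<delta>. \<delta> \<in> vector_measures T \<and> (\<forall>t\<in>{0<..T}. \<delta> {0..t} = z t - z 0))"

text \<open>\<open>z \<in> W\<^sup>1\<^sup>,\<^sup>1([a,b])\<close> (i.e. \<open>z\<close> is absolutely continuous) and its a.e. derivative is \<open>w\<close>.\<close>

definition W11_deriv ::
    "real \<Rightarrow> real \<Rightarrow> (real \<Rightarrow> 'a::euclidean_space) \<Rightarrow> (real \<Rightarrow> 'a) \<Rightarrow> bool" where
  "W11_deriv a b z w \<longleftrightarrow>
    set_integrable lebesgue {a..b} w \<and> (\<forall>t\<in>{a..b}. z t = z a + (LINT s:{a..t}|lebesgue. w s))"

definition left_lim :: "(real \<Rightarrow> 'a::t2_space) \<Rightarrow> real \<Rightarrow> 'a" where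
  "left_lim z t = Lim (at_left t) z"

definition C1_map :: "('a::real_normed_vector \<Rightarrow> 'b::real_normed_vector) \<Rightarrow> bool" where
  "C1_map F \<longleftrightarrow>
    (\<exists>F' :: 'a \<Rightarrow> 'a \<Rightarrow>\<^sub>L 'b. (\<forall>z. (F has_derivative blinfun_apply (F' z)) (at z)) \<and> continuous_on UNIV F')"

definition norm1 :: "real ^ 'm \<Rightarrow> real" where
  "norm1 w = (\<Sum>j\<in>UNIV. \<bar>w $ j\<bar>)"


section \<open>Impulse controls\<close>

text \<open>Attached controls are written \<open>\<omega> r l s\<close> for \<open>\<omega>\<^sup>r\<^sub>l(s)\<close>, with \<open>l \<in> {1..N}\<close>. Padding by zero
  implements the convention that \<open>\<omega>\<close> vanishes for \<open>r = h, l = 0\<close> and for \<open>r = 0, l = N+1\<close>.\<close>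

definition padded :: "nat \<Rightarrow> (real \<Rightarrow> nat \<Rightarrow> real \<Rightarrow> 'a::zero) \<Rightarrow> real \<Rightarrow> nat \<Rightarrow> real \<Rightarrow> 'a" where
  "padded N \<omega> r l s = (if l \<in> {1..N} then \<omega> r l s else 0)"

definition impulse_control ::
    "(real ^ 'm) set \<Rightarrow> nat \<Rightarrow> real \<Rightarrow> (real set \<Rightarrow> real ^ 'm) \<Rightarrow> real measure \<Rightarrow>
     (real \<Rightarrow> nat \<Rightarrow> real \<Rightarrow> real ^ 'm) \<Rightarrow> bool" where
  "impulse_control K N h \<mu> \<nu> \<omega> \<longleftrightarrow>
    (let T = real N * h in
     \<mu> \<in> vector_measures_in K T \<and> \<nu> \<in> V\<^sub>c K T \<mu> \<and>
     (\<forall>r\<in>{0..h}. \<forall>l\<in>{1..N}.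
        \<omega> r l \<in> borel_measurable (lebesgue_on {0..1}) \<and>
        (\<exists>C. AE s in lebesgue_on {0..1}. norm (\<omega> r l s) \<le> C) \<and>
        (\<forall>s\<in>{0..1}. \<omega> r l s \<in> K)) \<and>
     (\<forall>r\<in>{0..h}. AE s in lebesgue_on {0..1}.
        (\<Sum>l=1..N. norm1 (\<omega> r l s)) = (\<Sum>l=1..N. LINT s':{0..1}|lebesgue. norm1 (\<omega> r l s'))) \<and>
     (\<forall>r\<in>{0<..<h}. \<forall>l\<in>{1..N}.
        (LINT s:{0..1}|lebesgue. norm1 (\<omega> r l s)) = measure \<nu> {r + (real l - 1) * h} \<and>
        (LINT s:{0..1}|lebesgue. \<omega> r l s) = \<mu> {r + (real l - 1) * h}) \<and>
     (\<forall>l\<in>{0..N}.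
        (LINT s:{0..1}|lebesgue. norm1 (padded N \<omega> h l s) + norm1 (padded N \<omega> 0 (l + 1) s))
          = measure \<nu> {real l * h} \<and>
        (LINT s:{0..1}|lebesgue. padded N \<omega> h l s + padded N \<omega> 0 (l + 1) s) = \<mu> {real l * h}))"


section \<open>Impulse solutions and processes\<close>

text \<open>
  The \<open>M + 1\<close> delayed arguments of \<open>f\<close> and \<open>g\<^sub>j\<close> are indexed by a finite type \<open>'k\<close>; a bijection
  \<open>lag\<close> from \<open>'k\<close> onto \<open>{0..M}\<close> tells which delay each argument carries, so that \<open>(real ^ 'n) ^ 'k\<close>
  is the space of \<open>(M+1)\<close>-tuples.
\<close>

definition delayed :: "('k \<Rightarrow> nat) \<Rightarrow> real \<Rightarrow> (real \<Rightarrow> 'a) \<Rightarrow> real \<Rightarrow> 'a ^ 'k" where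
  "delayed lag h z t = (\<chi> k. z (t - real (lag k) * h))"

definition shifted :: "('k \<Rightarrow> nat) \<Rightarrow> (int \<Rightarrow> 'a) \<Rightarrow> int \<Rightarrow> 'a ^ 'k" where
  "shifted lag z l = (\<chi> k. z (l - int (lag k)))"

text \<open>
  \<open>\<zeta> r l s\<close> and \<open>\<theta> r l s\<close> stand for the values at \<open>s\<close> of the auxiliary arcs with upper index
  \<open>r \<in> [0,h]\<close> and lower index \<open>l\<close>; the conventions fix \<open>\<zeta>\<close> for \<open>l \<in> {-(M-1)..0}\<close> and \<open>\<theta>\<close> for \<open>l = 0\<close>.
\<close>

definition attached_arcs ::
    "nat \<Rightarrow> nat \<Rightarrow> real \<Rightarrow> ('k::finite \<Rightarrow> nat) \<Rightarrow>
     ('m::finite \<Rightarrow> real \<times> ((real ^ 'n) ^ 'k) \<Rightarrow> real ^ 'n) \<Rightarrow> real ^ 'n \<Rightarrow> (real \<Rightarrow> real ^ 'n) \<Rightarrow>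
     (real \<Rightarrow> nat \<Rightarrow> real \<Rightarrow> real ^ 'm) \<Rightarrow> (real \<Rightarrow> real ^ 'n) \<Rightarrow> (real \<Rightarrow> real) \<Rightarrow>
     (real \<Rightarrow> int \<Rightarrow> real \<Rightarrow> real ^ 'n) \<Rightarrow> (real \<Rightarrow> int \<Rightarrow> real \<Rightarrow> real) \<Rightarrow> bool" where
  "attached_arcs N M h lag g x0 \<xi>0 \<omega> x v \<zeta> \<theta> \<longleftrightarrow>
    (\<forall>r\<in>{0..h}. \<forall>s\<in>{0..1}.
       \<theta> r 0 s = 0 \<and>
       \<zeta> r 0 s = (if s < 1 \<or> r < h then \<xi>0 (r - h) else x0) \<and>
       (\<forall>a\<in>{1..M - 1}. \<zeta> r (- int a) s = \<xi>0 (r - (real a + 1) * h))) \<and>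
    (\<forall>r\<in>{0..h}. \<forall>l\<in>{1..N}.
       \<zeta> r (int l) 0 = (if r = 0 then \<zeta> h (int l - 1) 1 else left_lim x (r + (real l - 1) * h)) \<and>
       \<theta> r (int l) 0 = (if r = 0 then \<theta> h (int l - 1) 1 else left_lim v (r + (real l - 1) * h)) \<and>
       W11_deriv 0 1 (\<zeta> r (int l))
         (\<lambda>s. \<Sum>j\<in>UNIV. (\<omega> r l s $ j) *\<^sub>R
                g j (r + (real l - 1) * h, shifted lag (\<lambda>l'. \<zeta> r l' s) (int l))) \<and>
       (\<forall>s\<in>{0..1}. \<theta> r (int l) s = \<theta> r (int l) 0 + (LINT s':{0..s}|lebesgue. norm1 (\<omega> r l s'))))"

text \<open>
  The sums over \<open>r\<close> below range over an uncountable set. For an impulse control they converge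
  absolutely, since the increments of \<open>\<zeta>\<close> and \<open>\<theta>\<close> over \<open>[0,1]\<close> are bounded by a multiple of
  \<open>\<nu>({r + (l-1)h})\<close>.
\<close>

definition impulse_solution ::
    "nat \<Rightarrow> nat \<Rightarrow> real \<Rightarrow> ('k::finite \<Rightarrow> nat) \<Rightarrow>
     (real \<times> ((real ^ 'n) ^ 'k) \<Rightarrow> real ^ 'n) \<Rightarrow>
     ('m::finite \<Rightarrow> real \<times> ((real ^ 'n) ^ 'k) \<Rightarrow> real ^ 'n) \<Rightarrow> real ^ 'n \<Rightarrow> (real \<Rightarrow> real ^ 'n) \<Rightarrow>
     (real set \<Rightarrow> real ^ 'm) \<Rightarrow> real measure \<Rightarrow> (real \<Rightarrow> nat \<Rightarrow> real \<Rightarrow> real ^ 'm) \<Rightarrow>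
     (real \<Rightarrow> real ^ 'n) \<Rightarrow> (real \<Rightarrow> real) \<Rightarrow> bool" where
  "impulse_solution N M h lag f g x0 \<xi>0 \<mu> \<nu> \<omega> x v \<longleftrightarrow>
    (let T = real N * h in
     bounded_variation_on (- real M * h) T x \<and> bounded_variation_on 0 T v \<and>
     (\<forall>t\<in>{- real M * h..<0}. x t = \<xi>0 t) \<and> x 0 = x0 \<and> v 0 = 0 \<and>
     (\<exists>\<zeta> \<theta>. attached_arcs N M h lag g x0 \<xi>0 \<omega> x v \<zeta> \<theta> \<and>
       (\<forall>l\<in>{2..N}. x ((real l - 1) * h) = \<zeta> 0 (int l) 1 \<and> v ((real l - 1) * h) = \<theta> 0 (int l) 1) \<and>
       x T = \<zeta> h (int N) 1 \<and> v T = \<theta> h (int N) 1 \<and>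
       (\<forall>l\<in>{1..N}. \<forall>t\<in>{(real l - 1) * h<..<real l * h}.
          x t = \<zeta> 0 (int l) 1
            + (LINT t':{(real l - 1) * h..t}|lebesgue. f (t', delayed lag h x t'))
            + (\<Sum>j\<in>UNIV. signed_integral T (\<lambda>A. vector_continuous_part \<mu> A $ j) {(real l - 1) * h..t}
                           (\<lambda>t'. g j (t', delayed lag h x t')))
            + (\<Sum>\<^sub>\<infinity>r\<in>{0<..t - (real l - 1) * h}.
                 \<zeta> r (int l) 1 - left_lim x (r + (real l - 1) * h)) \<and>
          v t = \<theta> 0 (int l) 1
            + measure (continuous_part \<nu>) {(real l - 1) * h..t}
            + (\<Sum>\<^sub>\<infinity>r\<in>{0<..t - (real l - 1) * h}.
                 \<theta> r (int l) 1 - left_lim v (r + (real l - 1) * h)))))"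

definition impulse_process ::
    "(real ^ 'm::finite) set \<Rightarrow> nat \<Rightarrow> nat \<Rightarrow> real \<Rightarrow> ('k::finite \<Rightarrow> nat) \<Rightarrow>
     (real \<times> ((real ^ 'n) ^ 'k) \<Rightarrow> real ^ 'n) \<Rightarrow>
     ('m \<Rightarrow> real \<times> ((real ^ 'n) ^ 'k) \<Rightarrow> real ^ 'n) \<Rightarrow> real ^ 'n \<Rightarrow> (real \<Rightarrow> real ^ 'n) \<Rightarrow>
     (real set \<Rightarrow> real ^ 'm) \<Rightarrow> real measure \<Rightarrow> (real \<Rightarrow> nat \<Rightarrow> real \<Rightarrow> real ^ 'm) \<Rightarrow>
     (real \<Rightarrow> real ^ 'n) \<Rightarrow> (real \<Rightarrow> real) \<Rightarrow> bool" where
  "impulse_process K N M h lag f g x0 \<xi>0 \<mu> \<nu> \<omega> x v \<longleftrightarrow>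
    impulse_control K N h \<mu> \<nu> \<omega> \<and> impulse_solution N M h lag f g x0 \<xi>0 \<mu> \<nu> \<omega> x v"


section \<open>Strict sense controls and processes\<close>

text \<open>
  ``\<open>du\<close> ranges in \<open>K\<close>'' is read as \<open>du/dt \<in> K\<close> a.e. For a convex closed cone this is the same as
  \<open>du(A) \<in> K\<close> for every Borel set \<open>A\<close>. For a nonconvex \<open>K\<close> the latter is far more restrictive:
  the range of the atomless measure \<open>du\<close> is convex by Lyapunov's theorem, so that \<open>du\<close> would be
  confined to a convex subset of \<open>K\<close>, whereas attached controls are free to move through \<open>K\<close>.
\<close>

definition strict_sense_control :: "(real ^ 'm) set \<Rightarrow> real \<Rightarrow> (real \<Rightarrow> real ^ 'm) \<Rightarrow> bool" where
  "strict_sense_control K T u \<longleftrightarrow>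
    u 0 = 0 \<and> (\<exists>w. W11_deriv 0 T u w \<and> (AE t in lebesgue_on {0..T}. w t \<in> K))"

text \<open>The impulse solution associated with \<open>(du, |du|, 0)\<close>.\<close>

definition strict_sense_process ::
    "(real ^ 'm::finite) set \<Rightarrow> nat \<Rightarrow> nat \<Rightarrow> real \<Rightarrow> ('k::finite \<Rightarrow> nat) \<Rightarrow>
     (real \<times> ((real ^ 'n) ^ 'k) \<Rightarrow> real ^ 'n) \<Rightarrow>
     ('m \<Rightarrow> real \<times> ((real ^ 'n) ^ 'k) \<Rightarrow> real ^ 'n) \<Rightarrow> real ^ 'n \<Rightarrow> (real \<Rightarrow> real ^ 'n) \<Rightarrow>
     (real \<Rightarrow> real ^ 'm) \<Rightarrow> (real \<Rightarrow> real ^ 'n) \<Rightarrow> (real \<Rightarrow> real) \<Rightarrow> bool" where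
  "strict_sense_process K N M h lag f g x0 \<xi>0 u x v \<longleftrightarrow>
    (let T = real N * h in
     strict_sense_control K T u \<and>
     impulse_solution N M h lag f g x0 \<xi>0
       (stieltjes T u) (total_variation T (stieltjes T u)) (\<lambda>r l s. 0) x v)"

end

theory Submission
  imports Defs
begin

text \<open>
  An impulse process jumps wherever \<open>\<nu>\<close> has an atom, and the delays couple the jumps at all times
  \<open>r, r + h, r + 2h, \<dots>\<close>. The idea is to slow time down so that every jump is performed continuously, and to
  recover strict sense processes by letting time run slightly at all moments.

  \<^emph>\<open>Graph completion.\<close> All pieces \<open>[(l-1)h, lh]\<close> are folded onto one interval \<open>[0, h]\<close>, and a single finite
  measure \<open>lam\<close> on it is formed: Lebesgue measure plus the folded copies of \<open>\<nu>\<close>. Since \<open>lam\<close> dominates Lebesgue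
  measure, its quantile function \<open>\<phi> : [0, S] \<rightarrow> [0, h]\<close> is nondecreasing and 1-Lipschitz, it maps Lebesgue measure to
  \<open>lam\<close>, and it stays at an atom \<open>r\<close> during an interval of length \<open>lam {r}\<close>. During this interval the attached controls
  \<open>\<omega>\<^sup>r\<^sub>l\<close> of all \<open>l\<close> act simultaneously at speed \<open>1 / lam {r}\<close>; elsewhere the control of piece \<open>l\<close> is the density
  of the folded atomless part of \<open>\<mu>\<close>. As one \<open>\<phi>\<close> serves all pieces, a delay of \<open>h\<close> in time becomes exactly a delay of
  \<open>S\<close> in the parameter: this is the reason for folding. Gluing the \<open>N\<close> pieces gives a time change \<open>\<Phi>\<close> with
  \<open>\<Phi> (s + S) = \<Phi> s + h\<close>, a bounded control \<open>w\<close> with values in \<open>K\<close>, and a Lipschitz path \<open>y\<close> that solves an ordinary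
  delay equation. The data of the impulse process are read off: \<open>\<mu>\<close> and \<open>\<nu>\<close> are the images under \<open>\<Phi>\<close> of the measures
  with densities \<open>w\<close> and \<open>norm1 w\<close>, and \<open>x t\<close> is the value of \<open>y\<close> at the last \<open>s\<close> with \<open>\<Phi> s \<le> t\<close>
  (locale \<open>impulse\<close>, up to \<open>y_equation\<close>, \<open>\<mu>_pf\<close>, \<open>\<nu>_pf\<close> and \<open>values_from_completion\<close>).

  \<^emph>\<open>Approximation.\<close> For \<open>e > 0\<close> replace \<open>\<Phi>\<close> by the convex combination of \<open>\<Phi>\<close> and the linear time change
  \<open>s \<mapsto> (h / S) s\<close> with weights \<open>1 - e\<close> and \<open>e\<close>, keep \<open>w\<close>, and solve the resulting delay equation. The new time
  change is bi-Lipschitz and still turns \<open>S\<close> into \<open>h\<close>; inverting it gives a strict sense process. As \<open>e \<rightarrow> 0\<close> the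
  solutions converge uniformly in \<open>s\<close>, by a Gronwall estimate in an exponentially weighted norm. All
  measures in question are images of uniformly bounded densities on the fixed interval \<open>[0, L]\<close>, so weak star
  convergence follows by dominated convergence, and the values at \<open>t\<close> converge unless \<open>\<Phi>\<close> takes the value \<open>t\<close> on a
  whole interval, which happens for countably many \<open>t\<close> only (locale \<open>graph_completion\<close>, theorem \<open>approximation\<close>).
\<close>

section \<open>Set functions and their Jordan decompositions\<close>

lemma sets_borel_upto: "A \<in> sets (borel_upto T) \<longleftrightarrow> A \<in> sets borel \<and> A \<subseteq> {0..T}"
  by (auto simp: sets_restrict_space)

lemma space_borel_upto [simp]: "space (borel_upto T) = {0..T}"
  by (simp add: space_restrict_space)

lemma sets_borel_upto_subset: "A \<in> sets (borel_upto T) \<Longrightarrow> A \<subseteq> {0..T}"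
  by (simp add: sets_borel_upto)

subsection \<open>Finite sums of measures\<close>

text \<open>Needed because Jordan parts, total variations and the folded measure are finite sums of measures.\<close>
definition sum_measure :: "'a measure \<Rightarrow> 'i set \<Rightarrow> ('i \<Rightarrow> 'a measure) \<Rightarrow> 'a measure" where
  "sum_measure M I m = measure_of (space M) (sets M) (\<lambda>A. \<Sum>i\<in>I. emeasure (m i) A)"

lemma sets_sum_measure [simp, measurable_cong]: "sets (sum_measure M I m) = sets M"
  by (simp add: sum_measure_def)

lemma space_sum_measure [simp]: "space (sum_measure M I m) = space M"
  by (simp add: sum_measure_def space_measure_of_conv)

lemma emeasure_sum_measure:
  assumes "\<And>i. i \<in> I \<Longrightarrow> sets (m i) = sets M" "A \<in> sets M"
  shows "emeasure (sum_measure M I m) A = (\<Sum>i\<in>I. emeasure (m i) A)"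
  unfolding sum_measure_def
proof (rule emeasure_measure_of_sigma)
  show "sigma_algebra (space M) (sets M)" by (rule sets.sigma_algebra_axioms)
  show "positive (sets M) (\<lambda>A. \<Sum>i\<in>I. emeasure (m i) A)" by (simp add: positive_def)
  show "countably_additive (sets M) (\<lambda>A. \<Sum>i\<in>I. emeasure (m i) A)"
  proof (rule countably_additiveI)
    fix A :: "nat \<Rightarrow> _" assume A: "range A \<subseteq> sets M" "disjoint_family A"
    have "(\<Sum>n. \<Sum>i\<in>I. emeasure (m i) (A n)) = (\<Sum>i\<in>I. \<Sum>n. emeasure (m i) (A n))"
      by (rule suminf_sum) (auto intro: summableI)
    also have "\<dots> = (\<Sum>i\<in>I. emeasure (m i) (\<Union> (range A)))"
      using A assms(1) by (intro sum.cong refl suminf_emeasure) auto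
    finally show "(\<Sum>n. \<Sum>i\<in>I. emeasure (m i) (A n)) = (\<Sum>i\<in>I. emeasure (m i) (\<Union> (range A)))" .
  qed
qed fact

lemma nn_integral_sum_measure:
  assumes "finite I" "\<And>i. i \<in> I \<Longrightarrow> sets (m i) = sets M" and "f \<in> borel_measurable M"
  shows "(\<integral>\<^sup>+x. f x \<partial>sum_measure M I m) = (\<Sum>i\<in>I. \<integral>\<^sup>+x. f x \<partial>m i)"
  using assms(3)
proof (induction f rule: borel_measurable_induct)
  case (cong f g)
  have "(\<integral>\<^sup>+x. g x \<partial>sum_measure M I m) = (\<integral>\<^sup>+x. f x \<partial>sum_measure M I m)"
    using cong by (intro nn_integral_cong) auto
  moreover have "(\<integral>\<^sup>+x. g x \<partial>m i) = (\<integral>\<^sup>+x. f x \<partial>m i)" if "i \<in> I" for i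
    using cong sets_eq_imp_space_eq[OF assms(2)[OF that]] by (intro nn_integral_cong) auto
  ultimately show ?case using cong by simp
next
  case (set A)
  then show ?case using assms by (simp add: emeasure_sum_measure)
next
  case (mult u c)
  have "u \<in> borel_measurable (m i)" if "i \<in> I" for i
    using mult.hyps(2) measurable_cong_sets[OF assms(2)[OF that] refl] by auto
  moreover have "u \<in> borel_measurable (sum_measure M I m)" using mult.hyps(2) by measurable
  ultimately show ?case using mult by (simp add: nn_integral_cmult sum_distrib_left)
next
  case (add u v)
  have "u \<in> borel_measurable (m i)" "v \<in> borel_measurable (m i)" if "i \<in> I" for i
    using add.hyps(1,3) measurable_cong_sets[OF assms(2)[OF that] refl, of borel] by auto
  moreover have "u \<in> borel_measurable (sum_measure M I m)" "v \<in> borel_measurable (sum_measure M I m)"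
    using add.hyps by measurable
  ultimately show ?case using add by (simp add: nn_integral_add sum.distrib)
next
  case (seq U)
  have *: "U n \<in> borel_measurable (m i)" if "i \<in> I" for i n
    using seq.hyps(1) measurable_cong_sets[OF assms(2)[OF that] refl, of borel] by auto
  have **: "U n \<in> borel_measurable (sum_measure M I m)" for n
    using seq.hyps(1)[of n] by measurable
  have "(\<integral>\<^sup>+x. (SUP n. U n x) \<partial>sum_measure M I m) = (SUP n. \<integral>\<^sup>+x. U n x \<partial>sum_measure M I m)"
    by (rule nn_integral_monotone_convergence_SUP[OF seq.hyps(3) **])
  also have "\<dots> = (SUP n. \<Sum>i\<in>I. \<integral>\<^sup>+x. U n x \<partial>m i)" using seq by simp
  also have "\<dots> = (\<Sum>i\<in>I. SUP n. \<integral>\<^sup>+x. U n x \<partial>m i)"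
    using seq.hyps(3)
    by (intro ennreal_SUP_sum) (auto simp: incseq_def le_fun_def intro!: nn_integral_mono)
  also have "\<dots> = (\<Sum>i\<in>I. \<integral>\<^sup>+x. (SUP n. U n x) \<partial>m i)"
    using seq.hyps(3) * by (intro sum.cong refl nn_integral_monotone_convergence_SUP[symmetric]) auto
  finally show ?case by (simp add: image_comp)
qed

subsection \<open>Countably additive set functions\<close>

lemma vector_measures_sums:
  "\<mu> \<in> vector_measures T \<Longrightarrow> range A \<subseteq> sets (borel_upto T) \<Longrightarrow> disjoint_family A \<Longrightarrow>
    (\<lambda>i::nat. \<mu> (A i)) sums \<mu> (\<Union>i. A i)"
  by (auto simp: vector_measures_def)

lemma vector_measures_empty [simp]:
  assumes "\<mu> \<in> vector_measures T" shows "\<mu> {} = 0"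
proof -
  have "(\<lambda>i::nat. \<mu> {}) sums \<mu> {}"
    using vector_measures_sums[OF assms, of "\<lambda>_. {}"] by (simp add: disjoint_family_on_def)
  then have "(\<lambda>i::nat. \<mu> {}) \<longlonglongrightarrow> 0" by (auto intro: summable_LIMSEQ_zero sums_summable)
  then show ?thesis by (simp add: LIMSEQ_const_iff)
qed

lemma vector_measures_Un:
  assumes "\<mu> \<in> vector_measures T" "A \<in> sets (borel_upto T)" "B \<in> sets (borel_upto T)" "A \<inter> B = {}"
  shows "\<mu> (A \<union> B) = \<mu> A + \<mu> B"
proof -
  have "(\<lambda>i. \<mu> (binaryset A B i)) sums \<mu> (\<Union>i. binaryset A B i)"
    using assms by (intro vector_measures_sums) (auto simp: binaryset_def disjoint_family_on_def)
  moreover have "(\<lambda>i. \<mu> (binaryset A B i)) sums (\<mu> A + \<mu> B)"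
    using assms(1) by (intro binaryset_sums) simp
  ultimately show ?thesis by (simp add: UN_binaryset_eq sums_unique2)
qed

lemma vector_measures_Diff:
  assumes "\<mu> \<in> vector_measures T" "A \<in> sets (borel_upto T)" "B \<in> sets (borel_upto T)" "B \<subseteq> A"
  shows "\<mu> (A - B) = \<mu> A - \<mu> B"
  using vector_measures_Un[OF assms(1), of B "A - B"] assms by (auto simp: Un_absorb1)

lemma vector_measures_bounded_linear:
  assumes "\<mu> \<in> vector_measures T" "bounded_linear F"
  shows "(\<lambda>A. F (\<mu> A)) \<in> vector_measures T"
  using assms unfolding vector_measures_def by (auto intro: bounded_linear.sums)

lemma vector_measures_nth:
  "\<mu> \<in> vector_measures T \<Longrightarrow> (\<lambda>A. \<mu> A $ j) \<in> vector_measures T"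
  by (rule vector_measures_bounded_linear[OF _ bounded_linear_vec_nth])

lemma vector_measures_uminus:
  "\<mu> \<in> vector_measures T \<Longrightarrow> (\<lambda>A. - \<mu> A) \<in> vector_measures T"
  by (rule vector_measures_bounded_linear[OF _ bounded_linear_minus[OF bounded_linear_ident]])

text \<open>If a countably additive real set function were unbounded below some set, it would be unbounded on one of the two halves of a
  suitable splitting, with a value of modulus greater than 1 on the other half; iterating yields disjoint sets whose values do not tend to 0.\<close>
lemma vector_measures_bounded:
  fixes \<alpha> :: "real set \<Rightarrow> real"
  assumes \<alpha>: "\<alpha> \<in> vector_measures T"
  shows "\<exists>c. \<forall>B\<in>sets (borel_upto T). \<bar>\<alpha> B\<bar> \<le> c"
proof (rule ccontr)
  let ?S = "sets (borel_upto T)"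
  define unb where "unb A \<longleftrightarrow> (\<forall>c. \<exists>B\<in>?S. B \<subseteq> A \<and> \<bar>\<alpha> B\<bar> > c)" for A
  assume "\<not> ?thesis"
  then have 0: "{0..T} \<in> ?S \<and> unb {0..T}"
    unfolding unb_def by (force simp: not_le sets_borel_upto)
  have step: "\<exists>B. (B \<in> ?S \<and> unb B) \<and> B \<subseteq> A \<and> \<bar>\<alpha> (A - B)\<bar> > 1" if A: "A \<in> ?S \<and> unb A" for A
  proof -
    obtain B where B: "B \<in> ?S" "B \<subseteq> A" "\<bar>\<alpha> B\<bar> > \<bar>\<alpha> A\<bar> + 1" using A unfolding unb_def by blast
    have d: "\<alpha> (A - B) = \<alpha> A - \<alpha> B" using vector_measures_Diff[OF \<alpha>] A B by blast
    have "unb B \<or> unb (A - B)"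
    proof (rule ccontr)
      assume "\<not> ?thesis"
      then obtain c1 c2 where c: "\<And>C. C \<in> ?S \<Longrightarrow> C \<subseteq> B \<Longrightarrow> \<bar>\<alpha> C\<bar> \<le> c1"
        "\<And>C. C \<in> ?S \<Longrightarrow> C \<subseteq> A - B \<Longrightarrow> \<bar>\<alpha> C\<bar> \<le> c2"
        unfolding unb_def by (force simp: not_less)
      obtain C where C: "C \<in> ?S" "C \<subseteq> A" "\<bar>\<alpha> C\<bar> > c1 + c2" using A unfolding unb_def by blast
      have "\<alpha> C = \<alpha> (C \<inter> B) + \<alpha> (C - B)"
        using vector_measures_Un[OF \<alpha>, of "C \<inter> B" "C - B"] C B by (auto simp: Int_Diff_Un)
      moreover have "\<bar>\<alpha> (C \<inter> B)\<bar> \<le> c1" "\<bar>\<alpha> (C - B)\<bar> \<le> c2" using C B by (auto intro!: c)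
      ultimately show False using C(3) by linarith
    qed
    then show ?thesis
    proof
      assume "unb B" then show ?thesis using B d by (intro exI[of _ B]) auto
    next
      assume "unb (A - B)"
      moreover have "A - (A - B) = B" using B by auto
      ultimately show ?thesis using A B d by (intro exI[of _ "A - B"]) auto
    qed
  qed
  obtain A where A: "\<And>n::nat. A n \<in> ?S \<and> unb (A n)"
      "\<And>n. A (Suc n) \<subseteq> A n \<and> \<bar>\<alpha> (A n - A (Suc n))\<bar> > 1"
    using dependent_nat_choice[of "\<lambda>n A. A \<in> ?S \<and> unb A"
        "\<lambda>n A B. B \<subseteq> A \<and> \<bar>\<alpha> (A - B)\<bar> > 1"] 0 step by metis
  define D where "D n = A n - A (Suc n)" for n
  have dec: "A n \<subseteq> A m" if "m \<le> n" for m n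
    by (rule lift_Suc_antimono_le[of A, OF _ that]) (use A(2) in blast)
  have "disjoint_family D"
    unfolding disjoint_family_on_def
  proof (intro ballI impI)
    fix m n :: nat assume "m \<noteq> n"
    then show "D m \<inter> D n = {}"
      using dec[of "Suc m" n] dec[of "Suc n" m] unfolding D_def by (cases m n rule: linorder_cases) auto
  qed
  moreover have "range D \<subseteq> ?S" using A(1) by (auto simp: D_def)
  ultimately have "(\<lambda>n. \<alpha> (D n)) \<longlonglongrightarrow> 0"
    using vector_measures_sums[OF \<alpha>, of D] sums_summable summable_LIMSEQ_zero by blast
  then have "\<forall>\<^sub>F n in sequentially. \<bar>\<alpha> (D n)\<bar> < 1" using tendstoD[of _ 0 _ 1] by force
  then obtain n where "\<bar>\<alpha> (D n)\<bar> < 1" by (auto dest: eventually_happens)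
  then show False using A(2)[of n] by (simp add: D_def)
qed

subsection \<open>Jordan decomposition\<close>

lemma sets_jordan_pos [simp, measurable_cong]: "sets (jordan_pos T \<alpha>) = sets (borel_upto T)"
  unfolding jordan_pos_def using sets.sigma_sets_eq[of "borel_upto T"] sets.space_closed[of "borel_upto T"]
  by (simp add: sets_measure_of)

lemma space_jordan_pos [simp]: "space (jordan_pos T \<alpha>) = {0..T}"
  using sets_eq_imp_space_eq[OF sets_jordan_pos] by simp

lemma sets_jordan_neg [simp, measurable_cong]: "sets (jordan_neg T \<alpha>) = sets (borel_upto T)"
  by (simp add: jordan_neg_def)

lemma ennreal_sums_le:
  assumes "f sums (s::real)" shows "ennreal s \<le> (\<Sum>n. ennreal (f n))"
proof (rule LIMSEQ_le_const2)
  show "(\<lambda>n. ennreal (\<Sum>i<n. f i)) \<longlonglongrightarrow> ennreal s" using assms by (intro tendsto_ennrealI) (simp add: sums_def)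
  have "ennreal (\<Sum>i<n. f i) \<le> (\<Sum>i<n. ennreal (f i))" for n
  proof (induction n)
    case (Suc n)
    have "ennreal ((\<Sum>i<n. f i) + f n) \<le> ennreal (\<Sum>i<n. f i) + ennreal (f n)"
      by (cases "f n \<ge> 0"; cases "(\<Sum>i<n. f i) \<ge> 0")
         (auto simp: ennreal_plus[symmetric] ennreal_neg simp del: ennreal_plus intro!: ennreal_leI)
    then show ?case using Suc by (simp) (metis (no_types, lifting) add_right_mono order_trans)
  qed simp
  then show "\<exists>N. \<forall>n\<ge>N. ennreal (\<Sum>i<n. f i) \<le> (\<Sum>n. ennreal (f n))"
    by (meson order_trans sum_le_suminf[OF summableI] finite_lessThan zero_le)
qed

text \<open>The supremum formula is additive: superadditivity because disjoint competitors may be united, subadditivity because a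
  competitor splits along the given sets.\<close>
lemma emeasure_jordan_pos:
  assumes \<alpha>: "\<alpha> \<in> vector_measures T" and A: "A \<in> sets (borel_upto T)"
  shows "emeasure (jordan_pos T \<alpha>) A = (SUP B \<in> {B \<in> sets (borel_upto T). B \<subseteq> A}. ennreal (\<alpha> B))"
  unfolding jordan_pos_def
proof (rule emeasure_measure_of_sigma)
  let ?S = "sets (borel_upto T)"
  let ?p = "\<lambda>A. SUP B \<in> {B \<in> ?S. B \<subseteq> A}. ennreal (\<alpha> B)"
  show "sigma_algebra {0..T} ?S" using sets.sigma_algebra_axioms[of "borel_upto T"] by simp
  have e: "?p {} = 0"
  proof -
    have "{B \<in> ?S. B \<subseteq> {}} = {{}}" by auto
    then show ?thesis using vector_measures_empty[OF \<alpha>] by simp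
  qed
  then show "positive ?S ?p" by (simp add: positive_def)
  have upper: "ennreal (\<alpha> B) \<le> ?p A" if "B \<in> ?S" "B \<subseteq> A" for A B
    using that by (intro SUP_upper) auto
  have mono: "?p A \<le> ?p B" if "A \<subseteq> B" for A B
    using that by (intro SUP_subset_mono) auto
  have super: "?p A + ?p B \<le> ?p (A \<union> B)" if "A \<inter> B = {}" for A B
  proof -
    have ne: "{B \<in> ?S. B \<subseteq> A} \<noteq> {}" for A by auto
    have "ennreal (\<alpha> C) + ennreal (\<alpha> D) \<le> ?p (A \<union> B)" if C: "C \<in> ?S" "C \<subseteq> A" and D: "D \<in> ?S" "D \<subseteq> B" for C D
    proof (cases "\<alpha> C \<ge> 0 \<and> \<alpha> D \<ge> 0")
      case True
      have "ennreal (\<alpha> C) + ennreal (\<alpha> D) = ennreal (\<alpha> (C \<union> D))"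
        using True C D \<open>A \<inter> B = {}\<close> by (subst vector_measures_Un[OF \<alpha>]) (auto simp: ennreal_plus)
      also have "\<dots> \<le> ?p (A \<union> B)" using C D by (intro upper) auto
      finally show ?thesis .
    next
      case False
      then have "ennreal (\<alpha> C) + ennreal (\<alpha> D) \<le> max (ennreal (\<alpha> C)) (ennreal (\<alpha> D))"
        by (auto simp: ennreal_neg not_le)
      also have "\<dots> \<le> ?p (A \<union> B)" using C D by (intro max.boundedI upper) auto
      finally show ?thesis .
    qed
    then have "(SUP C\<in>{B \<in> ?S. B \<subseteq> A}. ennreal (\<alpha> C) + ennreal (\<alpha> D)) \<le> ?p (A \<union> B)" if "D \<in> ?S" "D \<subseteq> B" for D
      using that by (intro SUP_least) auto
    then have "?p A + ennreal (\<alpha> D) \<le> ?p (A \<union> B)" if "D \<in> ?S" "D \<subseteq> B" for D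
      using that ne by (subst (asm) ennreal_SUP_add_left) auto
    then have "(SUP D\<in>{C \<in> ?S. C \<subseteq> B}. ?p A + ennreal (\<alpha> D)) \<le> ?p (A \<union> B)"
      by (intro SUP_least) auto
    then show ?thesis using ennreal_SUP_add_right[OF ne[of B], of "?p A" "\<lambda>D. ennreal (\<alpha> D)"] by simp
  qed
  show "countably_additive ?S ?p"
  proof (rule countably_additiveI)
    fix A :: "nat \<Rightarrow> _" assume A: "range A \<subseteq> ?S" "disjoint_family A"
    have "(\<Sum>i<n. ?p (A i)) \<le> ?p (\<Union>i<n. A i)" for n
    proof (induction n)
      case (Suc n)
      have "(\<Sum>i<Suc n. ?p (A i)) \<le> ?p (\<Union>i<n. A i) + ?p (A n)" using Suc by (simp add: add_right_mono)
      also have "\<dots> \<le> ?p ((\<Union>i<n. A i) \<union> A n)"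
      proof (rule super)
        show "(\<Union>i<n. A i) \<inter> A n = {}"
          using disjoint_family_onD[OF A(2), of _ n] by fastforce
      qed
      finally show ?case by (simp add: lessThan_Suc Un_commute)
    qed (simp add: e)
    then have "(\<Sum>i<n. ?p (A i)) \<le> ?p (\<Union>i. A i)" for n by (rule order_trans) (auto intro!: mono)
    then have 1: "(\<Sum>i. ?p (A i)) \<le> ?p (\<Union>i. A i)" by (intro suminf_le_const summableI)
    have 2: "?p (\<Union>i. A i) \<le> (\<Sum>i. ?p (A i))"
    proof (rule SUP_least)
      fix B assume "B \<in> {B \<in> ?S. B \<subseteq> \<Union> (range A)}"
      then have B: "B \<in> ?S" "B = (\<Union>i. B \<inter> A i)" by auto
      have "(\<lambda>i. \<alpha> (B \<inter> A i)) sums \<alpha> (\<Union>i. B \<inter> A i)"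
        using A B(1) by (intro vector_measures_sums[OF \<alpha>]) (auto simp: disjoint_family_on_def)
      then have "ennreal (\<alpha> B) \<le> (\<Sum>i. ennreal (\<alpha> (B \<inter> A i)))" using B(2) ennreal_sums_le by simp
      also have "\<dots> \<le> (\<Sum>i. ?p (A i))"
        using A B(1) by (intro suminf_le summableI upper) auto
      finally show "ennreal (\<alpha> B) \<le> (\<Sum>i. ?p (A i))" .
    qed
    show "(\<Sum>i. ?p (A i)) = ?p (\<Union> (range A))" using 1 2 by (rule antisym)
  qed
qed (rule A)

lemma finite_measure_jordan_pos:
  assumes \<alpha>: "\<alpha> \<in> vector_measures T"
  shows "finite_measure (jordan_pos T \<alpha>)"
proof (rule finite_measureI)
  obtain c where c: "\<And>B. B \<in> sets (borel_upto T) \<Longrightarrow> \<bar>\<alpha> B\<bar> \<le> c"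
    using vector_measures_bounded[OF \<alpha>] by blast
  have "emeasure (jordan_pos T \<alpha>) {0..T} \<le> ennreal c"
    using c by (subst emeasure_jordan_pos[OF \<alpha>]) (auto simp: sets_borel_upto abs_le_iff intro!: SUP_least ennreal_leI)
  then show "emeasure (jordan_pos T \<alpha>) (space (jordan_pos T \<alpha>)) \<noteq> \<infinity>"
    by (auto simp: top_unique)
qed

lemma finite_measure_jordan_neg:
  "\<alpha> \<in> vector_measures T \<Longrightarrow> finite_measure (jordan_neg T \<alpha>)"
  unfolding jordan_neg_def by (rule finite_measure_jordan_pos[OF vector_measures_uminus])

text \<open>For \<open>B \<subseteq> A\<close> one has \<open>\<alpha> B = \<alpha> A - \<alpha> (A - B)\<close>; taking suprema over \<open>B\<close> gives both inequalities.\<close>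
lemma jordan_decomposition:
  assumes \<alpha>: "\<alpha> \<in> vector_measures T" and A: "A \<in> sets (borel_upto T)"
  shows "\<alpha> A = measure (jordan_pos T \<alpha>) A - measure (jordan_neg T \<alpha>) A"
proof -
  have *: "measure (jordan_pos T \<beta>) A \<le> \<beta> A + measure (jordan_neg T \<beta>) A"
    if \<beta>: "\<beta> \<in> vector_measures T" for \<beta>
  proof -
    interpret P: finite_measure "jordan_pos T \<beta>" by (rule finite_measure_jordan_pos[OF \<beta>])
    interpret Q: finite_measure "jordan_neg T \<beta>" by (rule finite_measure_jordan_neg[OF \<beta>])
    have up: "- \<beta> B \<le> measure (jordan_neg T \<beta>) A" if "B \<in> sets (borel_upto T)" "B \<subseteq> A" for B
    proof -
      have "ennreal (- \<beta> B) \<le> emeasure (jordan_neg T \<beta>) A"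
        unfolding jordan_neg_def using that
        by (subst emeasure_jordan_pos[OF vector_measures_uminus[OF \<beta>] A]) (auto intro: SUP_upper)
      then show ?thesis by (simp add: Q.emeasure_eq_measure ennreal_le_iff)
    qed
    have "emeasure (jordan_pos T \<beta>) A \<le> ennreal (\<beta> A + measure (jordan_neg T \<beta>) A)"
    proof (subst emeasure_jordan_pos[OF \<beta> A], rule SUP_least)
      fix B assume "B \<in> {B \<in> sets (borel_upto T). B \<subseteq> A}"
      then have B: "B \<in> sets (borel_upto T)" "B \<subseteq> A" by auto
      show "ennreal (\<beta> B) \<le> ennreal (\<beta> A + measure (jordan_neg T \<beta>) A)"
        using up[of "A - B"] vector_measures_Diff[OF \<beta> A B] A B by (intro ennreal_leI) auto
    qed
    then show ?thesis using up[of A] A by (simp add: P.emeasure_eq_measure ennreal_le_iff)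
  qed
  have "jordan_pos T (\<lambda>A. - \<alpha> A) = jordan_neg T \<alpha>" "jordan_neg T (\<lambda>A. - \<alpha> A) = jordan_pos T \<alpha>"
    by (simp_all add: jordan_neg_def)
  then show ?thesis using *[OF \<alpha>] *[OF vector_measures_uminus[OF \<alpha>]] by simp
qed

lemma jordan_pos_cong:
  "(\<And>A. A \<in> sets (borel_upto T) \<Longrightarrow> \<alpha> A = \<beta> A) \<Longrightarrow> jordan_pos T \<alpha> = jordan_pos T \<beta>"
  unfolding jordan_pos_def by (intro arg_cong[where f = "measure_of _ _"] ext SUP_cong) auto

lemma signed_integral_cong_measure:
  "(\<And>A. A \<in> sets (borel_upto T) \<Longrightarrow> \<alpha> A = \<beta> A) \<Longrightarrow> signed_integral T \<alpha> = signed_integral T \<beta>"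
  unfolding signed_integral_def jordan_neg_def
  using jordan_pos_cong[of T \<alpha> \<beta>] jordan_pos_cong[of T "\<lambda>A. - \<alpha> A" "\<lambda>A. - \<beta> A"]
  by (intro ext) simp

lemma sum_less_top_ennreal:
  fixes f :: "'i \<Rightarrow> ennreal"
  shows "finite I \<Longrightarrow> (\<And>i. i \<in> I \<Longrightarrow> f i < top) \<Longrightarrow> sum f I < top"
  by (induction I rule: finite_induct) auto

lemma integral_sum_measure:
  fixes f :: "'a \<Rightarrow> real"
  assumes I: "finite I" and m: "\<And>i. i \<in> I \<Longrightarrow> sets (m i) = sets M" and f: "f \<in> borel_measurable M"
    and int: "\<And>i. i \<in> I \<Longrightarrow> integrable (m i) f"
  shows "(\<integral>x. f x \<partial>sum_measure M I m) = (\<Sum>i\<in>I. \<integral>x. f x \<partial>m i)"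
proof -
  have fin: "(\<integral>\<^sup>+x. ennreal \<bar>f x\<bar> \<partial>m i) < top" if "i \<in> I" for i
    using int[OF that] by (simp add: integrable_iff_bounded)
  have f': "f \<in> borel_measurable (sum_measure M I m)" using f by measurable
  have nn: "(\<integral>\<^sup>+x. ennreal (g x) \<partial>sum_measure M I m) = (\<Sum>i\<in>I. \<integral>\<^sup>+x. ennreal (g x) \<partial>m i)"
    if "g \<in> borel_measurable M" for g :: "'a \<Rightarrow> real"
    using that by (intro nn_integral_sum_measure I m) auto
  have "(\<Sum>i\<in>I. \<integral>\<^sup>+x. ennreal \<bar>f x\<bar> \<partial>m i) < top"
    using fin by (intro sum_less_top_ennreal I)
  then have i: "integrable (sum_measure M I m) f"
    using f' f by (simp add: integrable_iff_bounded nn)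
  have *: "(\<integral>\<^sup>+x. ennreal (f x) \<partial>m i) < top" "(\<integral>\<^sup>+x. ennreal (- f x) \<partial>m i) < top" if "i \<in> I" for i
    using order_le_less_trans[OF nn_integral_mono fin[OF that]] by (auto intro!: ennreal_leI)
  show ?thesis
    using * int f by (simp add: real_lebesgue_integral_def[OF i] real_lebesgue_integral_def nn enn2real_sum sum_subtractf)
qed

text \<open>Any representation of \<open>\<alpha>\<close> as a difference of finite measures computes the signed integral: with \<open>J\<close>, \<open>K\<close> the Jordan
  parts, the measures \<open>J + Q\<close> and \<open>P + K\<close> coincide.\<close>
lemma signed_integral_measure_diff:
  fixes \<psi> :: "real \<Rightarrow> real"
  assumes \<alpha>: "\<alpha> \<in> vector_measures T"
    and P: "sets P = sets (borel_upto T)" "finite_measure P"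
    and Q: "sets Q = sets (borel_upto T)" "finite_measure Q"
    and eq: "\<And>A. A \<in> sets (borel_upto T) \<Longrightarrow> \<alpha> A = measure P A - measure Q A"
    and \<psi>: "continuous_on {0..T} \<psi>"
  shows "signed_integral T \<alpha> {0..T} \<psi> = (LINT t:{0..T}|P. \<psi> t) - (LINT t:{0..T}|Q. \<psi> t)"
proof -
  let ?M = "borel_upto T"
  define J K where "J = jordan_pos T \<alpha>" and "K = jordan_neg T \<alpha>"
  interpret J: finite_measure J unfolding J_def by (rule finite_measure_jordan_pos[OF \<alpha>])
  interpret K: finite_measure K unfolding K_def by (rule finite_measure_jordan_neg[OF \<alpha>])
  interpret P: finite_measure P by fact
  interpret Q: finite_measure Q by fact
  have JK: "sets J = sets ?M" "sets K = sets ?M" by (simp_all add: J_def K_def)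
  let ?m = "\<lambda>b. if b then J else Q" and ?n = "\<lambda>b. if b then P else K"
  have s: "sets (?m b) = sets ?M" "sets (?n b) = sets ?M" for b using JK P Q by auto
  have "sum_measure ?M UNIV ?m = sum_measure ?M UNIV ?n"
  proof (rule measure_eqI)
    fix A assume "A \<in> sets (sum_measure ?M UNIV ?m)"
    then have A: "A \<in> sets ?M" by simp
    have "measure J A + measure Q A = measure P A + measure K A"
      using eq[OF A] jordan_decomposition[OF \<alpha> A] by (simp add: J_def K_def)
    then have "ennreal (measure J A) + ennreal (measure Q A) = ennreal (measure P A) + ennreal (measure K A)"
      by (simp flip: ennreal_plus)
    then show "emeasure (sum_measure ?M UNIV ?m) A = emeasure (sum_measure ?M UNIV ?n) A"
      using A s by (simp add: emeasure_sum_measure UNIV_bool J.emeasure_eq_measure K.emeasure_eq_measure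
          P.emeasure_eq_measure Q.emeasure_eq_measure add_ac)
  qed simp
  moreover define f where "f t = indicator {0..T} t *\<^sub>R \<psi> t" for t
  have f: "f \<in> borel_measurable ?M"
  proof -
    have "\<psi> \<in> borel_measurable ?M" using \<psi> by (rule borel_measurable_continuous_on_restrict)
    then show ?thesis by (subst measurable_cong[of _ f \<psi>]) (auto simp: f_def)
  qed
  obtain c where c: "\<And>t. t \<in> {0..T} \<Longrightarrow> norm (\<psi> t) \<le> c"
    using compact_imp_bounded[OF compact_continuous_image[OF \<psi> compact_Icc]]
    unfolding bounded_iff by blast
  have int: "integrable N f" if "sets N = sets ?M" "finite_measure N" for N
  proof -
    interpret finite_measure N by fact
    have sp: "space N = {0..T}" using sets_eq_imp_space_eq[OF that(1)] by simp
    show ?thesis using c f that sp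
      by (intro integrable_const_bound[of _ c]) (auto simp: f_def measurable_cong_sets[OF that(1) refl])
  qed
  ultimately have "(\<integral>x. f x \<partial>J) + (\<integral>x. f x \<partial>Q) = (\<integral>x. f x \<partial>P) + (\<integral>x. f x \<partial>K)"
    using integral_sum_measure[of UNIV ?m ?M f] integral_sum_measure[of UNIV ?n ?M f] s f int JK
      P Q J.finite_measure_axioms K.finite_measure_axioms
    by (simp add: UNIV_bool)
  then show ?thesis
    unfolding signed_integral_def set_lebesgue_integral_def J_def[symmetric] K_def[symmetric] f_def by simp
qed

text \<open>The supremum is attained at the part of \<open>A\<close> where the density is positive.\<close>
lemma SUP_density:
  fixes k :: "'a \<Rightarrow> real"
  assumes k: "integrable M k" and A: "A \<in> sets M"
    and \<alpha>: "\<And>B. B \<in> sets M \<Longrightarrow> B \<subseteq> A \<Longrightarrow> \<alpha> B = (LINT x:B|M. k x)"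
  shows "(SUP B \<in> {B \<in> sets M. B \<subseteq> A}. ennreal (\<alpha> B)) = (\<integral>\<^sup>+x. ennreal (k x) * indicator A x \<partial>M)"
proof (rule antisym)
  have int: "integrable M (\<lambda>x. indicator B x *\<^sub>R k x)" if "B \<in> sets M" for B
    using k that by (rule integrable_mult_indicator[rotated])
  show "(SUP B \<in> {B \<in> sets M. B \<subseteq> A}. ennreal (\<alpha> B)) \<le> (\<integral>\<^sup>+x. ennreal (k x) * indicator A x \<partial>M)"
  proof (rule SUP_least)
    fix B assume "B \<in> {B \<in> sets M. B \<subseteq> A}"
    then have B: "B \<in> sets M" "B \<subseteq> A" by auto
    have "ennreal (\<alpha> B) \<le> ennreal (\<integral>x. indicator B x *\<^sub>R max 0 (k x) \<partial>M)"
      unfolding \<alpha>[OF B] set_lebesgue_integral_def using int[OF B(1)] k B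
      by (intro ennreal_leI integral_mono integrable_mult_indicator integrable_max) (auto simp: indicator_def)
    also have "\<dots> = (\<integral>\<^sup>+x. ennreal (indicator B x *\<^sub>R max 0 (k x)) \<partial>M)"
      using k B by (intro nn_integral_eq_integral[symmetric] integrable_mult_indicator integrable_max) auto
    also have "\<dots> \<le> (\<integral>\<^sup>+x. ennreal (k x) * indicator A x \<partial>M)"
      using B by (intro nn_integral_mono) (auto simp: indicator_def max_def ennreal_neg)
    finally show "ennreal (\<alpha> B) \<le> (\<integral>\<^sup>+x. ennreal (k x) * indicator A x \<partial>M)" .
  qed
  have km[measurable]: "k \<in> borel_measurable M" using k by simp
  define B where "B = A \<inter> {x\<in>space M. k x > 0}"
  have B: "B \<in> sets M" "B \<subseteq> A" unfolding B_def using A by auto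
  have "(\<integral>\<^sup>+x. ennreal (k x) * indicator A x \<partial>M) = (\<integral>\<^sup>+x. ennreal (indicator B x *\<^sub>R k x) \<partial>M)"
    by (intro nn_integral_cong) (auto simp: B_def indicator_def ennreal_neg)
  also have "\<dots> = ennreal (\<alpha> B)"
    unfolding \<alpha>[OF B] set_lebesgue_integral_def using int[OF B(1)]
    by (intro nn_integral_eq_integral) (auto simp: B_def indicator_def)
  also have "\<dots> \<le> (SUP B \<in> {B \<in> sets M. B \<subseteq> A}. ennreal (\<alpha> B))"
    using B by (intro SUP_upper) auto
  finally show "(\<integral>\<^sup>+x. ennreal (k x) * indicator A x \<partial>M) \<le> (SUP B \<in> {B \<in> sets M. B \<subseteq> A}. ennreal (\<alpha> B))" .
qed

lemma jordan_pos_density: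
  fixes k :: "real \<Rightarrow> real"
  assumes \<alpha>: "\<alpha> \<in> vector_measures T" and M: "sets M = sets (borel_upto T)" and k: "integrable M k"
    and eq: "\<And>B. B \<in> sets (borel_upto T) \<Longrightarrow> \<alpha> B = (LINT x:B|M. k x)"
  shows "jordan_pos T \<alpha> = density M (\<lambda>x. ennreal (k x))"
proof (rule measure_eqI)
  fix A assume "A \<in> sets (jordan_pos T \<alpha>)"
  then have A: "A \<in> sets (borel_upto T)" by simp
  then show "emeasure (jordan_pos T \<alpha>) A = emeasure (density M (\<lambda>x. ennreal (k x))) A"
    using SUP_density[OF k, of A \<alpha>] M k eq by (simp add: emeasure_jordan_pos[OF \<alpha>] emeasure_density)
qed (simp add: M)

lemma jordan_neg_density:
  fixes k :: "real \<Rightarrow> real"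
  assumes "\<alpha> \<in> vector_measures T" and M: "sets M = sets (borel_upto T)" and "integrable M k"
    and "\<And>B. B \<in> sets (borel_upto T) \<Longrightarrow> \<alpha> B = (LINT x:B|M. k x)"
  shows "jordan_neg T \<alpha> = density M (\<lambda>x. ennreal (- k x))"
  unfolding jordan_neg_def
proof (rule jordan_pos_density[OF vector_measures_uminus[OF assms(1)] M])
  show "integrable M (\<lambda>x. - k x)" using assms(3) by simp
  show "- \<alpha> B = (LINT x:B|M. - k x)" if "B \<in> sets (borel_upto T)" for B
    using assms(4)[OF that] by (simp add: set_lebesgue_integral_def)
qed

lemma sets_total_variation [simp, measurable_cong]: "sets (total_variation T \<mu>) = sets (borel_upto T)"
  unfolding total_variation_def using sets.sigma_sets_eq[of "borel_upto T"] sets.space_closed[of "borel_upto T"]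
  by (simp add: sets_measure_of)

lemma emeasure_total_variation:
  assumes "A \<in> sets (borel_upto T)"
  shows "emeasure (total_variation T \<mu>) A =
    (\<Sum>j\<in>UNIV. emeasure (jordan_pos T (\<lambda>B. \<mu> B $ j)) A + emeasure (jordan_neg T (\<lambda>B. \<mu> B $ j)) A)"
proof -
  let ?M = "borel_upto T"
  let ?m = "\<lambda>(j, b). if b then jordan_pos T (\<lambda>B. \<mu> B $ j) else jordan_neg T (\<lambda>B. \<mu> B $ j)"
  have *: "(\<Sum>i\<in>UNIV. emeasure (?m i) A) =
    (\<Sum>j\<in>UNIV. emeasure (jordan_pos T (\<lambda>B. \<mu> B $ j)) A + emeasure (jordan_neg T (\<lambda>B. \<mu> B $ j)) A)" for A
    unfolding UNIV_Times_UNIV[symmetric] sum.cartesian_product' by (simp add: UNIV_bool add.commute)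
  have "total_variation T \<mu> = sum_measure ?M UNIV ?m"
    unfolding total_variation_def sum_measure_def * by simp
  then show ?thesis using assms by (simp add: emeasure_sum_measure split_beta *[unfolded split_beta])
qed

lemma total_variation_density:
  fixes w :: "real \<Rightarrow> real ^ 'm"
  assumes \<mu>: "\<mu> \<in> vector_measures T" and M: "sets M = sets (borel_upto T)" and w: "integrable M w"
    and eq: "\<And>B. B \<in> sets (borel_upto T) \<Longrightarrow> \<mu> B = (LINT x:B|M. w x)"
  shows "total_variation T \<mu> = density M (\<lambda>x. ennreal (norm1 (w x)))"
proof (rule measure_eqI)
  have wj: "integrable M (\<lambda>x. w x $ j)" for j
    using integrable_bounded_linear[OF bounded_linear_vec_nth w] .
  then have [measurable]: "(\<lambda>x. w x $ j) \<in> borel_measurable M" for j by auto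
  have *: "\<mu> B $ j = (LINT x:B|M. w x $ j)" if "B \<in> sets (borel_upto T)" for B j
    unfolding eq[OF that] set_lebesgue_integral_def
    using w that M by (subst integral_bounded_linear[OF bounded_linear_vec_nth, symmetric]) (auto intro: integrable_mult_indicator)
  have p: "jordan_pos T (\<lambda>B. \<mu> B $ j) = density M (\<lambda>x. ennreal (w x $ j))"
    "jordan_neg T (\<lambda>B. \<mu> B $ j) = density M (\<lambda>x. ennreal (- (w x $ j)))" for j
    using jordan_pos_density[OF vector_measures_nth[OF \<mu>] M wj *] jordan_neg_density[OF vector_measures_nth[OF \<mu>] M wj *] by auto
  fix A assume "A \<in> sets (total_variation T \<mu>)"
  then have A: "A \<in> sets M" by (simp add: M)
  have "emeasure (total_variation T \<mu>) A =
    (\<Sum>j\<in>UNIV. (\<integral>\<^sup>+x. ennreal (w x $ j) * indicator A x \<partial>M) + (\<integral>\<^sup>+x. ennreal (- (w x $ j)) * indicator A x \<partial>M))"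
    using A M by (simp add: emeasure_total_variation p emeasure_density)
  also have "\<dots> = (\<integral>\<^sup>+x. (\<Sum>j\<in>UNIV. ennreal (w x $ j) * indicator A x + ennreal (- (w x $ j)) * indicator A x) \<partial>M)"
    using A by (simp add: nn_integral_sum nn_integral_add)
  also have "\<dots> = (\<integral>\<^sup>+x. ennreal (norm1 (w x)) * indicator A x \<partial>M)"
  proof (intro nn_integral_cong)
    fix x
    have "ennreal (w x $ j) + ennreal (- (w x $ j)) = ennreal \<bar>w x $ j\<bar>" for j
      by (cases "w x $ j \<ge> 0") (auto simp: ennreal_neg)
    then have "(\<Sum>j\<in>UNIV. ennreal (w x $ j) + ennreal (- (w x $ j))) = ennreal (norm1 (w x))"
      by (simp add: norm1_def)
    then show "(\<Sum>j\<in>UNIV. ennreal (w x $ j) * indicator A x + ennreal (- (w x $ j)) * indicator A x) =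
      ennreal (norm1 (w x)) * indicator A x"
      by (simp add: sum_distrib_right[symmetric] distrib_right[symmetric])
  qed
  also have "\<dots> = emeasure (density M (\<lambda>x. ennreal (norm1 (w x)))) A"
    using A by (subst emeasure_density) (auto simp: norm1_def)
  finally show "emeasure (total_variation T \<mu>) A = emeasure (density M (\<lambda>x. ennreal (norm1 (w x)))) A" .
qed (simp add: M)

subsection \<open>Images of densities\<close>

lemma set_integral_sums:
  fixes q :: "'a \<Rightarrow> 'b::{banach, second_countable_topology}"
  assumes A: "\<And>i::nat. A i \<in> sets M" "disjoint_family A" and q: "set_integrable M (\<Union>i. A i) q"
  shows "(\<lambda>i. LINT s:A i|M. q s) sums (LINT s:(\<Union>i. A i)|M. q s)"
proof -
  have "(LINT s:(\<Union>i<n. A i)|M. q s) = (\<Sum>i<n. LINT s:A i|M. q s)" for n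
    using A by (intro set_integral_finite_Union set_integrable_subset[OF q])
      (auto simp: disjoint_family_on_def)
  moreover have "(\<lambda>n. LINT s:(\<Union>i<n. A i)|M. q s) \<longlonglongrightarrow> (LINT s:(\<Union>n. \<Union>i<n. A i)|M. q s)"
  proof (rule set_integral_cont_up)
    have "(\<Union>n. \<Union>i<n. A i) = (\<Union>i. A i)" by auto
    then show "set_integrable M (\<Union>n. \<Union>i<n. A i) q" using q by simp
  qed (use A in \<open>auto intro!: incseq_SucI simp: lessThan_Suc\<close>)
  moreover have "(\<Union>n. \<Union>i<n. A i) = (\<Union>i. A i)" by auto
  ultimately show ?thesis by (simp add: sums_def)
qed

text \<open>The push-forward: the image under \<open>\<Phi>\<close> of the (vector valued) measure with density \<open>q\<close> on \<open>[0, L]\<close>. All measures of the problem have this form,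
  with a common interval \<open>[0, L]\<close>; this turns weak star convergence into convergence of integrals over \<open>[0, L]\<close>.\<close>
definition pf :: "(real \<Rightarrow> real) \<Rightarrow> real \<Rightarrow> (real \<Rightarrow> 'a::{banach, second_countable_topology}) \<Rightarrow> real set \<Rightarrow> 'a" where
  "pf \<Phi> L q A = (LBINT s:{s\<in>{0..L}. \<Phi> s \<in> A}. q s)"

lemma pf_vector_measures:
  assumes [measurable]: "\<Phi> \<in> borel_measurable borel" and q: "set_integrable lborel {0..L} q"
  shows "pf \<Phi> L q \<in> vector_measures T"
  unfolding vector_measures_def
proof (intro CollectI allI impI)
  fix A :: "nat \<Rightarrow> real set" assume A: "range A \<subseteq> sets (borel_upto T)" "disjoint_family A"
  let ?A = "\<lambda>i. {s\<in>{0..L}. \<Phi> s \<in> A i}"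
  have [measurable]: "A i \<in> sets borel" for i using A(1) by (auto simp: sets_borel_upto image_subset_iff)
  have "(\<lambda>i. LBINT s:?A i. q s) sums (LBINT s:(\<Union>i. ?A i). q s)"
  proof (rule set_integral_sums)
    show "?A i \<in> sets lborel" for i by measurable
    show "disjoint_family ?A" using A(2) by (auto simp: disjoint_family_on_def)
    have "(\<Union>i. ?A i) \<in> sets borel" by measurable
    then show "set_integrable lborel (\<Union>i. ?A i) q" by (intro set_integrable_subset[OF q]) auto
  qed
  moreover have "(\<Union>i. ?A i) = {s\<in>{0..L}. \<Phi> s \<in> (\<Union>i. A i)}" by auto
  ultimately show "(\<lambda>i. pf \<Phi> L q (A i)) sums pf \<Phi> L q (\<Union>i. A i)" by (simp add: pf_def)
qed

text \<open>The intervals \<open>]a, b]\<close> form a generator that is stable under intersection.\<close>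
lemma vector_measures_eqI:
  assumes \<delta>: "\<delta> \<in> vector_measures T" "\<delta>' \<in> vector_measures T" and T: "T > 0"
    and eq: "\<And>t. t \<in> {0<..T} \<Longrightarrow> \<delta> {0..t} = \<delta>' {0..t}" and A: "A \<in> sets (borel_upto T)"
  shows "\<delta> A = \<delta>' A"
proof -
  let ?G = "{{a<..b} | a b. 0 < a \<and> b \<le> T}"
  have G: "sets (borel_upto T) = sigma_sets {0..T} ?G"
  proof
    have "?G \<subseteq> sets (borel_upto T)" by (auto simp: sets_borel_upto)
    then show "sigma_sets {0..T} ?G \<subseteq> sets (borel_upto T)"
      using sets.sigma_sets_subset[of ?G "borel_upto T"] by simp
    have gen: "{0..T} \<inter> {..a} \<in> sigma_sets {0..T} ?G" if "0 < a" for a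
    proof -
      have "{0..T} - {a<..T} \<in> sigma_sets {0..T} ?G"
        using that by (intro sigma_sets.Compl sigma_sets.Basic) auto
      moreover have "{0..T} - {a<..T} = {0..T} \<inter> {..a}" by auto
      ultimately show ?thesis by simp
    qed
    have "{0..T} \<inter> {..a} \<in> sigma_sets {0..T} ?G" for a
    proof -
      consider "0 < a" | "a < 0" | "a = 0" by linarith
      then show ?thesis
      proof cases
        case 2 then have "{0..T} \<inter> {..a} = {}" by auto
        then show ?thesis by (simp add: sigma_sets.Empty)
      next
        case 3
        have "{0..T} \<inter> {..a} = (\<Inter>n::nat. {0..T} \<inter> {..1 / Suc n})"
        proof -
          have *: "x \<le> 0" if "\<forall>n::nat. x \<le> 1 / Suc n" for x :: real
            using that LIMSEQ_inverse_real_of_nat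
            by (intro LIMSEQ_le_const[of "\<lambda>n. inverse (real (Suc n))"]) (auto simp: inverse_eq_divide)
          show ?thesis
          proof (intro set_eqI iffI)
            fix x assume "x \<in> {0..T} \<inter> {..a}"
            then show "x \<in> (\<Inter>n::nat. {0..T} \<inter> {..1 / Suc n})" using 3 by auto
          next
            fix x assume "x \<in> (\<Inter>n::nat. {0..T} \<inter> {..1 / Suc n})"
            then have "x \<in> {0..T}" "\<forall>n::nat. x \<le> 1 / Suc n" by auto
            then show "x \<in> {0..T} \<inter> {..a}" using 3 *[of x] by auto
          qed
        qed
        also have "\<dots> \<in> sigma_sets {0..T} ?G"
          by (intro sigma_sets_INTER gen) auto
        finally show ?thesis .
      qed (rule gen)
    qed
    then have *: "(\<inter>) {0..T} ` range atMost \<subseteq> sigma_sets {0..T} ?G" by auto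
    have sets_borel_atMost: "{0..T} \<in> sigma_sets UNIV (range atMost)"
    proof -
      have "{0..T} \<in> sets (sigma UNIV (range atMost) :: real measure)"
        unfolding borel_eq_atMost[symmetric] by simp
      then show ?thesis by simp
    qed
    have "sets (borel_upto T) = (\<inter>) {0..T} ` sigma_sets UNIV (range atMost)"
      by (simp add: sets_restrict_space borel_eq_atMost)
    also have "\<dots> = sigma_sets {0..T} ((\<inter>) {0..T} ` range atMost)"
      by (rule sigma_sets_Int) (use sets_borel_atMost in simp_all)
    also have "\<dots> \<subseteq> sigma_sets {0..T} ?G"
      by (rule sigma_sets_mono[OF *])
    finally show "sets (borel_upto T) \<subseteq> sigma_sets {0..T} ?G" .
  qed
  have st: "Int_stable ?G"
  proof (rule Int_stableI)
    fix A B assume "A \<in> ?G" "B \<in> ?G"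
    then obtain a b c d where "A = {a<..b}" "B = {c<..d}" "0 < a" "b \<le> T" "0 < c" "d \<le> T" by auto
    then show "A \<inter> B \<in> ?G" by (intro CollectI exI[of _ "max a c"] exI[of _ "min b d"]) auto
  qed
  have sub: "?G \<subseteq> Pow {0..T}" by auto
  have tot: "\<delta> {0..T} = \<delta>' {0..T}" using eq T by simp
  from A show ?thesis unfolding G
  proof (induction rule: sigma_sets_induct_disjoint[OF st sub, consumes 1, case_names basic empty compl union])
    case (basic A)
    then obtain a b where ab: "A = {a<..b}" "0 < a" "b \<le> T" by auto
    show ?case
    proof (cases "a \<le> b")
      case True
      then have "A = {0..b} - {0..a}" using ab by auto
      then show ?thesis using ab True eq[of a] eq[of b]
          vector_measures_Diff[OF \<delta>(1), of "{0..b}" "{0..a}"] vector_measures_Diff[OF \<delta>(2), of "{0..b}" "{0..a}"]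
        by (auto simp: sets_borel_upto)
    next
      case False then show ?thesis using ab \<delta> by simp
    qed
  next
    case empty then show ?case using \<delta> by simp
  next
    case (compl A)
    then have "A \<in> sets (borel_upto T)" using G by simp
    then show ?case using compl(2) tot vector_measures_Diff[OF \<delta>(1), of "{0..T}" A]
      vector_measures_Diff[OF \<delta>(2), of "{0..T}" A] by (auto simp: sets_borel_upto)
  next
    case (union A)
    then have "range A \<subseteq> sets (borel_upto T)" using G by simp
    then show ?case using union(1,3) vector_measures_sums[OF \<delta>(1), of A] vector_measures_sums[OF \<delta>(2), of A]
      by (auto intro: sums_unique2)
  qed
qed

text \<open>Turns the choice in the definition of \<open>stieltjes\<close> into an equation: any measure with the right distribution function is the Stieltjes measure.\<close>
lemma stieltjes_eq:
  assumes \<delta>: "\<delta> \<in> vector_measures T" and T: "T > 0"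
    and z: "\<And>t. t \<in> {0<..T} \<Longrightarrow> \<delta> {0..t} = z t - z 0"
  shows "stieltjes T z \<in> vector_measures T" and "A \<in> sets (borel_upto T) \<Longrightarrow> stieltjes T z A = \<delta> A"
proof -
  have "stieltjes T z \<in> vector_measures T \<and> (\<forall>t\<in>{0<..T}. stieltjes T z {0..t} = z t - z 0)"
    unfolding stieltjes_def by (rule someI[of _ \<delta>]) (use \<delta> z in auto)
  then show "stieltjes T z \<in> vector_measures T" "A \<in> sets (borel_upto T) \<Longrightarrow> stieltjes T z A = \<delta> A"
    using vector_measures_eqI[of "stieltjes T z" T \<delta> A] \<delta> T z by auto
qed

text \<open>The positive and negative parts of \<open>q\<close> give a representation of the image as a difference of two measures, possibly not the
  Jordan one; \<open>signed_integral_measure_diff\<close> says that this does not matter.\<close>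
lemma signed_integral_pf:
  fixes q \<psi> :: "real \<Rightarrow> real"
  assumes [measurable]: "\<Phi> \<in> borel_measurable borel" "q \<in> borel_measurable borel"
    and \<Phi>: "\<And>s. s \<in> {0..L} \<Longrightarrow> \<Phi> s \<in> {0..T}" and q: "set_integrable lborel {0..L} q"
    and \<psi>: "continuous_on {0..T} \<psi>"
  shows "signed_integral T (pf \<Phi> L q) {0..T} \<psi> = (LBINT s:{0..L}. \<psi> (\<Phi> s) * q s)"
proof -
  let ?R = "restrict_space lborel {0..L}"
  define P where "P q = distr (density ?R (\<lambda>s. ennreal (max 0 (q s)))) (borel_upto T) \<Phi>" for q :: "real \<Rightarrow> real"
  have \<Phi>m: "\<Phi> \<in> measurable ?R (borel_upto T)"
    using \<Phi> by (intro measurable_restrict_space2 measurable_restrict_space1) (auto simp: space_restrict_space)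
  have meas: "emeasure (P q) A = ennreal (LBINT s:{s\<in>{0..L}. \<Phi> s \<in> A}. max 0 (q s))"
    if A: "A \<in> sets (borel_upto T)" and [measurable]: "q \<in> borel_measurable borel" and q: "set_integrable lborel {0..L} q"
    for A and q :: "real \<Rightarrow> real"
  proof -
    have [measurable]: "A \<in> sets borel" using A by (simp add: sets_borel_upto)
    have "emeasure (P q) A = (\<integral>\<^sup>+s. ennreal (max 0 (q s)) * indicator (\<Phi> -` A \<inter> {0..L}) s \<partial>?R)"
    proof -
      have pre: "\<Phi> -` A \<inter> {0..L} \<in> sets ?R"
        using measurable_sets[OF \<Phi>m A] by (simp add: space_restrict_space)
      have "emeasure (P q) A = emeasure (density ?R (\<lambda>s. ennreal (max 0 (q s)))) (\<Phi> -` A \<inter> {0..L})"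
        unfolding P_def using \<Phi>m A by (subst emeasure_distr) (simp_all add: space_restrict_space)
      then show ?thesis using pre by (simp add: emeasure_density measurable_restrict_space1)
    qed
    also have "\<dots> = (\<integral>\<^sup>+s. ennreal (indicator {s\<in>{0..L}. \<Phi> s \<in> A} s *\<^sub>R max 0 (q s)) \<partial>lborel)"
      by (subst nn_integral_restrict_space) (auto intro!: nn_integral_cong simp: indicator_def)
    also have "\<dots> = ennreal (LBINT s:{s\<in>{0..L}. \<Phi> s \<in> A}. max 0 (q s))"
      unfolding set_lebesgue_integral_def
    proof (rule nn_integral_eq_integral)
      have "set_integrable lborel {0..L} (\<lambda>s. max 0 (q s))"
        by (rule set_integrable_bound[OF q]) (auto simp: set_borel_measurable_def)
      then have "set_integrable lborel {s\<in>{0..L}. \<Phi> s \<in> A} (\<lambda>s. max 0 (q s))"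
        by (rule set_integrable_subset) auto
      then show "integrable lborel (\<lambda>s. indicat_real {s \<in> {0..L}. \<Phi> s \<in> A} s *\<^sub>R max 0 (q s))"
        by (auto simp: set_integrable_def)
    qed (auto simp: indicator_def)
    finally show ?thesis .
  qed
  have fin: "finite_measure (P q)" if "q \<in> borel_measurable borel" "set_integrable lborel {0..L} q" for q :: "real \<Rightarrow> real"
    using meas[OF _ that, of "{0..T}"] by (intro finite_measureI) (auto simp: P_def sets_borel_upto)
  have mq: "(\<lambda>s. - q s) \<in> borel_measurable borel" "set_integrable lborel {0..L} (\<lambda>s. - q s)"
    using q by (auto simp: set_integrable_def)
  have int: "(LINT t:{0..T}|P q. \<psi> t) = (LBINT s:{0..L}. max 0 (q s) * \<psi> (\<Phi> s))"
    if [measurable]: "q \<in> borel_measurable borel" for q :: "real \<Rightarrow> real"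
  proof -
    have \<psi>m: "\<psi> \<in> borel_measurable (borel_upto T)" using \<psi> by (rule borel_measurable_continuous_on_restrict)
    have "(LINT t:{0..T}|P q. \<psi> t) = (\<integral>t. \<psi> t \<partial>P q)"
      unfolding set_lebesgue_integral_def by (intro Bochner_Integration.integral_cong) (auto simp: P_def)
    also have "\<dots> = (\<integral>s. \<psi> (\<Phi> s) \<partial>density ?R (\<lambda>s. ennreal (max 0 (q s))))"
      unfolding P_def using \<Phi>m \<psi>m by (intro integral_distr) auto
    also have "\<dots> = (\<integral>s. max 0 (q s) *\<^sub>R \<psi> (\<Phi> s) \<partial>?R)"
      using measurable_compose[OF \<Phi>m \<psi>m] by (intro integral_density) (auto intro: measurable_restrict_space1)
    also have "\<dots> = (LBINT s:{0..L}. max 0 (q s) * \<psi> (\<Phi> s))"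
      by (subst integral_restrict_space) (auto simp: set_lebesgue_integral_def)
    finally show ?thesis .
  qed
  obtain c where c: "\<And>t. t \<in> {0..T} \<Longrightarrow> norm (\<psi> t) \<le> c"
    using compact_imp_bounded[OF compact_continuous_image[OF \<psi> compact_Icc]]
    unfolding bounded_iff by blast
  have i: "set_integrable lborel {0..L} (\<lambda>s. max 0 (q s) * \<psi> (\<Phi> s))"
    if [measurable]: "q \<in> borel_measurable borel" and q: "set_integrable lborel {0..L} q" for q :: "real \<Rightarrow> real"
  proof -
    have \<psi>m: "\<psi> \<in> borel_measurable (borel_upto T)" using \<psi> by (rule borel_measurable_continuous_on_restrict)
    have "(\<lambda>s. \<psi> (\<Phi> s)) \<in> borel_measurable ?R" using measurable_compose[OF \<Phi>m \<psi>m] .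
    then have m: "(\<lambda>s. indicator {0..L} s *\<^sub>R \<psi> (\<Phi> s)) \<in> borel_measurable lborel"
      by (subst (asm) borel_measurable_restrict_space_iff) auto
    have "(\<lambda>s. max 0 (q s) *\<^sub>R (indicator {0..L} s *\<^sub>R \<psi> (\<Phi> s))) \<in> borel_measurable lborel"
      by (intro borel_measurable_scaleR m) auto
    then have "set_borel_measurable lborel {0..L} (\<lambda>s. max 0 (q s) * \<psi> (\<Phi> s))"
      by (simp add: set_borel_measurable_def mult_ac)
    from set_integrable_mult_right[of c, OF q] this show ?thesis
    proof (rule set_integrable_bound)
      show "AE x in lborel. x \<in> {0..L} \<longrightarrow> norm (max 0 (q x) * \<psi> (\<Phi> x)) \<le> norm (c * q x)"
      proof (intro AE_I2 impI)
        fix x assume "x \<in> {0..L}"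
        then have "\<bar>\<psi> (\<Phi> x)\<bar> \<le> \<bar>c\<bar>" using c[OF \<Phi>] by force
        then have "\<bar>max 0 (q x)\<bar> * \<bar>\<psi> (\<Phi> x)\<bar> \<le> \<bar>q x\<bar> * \<bar>c\<bar>" by (intro mult_mono) auto
        then show "norm (max 0 (q x) * \<psi> (\<Phi> x)) \<le> norm (c * q x)" by (simp add: abs_mult mult.commute)
      qed
    qed
  qed
  have "signed_integral T (pf \<Phi> L q) {0..T} \<psi> = (LINT t:{0..T}|P q. \<psi> t) - (LINT t:{0..T}|P (\<lambda>s. - q s). \<psi> t)"
  proof (rule signed_integral_measure_diff[OF pf_vector_measures _ _ _ _ _ \<psi>])
    fix A assume A: "A \<in> sets (borel_upto T)"
    then have [measurable]: "A \<in> sets borel" by (simp add: sets_borel_upto)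
    let ?A = "{s\<in>{0..L}. \<Phi> s \<in> A}"
    have si: "set_integrable lborel ?A (\<lambda>s. max 0 (q s))" if "q \<in> borel_measurable borel" "set_integrable lborel {0..L} q" for q :: "real \<Rightarrow> real"
      by (rule set_integrable_bound[OF set_integrable_subset[OF that(2), of ?A]]) (use that in \<open>auto simp: set_borel_measurable_def\<close>)
    have nn: "(LBINT s:?A. max 0 (q s)) \<ge> 0" for q :: "real \<Rightarrow> real"
      unfolding set_lebesgue_integral_def by (intro integral_nonneg_AE) (auto simp: indicator_def)
    have "pf \<Phi> L q A = (LBINT s:?A. max 0 (q s) - max 0 (- q s))"
      unfolding pf_def by (intro arg_cong[where f="set_lebesgue_integral _ _"] ext) (auto simp: max_def)
    also have "\<dots> = measure (P q) A - measure (P (\<lambda>s. - q s)) A"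
      using si[OF assms(2) q] si[OF mq] meas[OF A assms(2) q] meas[OF A mq] nn
      by (simp add: measure_def)
    finally show "pf \<Phi> L q A = measure (P q) A - measure (P (\<lambda>s. - q s)) A" .
  qed (use fin q mq assms in \<open>auto simp: P_def\<close>)
  also have "\<dots> = (LBINT s:{0..L}. max 0 (q s) * \<psi> (\<Phi> s) - max 0 (- q s) * \<psi> (\<Phi> s))"
    using i[OF assms(2) q] i[OF mq] int[OF assms(2)] int[OF mq(1)] by (simp add: set_integral_diff)
  also have "\<dots> = (LBINT s:{0..L}. \<psi> (\<Phi> s) * q s)"
    by (intro arg_cong[where f="set_lebesgue_integral _ _"] ext) (auto simp: max_def)
  finally show ?thesis .
qed

section \<open>Delay equations\<close>

subsection \<open>Integrals of bounded functions over intervals\<close>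

lemma set_integrable_bounded:
  fixes F :: "real \<Rightarrow> 'e::{banach, second_countable_topology}"
  assumes [measurable]: "F \<in> borel_measurable borel" and B: "\<And>s. s \<in> {a..b} \<Longrightarrow> norm (F s) \<le> B"
  shows "set_integrable lborel {a..b} F"
proof -
  have "set_integrable lborel {a..b} (\<lambda>_. B)"
    by (rule borel_integrable_atLeastAtMost') simp
  then show ?thesis
    by (rule set_integrable_bound) (use B in \<open>force simp: set_borel_measurable_def intro!: AE_I2 order_trans[OF B]\<close>)+
qed

lemma norm_set_integral_le:
  fixes F :: "real \<Rightarrow> 'e::{banach, second_countable_topology}" and \<phi> :: "real \<Rightarrow> real"
  assumes [measurable]: "F \<in> borel_measurable borel" and \<phi>: "set_integrable lborel {a..b} \<phi>"
    and B: "\<And>s. s \<in> {a..b} \<Longrightarrow> norm (F s) \<le> \<phi> s"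
  shows "norm (LBINT s:{a..b}. F s) \<le> (LBINT s:{a..b}. \<phi> s)"
  unfolding set_lebesgue_integral_def
proof (rule order_trans[OF integral_norm_bound integral_mono])
  show "integrable lborel (\<lambda>s. indicat_real {a..b} s *\<^sub>R \<phi> s)" using \<phi> by (simp add: set_integrable_def)
  then show "integrable lborel (\<lambda>s. norm (indicat_real {a..b} s *\<^sub>R F s))"
    by (rule Bochner_Integration.integrable_bound) (use B in \<open>force simp: indicator_def intro!: AE_I2\<close>)+
qed (use B in \<open>auto simp: indicator_def\<close>)

lemma norm_set_integral_bounded:
  fixes F :: "real \<Rightarrow> 'e::{banach, second_countable_topology}"
  assumes "F \<in> borel_measurable borel" and "a \<le> b"
    and "\<And>s. s \<in> {a..b} \<Longrightarrow> norm (F s) \<le> B"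
  shows "norm (LBINT s:{a..b}. F s) \<le> B * (b - a)"
proof -
  have "norm (LBINT s:{a..b}. F s) \<le> (LBINT s:{a..b}. B)"
    using assms by (intro norm_set_integral_le) (auto simp: set_integrable_def)
  then show ?thesis using assms(2) by (simp add: set_lebesgue_integral_def mult.commute)
qed

lemma set_integral_Icc_add:
  fixes F :: "real \<Rightarrow> 'e::{banach, second_countable_topology}"
  assumes F: "set_integrable lborel {a..c} F" and "a \<le> b" "b \<le> c"
  shows "(LBINT s:{a..c}. F s) = (LBINT s:{a..b}. F s) + (LBINT s:{b..c}. F s)"
proof -
  have i: "set_integrable lborel {a..b} F" "set_integrable lborel {b..c} F"
    using assms by (auto intro!: set_integrable_subset[OF F])
  have "AE x in lborel. \<not> (x \<in> {a..b} \<and> x \<in> {b..c})"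
    by (rule AE_mp[OF AE_lborel_singleton[of b]]) auto
  from set_integral_Un_AE[OF this _ _ i] have "(LBINT s:{a..b} \<union> {b..c}. F s) = (LBINT s:{a..b}. F s) + (LBINT s:{b..c}. F s)"
    by simp
  moreover have "{a..b} \<union> {b..c} = {a..c}" using assms by auto
  ultimately show ?thesis by simp
qed

lemma indefinite_integral_Lipschitz:
  fixes F :: "real \<Rightarrow> 'e::{banach, second_countable_topology}"
  assumes F: "F \<in> borel_measurable borel" and B: "\<And>s. norm (F s) \<le> B" and ab: "0 \<le> a" "a \<le> b"
  shows "norm ((LBINT s:{0..b}. F s) - (LBINT s:{0..a}. F s)) \<le> B * (b - a)"
  using set_integral_Icc_add[OF set_integrable_bounded[OF F, of 0 b B] ab] B
    norm_set_integral_bounded[OF F ab(2), of B] by simp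

lemma continuous_indefinite_integral:
  fixes F :: "real \<Rightarrow> 'e::{banach, second_countable_topology}"
  assumes F: "F \<in> borel_measurable borel" and B: "\<And>s. norm (F s) \<le> B"
  shows "continuous_on {0..} (\<lambda>b. LBINT s:{0..b}. F s)"
proof -
  have B0: "B \<ge> 0" using B[of 0] norm_ge_zero order_trans by blast
  have "B-lipschitz_on {0..} (\<lambda>b. LBINT s:{0..b}. F s)"
  proof (rule lipschitz_onI[OF _ B0])
    fix x y :: real assume "x \<in> {0..}" "y \<in> {0..}"
    then show "dist (LBINT s:{0..x}. F s) (LBINT s:{0..y}. F s) \<le> B * dist x y"
      using indefinite_integral_Lipschitz[OF F B, of x y] indefinite_integral_Lipschitz[OF F B, of y x]
      by (cases "x \<le> y") (auto simp: dist_norm norm_minus_commute abs_if)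
  qed
  then show ?thesis by (rule lipschitz_on_continuous_on)
qed

lemma integral_exp_weight:
  assumes "C > 0" "s \<ge> (0::real)"
  shows "set_integrable lborel {0..s} (\<lambda>r. C * exp (2 * C * r))"
    and "(LBINT r:{0..s}. C * exp (2 * C * r)) = (exp (2 * C * s) - 1) / 2"
proof -
  have "continuous_on {0..s} (\<lambda>r. C * exp (2 * C * r))" by (intro continuous_intros)
  then show "set_integrable lborel {0..s} (\<lambda>r. C * exp (2 * C * r))"
    unfolding set_integrable_def by (rule borel_integrable_compact[rotated]) simp
  have "integral\<^sup>L lborel (\<lambda>x. indicator {0..s} x *\<^sub>R (C * exp (2 * C * x))) = exp (2 * C * s) / 2 - exp (2 * C * 0) / 2"
    using assms by (intro integral_FTC_Icc) (auto intro!: derivative_eq_intros continuous_intros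
        simp: has_real_derivative_iff_has_vector_derivative[symmetric])
  then show "(LBINT r:{0..s}. C * exp (2 * C * r)) = (exp (2 * C * s) - 1) / 2"
    unfolding set_lebesgue_integral_def by (simp only: diff_divide_distrib mult_zero_right exp_zero)
qed

subsection \<open>Existence and stability\<close>

lemma norm_delayed_le:
  fixes z :: "real \<Rightarrow> 'e::real_normed_vector" and lag :: "'k::finite \<Rightarrow> nat" and c S :: real
  assumes "\<And>k. norm (z (t - real (lag k) * S)) \<le> c"
  shows "norm (delayed lag S z t) \<le> CARD('k) * c"
proof -
  have "norm (delayed lag S z t) \<le> (\<Sum>k\<in>UNIV. norm (delayed lag S z t $ k))"
    unfolding norm_vec_def by (rule L2_set_le_sum) simp
  also have "\<dots> \<le> (\<Sum>k\<in>(UNIV::'k set). c)" using assms by (intro sum_mono) (simp add: delayed_def)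
  finally show ?thesis by simp
qed

lemma delayed_diff: "delayed lag S y t - delayed lag S z t = delayed lag S (\<lambda>t. y t - z t) t"
  by (simp add: delayed_def vec_eq_iff)

lemma borel_measurable_vec_lambda:
  fixes f :: "'k::finite \<Rightarrow> 'a \<Rightarrow> 'e::euclidean_space"
  assumes "\<And>k. f k \<in> borel_measurable M"
  shows "(\<lambda>x. (\<chi> k. f k x) :: 'e ^ 'k) \<in> borel_measurable M"
proof -
  have "(\<lambda>x. (\<chi> k. f k x) :: 'e ^ 'k) = (\<lambda>x. \<Sum>k\<in>UNIV. axis k (f k x))"
    by (intro ext) (simp add: vec_eq_iff axis_def if_distrib sum.If_cases cong: if_cong)
  moreover have "(\<lambda>x. axis k (f k x) :: 'e ^ 'k) \<in> borel_measurable M" for k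
  proof -
    have "linear (\<lambda>v. axis k v :: 'e ^ 'k)"
      by (intro linearI) (auto simp: axis_def vec_eq_iff)
    then have "continuous_on UNIV (\<lambda>v. axis k v :: 'e ^ 'k)" by (rule linear_continuous_on[OF linear_conv_bounded_linear[THEN iffD1]])
    then show ?thesis using assms borel_measurable_continuous_on by blast
  qed
  ultimately show ?thesis by simp
qed

lemma delayed_measurable [measurable]:
  fixes y :: "real \<Rightarrow> 'e::euclidean_space" and lag :: "'k::finite \<Rightarrow> nat"
  assumes [measurable]: "y \<in> borel_measurable borel"
  shows "delayed lag S y \<in> borel_measurable borel"
proof -
  have "(\<lambda>t. (\<chi> k. y (t - real (lag k) * S)) :: 'e ^ 'k) \<in> borel_measurable borel"
    by (rule borel_measurable_vec_lambda) measurable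
  then show ?thesis unfolding delayed_def[abs_def] .
qed

text \<open>In the norm weighted by \<open>exp (- 2 c s)\<close>, where \<open>c = C * CARD('k)\<close> is the Lipschitz constant in terms of the path, the Picard
  operator contracts by the factor \<open>1/2\<close>. A delay only helps, since the weight increases.\<close>
lemma delay_equation_contraction:
  fixes G :: "real \<Rightarrow> 'e::euclidean_space ^ 'k::finite \<Rightarrow> 'e" and y z :: "real \<Rightarrow> 'e" and \<rho> B C D S :: real
  assumes [measurable]: "(\<lambda>s. G s (delayed lag S y s)) \<in> borel_measurable borel" "(\<lambda>s. G s (delayed lag S z s)) \<in> borel_measurable borel"
    and GB: "\<And>s q. norm (G s q) \<le> B"
    and lip: "\<And>s q q'. norm q \<le> CARD('k) * \<rho> \<Longrightarrow> norm q' \<le> CARD('k) * \<rho> \<Longrightarrow> norm (G s q - G s q') \<le> C * norm (q - q')"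
    and C: "C > 0" and S: "S \<ge> 0"
    and yz: "\<And>s. norm (y s) \<le> \<rho>" "\<And>s. norm (z s) \<le> \<rho>" "\<And>s. s < 0 \<Longrightarrow> y s = z s"
    and D: "\<And>s. s \<ge> 0 \<Longrightarrow> norm (y s - z s) \<le> D * exp (2 * (C * CARD('k)) * s)" and s: "s \<ge> 0"
  shows "norm ((LBINT r:{0..s}. G r (delayed lag S y r)) - (LBINT r:{0..s}. G r (delayed lag S z r)))
    \<le> D / 2 * exp (2 * (C * CARD('k)) * s)"
proof -
  let ?C = "C * CARD('k)"
  have C': "?C > 0" using C by simp
  have D0: "D \<ge> 0" using D[of 0] by (auto intro: order_trans[OF norm_ge_zero])
  have i: "set_integrable lborel {0..s} (\<lambda>s. G s (delayed lag S y s))" "set_integrable lborel {0..s} (\<lambda>s. G s (delayed lag S z s))"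
    by (rule set_integrable_bounded[where B = B]; use GB in simp)+
  have pt: "norm (G r (delayed lag S y r) - G r (delayed lag S z r)) \<le> D * (?C * exp (2 * ?C * r))"
    if "r \<in> {0..s}" for r
  proof -
    have "norm (G r (delayed lag S y r) - G r (delayed lag S z r)) \<le> C * norm (delayed lag S y r - delayed lag S z r)"
      using yz by (intro lip norm_delayed_le) auto
    also have "norm (delayed lag S y r - delayed lag S z r) \<le> CARD('k) * (D * exp (2 * ?C * r))"
      unfolding delayed_diff
    proof (rule norm_delayed_le)
      fix k
      let ?t = "r - real (lag k) * S"
      have "?t \<le> r" using S by simp
      show "norm (y ?t - z ?t) \<le> D * exp (2 * ?C * r)"
      proof (cases "?t < 0")
        case True then show ?thesis using yz(3)[OF True] D0 by simp
      next
        case False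
        then have "norm (y ?t - z ?t) \<le> D * exp (2 * ?C * ?t)" by (intro D) simp
        also have "\<dots> \<le> D * exp (2 * ?C * r)"
          using D0 C C' \<open>?t \<le> r\<close> by (intro mult_left_mono) (auto intro!: mult_left_mono simp del: mult_le_cancel_left_pos)
        finally show ?thesis .
      qed
    qed
    finally show ?thesis using C by (simp add: algebra_simps)
  qed
  have "norm (LBINT r:{0..s}. G r (delayed lag S y r) - G r (delayed lag S z r))
     \<le> (LBINT r:{0..s}. D * (?C * exp (2 * ?C * r)))"
    using pt integral_exp_weight(1)[OF C' s] by (intro norm_set_integral_le) auto
  also have "\<dots> = D * ((exp (2 * ?C * s) - 1) / 2)" using integral_exp_weight(2)[OF C' s] by simp
  also have "\<dots> \<le> D / 2 * exp (2 * ?C * s)" using D0 by (simp add: field_simps)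
  finally show ?thesis using i by (simp add: set_integral_diff)
qed

text \<open>Picard iteration, starting from the history extended by the constant initial value.\<close>
lemma delay_equation_exists:
  fixes G :: "real \<Rightarrow> 'e::euclidean_space ^ 'k::finite \<Rightarrow> 'e" and H :: "real \<Rightarrow> 'e" and \<rho> B C S L :: real
  assumes meas: "\<And>y. y \<in> borel_measurable borel \<Longrightarrow> (\<lambda>s. G s (delayed lag S y s)) \<in> borel_measurable borel"
    and GB: "\<And>s q. norm (G s q) \<le> B" and G0: "\<And>s q. s > L \<Longrightarrow> G s q = 0"
    and lip: "\<And>s q q'. norm q \<le> CARD('k) * \<rho> \<Longrightarrow> norm q' \<le> CARD('k) * \<rho> \<Longrightarrow> norm (G s q - G s q') \<le> C * norm (q - q')"
    and C: "C > 0" and S: "S \<ge> 0" and L: "L \<ge> 0"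
    and H[measurable]: "H \<in> borel_measurable borel" and HB: "\<And>s. norm (H s) \<le> \<rho>" and \<rho>: "norm x0 + B * L \<le> \<rho>"
  shows "\<exists>y. y \<in> borel_measurable borel \<and> (\<forall>s. norm (y s) \<le> \<rho>) \<and> (\<forall>s<0. y s = H s) \<and>
    (\<forall>s\<ge>0. y s = x0 + (LBINT r:{0..s}. G r (delayed lag S y r)))"
proof -
  let ?C = "C * CARD('k)"
  define P where "P y \<longleftrightarrow> y \<in> borel_measurable borel \<and> (\<forall>s. norm (y s) \<le> \<rho>) \<and> (\<forall>s<0. y s = H s)" for y
  define step where "step y s = (if s < 0 then H s else x0 + (LBINT r:{0..s}. G r (delayed lag S y r)))" for y s
  have B0: "B \<ge> 0" using GB[of 0 0] norm_ge_zero order_trans by blast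
  have Pstep: "P (step y)" if y: "P y" for y
  proof -
    have [measurable]: "(\<lambda>s. G s (delayed lag S y s)) \<in> borel_measurable borel" using y by (intro meas) (simp add: P_def)
    have c: "continuous_on {0..} (\<lambda>s. x0 + (LBINT r:{0..s}. G r (delayed lag S y r)))"
      using GB by (intro continuous_intros continuous_indefinite_integral[where B = B]) auto
    have "continuous_on UNIV (\<lambda>s. x0 + (LBINT r:{0..max 0 s}. G r (delayed lag S y r)))"
      by (rule continuous_on_compose2[OF c, of UNIV "max 0"]) (auto intro!: continuous_intros)
    then have [measurable]: "(\<lambda>s. x0 + (LBINT r:{0..max 0 s}. G r (delayed lag S y r))) \<in> borel_measurable borel"
      by (rule borel_measurable_continuous_onI)
    have "step y = (\<lambda>s. if s < 0 then H s else x0 + (LBINT r:{0..max 0 s}. G r (delayed lag S y r)))"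
      by (auto simp: step_def max_def fun_eq_iff)
    also have "\<dots> \<in> borel_measurable borel" by measurable
    finally have "step y \<in> borel_measurable borel" .
    moreover have "norm (step y s) \<le> \<rho>" for s
    proof (cases "s < 0")
      case False
      have "(LBINT r:{0..s}. G r (delayed lag S y r)) = (LBINT r:{0..min s L}. G r (delayed lag S y r))"
        unfolding set_lebesgue_integral_def
        by (intro Bochner_Integration.integral_cong) (auto simp: indicator_def G0)
      also have "norm \<dots> \<le> B * (min s L - 0)"
        using False L GB by (intro norm_set_integral_bounded) auto
      also have "\<dots> \<le> B * L" using B0 by (intro mult_left_mono) auto
      finally show ?thesis using False \<rho> norm_triangle_ineq[of x0 "LBINT r:{0..s}. G r (delayed lag S y r)"]
        by (simp add: step_def)
    qed (use HB in \<open>simp add: step_def\<close>)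
    ultimately show ?thesis by (simp add: P_def step_def)
  qed
  have contr: "norm (step y s - step z s) \<le> D / 2 * exp (2 * ?C * s)"
    if "P y" "P z" "\<And>s. s \<ge> 0 \<Longrightarrow> norm (y s - z s) \<le> D * exp (2 * ?C * s)" "s \<ge> 0" for y z D s
    using delay_equation_contraction[of G lag S y z B \<rho> C D s] that meas GB lip C S
    by (auto simp: step_def P_def)
  define Y where "Y n = (step ^^ n) (step (\<lambda>s. if s < 0 then H s else x0))" for n
  have x0\<rho>: "norm x0 \<le> \<rho>" using \<rho> mult_nonneg_nonneg[OF B0 L] by linarith
  have YS: "Y (Suc n) = step (Y n)" for n by (simp add: Y_def)
  have PY: "P (Y n)" for n
  proof (induction n)
    case 0
    have "P (\<lambda>s. if s < 0 then H s else x0)"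
      using x0\<rho> HB by (auto simp: P_def)
    then show ?case by (simp add: Y_def Pstep)
  qed (simp add: YS Pstep)
  have d: "norm (Y (Suc n) s - Y n s) \<le> 2 * \<rho> * (1/2) ^ n * exp (2 * ?C * s)" if "s \<ge> 0" for n s
    using that
  proof (induction n arbitrary: s)
    case 0
    have "norm (Y (Suc 0) s - Y 0 s) \<le> 2 * \<rho>"
      using PY[of 0] PY[of "Suc 0"] norm_triangle_ineq4[of "Y (Suc 0) s" "Y 0 s"]
      by (auto simp: P_def intro: order_trans) (smt (verit))
    also have "2 * \<rho> \<le> 2 * \<rho> * exp (2 * ?C * s)"
    proof -
      have "1 \<le> exp (2 * ?C * s)" using 0 C by simp
      moreover have "0 \<le> 2 * \<rho>" using x0\<rho> norm_ge_zero[of x0] by linarith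
      ultimately show ?thesis using mult_left_mono[of 1 "exp (2 * ?C * s)" "2 * \<rho>"] by simp
    qed
    finally show ?case by simp
  next
    case (Suc n)
    show ?case using contr[OF PY PY Suc.IH Suc.prems] unfolding YS[symmetric] by simp
  qed
  have neg: "Y n s = H s" if "s < 0" for n s using PY that by (simp add: P_def)
  define y where "y s = Y 0 s + (\<Sum>m. Y (Suc m) s - Y m s)" for s
  have tail: "norm (y s - Y n s) \<le> 4 * \<rho> * (1/2) ^ n * exp (2 * ?C * s)" "summable (\<lambda>m. Y (Suc m) s - Y m s)" if "s \<ge> 0" for n s
  proof -
    let ?d = "\<lambda>m. Y (Suc m) s - Y m s"
    have g: "summable (\<lambda>m. 2 * \<rho> * (1/2) ^ (m + n) * exp (2 * ?C * s))" for n
      by (intro summable_mult2 summable_mult summable_ignore_initial_segment) (simp add: summable_geometric)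
    show sd: "summable ?d" using d[OF that] g[of 0] by (intro summable_comparison_test'[of _ 0 ?d]) auto
    have "(\<Sum>m<n. ?d m) = Y n s - Y 0 s" by (rule sum_lessThan_telescope)
    then have tele: "Y n s = Y 0 s + (\<Sum>m<n. ?d m)" by simp
    have "y s - Y n s = (\<Sum>m. ?d (m + n))"
      by (subst tele) (simp add: y_def suminf_minus_initial_segment[OF sd])
    also have "norm \<dots> \<le> (\<Sum>m. 2 * \<rho> * (1/2) ^ (m + n) * exp (2 * ?C * s))"
      by (rule norm_suminf_le[OF d[OF that] g])
    also have "\<dots> = (\<Sum>m. (2 * \<rho> * (1/2) ^ n * exp (2 * ?C * s)) * (1/2) ^ m)"
      by (intro suminf_cong) (simp add: power_add)
    also have "\<dots> = 4 * \<rho> * (1/2) ^ n * exp (2 * ?C * s)"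
      by (subst suminf_mult) (auto simp: suminf_geometric)
    finally show "norm (y s - Y n s) \<le> 4 * \<rho> * (1/2) ^ n * exp (2 * ?C * s)" .
  qed
  have lim0: "(\<lambda>n. c * (1/2) ^ n * e) \<longlonglongrightarrow> 0" for c e :: real
    by (intro tendsto_mult_left_zero tendsto_mult_right_zero LIMSEQ_power_zero) auto
  have yneg: "y s = H s" if "s < 0" for s using that by (simp add: y_def neg)
  have conv: "(\<lambda>n. Y n s) \<longlonglongrightarrow> y s" for s
  proof (cases "s < 0")
    case False
    then have "(\<lambda>n. norm (Y n s - y s)) \<longlonglongrightarrow> 0"
      using tail(1)[of s] by (intro tendsto_sandwich[OF _ _ tendsto_const lim0[of "4*\<rho>" "exp (2 * ?C * s)"]])
        (auto simp: norm_minus_commute)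
    then show ?thesis using LIM_zero_cancel tendsto_norm_zero_iff by blast
  qed (simp add: neg yneg)
  have Py: "P y"
    unfolding P_def
  proof (intro conjI allI impI)
    show "y \<in> borel_measurable borel"
      by (rule borel_measurable_LIMSEQ_metric[OF _ conv]) (use PY in \<open>simp add: P_def\<close>)
    show "norm (y s) \<le> \<rho>" for s
      using PY by (intro LIMSEQ_le_const2[OF tendsto_norm[OF conv[of s]]]) (auto simp: P_def)
  qed (rule yneg)
  have "y s = step y s" if "s \<ge> 0" for s
  proof -
    have "norm (step y s - y s) \<le> 4 * \<rho> * (1/2) ^ n * exp (2 * ?C * s)" for n
    proof -
      have "norm (step y s - step (Y n) s) \<le> (4 * \<rho> * (1/2) ^ n) / 2 * exp (2 * ?C * s)"
        by (rule contr[OF Py PY tail(1) that])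
      moreover have "norm (y s - step (Y n) s) \<le> 4 * \<rho> * (1/2) ^ Suc n * exp (2 * ?C * s)"
        using tail(1)[OF that, of "Suc n"] by (simp add: YS)
      moreover have "norm (step y s - y s) \<le> norm (step y s - step (Y n) s) + norm (y s - step (Y n) s)"
        using norm_triangle_ineq4[of "step y s - step (Y n) s" "y s - step (Y n) s"] by simp
      moreover have "(4 * \<rho> * (1/2) ^ n) / 2 * e + 4 * \<rho> * (1/2) ^ Suc n * e = 4 * \<rho> * (1/2) ^ n * e" for e
        by simp
      ultimately show ?thesis by smt
    qed
    then have "norm (step y s - y s) \<le> 0" by (intro LIMSEQ_le_const[OF lim0[of "4*\<rho>" "exp (2 * ?C * s)"]]) auto
    then show ?thesis by simp
  qed
  then show ?thesis using Py by (intro exI[of _ y]) (auto simp: P_def step_def)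
qed

text \<open>Gronwall in weighted form: with \<open>m\<close> the supremum of the weighted difference, the contraction estimate yields
  \<open>m \<le> const * \<eta> + m / 2\<close>.\<close>
lemma delay_equation_stability:
  fixes G G' :: "real \<Rightarrow> 'e::euclidean_space ^ 'k::finite \<Rightarrow> 'e" and y y' :: "real \<Rightarrow> 'e" and \<rho> B C S L \<eta> :: real
  assumes [measurable]: "(\<lambda>s. G s (delayed lag S y s)) \<in> borel_measurable borel" "(\<lambda>s. G' s (delayed lag S y' s)) \<in> borel_measurable borel"
    and GB: "\<And>s q. norm (G s q) \<le> B" "\<And>s q. norm (G' s q) \<le> B"
    and close: "\<And>s q q'. s \<in> {0..L} \<Longrightarrow> norm q \<le> CARD('k) * \<rho> \<Longrightarrow> norm q' \<le> CARD('k) * \<rho> \<Longrightarrow>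
        norm (G s q - G' s q') \<le> \<eta> + C * norm (q - q')"
    and C: "C > 0" and S: "S \<ge> 0" and \<eta>: "\<eta> \<ge> 0"
    and B: "\<And>s. norm (y s) \<le> \<rho>" "\<And>s. norm (y' s) \<le> \<rho>"
    and neg: "\<And>s k. s \<in> {0..L} \<Longrightarrow> s - real (lag k) * S < 0 \<Longrightarrow>
       norm (y (s - real (lag k) * S) - y' (s - real (lag k) * S)) \<le> \<eta>"
    and y: "\<And>s. s \<in> {0..L} \<Longrightarrow> y s = x0 + (LBINT r:{0..s}. G r (delayed lag S y r))"
    and y': "\<And>s. s \<in> {0..L} \<Longrightarrow> y' s = x0 + (LBINT r:{0..s}. G' r (delayed lag S y' r))"
    and s: "s \<in> {0..L}"
  shows "norm (y s - y' s) \<le> 2 * L * (1 + C * CARD('k)) * exp (2 * (C * CARD('k)) * L) * \<eta>"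
proof -
  let ?C = "C * CARD('k)"
  let ?e = "\<lambda>s. norm (y s - y' s) * exp (- (2 * ?C * s))"
  have C': "?C > 0" using C by simp
  have L: "L \<ge> 0" using s by simp
  have bdd: "bdd_above (?e ` {0..L})"
  proof (intro bdd_aboveI2)
    fix s assume "s \<in> {0..L}"
    then have "exp (- (2 * ?C * s)) \<le> 1" using C' by simp
    moreover have "norm (y s - y' s) \<le> 2 * \<rho>" using B[of s] norm_triangle_ineq4[of "y s" "y' s"] by linarith
    moreover have "0 \<le> \<rho>" using B(1)[of s] norm_ge_zero order_trans by blast
    ultimately show "?e s \<le> 2 * \<rho> * 1" by (intro mult_mono) auto
  qed
  \<comment> \<open>the best constant in the weighted estimate; it exists as both paths are bounded\<close>
  define m where "m = (SUP s\<in>{0..L}. ?e s)"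
  have m: "norm (y s - y' s) \<le> m * exp (2 * ?C * s)" if "s \<in> {0..L}" for s
  proof -
    have "?e s \<le> m" unfolding m_def using that bdd by (rule cSUP_upper)
    then show ?thesis by (simp add: exp_minus field_simps)
  qed
  have m0: "m \<ge> 0" using m[OF s] by (smt (verit) exp_gt_zero norm_ge_zero zero_le_mult_iff)
  have est: "norm (y s - y' s) \<le> L * (1 + ?C) * \<eta> + m / 2 * exp (2 * ?C * s)" if s: "s \<in> {0..L}" for s
  proof -
    have i: "set_integrable lborel {0..s} (\<lambda>s. G s (delayed lag S y s))" "set_integrable lborel {0..s} (\<lambda>s. G' s (delayed lag S y' s))"
      by (rule set_integrable_bounded[where B = B]; use GB in simp)+
    have pt: "norm (G r (delayed lag S y r) - G' r (delayed lag S y' r)) \<le> (1 + ?C) * \<eta> + m * (?C * exp (2 * ?C * r))"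
      if r: "r \<in> {0..s}" for r
    proof -
      have rL: "r \<in> {0..L}" using r s by auto
      have "norm (G r (delayed lag S y r) - G' r (delayed lag S y' r)) \<le> \<eta> + C * norm (delayed lag S y r - delayed lag S y' r)"
        using B by (intro close norm_delayed_le rL) auto
      also have "norm (delayed lag S y r - delayed lag S y' r) \<le> CARD('k) * (\<eta> + m * exp (2 * ?C * r))"
        unfolding delayed_diff
      proof (rule norm_delayed_le)
        fix k
        let ?t = "r - real (lag k) * S"
        have "?t \<le> r" using S by simp
        show "norm (y ?t - y' ?t) \<le> \<eta> + m * exp (2 * ?C * r)"
        proof (cases "?t < 0")
          case True
          have "0 \<le> m * exp (2 * ?C * r)" using m0 by simp
          then show ?thesis using neg[OF rL True] by linarith
        next
          case False
          then have "norm (y ?t - y' ?t) \<le> m * exp (2 * ?C * ?t)" using rL \<open>?t \<le> r\<close> by (intro m) auto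
          also have "\<dots> \<le> m * exp (2 * ?C * r)"
            using m0 C C' \<open>?t \<le> r\<close> by (intro mult_left_mono) (auto intro!: mult_left_mono simp del: mult_le_cancel_left_pos)
          finally show ?thesis using \<eta> by linarith
        qed
      qed
      finally show ?thesis using C by (simp add: mult_left_mono algebra_simps)
    qed
    have iw: "set_integrable lborel {0..s} (\<lambda>r. m * (?C * exp (2 * ?C * r)))"
      using integral_exp_weight(1)[OF C', of s] s by auto
    have ic: "set_integrable lborel {0..s} (\<lambda>r. (1 + ?C) * \<eta>)"
      by (rule borel_integrable_atLeastAtMost') simp
    have "y s - y' s = (LBINT r:{0..s}. G r (delayed lag S y r) - G' r (delayed lag S y' r))"
      using y[OF s] y'[OF s] i by (simp add: set_integral_diff)
    also have "norm \<dots> \<le> (LBINT r:{0..s}. (1 + ?C) * \<eta> + m * (?C * exp (2 * ?C * r)))"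
      using pt iw ic by (intro norm_set_integral_le set_integral_add) auto
    also have "\<dots> = (LBINT r:{0..s}. (1 + ?C) * \<eta>) + (LBINT r:{0..s}. m * (?C * exp (2 * ?C * r)))"
      using iw ic by (simp add: set_integral_add)
    also have "(LBINT r:{0..s}. (1 + ?C) * \<eta>) = s * ((1 + ?C) * \<eta>)"
      using s by (simp add: set_lebesgue_integral_def)
    also have "(LBINT r:{0..s}. m * (?C * exp (2 * ?C * r))) = m * ((exp (2 * ?C * s) - 1) / 2)"
      using integral_exp_weight(2)[OF C', of s] s by simp
    finally have "norm (y s - y' s) \<le> s * ((1 + ?C) * \<eta>) + m * ((exp (2 * ?C * s) - 1) / 2)" .
    also have "\<dots> \<le> L * ((1 + ?C) * \<eta>) + m / 2 * exp (2 * ?C * s)"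
    proof (intro add_mono mult_right_mono)
      show "0 \<le> (1 + ?C) * \<eta>" using C' \<eta> by simp
    qed (use s m0 in \<open>auto simp: field_simps\<close>)
    finally show ?thesis by (simp add: mult_ac)
  qed
  have "m \<le> L * (1 + ?C) * \<eta> + m / 2"
    unfolding m_def
  proof (rule cSUP_least)
    show "{0..L} \<noteq> {}" using L by auto
    fix s assume s: "s \<in> {0..L}"
    have "?e s \<le> (L * (1 + ?C) * \<eta> + m / 2 * exp (2 * ?C * s)) * exp (- (2 * ?C * s))"
      using est[OF s] by (intro mult_right_mono) auto
    also have "\<dots> = L * (1 + ?C) * \<eta> * exp (- (2 * ?C * s)) + m / 2"
      by (simp add: exp_minus field_simps)
    also have "\<dots> \<le> L * (1 + ?C) * \<eta> * 1 + m / 2"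
      using s L C' \<eta> by (intro add_mono mult_left_mono) auto
    finally show "?e s \<le> L * (1 + ?C) * \<eta> + (SUP s\<in>{0..L}. ?e s) / 2" by (simp add: m_def)
  qed
  then have mm: "m \<le> 2 * L * (1 + ?C) * \<eta>" by simp
  have "norm (y s - y' s) \<le> m * exp (2 * ?C * s)" by (rule m[OF s])
  also have "\<dots> \<le> (2 * L * (1 + ?C) * \<eta>) * exp (2 * ?C * L)"
  proof (intro mult_mono mm)
    show "exp (2 * ?C * s) \<le> exp (2 * ?C * L)"
      using mult_left_mono[of s L "2 * ?C"] C' s by simp
  qed (use L \<eta> C' in auto)
  finally show ?thesis by (simp add: mult_ac)
qed

section \<open>Strict sense processes\<close>

text \<open>Times in the \<open>l\<close>-th piece are written \<open>r + node h l\<close> with \<open>r\<close> in \<open>[0, h]\<close>.\<close>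
abbreviation node :: "real \<Rightarrow> nat \<Rightarrow> real" where "node h l \<equiv> (real l - 1) * h"

lemma bounded_variation_Lipschitz:
  fixes z :: "real \<Rightarrow> 'a::real_normed_vector"
  assumes lip: "\<And>s t. a \<le> s \<Longrightarrow> s \<le> t \<Longrightarrow> t \<le> b \<Longrightarrow> norm (z t - z s) \<le> c * (t - s)" and "c \<ge> 0"
  shows "bounded_variation_on a b z"
  unfolding bounded_variation_on_def
proof (intro exI[of _ "c * (b - a)"] allI impI)
  fix n :: nat and p :: "nat \<Rightarrow> real" assume p: "mono p" "range p \<subseteq> {a..b}"
  then have pi: "a \<le> p i" "p i \<le> b" "p i \<le> p (Suc i)" for i by (auto simp: mono_iff_le_Suc image_subset_iff)
  have "(\<Sum>i<n. norm (z (p (Suc i)) - z (p i))) \<le> (\<Sum>i<n. c * (p (Suc i) - p i))"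
    using pi by (intro sum_mono lip)
  also have "\<dots> = c * (p n - p 0)" by (simp add: sum_distrib_left[symmetric] sum_lessThan_telescope)
  also have "\<dots> \<le> c * (b - a)" using pi[of n] pi[of 0] \<open>c \<ge> 0\<close> by (intro mult_left_mono) auto
  finally show "(\<Sum>i<n. norm (z (p (Suc i)) - z (p i))) \<le> c * (b - a)" .
qed

text \<open>Variation is controlled by that of \<open>x\<close> on the history, by the Lipschitz constant on \<open>[0, b]\<close>, and by one possible jump at 0; the
  pointwise bound adds these three contributions and telescopes.\<close>
lemma bounded_variation_glue:
  fixes x z :: "real \<Rightarrow> 'a::real_normed_vector"
  assumes x: "bounded_variation_on a b x" and xz: "\<And>t. a \<le> t \<Longrightarrow> t < 0 \<Longrightarrow> z t = x t"
    and zb: "\<And>t. a \<le> t \<Longrightarrow> t < 0 \<Longrightarrow> norm (z t) \<le> d"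
    and lip: "\<And>s t. 0 \<le> s \<Longrightarrow> s \<le> t \<Longrightarrow> t \<le> b \<Longrightarrow> norm (z t - z s) \<le> c * (t - s)" and "c \<ge> 0" "b \<ge> 0" "d \<ge> 0"
  shows "bounded_variation_on a b z"
proof -
  obtain C where C: "\<And>(n::nat) (p :: nat \<Rightarrow> real). mono p \<Longrightarrow> range p \<subseteq> {a..b} \<Longrightarrow>
       (\<Sum>i<n. norm (x (p (Suc i)) - x (p i))) \<le> C"
    using x unfolding bounded_variation_on_def by blast
  let ?d = "norm (z 0) + d"
  let ?I = "\<lambda>t::real. if t \<ge> 0 then 1 else 0 :: real"
  have pt: "norm (z t - z s) \<le> norm (x t - x s) + c * (max t 0 - max s 0) + ?d * (?I t - ?I s)"
    if st: "a \<le> s" "s \<le> t" "t \<le> b" for s t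
  proof -
    consider "t < 0" | "0 \<le> s" | "s < 0" "0 \<le> t" by linarith
    then show ?thesis
    proof cases
      case 1 then show ?thesis using xz[of s] xz[of t] st by simp
    next
      case 2
      then have "norm (z t - z s) \<le> c * (t - s)" using st by (intro lip)
      moreover have "max t 0 - max s 0 = t - s" "?I t - ?I s = 0" using 2 st by auto
      ultimately show ?thesis by (simp add: add_increasing)
    next
      case 3
      have "norm (z t - z s) \<le> norm (z t - z 0) + norm (z 0) + norm (z s)"
        using norm_triangle_ineq4[of "z t - z 0 + z 0" "z s"] norm_triangle_ineq[of "z t - z 0" "z 0"] by simp
      moreover have "norm (z t - z 0) \<le> c * (t - 0)" using 3 st by (intro lip) auto
      moreover have "norm (z s) \<le> d" using 3 st by (intro zb) auto
      ultimately have "norm (z t - z s) \<le> 0 + c * t + ?d" by simp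
      also have "\<dots> \<le> norm (x t - x s) + c * t + ?d" by (intro add_mono) auto
      finally show ?thesis using 3 by (simp add: max_def)
    qed
  qed
  show ?thesis
    unfolding bounded_variation_on_def
  proof (intro exI[of _ "C + c * b + ?d"] allI impI)
    fix n :: nat and p :: "nat \<Rightarrow> real" assume p: "mono p" "range p \<subseteq> {a..b}"
    then have pi: "a \<le> p i" "p i \<le> b" "p i \<le> p (Suc i)" for i by (auto simp: mono_iff_le_Suc image_subset_iff)
    have "(\<Sum>i<n. norm (z (p (Suc i)) - z (p i))) \<le>
       (\<Sum>i<n. norm (x (p (Suc i)) - x (p i)) + c * (max (p (Suc i)) 0 - max (p i) 0) + ?d * (?I (p (Suc i)) - ?I (p i)))"
      using pi by (intro sum_mono pt)
    also have "\<dots> = (\<Sum>i<n. norm (x (p (Suc i)) - x (p i))) + c * (max (p n) 0 - max (p 0) 0) + ?d * (?I (p n) - ?I (p 0))"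
      by (simp add: sum.distrib sum_distrib_left[symmetric] sum_lessThan_telescope[of "\<lambda>i. max (p i) 0"]
          sum_lessThan_telescope[of "\<lambda>i. ?I (p i)"] del: if_distrib)
    also have "\<dots> \<le> C + c * b + ?d * 1"
    proof (intro add_mono)
      show "(\<Sum>i<n. norm (x (p (Suc i)) - x (p i))) \<le> C" using C p by blast
      show "c * (max (p n) 0 - max (p 0) 0) \<le> c * b"
        using pi[of n] \<open>c \<ge> 0\<close> \<open>b \<ge> 0\<close> by (intro mult_left_mono) auto
      show "?d * (?I (p n) - ?I (p 0)) \<le> ?d * 1" using \<open>d \<ge> 0\<close> by (intro mult_left_mono) auto
    qed
    finally show "(\<Sum>i<n. norm (z (p (Suc i)) - z (p i))) \<le> C + c * b + ?d" by simp
  qed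
qed

lemma set_integral_lebesgue_lborel:
  fixes F :: "real \<Rightarrow> 'e::{banach, second_countable_topology}"
  assumes [measurable]: "F \<in> borel_measurable borel" "A \<in> sets borel"
  shows "(LINT t:A|lebesgue. F t) = (LBINT t:A. F t)"
  unfolding set_lebesgue_integral_def by (rule integral_completion) measurable

lemma set_integrable_lebesgue_lborel:
  fixes F :: "real \<Rightarrow> 'e::{banach, second_countable_topology}"
  assumes [measurable]: "F \<in> borel_measurable borel" "A \<in> sets borel"
  shows "set_integrable lebesgue A F \<longleftrightarrow> set_integrable lborel A F"
  unfolding set_integrable_def by (rule integrable_completion) measurable

lemma integrable_restrict_lborel:
  fixes F :: "real \<Rightarrow> 'e::{banach, second_countable_topology}"
  shows "integrable (restrict_space lborel {a..b}) F \<longleftrightarrow> set_integrable lborel {a..b} F"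
  by (simp add: integrable_restrict_space set_integrable_def)

lemma set_integral_restrict_lborel:
  fixes F :: "real \<Rightarrow> 'e::{banach, second_countable_topology}"
  assumes "A \<in> sets (borel_upto T)"
  shows "(LINT t:A|restrict_space lborel {0..T}. F t) = (LBINT t:A. F t)"
proof -
  have "A \<subseteq> {0..T}" using assms by (rule sets_borel_upto_subset)
  then have *: "(indicat_real {0..T} t * indicat_real A t) *\<^sub>R F t = indicat_real A t *\<^sub>R F t" for t
    by (auto simp: indicator_def)
  show ?thesis
    unfolding set_lebesgue_integral_def by (subst integral_restrict_space) (auto simp: *)
qed

lemma sets_restrict_lborel: "sets (restrict_space lborel {0..T}) = sets (borel_upto T)"
  by (simp add: sets_restrict_space)

lemma signed_integral_density:
  fixes k :: "real \<Rightarrow> real" and \<phi> :: "real \<Rightarrow> 'e::{banach, second_countable_topology}"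
  assumes \<alpha>: "\<alpha> \<in> vector_measures T" and [measurable]: "k \<in> borel_measurable borel" "\<phi> \<in> borel_measurable borel"
    and kB: "\<And>t. \<bar>k t\<bar> \<le> B" and \<phi>B: "\<And>t. norm (\<phi> t) \<le> B'"
    and eq: "\<And>A. A \<in> sets (borel_upto T) \<Longrightarrow> \<alpha> A = (LBINT t:A. k t)"
    and ab: "{a..b} \<subseteq> {0..T}"
  shows "signed_integral T \<alpha> {a..b} \<phi> = (LBINT t:{a..b}. k t *\<^sub>R \<phi> t)"
proof -
  let ?M = "restrict_space lborel {0..T}"
  have ik: "integrable ?M k"
    unfolding integrable_restrict_lborel using kB by (intro set_integrable_bounded[where B = B]) auto
  have eq': "\<alpha> A = (LINT t:A|?M. k t)" if "A \<in> sets (borel_upto T)" for A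
    by (simp add: eq[OF that] set_integral_restrict_lborel[OF that])
  have A: "{a..b} \<in> sets (borel_upto T)" using ab by (simp add: sets_borel_upto)
  have *: "(LINT t:{a..b}|density ?M (\<lambda>x. ennreal (k x)). \<phi> t) = (LBINT t:{a..b}. max 0 (k t) *\<^sub>R \<phi> t)"
    if [measurable]: "k \<in> borel_measurable borel" for k :: "real \<Rightarrow> real"
  proof -
    have dd: "density ?M (\<lambda>x. ennreal (k x)) = density ?M (\<lambda>x. ennreal (max 0 (k x)))"
      by (intro arg_cong2[where f = density] ext) (auto simp: max_def ennreal_neg)
    have "(LINT t:{a..b}|density ?M (\<lambda>x. ennreal (k x)). \<phi> t) = (\<integral>t. max 0 (k t) *\<^sub>R (indicator {a..b} t *\<^sub>R \<phi> t) \<partial>?M)"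
      unfolding set_lebesgue_integral_def dd
      by (intro integral_density) (auto intro!: measurable_restrict_space1)
    also have "\<dots> = (LINT t:{a..b}|?M. max 0 (k t) *\<^sub>R \<phi> t)"
      unfolding set_lebesgue_integral_def by (simp add: mult_ac)
    finally show ?thesis using set_integral_restrict_lborel[OF A] by simp
  qed
  have i: "set_integrable lborel {a..b} (\<lambda>t. max 0 (k t) *\<^sub>R \<phi> t)"
    if [measurable]: "k \<in> borel_measurable borel" and kB: "\<And>t. \<bar>k t\<bar> \<le> B" for k :: "real \<Rightarrow> real"
  proof (rule set_integrable_bounded[where B = "B * B'"])
    show "norm (max 0 (k s) *\<^sub>R \<phi> s) \<le> B * B'" for s
      using kB[of s] \<phi>B[of s] by (auto intro!: mult_mono)
  qed measurable
  have jp: "jordan_pos T \<alpha> = density ?M (\<lambda>x. ennreal (k x))"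
    by (rule jordan_pos_density[OF \<alpha> sets_restrict_lborel ik]) (rule eq')
  have jn: "jordan_neg T \<alpha> = density ?M (\<lambda>x. ennreal (- k x))"
    by (rule jordan_neg_density[OF \<alpha> sets_restrict_lborel ik]) (rule eq')
  have "signed_integral T \<alpha> {a..b} \<phi> = (LBINT t:{a..b}. max 0 (k t) *\<^sub>R \<phi> t - max 0 (- k t) *\<^sub>R \<phi> t)"
    unfolding signed_integral_def jp jn
    using i[of k] i[of "\<lambda>t. - k t"] kB by (simp add: * set_integral_diff)
  also have "\<dots> = (LBINT t:{a..b}. k t *\<^sub>R \<phi> t)"
    by (intro arg_cong[where f="set_lebesgue_integral _ _"] ext) (auto simp: max_def scaleR_left_diff_distrib[symmetric])
  finally show ?thesis .
qed

lemma norm1_nonneg [simp]: "norm1 w \<ge> 0"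
  by (simp add: norm1_def sum_nonneg)

lemma norm1_component_le: "\<bar>w $ j\<bar> \<le> norm1 w"
  unfolding norm1_def by (rule member_le_sum) auto

lemma norm_le_norm1: "norm w \<le> norm1 w"
  unfolding norm1_def by (rule norm_le_l1_cart)

lemma norm1_measurable [measurable]:
  "w \<in> borel_measurable M \<Longrightarrow> (\<lambda>t. norm1 (w t)) \<in> borel_measurable M"
proof -
  have "continuous_on UNIV norm1" unfolding norm1_def by (intro continuous_intros)
  then show "w \<in> borel_measurable M \<Longrightarrow> (\<lambda>t. norm1 (w t)) \<in> borel_measurable M"
    by (rule borel_measurable_continuous_on)
qed

lemma component_measurable [measurable]:
  fixes w :: "'a \<Rightarrow> real ^ 'm"
  assumes "w \<in> borel_measurable M" shows "(\<lambda>t. w t $ j) \<in> borel_measurable M"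
  using borel_measurable_continuous_on[OF linear_continuous_on[OF bounded_linear_vec_nth] assms] .

lemma left_lim_continuous:
  fixes z :: "real \<Rightarrow> 'a::t2_space"
  assumes "continuous_on {a..b} z" "a < t" "t \<le> b"
  shows "left_lim z t = z t"
proof -
  have "(z \<longlongrightarrow> z t) (at t within {a..b})" using assms by (auto simp: continuous_on_def)
  then have "(z \<longlongrightarrow> z t) (at t within {a<..<t})" by (rule tendsto_within_subset) (use assms in auto)
  then have "(z \<longlongrightarrow> z t) (at_left t)"
    using at_within_nhd[of t "{a<..}" "{..<t}" "{a<..<t}"] assms(2) by (auto simp: greaterThanLessThan_def Int_commute)
  then show ?thesis unfolding left_lim_def by (intro tendsto_Lim) auto
qed

lemma stieltjes_density:
  fixes W :: "real \<Rightarrow> 'e::{banach, second_countable_topology}"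
  assumes T: "T > 0" and [measurable]: "W \<in> borel_measurable borel" and WB: "\<And>t. norm (W t) \<le> c"
    and z: "\<And>t. t \<in> {0..T} \<Longrightarrow> z t = z 0 + (LBINT s:{0..t}. W s)"
  shows "stieltjes T z \<in> vector_measures T"
    and "A \<in> sets (borel_upto T) \<Longrightarrow> stieltjes T z A = (LBINT s:A. W s)"
proof -
  have i: "set_integrable lborel {0..T} W" using WB by (intro set_integrable_bounded) auto
  have pf: "pf (\<lambda>s. s) T W A = (LBINT s:A. W s)" if "A \<subseteq> {0..T}" for A
  proof -
    have "{s\<in>{0..T}. s \<in> A} = A" using that by auto
    then show ?thesis by (simp add: pf_def)
  qed
  have *: "pf (\<lambda>s. s) T W {0..t} = z t - z 0" if "t \<in> {0<..T}" for t
    using that z[of t] by (subst pf) auto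
  show "stieltjes T z \<in> vector_measures T"
    by (rule stieltjes_eq(1)[OF pf_vector_measures[OF _ i] T *]) auto
  show "stieltjes T z A = (LBINT s:A. W s)" if A: "A \<in> sets (borel_upto T)"
    using stieltjes_eq(2)[OF pf_vector_measures[OF _ i] T * A] pf[OF sets_borel_upto_subset[OF A]] by auto
qed

lemma C1_map_continuous: "C1_map F \<Longrightarrow> continuous_on UNIV F"
  unfolding C1_map_def continuous_on_eq_continuous_within
  by (auto intro: has_derivative_continuous)

lemma field_along_measurable:
  fixes F :: "real \<times> ((real ^ 'n) ^ 'k::finite) \<Rightarrow> real ^ 'n"
  assumes "continuous_on UNIV F" and [measurable]: "\<Phi> \<in> borel_measurable borel" "z \<in> borel_measurable borel"
  shows "(\<lambda>t. F (\<Phi> t, delayed lag S z t)) \<in> borel_measurable borel"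
proof -
  have "(\<lambda>t. (\<Phi> t, delayed lag S z t)) \<in> borel_measurable borel" by (intro borel_measurable_Pair) measurable
  then show ?thesis by (rule borel_measurable_continuous_on[OF assms(1)])
qed

lemma vector_continuous_part_density:
  fixes W :: "real \<Rightarrow> 'e::{banach, second_countable_topology}"
  assumes "\<And>A. A \<in> sets (borel_upto T) \<Longrightarrow> \<delta> A = (LBINT s:A. W s)" and A: "A \<in> sets (borel_upto T)"
  shows "vector_continuous_part \<delta> A = \<delta> A"
proof -
  have "\<delta> {t} = 0" if "t \<in> {0..T}" for t
    using assms(1)[of "{t}"] that AE_lborel_singleton[of t]
    by (auto simp: sets_borel_upto set_lebesgue_integral_def indicator_def intro!: integral_eq_zero_AE)
  then have "A - {t. \<delta> {t} \<noteq> 0} = A" using sets_borel_upto_subset[OF A] by auto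
  then show ?thesis by (simp add: vector_continuous_part_def)
qed

text \<open>A bounded control and a Lipschitz solution of the classical delay equation form an impulse solution in the sense of the
  definitions: the measures involved have no atoms, so the attached arcs with zero control are constant and all jump terms vanish.\<close>
lemma strict_sense_processI:
  fixes N M :: nat and h T c :: real
    and K :: "(real ^ 'm::finite) set" and lag :: "'k::finite \<Rightarrow> nat"
    and f :: "real \<times> ((real ^ 'n::finite) ^ 'k) \<Rightarrow> real ^ 'n"
    and g :: "'m \<Rightarrow> real \<times> ((real ^ 'n) ^ 'k) \<Rightarrow> real ^ 'n"
    and X :: "real \<Rightarrow> real ^ 'n" and W :: "real \<Rightarrow> real ^ 'm"
  assumes N: "N \<ge> 1" and h: "h > 0" and T: "T = real N * h"
    and f: "bounded (range f)" "continuous_on UNIV f"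
    and g: "\<And>j. bounded (range (g j))" "\<And>j. continuous_on UNIV (g j)"
    and W[measurable]: "W \<in> borel_measurable borel" and Wc: "\<And>t. norm1 (W t) \<le> c" and WK: "\<And>t. W t \<in> K"
    and X[measurable]: "X \<in> borel_measurable borel" and X_hist: "\<And>t. t \<in> {- real M * h..<0} \<Longrightarrow> X t = \<xi>0 t"
    and BV: "bounded_variation_on (- real M * h) T X"
    and X_eq: "\<And>t. t \<in> {0..T} \<Longrightarrow> X t = x0 + (LBINT t':{0..t}. f (t', delayed lag h X t')
        + (\<Sum>j\<in>UNIV. (W t' $ j) *\<^sub>R g j (t', delayed lag h X t')))"
  defines "u \<equiv> \<lambda>t. LBINT s:{0..t}. W s" and "v \<equiv> \<lambda>t. LBINT s:{0..t}. norm1 (W s)"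
  shows "strict_sense_process K N M h lag f g x0 \<xi>0 u X v"
    and "total_variation T (stieltjes T u) = density (restrict_space lborel {0..T}) (\<lambda>t. ennreal (norm1 (W t)))"
    and "\<And>A. A \<in> sets (borel_upto T) \<Longrightarrow> measure (total_variation T (stieltjes T u)) A = stieltjes T v A"
proof -
  have T0: "T > 0" using N h T by simp
  have wB: "norm (W t) \<le> c" for t using Wc norm_le_norm1 order_trans by blast
  have c0: "c \<ge> 0" using wB[of 0] norm_ge_zero order_trans by blast
  let ?F = "\<lambda>t'. f (t', delayed lag h X t')" and ?G = "\<lambda>j t'. g j (t', delayed lag h X t')"
  have Fm[measurable]: "?F \<in> borel_measurable borel" and Gm[measurable]: "\<And>j. ?G j \<in> borel_measurable borel"
    using f(2) g(2) by (auto intro!: field_along_measurable)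
  obtain b where b: "\<And>z. norm (f z) \<le> b" using f(1) by (auto simp: bounded_iff)
  obtain b' where b': "\<And>j z. norm (g j z) \<le> b' j" using g(1) unfolding bounded_iff by (metis rangeI)
  let ?H = "\<lambda>t'. ?F t' + (\<Sum>j\<in>UNIV. (W t' $ j) *\<^sub>R ?G j t')"
  have Hm[measurable]: "?H \<in> borel_measurable borel" by measurable
  define B where "B = b + (\<Sum>j\<in>UNIV. c * b' j)"
  have WG: "norm ((W t $ j) *\<^sub>R ?G j t) \<le> c * b' j" for t j
    using b'[of j "(t, delayed lag h X t)"] norm1_component_le[of "W t" j] Wc[of t] c0
    by (auto intro!: mult_mono)
  have HB: "norm (?H t) \<le> B" for t
    unfolding B_def using b WG by (intro norm_triangle_mono sum_norm_le) auto
  have B0: "B \<ge> 0" using HB[of 0] norm_ge_zero order_trans by blast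
  note u_st = stieltjes_density[of T W c u, OF T0 W wB]
  have u0: "u 0 = 0" and v0: "v 0 = 0"
    using AE_lborel_singleton[of "0::real"]
    by (auto simp: u_def v_def set_lebesgue_integral_def indicator_def intro!: integral_eq_zero_AE)
  have X0: "X 0 = x0"
  proof -
    have "(LBINT t':{0..0}. ?H t') = 0"
      using AE_lborel_singleton[of "0::real"]
      by (auto simp: set_lebesgue_integral_def indicator_def intro!: integral_eq_zero_AE)
    then show ?thesis using X_eq[of 0] T0 by simp
  qed
  have u_vm: "stieltjes T u \<in> vector_measures T"
    and u_eq: "\<And>A. A \<in> sets (borel_upto T) \<Longrightarrow> stieltjes T u A = (LBINT s:A. W s)"
    using u_st u0 by (auto simp: u_def)
  have n1m: "(\<lambda>s. norm1 (W s)) \<in> borel_measurable borel" and n1B: "norm (norm1 (W t)) \<le> c" for t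
    using Wc by auto
  have v_eq: "stieltjes T v A = (LBINT s:A. norm1 (W s))" if "A \<in> sets (borel_upto T)" for A
    using stieltjes_density(2)[of T "\<lambda>s. norm1 (W s)" c v, OF T0 n1m n1B _ that] v0 by (auto simp: v_def)
  let ?M = "restrict_space lborel {0..T}"
  show TV: "total_variation T (stieltjes T u) = density ?M (\<lambda>t. ennreal (norm1 (W t)))"
  proof (rule total_variation_density[OF u_vm sets_restrict_lborel])
    show "integrable ?M W"
      unfolding integrable_restrict_lborel using wB by (intro set_integrable_bounded) auto
    show "stieltjes T u A = (LINT x:A|?M. W x)" if "A \<in> sets (borel_upto T)" for A
      by (simp add: u_eq[OF that] set_integral_restrict_lborel[OF that])
  qed
  have in1: "set_integrable lborel {a..b} (\<lambda>t. norm1 (W t))" for a b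
    using n1B by (intro set_integrable_bounded) auto
  have TV_em: "emeasure (total_variation T (stieltjes T u)) A = ennreal (LBINT s:A. norm1 (W s))"
    if A: "A \<in> sets (borel_upto T)" for A
  proof -
    have [measurable]: "A \<in> sets borel" and sub: "A \<subseteq> {0..T}" using A by (auto simp: sets_borel_upto)
    have "emeasure (total_variation T (stieltjes T u)) A = (\<integral>\<^sup>+t. ennreal (norm1 (W t)) * indicator A t \<partial>?M)"
      unfolding TV using A by (intro emeasure_density) (auto simp: sets_restrict_lborel intro!: measurable_restrict_space1)
    also have "\<dots> = (\<integral>\<^sup>+t. ennreal (indicator A t *\<^sub>R norm1 (W t)) \<partial>lborel)"
      using sub by (subst nn_integral_restrict_space) (auto intro!: nn_integral_cong simp: indicator_def)
    also have "\<dots> = ennreal (LBINT s:A. norm1 (W s))"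
      unfolding set_lebesgue_integral_def
      using set_integrable_subset[OF in1[of 0 T] _ sub] by (intro nn_integral_eq_integral) (auto simp: set_integrable_def)
    finally show ?thesis .
  qed
  have TV_meas: "measure (total_variation T (stieltjes T u)) A = (LBINT s:A. norm1 (W s))"
    if A: "A \<in> sets (borel_upto T)" for A
    unfolding measure_def TV_em[OF A] by (rule enn2real_ennreal) (auto simp: set_lebesgue_integral_def intro!: Bochner_Integration.integral_nonneg)
  show "measure (total_variation T (stieltjes T u)) A = stieltjes T v A" if "A \<in> sets (borel_upto T)" for A
    using TV_meas[OF that] v_eq[OF that] by simp
  have cont_TV: "continuous_part (total_variation T (stieltjes T u)) = total_variation T (stieltjes T u)"
  proof -
    have z: "emeasure (total_variation T (stieltjes T u)) {t} = 0" for t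
    proof (cases "t \<in> {0..T}")
      case True
      have "(LBINT s:{t}. norm1 (W s)) = 0"
        using AE_lborel_singleton[of t] by (auto simp: set_lebesgue_integral_def indicator_def intro!: integral_eq_zero_AE)
      then show ?thesis using True by (subst TV_em) (auto simp: sets_borel_upto)
    next
      case False then show ?thesis by (intro emeasure_notin_sets) (auto simp: sets_borel_upto)
    qed
    show ?thesis unfolding continuous_part_def z by (simp add: density_1)
  qed
  have Xlip: "norm (X t - X s) \<le> B * (t - s)" if "0 \<le> s" "s \<le> t" "t \<le> T" for s t
    using X_eq[of t] X_eq[of s] that indefinite_integral_Lipschitz[OF Hm HB, of s t] by simp
  have vlip: "norm (v t - v s) \<le> c * (t - s)" if "0 \<le> s" "s \<le> t" "t \<le> T" for s t
    unfolding v_def using that indefinite_integral_Lipschitz[OF n1m n1B, of s t] by simp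
  have lip_cont: "continuous_on {0..T} z" if "\<And>s t. 0 \<le> s \<Longrightarrow> s \<le> t \<Longrightarrow> t \<le> T \<Longrightarrow> norm (z t - z s) \<le> C * (t - s)" "C \<ge> 0"
    for z :: "real \<Rightarrow> 'e::real_normed_vector" and C
  proof -
    have "C-lipschitz_on {0..T} z"
    proof (rule lipschitz_onI)
      fix x y assume "x \<in> {0..T}" "y \<in> {0..T}"
      then show "dist (z x) (z y) \<le> C * dist x y"
        using that(1)[of x y] that(1)[of y x] by (cases "x \<le> y") (auto simp: dist_norm norm_minus_commute)
    qed fact
    then show ?thesis by (rule lipschitz_on_continuous_on)
  qed
  have Xc: "continuous_on {0..T} X" and vc: "continuous_on {0..T} v"
    using lip_cont[OF Xlip B0] lip_cont[OF vlip c0] by auto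
  have Xleft: "left_lim X t = X t" and vleft: "left_lim v t = v t" if "t \<in> {0<..T}" for t
    using that left_lim_continuous[OF Xc] left_lim_continuous[OF vc] by auto
  have pt_in: "r + node h l \<in> {0..T}" "r > 0 \<Longrightarrow> r + node h l \<in> {0<..T}"
    if "l \<in> {1..N}" "r \<in> {0..h}" for l :: nat and r
  proof -
    have "0 \<le> node h l" using that h by simp
    moreover have "h + node h l \<le> T"
    proof -
      have "h + node h l = real l * h" by (simp add: algebra_simps)
      also have "\<dots> \<le> T" unfolding T using that h by (intro mult_right_mono) auto
      finally show ?thesis .
    qed
    ultimately show "r + node h l \<in> {0..T}" "r > 0 \<Longrightarrow> r + node h l \<in> {0<..T}"
      using that(2) unfolding atLeastAtMost_iff greaterThanAtMost_iff by linarith+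
  qed
  define \<zeta> where "\<zeta> r l s = (if l \<ge> 1 then X (r + (real_of_int l - 1) * h) else if l = 0 then (if s < 1 \<or> r < h then \<xi>0 (r - h) else x0)
     else \<xi>0 (r - (1 - real_of_int l) * h))" for r :: real and l :: int and s :: real
  define \<theta> where "\<theta> r l s = (if l \<ge> 1 then v (r + (real_of_int l - 1) * h) else 0)" for r :: real and l :: int and s :: real
  have arcs: "attached_arcs N M h lag g x0 \<xi>0 (\<lambda>r l s. 0 :: real ^ 'm) X v \<zeta> \<theta>"
    unfolding attached_arcs_def
  proof (intro conjI ballI)
    fix r s :: real assume r: "r \<in> {0..h}" and s: "s \<in> {0..1}"
    show "\<theta> r 0 s = 0" "\<zeta> r 0 s = (if s < 1 \<or> r < h then \<xi>0 (r - h) else x0)" by (simp_all add: \<theta>_def \<zeta>_def)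
    show "\<zeta> r (- int a) s = \<xi>0 (r - (real a + 1) * h)" if "a \<in> {1..M - 1}" for a
      using that by (simp add: \<zeta>_def add.commute)
  next
    fix r and l :: nat assume r: "r \<in> {0..h}" and l: "l \<in> {1..N}"
    have prev: "r = 0 \<Longrightarrow> 2 \<le> l \<Longrightarrow> h + (real l - 2) * h = node h l" by (simp add: algebra_simps)
    show "\<zeta> r (int l) 0 = (if r = 0 then \<zeta> h (int l - 1) 1 else left_lim X (r + node h l))"
    proof (cases "r = 0")
      case True
      show ?thesis
      proof (cases "l = 1")
        case False then show ?thesis using l True prev by (simp add: \<zeta>_def)
      qed (use True X0 in \<open>simp add: \<zeta>_def\<close>)
    next
      case False then show ?thesis using pt_in(2)[OF l r] Xleft r l by (simp add: \<zeta>_def)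
    qed
    show "\<theta> r (int l) 0 = (if r = 0 then \<theta> h (int l - 1) 1 else left_lim v (r + node h l))"
    proof (cases "r = 0")
      case True
      show ?thesis
      proof (cases "l = 1")
        case False then show ?thesis using l True prev by (simp add: \<theta>_def)
      qed (use True v0 in \<open>simp add: \<theta>_def\<close>)
    next
      case False then show ?thesis using pt_in(2)[OF l r] vleft r l by (simp add: \<theta>_def)
    qed
    show "W11_deriv 0 1 (\<zeta> r (int l)) (\<lambda>s. \<Sum>j\<in>UNIV. ((0 :: real ^ 'm) $ j) *\<^sub>R
                g j (r + node h l, shifted lag (\<lambda>l'. \<zeta> r l' s) (int l)))"
      using l by (simp add: W11_deriv_def \<zeta>_def set_integrable_def)
    show "\<theta> r (int l) s = \<theta> r (int l) 0 + (LINT s':{0..s}|lebesgue. norm1 (0 :: real ^ 'm))" if "s \<in> {0..1}" for s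
      using l by (simp add: \<theta>_def norm1_def)
  qed
  have piece: "{node h l..t} \<subseteq> {0..T}" "0 \<le> node h l" "node h l \<le> t" "t \<le> T"
    if "l \<in> {1..N}" "t \<in> {node h l<..<real l * h}" for l :: nat and t
    using pt_in(1)[OF that(1), of 0] pt_in(1)[OF that(1), of h] h that by (auto simp: algebra_simps)
  have Xpiece: "X t = \<zeta> 0 (int l) 1
            + (LINT t':{node h l..t}|lebesgue. f (t', delayed lag h X t'))
            + (\<Sum>j\<in>UNIV. signed_integral T (\<lambda>A. vector_continuous_part (stieltjes T u) A $ j) {node h l..t}
                           (\<lambda>t'. g j (t', delayed lag h X t')))
            + (\<Sum>\<^sub>\<infinity>r\<in>{0<..t - node h l}. \<zeta> r (int l) 1 - left_lim X (r + node h l))"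
    and vpiece: "v t = \<theta> 0 (int l) 1 + measure (continuous_part (total_variation T (stieltjes T u))) {node h l..t}
            + (\<Sum>\<^sub>\<infinity>r\<in>{0<..t - node h l}. \<theta> r (int l) 1 - left_lim v (r + node h l))"
    if l: "l \<in> {1..N}" and t: "t \<in> {node h l<..<real l * h}" for l t
  proof -
    let ?a = "node h l"
    note pc = piece[OF l t]
    have r: "r \<in> {0..h}" "r > 0" if "r \<in> {0<..t - ?a}" for r using that t by (auto simp: algebra_simps)
    have i0: "(\<Sum>\<^sub>\<infinity>r\<in>{0<..t - ?a}. \<zeta> r (int l) 1 - left_lim X (r + ?a)) = 0"
      using pt_in(2)[OF l r] Xleft l by (intro infsum_0) (auto simp: \<zeta>_def)
    have i1: "(\<Sum>\<^sub>\<infinity>r\<in>{0<..t - ?a}. \<theta> r (int l) 1 - left_lim v (r + ?a)) = 0"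
      using pt_in(2)[OF l r] vleft l by (intro infsum_0) (auto simp: \<theta>_def)
    have si: "signed_integral T (\<lambda>A. vector_continuous_part (stieltjes T u) A $ j) {?a..t} (?G j) =
      (LBINT t':{?a..t}. (W t' $ j) *\<^sub>R ?G j t')" for j
    proof -
      have eq: "vector_continuous_part (stieltjes T u) A $ j = stieltjes T u A $ j" if "A \<in> sets (borel_upto T)" for A
        using vector_continuous_part_density[OF u_eq that] by simp
      have "signed_integral T (\<lambda>A. stieltjes T u A $ j) {?a..t} (?G j) = (LBINT t':{?a..t}. (W t' $ j) *\<^sub>R ?G j t')"
      proof (rule signed_integral_density[where B = c and B' = "b' j", OF vector_measures_nth[OF u_vm] _ _ _ _ _ pc(1)])
        fix A assume A: "A \<in> sets (borel_upto T)"
        have "set_integrable lborel A W"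
          using A by (intro set_integrable_subset[OF set_integrable_bounded[OF W wB]]) (auto simp: sets_borel_upto)
        then show "stieltjes T u A $ j = (LBINT t:A. W t $ j)"
          unfolding u_eq[OF A] set_lebesgue_integral_def set_integrable_def
          by (subst integral_bounded_linear[OF bounded_linear_vec_nth, symmetric]) auto
      qed (use Wc norm1_component_le b' order_trans in \<open>auto intro: order_trans\<close>)
      moreover have "signed_integral T (\<lambda>A. vector_continuous_part (stieltjes T u) A $ j) {?a..t} (?G j) =
          signed_integral T (\<lambda>A. stieltjes T u A $ j) {?a..t} (?G j)"
        by (rule fun_cong[OF fun_cong[OF signed_integral_cong_measure]]) (rule eq)
      ultimately show ?thesis by simp
    qed
    have iF: "set_integrable lborel {?a..t} ?F" using b by (intro set_integrable_bounded) auto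
    have iG: "set_integrable lborel {?a..t} (\<lambda>t'. (W t' $ j) *\<^sub>R ?G j t')" for j
      using WG by (intro set_integrable_bounded[where B = "c * b' j"]) auto
    have "X t = X ?a + (LBINT t':{?a..t}. ?H t')"
    proof -
      have "(LBINT t':{0..t}. ?H t') = (LBINT t':{0..?a}. ?H t') + (LBINT t':{?a..t}. ?H t')"
        using HB pc by (intro set_integral_Icc_add set_integrable_bounded) auto
      then show ?thesis using X_eq[of t] X_eq[of ?a] pc by auto
    qed
    also have "(LBINT t':{?a..t}. ?H t') = (LBINT t':{?a..t}. ?F t') + (LBINT t':{?a..t}. \<Sum>j\<in>UNIV. (W t' $ j) *\<^sub>R ?G j t')"
      using iF iG by (intro set_integral_add) (auto simp: set_integrable_def scaleR_sum_right)
    also have "(LBINT t':{?a..t}. \<Sum>j\<in>UNIV. (W t' $ j) *\<^sub>R ?G j t') = (\<Sum>j\<in>UNIV. LBINT t':{?a..t}. (W t' $ j) *\<^sub>R ?G j t')"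
      using iG unfolding set_lebesgue_integral_def set_integrable_def scaleR_sum_right by (intro Bochner_Integration.integral_sum) auto
    also have "X ?a = \<zeta> 0 (int l) 1" using l by (simp add: \<zeta>_def)
    finally show "X t = \<zeta> 0 (int l) 1 + (LINT t':{?a..t}|lebesgue. ?F t')
            + (\<Sum>j\<in>UNIV. signed_integral T (\<lambda>A. vector_continuous_part (stieltjes T u) A $ j) {?a..t} (?G j))
            + (\<Sum>\<^sub>\<infinity>r\<in>{0<..t - ?a}. \<zeta> r (int l) 1 - left_lim X (r + ?a))"
      unfolding i0 si by (simp add: set_integral_lebesgue_lborel add.assoc)
    have "v t = v ?a + (LBINT t':{?a..t}. norm1 (W t'))"
      unfolding v_def using pc by (intro set_integral_Icc_add in1)
    moreover have "{?a..t} \<in> sets (borel_upto T)" using pc by (simp add: sets_borel_upto)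
    moreover have "v ?a = \<theta> 0 (int l) 1" using l by (simp add: \<theta>_def)
    ultimately show "v t = \<theta> 0 (int l) 1 + measure (continuous_part (total_variation T (stieltjes T u))) {?a..t}
            + (\<Sum>\<^sub>\<infinity>r\<in>{0<..t - ?a}. \<theta> r (int l) 1 - left_lim v (r + ?a))"
      unfolding i1 cont_TV by (simp add: TV_meas)
  qed
  have sol: "impulse_solution N M h lag f g x0 \<xi>0 (stieltjes T u) (total_variation T (stieltjes T u)) (\<lambda>r l s. 0) X v"
    unfolding impulse_solution_def Let_def T[symmetric]
  proof (intro conjI ballI exI[of _ \<zeta>] exI[of _ \<theta>])
    show "bounded_variation_on 0 T v" by (rule bounded_variation_Lipschitz[OF vlip c0])
    have Th: "h + (real N - 1) * h = T" unfolding T by (simp add: algebra_simps)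
    show "X T = \<zeta> h (int N) 1" "v T = \<theta> h (int N) 1" using N Th by (simp_all add: \<zeta>_def \<theta>_def)
    show "X (node h l) = \<zeta> 0 (int l) 1" "v (node h l) = \<theta> 0 (int l) 1" if "l \<in> {2..N}" for l
      using that by (simp_all add: \<zeta>_def \<theta>_def)
    show "attached_arcs N M h lag g x0 \<xi>0 (\<lambda>r l s. 0 :: real ^ 'm) X v \<zeta> \<theta>" by (rule arcs)
  qed (fact BV X0 v0 X_hist | erule (1) Xpiece vpiece)+
  have ctrl: "strict_sense_control K T u"
    unfolding strict_sense_control_def W11_deriv_def
  proof (intro conjI exI[of _ W] ballI)
    have "set_integrable lborel {0..T} W" using wB by (intro set_integrable_bounded) auto
    then show "set_integrable lebesgue {0..T} W" by (simp add: set_integrable_lebesgue_lborel)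
    show "u t = u 0 + (LINT s:{0..t}|lebesgue. W s)" for t
      unfolding u0 by (simp add: u_def set_integral_lebesgue_lborel)
  qed (use u0 WK in auto)
  show "strict_sense_process K N M h lag f g x0 \<xi>0 u X v"
    unfolding strict_sense_process_def Let_def T[symmetric] using sol ctrl by simp
qed

section \<open>Time changes\<close>

subsection \<open>Change of variables by an increasing absolutely continuous function\<close>

lemma set_integral_singleton [simp]:
  fixes F :: "real \<Rightarrow> 'e::{banach, second_countable_topology}"
  shows "(LBINT s:{a}. F s) = 0"
proof -
  have "AE s in lborel. indicat_real {a} s *\<^sub>R F s = 0"
    by (rule AE_mp[OF AE_lborel_singleton[of a]]) (auto intro!: AE_I2)
  then show ?thesis unfolding set_lebesgue_integral_def by (rule integral_eq_zero_AE)
qed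

text \<open>Half lines suffice to identify finite measures on the line.\<close>
lemma emeasure_density_Ioi:
  fixes p :: "real \<Rightarrow> real"
  assumes [measurable]: "p \<in> borel_measurable borel" and p: "\<And>s. 0 \<le> p s" "\<And>s. p s \<le> B" and a: "0 \<le> a" "a \<le> L"
  shows "emeasure (density lborel (\<lambda>s. ennreal (indicator {0..L} s * p s))) {a<..} =
    ennreal ((LBINT s:{0..L}. p s) - (LBINT s:{0..a}. p s))"
proof -
  have i: "set_integrable lborel {x..y} p" for x y
    using p by (intro set_integrable_bounded[where B = B]) auto
  have "emeasure (density lborel (\<lambda>s. ennreal (indicator {0..L} s * p s))) {a<..} =
    (\<integral>\<^sup>+s. ennreal (indicator {0..L} s * p s) * indicator {a<..} s \<partial>lborel)"
    by (intro emeasure_density) auto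
  also have "\<dots> = (\<integral>\<^sup>+s. ennreal (indicator {a..L} s *\<^sub>R p s) \<partial>lborel)"
  proof (rule nn_integral_cong_AE)
    show "AE s in lborel. ennreal (indicator {0..L} s * p s) * indicator {a<..} s = ennreal (indicator {a..L} s *\<^sub>R p s)"
      using AE_lborel_singleton[of a] a by (auto simp: indicator_def)
  qed
  also have "\<dots> = ennreal (LBINT s:{a..L}. p s)"
    unfolding set_lebesgue_integral_def using i[of a L] p
    by (intro nn_integral_eq_integral) (auto simp: set_integrable_def)
  finally show ?thesis using set_integral_Icc_add[OF i a] by simp
qed

text \<open>\<open>\<Psi>\<close> is a generalised inverse of \<open>\<Phi>\<close>; the assumption \<open>adj\<close> says that \<open>\<Psi>\<close> maps Lebesgue measure on \<open>[0, T]\<close> to the measure with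
  density \<open>p\<close> on \<open>[0, L]\<close>, as the two agree on half lines.\<close>
lemma substitution:
  fixes p \<Phi> \<Psi> :: "real \<Rightarrow> real" and H :: "real \<Rightarrow> 'e::{banach, second_countable_topology}"
  assumes [measurable]: "p \<in> borel_measurable borel" "\<Psi> \<in> borel_measurable borel" "H \<in> borel_measurable borel"
    and p: "\<And>s. 0 \<le> p s" "\<And>s. p s \<le> B" and L: "L \<ge> 0" and T: "T = \<Phi> L"
    and \<Phi>: "\<And>s. s \<in> {0..L} \<Longrightarrow> \<Phi> s = (LBINT r:{0..s}. p r)"
    and \<Psi>: "\<And>t. t \<in> {0..T} \<Longrightarrow> \<Psi> t \<in> {0..L}"
    and adj: "\<And>s t. s \<in> {0..L} \<Longrightarrow> t \<in> {0..T} \<Longrightarrow> \<Psi> t \<le> s \<longleftrightarrow> t \<le> \<Phi> s"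
  shows "(LBINT t:{0..T}. H (\<Psi> t)) = (LBINT s:{0..L}. p s *\<^sub>R H s)"
proof -
  let ?D = "density lborel (\<lambda>t. ennreal (indicator {0..T} t))"
  define M1 where "M1 = distr ?D borel \<Psi>"
  define M2 where "M2 = density lborel (\<lambda>s. ennreal (indicator {0..L} s * p s))"
  have i: "set_integrable lborel {x..y} p" for x y
    using p by (intro set_integrable_bounded[where B = B]) auto
  have \<Phi>T: "\<Phi> s \<in> {0..T}" if "s \<in> {0..L}" for s
  proof -
    have "0 \<le> (LBINT r:{x..y}. p r)" for x y
      unfolding set_lebesgue_integral_def using p by (intro integral_nonneg_AE) auto
    then show ?thesis using that L set_integral_Icc_add[OF i, of 0 s L] by (simp add: \<Phi> T)
  qed
  have T0: "T \<ge> 0" using \<Phi>T[of L] L T by simp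
  have m1: "emeasure M1 {a<..} = emeasure lborel {t\<in>{0..T}. \<Psi> t > a}" for a
  proof -
    have "emeasure M1 {a<..} = emeasure ?D {t. \<Psi> t > a}"
      unfolding M1_def by (subst emeasure_distr) (auto simp: vimage_def)
    also have "\<dots> = (\<integral>\<^sup>+t. ennreal (indicator {0..T} t) * indicator {t. \<Psi> t > a} t \<partial>lborel)"
      by (intro emeasure_density) measurable
    also have "\<dots> = (\<integral>\<^sup>+t. indicator {t\<in>{0..T}. \<Psi> t > a} t \<partial>lborel)"
      by (intro nn_integral_cong) (auto simp: indicator_def)
    finally show ?thesis by simp
  qed
  have "M1 = M2"
  proof (rule measure_eqI_lessThan)
    show "emeasure M1 {a<..} < \<infinity>" for a
    proof -
      have "emeasure M1 {a<..} \<le> emeasure lborel {0..T}" unfolding m1 by (intro emeasure_mono) auto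
      also have "\<dots> < \<infinity>" by (rule emeasure_compact_finite) simp
      finally show ?thesis .
    qed
    have eq: "emeasure M1 {a<..} = emeasure M2 {a<..}" if a: "a \<in> {0..L}" for a
    proof -
      have "{t\<in>{0..T}. \<Psi> t > a} = {\<Phi> a<..T}"
        using adj[OF a] \<Phi>T[OF a] by (auto simp: not_le[symmetric])
      then have "emeasure M1 {a<..} = ennreal (T - \<Phi> a)" using \<Phi>T[OF a] by (simp add: m1)
      then show ?thesis using emeasure_density_Ioi[OF assms(1) p, where a = a and L = L] a L by (simp add: M2_def T \<Phi>)
    qed
    show "emeasure M1 {a<..} = emeasure M2 {a<..}" for a
    proof -
      consider "a < 0" | "a \<in> {0..L}" | "a > L" by force
      then show ?thesis
      proof cases
        case 1
        have "\<Psi> t > a" if "t \<in> {0..T}" for t using \<Psi>[OF that] 1 by auto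
        then have "{t\<in>{0..T}. \<Psi> t > a} = {0..T}" by blast
        then have "emeasure M1 {a<..} = ennreal T" using T0 by (simp add: m1)
        moreover have "emeasure M2 {a<..} = emeasure M2 {0<..}"
          unfolding M2_def
        proof (subst (1 2) emeasure_density; (simp; fail)?)
          show "(\<integral>\<^sup>+s. ennreal (indicator {0..L} s * p s) * indicator {a<..} s \<partial>lborel) = (\<integral>\<^sup>+s. ennreal (indicator {0..L} s * p s) * indicator {0<..} s \<partial>lborel)"
          proof (rule nn_integral_cong_AE)
            show "AE s in lborel. ennreal (indicator {0..L} s * p s) * indicator {a<..} s = ennreal (indicator {0..L} s * p s) * indicator {0<..} s"
              by (rule AE_mp[OF AE_lborel_singleton[of "0::real"]]) (use 1 in \<open>auto simp: indicator_def intro!: AE_I2\<close>)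
          qed
        qed
        moreover have "emeasure M2 {0<..} = ennreal T"
        proof -
          have "(LBINT s:{0..0}. p s) = 0" by simp
          then show ?thesis using emeasure_density_Ioi[OF assms(1) p, where a = 0 and L = L] L by (simp add: M2_def T \<Phi>)
        qed
        ultimately show ?thesis by simp
      next
        case 3
        have "\<Psi> t \<le> a" if "t \<in> {0..T}" for t using \<Psi>[OF that] 3 by auto
        then have "{t\<in>{0..T}. \<Psi> t > a} = {}" by (auto simp: not_less)
        moreover have "emeasure M2 {a<..} = (\<integral>\<^sup>+s. ennreal (indicator {0..L} s * p s) * indicator {a<..} s \<partial>lborel)"
          unfolding M2_def by (intro emeasure_density) auto
        moreover have "(\<integral>\<^sup>+s. ennreal (indicator {0..L} s * p s) * indicator {a<..} s \<partial>lborel) = (\<integral>\<^sup>+s. 0 \<partial>(lborel :: real measure))"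
          using 3 by (intro nn_integral_cong) (auto simp: indicator_def)
        ultimately show ?thesis by (simp only: m1) simp
      qed (rule eq)
    qed
  qed (simp_all add: M1_def M2_def)
  have "(\<integral>t. H (\<Psi> t) \<partial>?D) = (\<integral>t. indicator {0..T} t *\<^sub>R H (\<Psi> t) \<partial>lborel)"
    by (rule integral_density) simp_all
  moreover have "(\<integral>s. H s \<partial>M1) = (\<integral>t. H (\<Psi> t) \<partial>?D)"
    unfolding M1_def by (rule integral_distr) simp_all
  moreover have "(\<integral>s. H s \<partial>M2) = (\<integral>s. (indicator {0..L} s * p s) *\<^sub>R H s \<partial>lborel)"
    unfolding M2_def using p by (intro integral_density) simp_all
  ultimately show ?thesis using \<open>M1 = M2\<close> by (simp add: set_lebesgue_integral_def)
qed

subsection \<open>Weak star convergence of images\<close>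

lemma signed_integral_of_measure:
  fixes \<psi> :: "real \<Rightarrow> real"
  assumes P: "sets P = sets (borel_upto T)" "finite_measure P"
    and \<alpha>: "\<alpha> \<in> vector_measures T" and eq: "\<And>A. A \<in> sets (borel_upto T) \<Longrightarrow> measure P A = \<alpha> A" and \<psi>: "continuous_on {0..T} \<psi>"
  shows "(LINT t:{0..T}|P. \<psi> t) = signed_integral T \<alpha> {0..T} \<psi>"
proof -
  have "signed_integral T \<alpha> {0..T} \<psi> = (LINT t:{0..T}|P. \<psi> t) - (LINT t:{0..T}|null_measure (borel_upto T). \<psi> t)"
    using P eq by (intro signed_integral_measure_diff \<psi> \<alpha>) (auto intro!: finite_measureI)
  moreover have "(LINT t:{0..T}|null_measure (borel_upto T). \<psi> t) = 0"
    unfolding set_lebesgue_integral_def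
    by (intro integral_eq_zero_AE AE_I'[of "{0..T}"]) (auto simp: null_sets_def sets_borel_upto)
  ultimately show ?thesis by simp
qed

text \<open>Dominated convergence on \<open>[0, L]\<close>.\<close>
lemma signed_integral_pf_tendsto:
  fixes q :: "real \<Rightarrow> real" and qs :: "nat \<Rightarrow> real \<Rightarrow> real" and \<psi> :: "real \<Rightarrow> real"
  assumes [measurable]: "\<Phi> \<in> borel_measurable borel" "q \<in> borel_measurable borel"
      "\<And>i. \<Phi>s i \<in> borel_measurable borel" "\<And>i. qs i \<in> borel_measurable borel"
    and \<Phi>: "\<And>s. s \<in> {0..L} \<Longrightarrow> \<Phi> s \<in> {0..T}" "\<And>i s. s \<in> {0..L} \<Longrightarrow> \<Phi>s i s \<in> {0..T}"
    and q: "\<And>s. \<bar>q s\<bar> \<le> B" "\<And>i s. \<bar>qs i s\<bar> \<le> B"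
    and conv: "\<And>s. s \<in> {0..L} \<Longrightarrow> (\<lambda>i. \<Phi>s i s) \<longlonglongrightarrow> \<Phi> s" "\<And>s. s \<in> {0..L} \<Longrightarrow> (\<lambda>i. qs i s) \<longlonglongrightarrow> q s"
    and \<psi>: "continuous_on {0..T} \<psi>" and T: "T \<ge> 0"
  shows "(\<lambda>i. signed_integral T (pf (\<Phi>s i) L (qs i)) {0..T} \<psi>) \<longlonglongrightarrow> signed_integral T (pf \<Phi> L q) {0..T} \<psi>"
proof -
  define \<psi>' where "\<psi>' t = \<psi> (max 0 (min T t))" for t
  have c: "continuous_on UNIV \<psi>'"
    unfolding \<psi>'_def by (rule continuous_on_compose2[OF \<psi>]) (use T in \<open>auto intro!: continuous_intros\<close>)
  then have [measurable]: "\<psi>' \<in> borel_measurable borel" by (rule borel_measurable_continuous_onI)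
  have eq: "\<psi>' t = \<psi> t" if "t \<in> {0..T}" for t using that by (simp add: \<psi>'_def)
  obtain C where C: "\<And>t. t \<in> {0..T} \<Longrightarrow> norm (\<psi> t) \<le> C"
    using compact_imp_bounded[OF compact_continuous_image[OF \<psi> compact_Icc]] unfolding bounded_iff by blast
  have C': "\<bar>\<psi>' t\<bar> \<le> C" for t using C[of "max 0 (min T t)"] T by (simp add: \<psi>'_def)
  have B0: "B \<ge> 0" using q(1)[of 0] by linarith
  have *: "signed_integral T (pf \<Phi> L q) {0..T} \<psi> = (LBINT s:{0..L}. \<psi>' (\<Phi> s) * q s)"
    if "\<Phi> \<in> borel_measurable borel" "q \<in> borel_measurable borel" "\<And>s. s \<in> {0..L} \<Longrightarrow> \<Phi> s \<in> {0..T}" "\<And>s. \<bar>q s\<bar> \<le> B" for \<Phi> q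
    unfolding signed_integral_pf[OF that(1,2,3) set_integrable_bounded[OF that(2), of 0 L B] \<psi>, simplified, OF that(4)]
    using eq that(3) by (intro set_lebesgue_integral_cong) auto
  have "(\<lambda>i. LBINT s:{0..L}. \<psi>' (\<Phi>s i s) * qs i s) \<longlonglongrightarrow> (LBINT s:{0..L}. \<psi>' (\<Phi> s) * q s)"
    unfolding set_lebesgue_integral_def
  proof (rule integral_dominated_convergence)
    show "integrable lborel (\<lambda>s. indicator {0..L} s *\<^sub>R (C * B))"
      using borel_integrable_atLeastAtMost'[of 0 L "\<lambda>_. C * B"] by (simp add: set_integrable_def)
    show "AE x in lborel. (\<lambda>i. indicat_real {0..L} x *\<^sub>R (\<psi>' (\<Phi>s i x) * qs i x)) \<longlonglongrightarrow> indicat_real {0..L} x *\<^sub>R (\<psi>' (\<Phi> x) * q x)"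
    proof (intro AE_I2)
      fix x
      show "(\<lambda>i. indicat_real {0..L} x *\<^sub>R (\<psi>' (\<Phi>s i x) * qs i x)) \<longlonglongrightarrow> indicat_real {0..L} x *\<^sub>R (\<psi>' (\<Phi> x) * q x)"
      proof (cases "x \<in> {0..L}")
        case True
        have "(\<lambda>i. \<psi>' (\<Phi>s i x)) \<longlonglongrightarrow> \<psi>' (\<Phi> x)"
          by (rule continuous_on_tendsto_compose[OF c conv(1)[OF True]]) simp_all
        then show ?thesis by (intro tendsto_intros conv(2) True)
      qed simp
    qed
    show "AE x in lborel. norm (indicat_real {0..L} x *\<^sub>R (\<psi>' (\<Phi>s i x) * qs i x)) \<le> indicator {0..L} x *\<^sub>R (C * B)" for i
    proof (intro AE_I2)
      fix x
      have "\<bar>\<psi>' (\<Phi>s i x)\<bar> * \<bar>qs i x\<bar> \<le> C * B" using C' q B0 order_trans[OF abs_ge_zero C'] by (intro mult_mono) auto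
      then show "norm (indicat_real {0..L} x *\<^sub>R (\<psi>' (\<Phi>s i x) * qs i x)) \<le> indicator {0..L} x *\<^sub>R (C * B)"
        by (auto simp: indicator_def abs_mult)
    qed
  qed measurable
  then show ?thesis using * assms by simp
qed

subsection \<open>Quasi-periodic time changes\<close>

lemma quasi_periodic_multiple:
  fixes F :: "real \<Rightarrow> real"
  assumes per: "\<And>s. F (s + S) = F s + h"
  shows "F (s + of_int k * S) = F s + of_int k * h"
proof -
  have nat: "F (s + of_nat n * S) = F s + of_nat n * h" for n s
  proof (induction n)
    case (Suc n)
    have "F (s + of_nat (Suc n) * S) = F ((s + of_nat n * S) + S)" by (simp add: algebra_simps)
    also have "\<dots> = F (s + of_nat n * S) + h" by (rule per)
    finally show ?case using Suc by (simp add: algebra_simps)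
  qed simp
  show ?thesis
  proof (cases "k \<ge> 0")
    case True
    then obtain n where "k = int n" by (metis nonneg_int_cases)
    then show ?thesis using nat by simp
  next
    case False
    then have n: "k = - int (nat (- k))" by simp
    define n where "n = nat (- k)"
    have n: "k = - int n" using n by (simp add: n_def)
    have "F (s + of_int k * S + of_nat n * S) = F (s + of_int k * S) + of_nat n * h" by (rule nat)
    then show ?thesis using n by simp
  qed
qed

text \<open>Monotonicity and the Lipschitz bound on one period propagate to the line, splitting \<open>[a, b]\<close> at multiples of the period.\<close>
lemma quasi_periodic_Lipschitz:
  fixes F :: "real \<Rightarrow> real"
  assumes S: "S > 0" and per: "\<And>s. F (s + S) = F s + h"
    and base: "\<And>a b. 0 \<le> a \<Longrightarrow> a \<le> b \<Longrightarrow> b \<le> S \<Longrightarrow> 0 \<le> F b - F a \<and> F b - F a \<le> b - a"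
    and ab: "a \<le> b"
  shows "0 \<le> F b - F a \<and> F b - F a \<le> b - a"
proof -
  define i j where "i = \<lfloor>a / S\<rfloor>" and "j = \<lfloor>b / S\<rfloor>"
  define a' b' where "a' = a - i * S" and "b' = b - j * S"
  have r: "0 \<le> a'" "a' \<le> S" "0 \<le> b'" "b' \<le> S"
    using S floor_divide_lower[OF S, of a] floor_divide_upper[OF S, of a] floor_divide_lower[OF S, of b] floor_divide_upper[OF S, of b]
    by (auto simp: a'_def b'_def i_def j_def algebra_simps)
  have F: "F a = F a' + i * h" "F b = F b' + j * h"
    using quasi_periodic_multiple[of F S h a' i, OF per] quasi_periodic_multiple[of F S h b' j, OF per]
    by (simp_all add: a'_def b'_def)
  have ij: "i \<le> j" unfolding i_def j_def using ab S by (intro floor_mono divide_right_mono) auto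
  have hF: "h = F S - F 0" using per[of 0] by simp
  have h: "0 \<le> h" "h \<le> S" using base[of 0 S] S hF by auto
  show ?thesis
  proof (cases "i = j")
    case True
    then have "a' \<le> b'" using ab by (simp add: a'_def b'_def)
    then show ?thesis using base[of a' b'] r F True by (simp add: a'_def b'_def)
  next
    case False
    then have "1 \<le> real_of_int (j - i)" using ij by linarith
    then obtain d where d: "d \<ge> 0" "real_of_int j = real_of_int i + 1 + d" by (intro that[of "real_of_int (j - i) - 1"]) auto
    have "F b - F a = (F b' - F 0) + (F S - F a') + d * h"
      unfolding F using hF d(2) by (simp add: algebra_simps)
    moreover have "b - a = b' + (S - a') + d * S" by (simp add: a'_def b'_def d(2) algebra_simps)
    moreover have "0 \<le> d * h" "d * h \<le> d * S" using d h by (auto intro: mult_left_mono)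
    ultimately show ?thesis using base[of 0 b'] base[of a' S] r by linarith
  qed
qed

lemma C1_map_Lipschitz_on_ball:
  fixes F :: "'a::euclidean_space \<Rightarrow> 'b::euclidean_space"
  assumes "C1_map F"
  shows "\<exists>C>0. \<forall>z\<in>cball 0 R. \<forall>z'\<in>cball 0 R. norm (F z - F z') \<le> C * norm (z - z')"
proof -
  obtain F' :: "'a \<Rightarrow> 'a \<Rightarrow>\<^sub>L 'b" where F': "\<And>z. (F has_derivative blinfun_apply (F' z)) (at z)" "continuous_on UNIV F'"
    using assms unfolding C1_map_def by blast
  have "compact (F' ` cball 0 R)"
    by (intro compact_continuous_image continuous_on_subset[OF F'(2)]) auto
  from compact_imp_bounded[OF this] obtain C where "\<forall>y\<in>F' ` cball 0 R. norm y \<le> C"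
    unfolding bounded_iff by blast
  then have C: "\<And>z. z \<in> cball 0 R \<Longrightarrow> norm (F' z) \<le> C" by blast
  have "norm (F z - F z') \<le> max 1 C * norm (z - z')" if "z \<in> cball 0 R" "z' \<in> cball 0 R" for z z'
  proof (rule differentiable_bound[OF convex_cball[of 0 R] _ _ that])
    show "(F has_derivative blinfun_apply (F' x)) (at x within cball 0 R)" for x
      using F'(1) by (rule has_derivative_at_withinI)
    show "onorm (blinfun_apply (F' x)) \<le> max 1 C" if "x \<in> cball 0 R" for x
      using C[OF that] by (simp add: norm_blinfun.rep_eq max.coboundedI2)
  qed
  then show ?thesis by (intro exI[of _ "max 1 C"]) auto
qed

text \<open>A fibre with two points contains a rational number.\<close>
lemma countable_nontrivial_fibres:
  fixes \<Phi> :: "real \<Rightarrow> real"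
  assumes mono: "mono_on I \<Phi>" and I: "is_interval I"
  shows "countable {t. \<exists>s\<in>I. \<exists>s'\<in>I. s < s' \<and> \<Phi> s = t \<and> \<Phi> s' = t}"
proof (rule countable_subset)
  show "countable (\<Phi> ` (\<rat> \<inter> I))" using countable_rat by blast
  show "{t. \<exists>s\<in>I. \<exists>s'\<in>I. s < s' \<and> \<Phi> s = t \<and> \<Phi> s' = t} \<subseteq> \<Phi> ` (\<rat> \<inter> I)"
  proof
    fix t assume "t \<in> {t. \<exists>s\<in>I. \<exists>s'\<in>I. s < s' \<and> \<Phi> s = t \<and> \<Phi> s' = t}"
    then obtain s s' where s: "s \<in> I" "s' \<in> I" "s < s'" "\<Phi> s = t" "\<Phi> s' = t" by auto
    obtain q where q: "q \<in> \<rat>" "s < q" "q < s'" using Rats_dense_in_real[OF s(3)] by auto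
    then have "q \<in> I" using I s unfolding is_interval_1 by (metis less_imp_le)
    moreover have "\<Phi> q = t"
      using mono_onD[OF mono s(1) \<open>q \<in> I\<close>] mono_onD[OF mono \<open>q \<in> I\<close> s(2)] q s by simp
    ultimately show "t \<in> \<Phi> ` (\<rat> \<inter> I)" using q by blast
  qed
qed

section \<open>Approximation of a graph completion\<close>

text \<open>\<open>\<Phi>\<close> is the time change with density \<open>p\<close>, \<open>w\<close> the control and \<open>y\<close> the path in the parameter \<open>s\<close>. A delay \<open>h\<close> in time is a delay
  \<open>S\<close> in the parameter. The history is prolonged to a bounded uniformly continuous function \<open>\<xi>\<close> on the line, so that the equations
  below need no case distinction for negative arguments.\<close>
locale graph_completion =
  fixes N M :: nat and h T S L c :: real and K :: "(real ^ 'm::finite) set" and lag :: "'k::finite \<Rightarrow> nat"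
    and f :: "real \<times> ((real ^ 'n::finite) ^ 'k) \<Rightarrow> real ^ 'n"
    and g :: "'m \<Rightarrow> real \<times> ((real ^ 'n) ^ 'k) \<Rightarrow> real ^ 'n"
    and x0 :: "real ^ 'n" and \<xi> :: "real \<Rightarrow> real ^ 'n"
    and \<Phi> p :: "real \<Rightarrow> real" and w :: "real \<Rightarrow> real ^ 'm" and y :: "real \<Rightarrow> real ^ 'n"
  assumes N: "N \<ge> 1" and h: "h > 0" and T: "T = real N * h" and S: "S > 0" and L: "L = real N * S"
    and lag: "\<And>k. lag k \<le> M" and K: "cone K"
    and f: "bounded (range f)" "C1_map f" and g: "\<And>j. bounded (range (g j))" "\<And>j. C1_map (g j)"
    and \<xi>: "uniformly_continuous_on UNIV \<xi>" "bounded (range \<xi>)"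
    and \<Phi>_per: "\<And>s. \<Phi> (s + S) = \<Phi> s + h" and \<Phi>_0: "\<Phi> 0 = 0"
    and \<Phi>_base: "\<And>a b. 0 \<le> a \<Longrightarrow> a \<le> b \<Longrightarrow> b \<le> S \<Longrightarrow> 0 \<le> \<Phi> b - \<Phi> a \<and> \<Phi> b - \<Phi> a \<le> b - a"
    and p_meas [measurable]: "p \<in> borel_measurable borel" and p: "\<And>s. 0 \<le> p s" "\<And>s. p s \<le> 1"
    and \<Phi>_p: "\<And>s. s \<in> {0..L} \<Longrightarrow> \<Phi> s = (LBINT r:{0..s}. p r)"
    and w_meas [measurable]: "w \<in> borel_measurable borel" and w: "\<And>s. norm1 (w s) \<le> c" "\<And>s. w s \<in> K"
    and y_meas [measurable]: "y \<in> borel_measurable borel" and y_hist: "\<And>s. s < 0 \<Longrightarrow> y s = \<xi> (\<Phi> s)"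
    and y_eq: "\<And>s. s \<in> {0..L} \<Longrightarrow> y s = x0 + (LBINT r:{0..s}. p r *\<^sub>R f (\<Phi> r, delayed lag S y r)
        + (\<Sum>j\<in>UNIV. (w r $ j) *\<^sub>R g j (\<Phi> r, delayed lag S y r)))"
    and y_end: "\<And>s. s > L \<Longrightarrow> y s = y L"
begin

lemma L_pos: "L > 0" and T_pos: "T > 0" and h_le_S: "h \<le> S"
  using N S h \<Phi>_base[of 0 S] \<Phi>_per[of 0] \<Phi>_0 by (auto simp: L T)

lemma c_nonneg: "c \<ge> 0"
  using order_trans[OF norm1_nonneg w(1)] .

definition \<kappa> where "\<kappa> = h / S"

text \<open>Time runs at least at speed \<open>e * \<kappa>\<close>; the choice \<open>\<kappa> = h / S\<close> keeps the relation between \<open>S\<close> and \<open>h\<close>.\<close>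
definition \<Phi>e :: "real \<Rightarrow> real \<Rightarrow> real" where "\<Phi>e e s = (1 - e) * \<Phi> s + e * \<kappa> * s"
definition pe :: "real \<Rightarrow> real \<Rightarrow> real" where "pe e s = (1 - e) * p s + e * \<kappa>"

text \<open>The right-hand side in the parameter \<open>s\<close>. It is cut off after \<open>L\<close>, so that solutions stay bounded on the whole line.\<close>
definition G :: "real \<Rightarrow> real \<Rightarrow> (real ^ 'n) ^ 'k \<Rightarrow> real ^ 'n" where
  "G e s q = (if s \<in> {0..L} then pe e s *\<^sub>R f (\<Phi>e e s, q) + (\<Sum>j\<in>UNIV. (w s $ j) *\<^sub>R g j (\<Phi>e e s, q)) else 0)"

lemma \<Phi>_Lipschitz: "a \<le> b \<Longrightarrow> 0 \<le> \<Phi> b - \<Phi> a \<and> \<Phi> b - \<Phi> a \<le> b - a"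
  by (rule quasi_periodic_Lipschitz[OF S \<Phi>_per \<Phi>_base])

lemma \<Phi>_multiple: "\<Phi> (s + of_int k * S) = \<Phi> s + of_int k * h"
  by (rule quasi_periodic_multiple[where F = \<Phi>]) (rule \<Phi>_per)

lemma \<Phi>_L: "\<Phi> L = T"
  using \<Phi>_multiple[of 0 "int N"] by (simp add: L T \<Phi>_0)

lemma slope: "0 < \<kappa>" "\<kappa> \<le> 1" and slope_S: "\<kappa> * S = h"
  using h S h_le_S by (auto simp: \<kappa>_def)

lemma pe_bounds: assumes "e \<in> {0..1}" shows "e * \<kappa> \<le> pe e s" "0 \<le> pe e s" "pe e s \<le> 1"
proof -
  have "(1 - e) * p s \<le> 1 - e" using mult_left_mono[OF p(2), of "1 - e" s] assms by simp
  moreover have "e * \<kappa> \<le> e" using mult_left_mono[OF slope(2), of e] assms by simp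
  moreover have "0 \<le> (1 - e) * p s" "0 \<le> e * \<kappa>" using p[of s] slope assms by auto
  ultimately show "e * \<kappa> \<le> pe e s" "0 \<le> pe e s" "pe e s \<le> 1" unfolding pe_def by linarith+
qed

lemma \<Phi>e_Lipschitz:
  assumes "e \<in> {0..1}" "a \<le> b"
  shows "e * \<kappa> * (b - a) \<le> \<Phi>e e b - \<Phi>e e a" "\<Phi>e e b - \<Phi>e e a \<le> b - a"
proof -
  have eq: "\<Phi>e e b - \<Phi>e e a = (1 - e) * (\<Phi> b - \<Phi> a) + e * \<kappa> * (b - a)"
    by (simp add: \<Phi>e_def algebra_simps)
  have "0 \<le> (1 - e) * (\<Phi> b - \<Phi> a)" "(1 - e) * (\<Phi> b - \<Phi> a) \<le> (1 - e) * (b - a)"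
    using assms \<Phi>_Lipschitz[OF assms(2)] by (auto intro!: mult_left_mono mult_nonneg_nonneg)
  moreover have "e * \<kappa> * (b - a) \<le> e * 1 * (b - a)"
    using assms slope by (intro mult_right_mono mult_left_mono) auto
  ultimately show "e * \<kappa> * (b - a) \<le> \<Phi>e e b - \<Phi>e e a" "\<Phi>e e b - \<Phi>e e a \<le> b - a"
    unfolding eq by (simp_all add: algebra_simps)
qed

lemma \<Phi>e_mono: "e \<in> {0..1} \<Longrightarrow> a \<le> b \<Longrightarrow> \<Phi>e e a \<le> \<Phi>e e b"
proof -
  assume a: "e \<in> {0..1}" "a \<le> b"
  have "0 \<le> e * \<kappa> * (b - a)" using a slope by (intro mult_nonneg_nonneg) auto
  then show ?thesis using \<Phi>e_Lipschitz(1)[OF a] by linarith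
qed

lemma \<Phi>e_strict: "e \<in> {0<..1} \<Longrightarrow> a < b \<Longrightarrow> \<Phi>e e a < \<Phi>e e b"
proof -
  assume a: "e \<in> {0<..1}" "a < b"
  then have "0 < e * \<kappa> * (b - a)" using slope by (intro mult_pos_pos) auto
  then show ?thesis using \<Phi>e_Lipschitz(1)[of e a b] a by auto
qed

lemma \<Phi>e_continuous: "e \<in> {0..1} \<Longrightarrow> continuous_on A (\<Phi>e e)"
proof -
  assume e: "e \<in> {0..1}"
  have "1-lipschitz_on UNIV (\<Phi>e e)"
  proof (rule lipschitz_onI)
    fix a b
    show "dist (\<Phi>e e a) (\<Phi>e e b) \<le> 1 * dist a b"
      using \<Phi>e_Lipschitz(2)[OF e, of a b] \<Phi>e_Lipschitz(2)[OF e, of b a] \<Phi>e_mono[OF e, of a b] \<Phi>e_mono[OF e, of b a]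
      by (cases "a \<le> b") (auto simp: dist_real_def)
  qed simp
  then show ?thesis using lipschitz_on_continuous_on continuous_on_subset by blast
qed

lemma \<Phi>e_measurable [measurable]: "e \<in> {0..1} \<Longrightarrow> \<Phi>e e \<in> borel_measurable borel"
  using \<Phi>e_continuous by (rule borel_measurable_continuous_onI)

lemma pe_measurable [measurable]: "pe e \<in> borel_measurable borel"
  unfolding pe_def[abs_def] by measurable

lemma \<Phi>e_0: "\<Phi>e e 0 = 0" and \<Phi>e_L: "\<Phi>e e L = T" and \<Phi>e_zero: "\<Phi>e 0 = \<Phi>" and pe_zero: "pe 0 = p"
proof -
  have "e * \<kappa> * L = e * (real N * (\<kappa> * S))" by (simp add: L)
  then have "e * \<kappa> * L = e * T" by (simp only: slope_S T)
  then show "\<Phi>e e L = T" by (simp add: \<Phi>e_def \<Phi>_L algebra_simps)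
qed (auto simp: \<Phi>e_def \<Phi>_0 pe_def)

lemma \<Phi>e_multiple: "\<Phi>e e (s + of_int k * S) = \<Phi>e e s + of_int k * h"
proof -
  have "e * \<kappa> * (s + of_int k * S) = e * \<kappa> * s + e * (of_int k * (\<kappa> * S))" by (simp add: algebra_simps)
  then have 1: "e * \<kappa> * (s + of_int k * S) = e * \<kappa> * s + e * (of_int k * h)" by (simp only: slope_S)
  have 2: "(1 - e) * \<Phi> (s + of_int k * S) = (1 - e) * \<Phi> s + (1 - e) * (of_int k * h)"
    unfolding \<Phi>_multiple by (simp add: algebra_simps)
  show ?thesis unfolding \<Phi>e_def 1 2 by (simp add: algebra_simps)
qed

lemma \<Phi>e_range: "e \<in> {0..1} \<Longrightarrow> s \<in> {0..L} \<Longrightarrow> \<Phi>e e s \<in> {0..T}"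
  using \<Phi>e_mono[of e 0 s] \<Phi>e_mono[of e s L] by (simp add: \<Phi>e_0 \<Phi>e_L)

lemma \<Phi>e_integral:
  assumes "e \<in> {0..1}" "s \<in> {0..L}" shows "\<Phi>e e s = (LBINT r:{0..s}. pe e r)"
proof -
  have i: "set_integrable lborel {0..s} p" using p by (intro set_integrable_bounded[where B = 1]) auto
  have ic: "set_integrable lborel {0..s} (\<lambda>_. e * \<kappa>)" by (rule borel_integrable_atLeastAtMost') simp
  have "(LBINT r:{0..s}. pe e r) = (LBINT r:{0..s}. (1 - e) * p r) + (LBINT r:{0..s}. e * \<kappa>)"
    unfolding pe_def using i ic by (intro set_integral_add) auto
  also have "(LBINT r:{0..s}. e * \<kappa>) = e * \<kappa> * s"
    using assms by (simp add: set_lebesgue_integral_def)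
  finally show ?thesis using assms by (simp add: \<Phi>e_def \<Phi>_p)
qed

lemma \<Phi>e_close: "e \<in> {0..1} \<Longrightarrow> \<bar>\<Phi>e e s - \<Phi> s\<bar> \<le> e * (2 * \<bar>s\<bar>)"
proof -
  assume e: "e \<in> {0..1}"
  have "\<bar>\<Phi> s\<bar> \<le> \<bar>s\<bar>" using \<Phi>_Lipschitz[of 0 s] \<Phi>_Lipschitz[of s 0] by (cases "s \<ge> 0") (auto simp: \<Phi>_0)
  moreover have "\<bar>\<kappa> * s\<bar> \<le> 1 * \<bar>s\<bar>" unfolding abs_mult using slope by (intro mult_right_mono) auto
  ultimately have "\<bar>\<kappa> * s - \<Phi> s\<bar> \<le> 2 * \<bar>s\<bar>" by linarith
  then have "e * \<bar>\<kappa> * s - \<Phi> s\<bar> \<le> e * (2 * \<bar>s\<bar>)" using e by (intro mult_left_mono) auto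
  moreover have "\<Phi>e e s - \<Phi> s = e * (\<kappa> * s - \<Phi> s)" by (simp add: \<Phi>e_def algebra_simps)
  ultimately show ?thesis using e by (simp add: abs_mult)
qed

lemma pe_close: "e \<in> {0..1} \<Longrightarrow> \<bar>pe e s - p s\<bar> \<le> e"
proof -
  assume e: "e \<in> {0..1}"
  have "\<bar>\<kappa> - p s\<bar> \<le> 1" using slope p[of s] by linarith
  then have "e * \<bar>\<kappa> - p s\<bar> \<le> e * 1" using e by (intro mult_left_mono) auto
  moreover have "pe e s - p s = e * (\<kappa> - p s)" by (simp add: pe_def algebra_simps)
  ultimately show ?thesis using e by (simp add: abs_mult)
qed

subsection \<open>The perturbed equations\<close>

definition Bf where "Bf = (SUP z. norm (f z))"
definition Bg where "Bg j = (SUP z. norm (g j z))"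
definition B where "B = Bf + (\<Sum>j\<in>UNIV. c * Bg j)"

text \<open>An a priori bound of all paths: histories are bounded by the supremum of \<open>\<xi>\<close>, and the right-hand sides by \<open>B\<close>.\<close>
definition \<rho> where "\<rho> = norm x0 + B * L + (SUP t. norm (\<xi> t))"

lemma Bf: "norm (f z) \<le> Bf" and Bg: "norm (g j z) \<le> Bg j" and \<xi>B: "norm (\<xi> t) \<le> (SUP t. norm (\<xi> t))"
proof -
  have "bdd_above (range (\<lambda>z. norm (f z)))" using f(1) unfolding bounded_iff bdd_above_def by blast
  then show "norm (f z) \<le> Bf" unfolding Bf_def by (intro cSUP_upper) auto
  have "bdd_above (range (\<lambda>z. norm (g j z)))" using g(1)[of j] unfolding bounded_iff bdd_above_def by blast
  then show "norm (g j z) \<le> Bg j" unfolding Bg_def by (intro cSUP_upper) auto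
  have "bdd_above (range (\<lambda>z. norm (\<xi> z)))" using \<xi>(2) unfolding bounded_iff bdd_above_def by blast
  then show "norm (\<xi> t) \<le> (SUP t. norm (\<xi> t))" by (intro cSUP_upper) auto
qed

lemma w_component: "\<bar>w s $ j\<bar> \<le> c"
  using norm1_component_le[of "w s" j] w(1)[of s] by linarith

lemma G_bound: assumes "e \<in> {0..1}" shows "norm (G e s q) \<le> B"
proof -
  have 1: "norm (pe e s *\<^sub>R f z) \<le> Bf" for z
    using mult_mono[OF pe_bounds(3)[OF assms] Bf[of z], of s] pe_bounds(2)[OF assms, of s] by simp
  have 2: "norm ((w s $ j) *\<^sub>R g j z) \<le> c * Bg j" for j z
    using c_nonneg by (simp add: mult_mono w_component Bg)
  have 3: "norm (pe e s *\<^sub>R f (\<Phi>e e s, q) + (\<Sum>j\<in>UNIV. (w s $ j) *\<^sub>R g j (\<Phi>e e s, q))) \<le> B"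
    unfolding B_def using 1 2 by (intro norm_triangle_mono sum_norm_le) auto
  then have "0 \<le> B" using norm_ge_zero order_trans by blast
  then show ?thesis using 3 by (simp add: G_def)
qed

lemma B_nonneg: "B \<ge> 0"
  using order_trans[OF norm_ge_zero G_bound[of 0 0 0]] by simp

lemma G_measurable:
  assumes e: "e \<in> {0..1}" and [measurable]: "z \<in> borel_measurable borel"
  shows "(\<lambda>s. G e s (delayed lag S z s)) \<in> borel_measurable borel"
proof -
  note [measurable] = \<Phi>e_measurable[OF e] field_along_measurable[OF C1_map_continuous[OF f(2)] \<Phi>e_measurable[OF e], where z = z and lag = lag and S = S]
    field_along_measurable[OF C1_map_continuous[OF g(2)] \<Phi>e_measurable[OF e], where z = z and lag = lag and S = S]
  show ?thesis unfolding G_def by measurable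
qed

definition Lipschitz_bound where
  "Lipschitz_bound C \<longleftrightarrow> C > 0 \<and> (\<forall>e\<in>{0..1}. \<forall>e'\<in>{0..1}. \<forall>s\<in>{0..L}. \<forall>q q'. norm q \<le> CARD('k) * \<rho> \<longrightarrow> norm q' \<le> CARD('k) * \<rho> \<longrightarrow>
    norm (G e s q - G e' s q') \<le> Bf * \<bar>pe e s - pe e' s\<bar> + C * (\<bar>\<Phi>e e s - \<Phi>e e' s\<bar> + norm (q - q')))"

lemma Lipschitz_bound_exists: "\<exists>C. Lipschitz_bound C"
proof -
  let ?R = "T + CARD('k) * \<rho>"
  obtain Cf where Cf: "Cf > 0" "\<And>z z'. z \<in> cball 0 ?R \<Longrightarrow> z' \<in> cball 0 ?R \<Longrightarrow> norm (f z - f z') \<le> Cf * norm (z - z')"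
    using C1_map_Lipschitz_on_ball[OF f(2), of ?R] by blast
  have "\<forall>j. \<exists>C>0. \<forall>z\<in>cball 0 ?R. \<forall>z'\<in>cball 0 ?R. norm (g j z - g j z') \<le> C * norm (z - z')"
    using C1_map_Lipschitz_on_ball[OF g(2), of ?R] by blast
  then obtain Cg where Cg: "\<And>j. Cg j > 0" "\<And>j z z'. z \<in> cball 0 ?R \<Longrightarrow> z' \<in> cball 0 ?R \<Longrightarrow> norm (g j z - g j z') \<le> Cg j * norm (z - z')"
    by metis
  define C where "C = Cf + (\<Sum>j\<in>UNIV. c * Cg j)"
  have C0: "C > 0" unfolding C_def using Cf(1) Cg(1) c_nonneg by (intro add_pos_nonneg sum_nonneg mult_nonneg_nonneg) (auto intro: less_imp_le)
  have "norm (G e s q - G e' s q') \<le> Bf * \<bar>pe e s - pe e' s\<bar> + C * (\<bar>\<Phi>e e s - \<Phi>e e' s\<bar> + norm (q - q'))"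
    if e: "e \<in> {0..1}" "e' \<in> {0..1}" and s: "s \<in> {0..L}" and q: "norm q \<le> CARD('k) * \<rho>" "norm q' \<le> CARD('k) * \<rho>"
    for e e' s q q'
  proof -
    let ?z = "(\<Phi>e e s, q)" and ?z' = "(\<Phi>e e' s, q')"
    let ?d = "\<bar>\<Phi>e e s - \<Phi>e e' s\<bar> + norm (q - q')"
    have z: "?z \<in> cball 0 ?R" "?z' \<in> cball 0 ?R"
      using norm_Pair_le[of "\<Phi>e e s" q] norm_Pair_le[of "\<Phi>e e' s" q'] \<Phi>e_range[OF e(1) s] \<Phi>e_range[OF e(2) s] q by auto
    have d: "norm (?z - ?z') \<le> ?d" using norm_Pair_le[of "\<Phi>e e s - \<Phi>e e' s" "q - q'"] by simp
    have F: "norm (f ?z - f ?z') \<le> Cf * ?d" using Cf(2)[OF z] mult_left_mono[OF d, of Cf] Cf(1) by linarith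
    have Gj: "norm (g j ?z - g j ?z') \<le> Cg j * ?d" for j
      using Cg(2)[OF z, of j] mult_left_mono[OF d, of "Cg j"] Cg(1)[of j] by linarith
    have eq: "G e s q - G e' s q' = (pe e s - pe e' s) *\<^sub>R f ?z + pe e' s *\<^sub>R (f ?z - f ?z')
      + (\<Sum>j\<in>UNIV. (w s $ j) *\<^sub>R (g j ?z - g j ?z'))"
      using s by (simp add: G_def algebra_simps sum_subtractf)
    have "norm ((pe e s - pe e' s) *\<^sub>R f ?z) \<le> Bf * \<bar>pe e s - pe e' s\<bar>"
      using Bf[of ?z] by (simp add: mult.commute mult_right_mono)
    moreover have "norm (pe e' s *\<^sub>R (f ?z - f ?z')) \<le> 1 * (Cf * ?d)"
      unfolding norm_scaleR using pe_bounds[OF e(2), of s] F by (intro mult_mono) auto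
    moreover have "norm (\<Sum>j\<in>UNIV. (w s $ j) *\<^sub>R (g j ?z - g j ?z')) \<le> (\<Sum>j\<in>UNIV. c * (Cg j * ?d))"
    proof (rule sum_norm_le)
      show "norm ((w s $ j) *\<^sub>R (g j ?z - g j ?z')) \<le> c * (Cg j * ?d)" for j
        unfolding norm_scaleR using w_component Gj c_nonneg by (intro mult_mono) auto
    qed
    moreover have "(\<Sum>j\<in>UNIV. c * (Cg j * ?d)) = (\<Sum>j\<in>UNIV. c * Cg j) * ?d" by (simp add: sum_distrib_right mult.assoc)
    ultimately have "norm (G e s q - G e' s q') \<le> Bf * \<bar>pe e s - pe e' s\<bar> + 1 * (Cf * ?d) + (\<Sum>j\<in>UNIV. c * Cg j) * ?d"
      unfolding eq by (intro norm_triangle_mono) auto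
    then show ?thesis by (simp add: C_def algebra_simps)
  qed
  then show ?thesis using C0 unfolding Lipschitz_bound_def by blast
qed

definition C where "C = (SOME C. Lipschitz_bound C)"

lemma C_spec: "Lipschitz_bound C"
  unfolding C_def by (rule someI_ex[OF Lipschitz_bound_exists])

lemmas C_pos = C_spec[unfolded Lipschitz_bound_def, THEN conjunct1]
  and C = C_spec[unfolded Lipschitz_bound_def, THEN conjunct2, rule_format]

definition solves :: "real \<Rightarrow> (real \<Rightarrow> real ^ 'n) \<Rightarrow> bool" where
  "solves e z \<longleftrightarrow> z \<in> borel_measurable borel \<and> (\<forall>s. norm (z s) \<le> \<rho>) \<and> (\<forall>s<0. z s = \<xi> (\<Phi>e e s)) \<and>
    (\<forall>s\<in>{0..L}. z s = x0 + (LBINT r:{0..s}. G e r (delayed lag S z r)))"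

definition ye :: "real \<Rightarrow> real \<Rightarrow> real ^ 'n" where "ye e = (SOME z. solves e z)"

lemma ye: assumes e: "e \<in> {0..1}" shows "solves e (ye e)"
proof -
  have \<xi>m: "\<xi> \<in> borel_measurable borel"
    using uniformly_continuous_imp_continuous[OF \<xi>(1)] by (rule borel_measurable_continuous_onI)
  have "\<exists>z. z \<in> borel_measurable borel \<and> (\<forall>s. norm (z s) \<le> \<rho>) \<and> (\<forall>s<0. z s = \<xi> (\<Phi>e e s)) \<and>
    (\<forall>s\<ge>0. z s = x0 + (LBINT r:{0..s}. G e r (delayed lag S z r)))"
  proof (rule delay_equation_exists[where B = B and L = L and C = C])
    show "norm (\<xi> (\<Phi>e e s)) \<le> \<rho>" for s
      using \<xi>B[of "\<Phi>e e s"] B_nonneg L_pos by (simp add: \<rho>_def add_increasing)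
    show "norm x0 + B * L \<le> \<rho>" using \<xi>B[of 0] norm_ge_zero[of "\<xi> 0"] unfolding \<rho>_def by linarith
    show "norm (G e s q - G e s q') \<le> C * norm (q - q')" if "norm q \<le> CARD('k) * \<rho>" "norm q' \<le> CARD('k) * \<rho>" for s q q'
    proof (cases "s \<in> {0..L}")
      case True then show ?thesis using C[OF e e True that] by simp
    next
      case False
      then have "G e s q = 0" "G e s q' = 0" unfolding G_def by auto
      then show ?thesis using C_pos by simp
    qed
    show "(\<lambda>s. \<xi> (\<Phi>e e s)) \<in> borel_measurable borel" using \<xi>m \<Phi>e_measurable[OF e] by measurable
    show "G e s q = 0" if "s > L" for s q using that by (simp add: G_def)
    show "(\<lambda>s. G e s (delayed lag S z s)) \<in> borel_measurable borel" if "z \<in> borel_measurable borel" for z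
      by (rule G_measurable[OF e that])
    show "norm (G e s q) \<le> B" for s q by (rule G_bound[OF e])
    show "C > 0" by (rule C_pos)
    show "S \<ge> 0" "L \<ge> 0" using S L_pos by simp_all
  qed
  then obtain z where "z \<in> borel_measurable borel" "\<And>s. norm (z s) \<le> \<rho>" "\<And>s. s < 0 \<Longrightarrow> z s = \<xi> (\<Phi>e e s)"
    "\<And>s. s \<ge> 0 \<Longrightarrow> z s = x0 + (LBINT r:{0..s}. G e r (delayed lag S z r))" by blast
  then have "solves e z" unfolding solves_def by simp
  then show ?thesis unfolding ye_def by (rule someI[of "solves e"])
qed

lemma y_solves: "solves 0 y"
  unfolding solves_def
proof (intro conjI allI impI ballI)
  have eq: "y s = x0 + (LBINT r:{0..s}. G 0 r (delayed lag S y r))" if "s \<in> {0..L}" for s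
  proof -
    have "(LBINT r:{0..s}. p r *\<^sub>R f (\<Phi> r, delayed lag S y r)
        + (\<Sum>j\<in>UNIV. (w r $ j) *\<^sub>R g j (\<Phi> r, delayed lag S y r))) = (LBINT r:{0..s}. G 0 r (delayed lag S y r))"
    proof (rule set_lebesgue_integral_cong, simp, intro allI impI)
      fix r assume "r \<in> {0..s}"
      then have "r \<in> {0..L}" using that by auto
      then show "p r *\<^sub>R f (\<Phi> r, delayed lag S y r) + (\<Sum>j\<in>UNIV. (w r $ j) *\<^sub>R g j (\<Phi> r, delayed lag S y r)) = G 0 r (delayed lag S y r)"
        by (simp only: G_def \<Phi>e_zero pe_zero if_True)
    qed
    then show ?thesis using y_eq[OF that] by (simp only:)
  qed
  then show "y s = x0 + (LBINT r:{0..s}. G 0 r (delayed lag S y r))" if "s \<in> {0..L}" for s using that .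
  have xb: "norm (y s) \<le> \<rho>" if "s \<in> {0..L}" for s
  proof -
    have "norm (LBINT r:{0..s}. G 0 r (delayed lag S y r)) \<le> B * (s - 0)"
      using that G_bound[of 0] G_measurable[of 0 y] by (intro norm_set_integral_bounded) auto
    also have "\<dots> \<le> B * L" using that B_nonneg by (intro mult_left_mono) auto
    finally show ?thesis unfolding eq[OF that] \<rho>_def
      using norm_triangle_ineq[of x0 "LBINT r:{0..s}. G 0 r (delayed lag S y r)"] \<xi>B[of 0] norm_ge_zero[of "\<xi> 0"] by linarith
  qed
  show "norm (y s) \<le> \<rho>" for s
  proof -
    consider "s < 0" | "s \<in> {0..L}" | "s > L" by force
    then show ?thesis
    proof cases
      case 1
      then show ?thesis using \<xi>B[of "\<Phi> s"] B_nonneg L_pos by (simp add: y_hist \<rho>_def add_increasing)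
    next
      case 3 then show ?thesis using y_end xb[of L] L_pos by simp
    qed (rule xb)
  qed
  show "y s = \<xi> (\<Phi>e 0 s)" if "s < 0" for s using y_hist[OF that] by (simp only: \<Phi>e_zero)
qed (rule y_meas)

text \<open>The right-hand sides, the histories and the time changes differ by \<open>O(e)\<close> or by the modulus of continuity of \<open>\<xi>\<close> at \<open>O(e)\<close>; the
  stability estimate converts this into a uniform bound for the paths.\<close>
lemma ye_uniform:
  assumes "\<eta> > 0"
  shows "\<exists>e0>0. \<forall>e\<in>{0..1}. e < e0 \<longrightarrow> (\<forall>s\<in>{- (M * S)..L}. norm (ye e s - y s) \<le> \<eta>)"
proof -
  define A where "A = 2 * L * (1 + C * CARD('k)) * exp (2 * (C * CARD('k)) * L)"
  \<comment> \<open>\<open>A\<close> is the constant of the stability estimate, \<open>e * D\<close> dominates every perturbation caused by \<open>e\<close>\<close>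
  define D where "D = Bf + C * (2 * (L + M * S)) + 2 * (L + M * S) + 1"
  have A0: "A \<ge> 0" unfolding A_def using L_pos C_pos by (intro mult_nonneg_nonneg add_nonneg_nonneg) auto
  define \<eta>' where "\<eta>' = \<eta> / (A + 1)"
  have \<eta>': "\<eta>' > 0" "A * \<eta>' \<le> \<eta>" "\<eta>' \<le> \<eta>" using assms A0 by (auto simp: \<eta>'_def field_simps)
  obtain d where d: "d > 0" "\<And>t t'. \<bar>t - t'\<bar> < d \<Longrightarrow> norm (\<xi> t - \<xi> t') < \<eta>'"
  proof -
    from \<xi>(1)[unfolded uniformly_continuous_on_def, rule_format, OF \<eta>'(1)]
    obtain d where "d > 0" and d: "\<forall>x x'. dist x' x < d \<longrightarrow> dist (\<xi> x') (\<xi> x) < \<eta>'" by blast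
    show ?thesis
      by (rule that[OF \<open>d > 0\<close>]) (use d in \<open>simp add: dist_norm\<close>)
  qed
  have Bf0: "Bf \<ge> 0" using Bf[of 0] norm_ge_zero order_trans by blast
  have D0: "D > 0" "Bf + C * (2 * L) \<le> D" "2 * (L + M * S) \<le> D"
  proof -
    have MS: "0 \<le> M * S" "0 \<le> 2 * (L + M * S)" using S L_pos by simp_all
    have CL: "0 \<le> C * (2 * (L + M * S))" "C * (2 * L) \<le> C * (2 * (L + M * S))"
      using MS C_pos by (auto intro!: mult_left_mono mult_nonneg_nonneg)
    show "D > 0" "Bf + C * (2 * L) \<le> D" "2 * (L + M * S) \<le> D"
      unfolding D_def using Bf0 MS CL by linarith+
  qed
  define e0 where "e0 = min d \<eta>' / D"
  have e0: "e0 > 0" using d(1) \<eta>'(1) D0(1) by (simp add: e0_def)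
  have main: "norm (ye e s - y s) \<le> \<eta>" if e: "e \<in> {0..1}" "e < e0" and s: "s \<in> {- (M * S)..L}" for e s
  proof -
    have eD: "e * D < d" "e * D < \<eta>'" using e(2) D0(1) by (auto simp: e0_def field_simps)
    have hist: "norm (ye e r - y r) \<le> \<eta>'" if r: "r < 0" "- (M * S) \<le> r" for r
    proof -
      have "\<bar>\<Phi>e e r - \<Phi> r\<bar> \<le> e * (2 * \<bar>r\<bar>)" by (rule \<Phi>e_close[OF e(1)])
      also have "\<dots> \<le> e * D" using r D0(3) L_pos e(1) by (intro mult_left_mono) auto
      finally have "norm (\<xi> (\<Phi>e e r) - \<xi> (\<Phi> r)) < \<eta>'" using eD by (intro d) auto
      then show ?thesis using ye[OF e(1)] y_hist r by (simp add: solves_def)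
    qed
    show ?thesis
    proof (cases "s < 0")
      case True then show ?thesis using hist[of s] s \<eta>' by auto
    next
      case False
      then have sL: "s \<in> {0..L}" using s by auto
      have "norm (ye e s - y s) \<le> A * \<eta>'"
        unfolding A_def
      proof (rule delay_equation_stability[where G = "G e" and G' = "G 0" and B = B and \<rho> = \<rho> and C = C, OF _ _ _ _ _ _ _ _ _ _ _ _ _ sL])
        show "norm (G e s q - G 0 s q') \<le> \<eta>' + C * norm (q - q')"
          if s: "s \<in> {0..L}" and q: "norm q \<le> CARD('k) * \<rho>" "norm q' \<le> CARD('k) * \<rho>" for s q q'
        proof -
          have "Bf * \<bar>pe e s - pe 0 s\<bar> \<le> Bf * e" unfolding pe_zero using pe_close[OF e(1)] Bf0 by (intro mult_left_mono) auto
          moreover have "C * \<bar>\<Phi>e e s - \<Phi>e 0 s\<bar> \<le> C * (e * (2 * \<bar>s\<bar>))"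
            unfolding \<Phi>e_zero using \<Phi>e_close[OF e(1)] C_pos by (intro mult_left_mono) auto
          moreover have "C * (e * (2 * \<bar>s\<bar>)) \<le> C * (e * (2 * L))" using s C_pos e(1) by (intro mult_left_mono) auto
          moreover have "Bf * e + C * (e * (2 * L)) \<le> e * D"
            using mult_left_mono[OF D0(2), of e] e(1) by (simp add: algebra_simps)
          moreover have "norm (G e s q - G 0 s q') \<le> Bf * \<bar>pe e s - pe 0 s\<bar> + (C * \<bar>\<Phi>e e s - \<Phi>e 0 s\<bar> + C * norm (q - q'))"
            using C[OF e(1) _ s q, of 0] by (simp add: distrib_left)
          ultimately show ?thesis using eD by linarith
        qed
        show "norm (ye e (s - real (lag k) * S) - y (s - real (lag k) * S)) \<le> \<eta>'"
          if "s \<in> {0..L}" "s - real (lag k) * S < 0" for s k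
        proof (rule hist[OF that(2)])
          have "real (lag k) * S \<le> M * S" using lag[of k] S by (intro mult_right_mono) auto
          then show "- (M * S) \<le> s - real (lag k) * S" using that(1) by auto
        qed
        show "(\<lambda>s. G e s (delayed lag S (ye e) s)) \<in> borel_measurable borel" "(\<lambda>s. G 0 s (delayed lag S y s)) \<in> borel_measurable borel"
          using ye[OF e(1)] e(1) by (auto intro!: G_measurable simp: solves_def)
        show "norm (G e s q) \<le> B" "norm (G 0 s q) \<le> B" for s q using G_bound e(1) by auto
        show "norm (ye e s) \<le> \<rho>" "norm (y s) \<le> \<rho>" for s using ye[OF e(1)] y_solves unfolding solves_def by blast+
        show "ye e s = x0 + (LBINT r:{0..s}. G e r (delayed lag S (ye e) r))" if "s \<in> {0..L}" for s
          using ye[OF e(1)] that unfolding solves_def by blast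
        show "y s = x0 + (LBINT r:{0..s}. G 0 r (delayed lag S y r))" if "s \<in> {0..L}" for s
          using y_solves that unfolding solves_def by blast
        show "C > 0" by (rule C_pos)
        show "S \<ge> 0" "\<eta>' \<ge> 0" using S \<eta>' by simp_all
      qed
      then show ?thesis using \<eta>' by linarith
    qed
  qed
  show ?thesis using e0 main by blast
qed

lemma ye_tendsto:
  assumes es: "\<And>i. es i \<in> {0<..1}" "es \<longlonglongrightarrow> 0" and s: "s \<in> {- (M * S)..L}"
  shows "(\<lambda>i. ye (es i) s) \<longlonglongrightarrow> y s"
proof (rule LIMSEQ_I)
  fix r :: real assume "r > 0"
  then have "r / 2 > 0" by simp
  from ye_uniform[OF this] obtain e0 where "e0 > 0"
    and "\<forall>e\<in>{0..1}. e < e0 \<longrightarrow> (\<forall>s\<in>{- (M * S)..L}. norm (ye e s - y s) \<le> r / 2)" by blast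
  then have e0: "e0 > 0" "\<And>e. e \<in> {0..1} \<Longrightarrow> e < e0 \<Longrightarrow> norm (ye e s - y s) \<le> r / 2"
    using s by blast+
  obtain n where n: "\<And>i. i \<ge> n \<Longrightarrow> norm (es i - 0) < e0" using LIMSEQ_D[OF es(2) e0(1)] by blast
  show "\<exists>no. \<forall>n\<ge>no. norm (ye (es n) s - y s) < r"
  proof (intro exI allI impI)
    fix i assume "i \<ge> n"
    then have "norm (ye (es i) s - y s) \<le> r / 2"
      using es(1)[of i] n[of i] by (intro e0(2)) simp_all
    then show "norm (ye (es i) s - y s) < r" using \<open>r > 0\<close> by linarith
  qed
qed

lemma G_tendsto:
  assumes es: "\<And>i. es i \<in> {0<..1}" "es \<longlonglongrightarrow> 0" and s: "s \<in> {0..L}"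
  shows "(\<lambda>i. G (es i) s (delayed lag S (ye (es i)) s)) \<longlonglongrightarrow> G 0 s (delayed lag S y s)"
proof (rule LIM_zero_cancel, rule Lim_null_comparison)
  have e: "es i \<in> {0..1}" for i using es(1)[of i] by auto
  have nb: "norm (delayed lag S z s) \<le> CARD('k) * \<rho>" if "solves e z" for z e s
    using that by (intro norm_delayed_le) (auto simp: solves_def)
  have Bf0: "Bf \<ge> 0" using Bf[of 0] norm_ge_zero order_trans by blast
  show "\<forall>\<^sub>F i in sequentially. norm (G (es i) s (delayed lag S (ye (es i)) s) - G 0 s (delayed lag S y s))
      \<le> Bf * es i + C * (es i * (2 * \<bar>s\<bar>) + norm (delayed lag S (ye (es i)) s - delayed lag S y s))"
  proof (rule always_eventually, rule allI)
    fix i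
    have "norm (G (es i) s (delayed lag S (ye (es i)) s) - G 0 s (delayed lag S y s)) \<le>
      Bf * \<bar>pe (es i) s - pe 0 s\<bar> + C * (\<bar>\<Phi>e (es i) s - \<Phi>e 0 s\<bar> + norm (delayed lag S (ye (es i)) s - delayed lag S y s))"
      by (rule C[OF e _ s nb[OF ye[OF e]] nb[OF y_solves]]) simp
    also have "\<dots> \<le> Bf * es i + C * (es i * (2 * \<bar>s\<bar>) + norm (delayed lag S (ye (es i)) s - delayed lag S y s))"
      unfolding pe_zero \<Phi>e_zero using pe_close[OF e] \<Phi>e_close[OF e] Bf0 C_pos by (intro add_mono mult_left_mono) auto
    finally show "norm (G (es i) s (delayed lag S (ye (es i)) s) - G 0 s (delayed lag S y s))
      \<le> Bf * es i + C * (es i * (2 * \<bar>s\<bar>) + norm (delayed lag S (ye (es i)) s - delayed lag S y s))" .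
  qed
  have "(\<lambda>i. delayed lag S (ye (es i)) s) \<longlonglongrightarrow> delayed lag S y s"
  proof (rule vec_tendstoI)
    fix k
    have "real (lag k) * S \<le> M * S" using lag[of k] S by (intro mult_right_mono) simp_all
    moreover have "0 \<le> real (lag k) * S" using S by simp
    ultimately have "s - real (lag k) * S \<in> {- (M * S)..L}"
      using s unfolding atLeastAtMost_iff by linarith
    then show "(\<lambda>i. delayed lag S (ye (es i)) s $ k) \<longlonglongrightarrow> delayed lag S y s $ k"
      unfolding delayed_def vec_lambda_beta by (rule ye_tendsto[OF es])
  qed
  then have d: "(\<lambda>i. norm (delayed lag S (ye (es i)) s - delayed lag S y s)) \<longlonglongrightarrow> 0"
    by (intro tendsto_norm_zero LIM_zero)
  have "(\<lambda>i. Bf * es i + C * (es i * (2 * \<bar>s\<bar>) + norm (delayed lag S (ye (es i)) s - delayed lag S y s))) \<longlonglongrightarrow> Bf * 0 + C * (0 * (2 * \<bar>s\<bar>) + 0)"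
    by (intro tendsto_add tendsto_mult tendsto_const es(2) d)
  then show "(\<lambda>i. Bf * es i + C * (es i * (2 * \<bar>s\<bar>) + norm (delayed lag S (ye (es i)) s - delayed lag S y s))) \<longlonglongrightarrow> 0" by simp
qed

subsection \<open>Back to the original time\<close>

definition \<Psi> :: "real \<Rightarrow> real \<Rightarrow> real" where "\<Psi> e = inv (\<Phi>e e)"

lemma \<Phi>e_bij: assumes e: "e \<in> {0<..1}" shows "bij (\<Phi>e e)"
proof (rule bijI)
  have e': "e \<in> {0..1}" using e by auto
  have "strict_mono (\<Phi>e e)" by (rule strict_monoI) (rule \<Phi>e_strict[OF e])
  then show "inj (\<Phi>e e)" by (rule strict_mono_imp_inj_on)
  have "\<exists>s. \<Phi>e e s = t" for t
  proof -
    define k where "k = \<lfloor>t / h\<rfloor>"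
    have v: "\<Phi>e e (of_int k * S) = of_int k * h" for k
      using \<Phi>e_multiple[of e 0 k] by (simp add: \<Phi>e_0)
    have "of_int k * h \<le> t" "t \<le> of_int (k + 1) * h"
      using floor_divide_lower[OF h, of t] floor_divide_upper[OF h, of t] by (simp_all add: k_def)
    moreover have "of_int k * S \<le> of_int (k + 1) * S" using S by (simp add: algebra_simps)
    ultimately show ?thesis
      using IVT'[of "\<Phi>e e" "of_int k * S" t "of_int (k + 1) * S"] \<Phi>e_continuous[OF e'] v[of k] v[of "k + 1"] by auto
  qed
  then show "surj (\<Phi>e e)" by (metis surjI surj_def)
qed

lemma \<Phi>e_\<Psi>: "e \<in> {0<..1} \<Longrightarrow> \<Phi>e e (\<Psi> e t) = t" and \<Psi>_\<Phi>e: "e \<in> {0<..1} \<Longrightarrow> \<Psi> e (\<Phi>e e s) = s"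
  unfolding \<Psi>_def using \<Phi>e_bij[of e] by (simp_all add: bij_is_surj surj_f_inv_f bij_is_inj)

lemma \<Phi>e_le_iff: "e \<in> {0<..1} \<Longrightarrow> \<Phi>e e a \<le> \<Phi>e e b \<longleftrightarrow> a \<le> b"
  using \<Phi>e_strict[of e a b] \<Phi>e_strict[of e b a] by (cases a b rule: linorder_cases) auto

lemma \<Psi>_le_iff: "e \<in> {0<..1} \<Longrightarrow> \<Psi> e t \<le> s \<longleftrightarrow> t \<le> \<Phi>e e s"
  and \<Psi>_ge_iff: "e \<in> {0<..1} \<Longrightarrow> s \<le> \<Psi> e t \<longleftrightarrow> \<Phi>e e s \<le> t"
  using \<Phi>e_le_iff[of e "\<Psi> e t" s] \<Phi>e_le_iff[of e s "\<Psi> e t"] \<Phi>e_\<Psi>[of e t] by auto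

lemma \<Psi>_measurable: assumes e: "e \<in> {0<..1}" shows "\<Psi> e \<in> borel_measurable borel"
proof (rule borel_measurable_mono, rule monoI)
  show "\<Psi> e a \<le> \<Psi> e b" if "a \<le> b" for a b
    using that by (simp add: \<Psi>_le_iff[OF e] \<Phi>e_\<Psi>[OF e])
qed

lemma \<Psi>_0: "e \<in> {0<..1} \<Longrightarrow> \<Psi> e 0 = 0" and \<Psi>_T: "e \<in> {0<..1} \<Longrightarrow> \<Psi> e T = L"
  using \<Psi>_\<Phi>e[of e 0] \<Psi>_\<Phi>e[of e L] by (simp_all add: \<Phi>e_0 \<Phi>e_L)

lemma \<Psi>_range: "e \<in> {0<..1} \<Longrightarrow> t \<in> {0..T} \<Longrightarrow> \<Psi> e t \<in> {0..L}"
  by (simp add: \<Psi>_le_iff \<Psi>_ge_iff \<Phi>e_0 \<Phi>e_L)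

lemma \<Psi>_shift: assumes e: "e \<in> {0<..1}" shows "\<Psi> e (t - real n * h) = \<Psi> e t - real n * S"
proof -
  have "\<Phi>e e (\<Psi> e t - real n * S) = t - real n * h"
    using \<Phi>e_multiple[of e "\<Psi> e t" "- int n"] \<Phi>e_\<Psi>[OF e] by simp
  then show ?thesis using \<Psi>_\<Phi>e[OF e] by metis
qed

text \<open>The control and path in the time \<open>t = \<Phi>e e s\<close>; the factor \<open>1 / pe\<close> is the derivative of the inverse time change.\<close>
definition W :: "real \<Rightarrow> real \<Rightarrow> real ^ 'm" where "W e t = (1 / pe e (\<Psi> e t)) *\<^sub>R w (\<Psi> e t)"
definition X :: "real \<Rightarrow> real \<Rightarrow> real ^ 'n" where "X e t = ye e (\<Psi> e t)"

lemma pe_pos: assumes "e \<in> {0<..1}" shows "0 < e * \<kappa>" "e * \<kappa> \<le> pe e s" "0 < pe e s"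
proof -
  show "0 < e * \<kappa>" using assms slope by simp
  then show "e * \<kappa> \<le> pe e s" "0 < pe e s" using pe_bounds(1)[of e s] assms by auto
qed

lemma W_props:
  assumes e: "e \<in> {0<..1}"
  shows "W e \<in> borel_measurable borel" "norm1 (W e t) \<le> c / (e * \<kappa>)" "W e t \<in> K"
    "norm1 (W e t) = (1 / pe e (\<Psi> e t)) * norm1 (w (\<Psi> e t))"
proof -
  note [measurable] = \<Psi>_measurable[OF e]
  show "W e \<in> borel_measurable borel" unfolding W_def[abs_def] by measurable
  show eq: "norm1 (W e t) = (1 / pe e (\<Psi> e t)) * norm1 (w (\<Psi> e t))"
    using pe_pos(3)[OF e, of "\<Psi> e t"] by (simp add: W_def norm1_def abs_mult sum_divide_distrib)
  show "norm1 (W e t) \<le> c / (e * \<kappa>)"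
    unfolding eq using pe_pos(1)[OF e] pe_pos(2,3)[OF e, of "\<Psi> e t"] w(1)[of "\<Psi> e t"] c_nonneg by (simp add: frac_le)
  show "W e t \<in> K"
    unfolding W_def using w(2)[of "\<Psi> e t"] pe_pos(3)[OF e, of "\<Psi> e t"] by (intro K[unfolded cone_def, rule_format]) auto
qed

lemma substitution_\<Psi>:
  fixes H :: "real \<Rightarrow> 'e::{banach, second_countable_topology}"
  assumes e: "e \<in> {0<..1}" and t: "t \<in> {0..T}" and H: "H \<in> borel_measurable borel"
  shows "(LBINT r:{0..t}. H (\<Psi> e r)) = (LBINT s:{0..\<Psi> e t}. pe e s *\<^sub>R H s)"
proof (rule substitution[OF pe_measurable \<Psi>_measurable[OF e] H, where B = 1 and \<Phi> = "\<Phi>e e"])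
  have e': "e \<in> {0..1}" using e by auto
  note r = \<Psi>_range[OF e t]
  show "0 \<le> pe e s" "pe e s \<le> 1" for s using pe_bounds[OF e'] by auto
  show "0 \<le> \<Psi> e t" using r by simp
  show "t = \<Phi>e e (\<Psi> e t)" using \<Phi>e_\<Psi>[OF e] by simp
  show "\<Phi>e e s = (LBINT r:{0..s}. pe e r)" if "s \<in> {0..\<Psi> e t}" for s
    using that r by (intro \<Phi>e_integral[OF e']) auto
  show "\<Psi> e r \<in> {0..\<Psi> e t}" if "r \<in> {0..t}" for r
    using that by (simp add: \<Psi>_le_iff[OF e] \<Psi>_ge_iff[OF e] \<Phi>e_0 \<Phi>e_\<Psi>[OF e])
  show "\<Psi> e r \<le> s \<longleftrightarrow> r \<le> \<Phi>e e s" for s r by (rule \<Psi>_le_iff[OF e])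
qed

lemma X_measurable: "e \<in> {0<..1} \<Longrightarrow> X e \<in> borel_measurable borel"
  unfolding X_def[abs_def] using \<Psi>_measurable[of e] ye[of e] by (auto simp: solves_def intro: measurable_compose)

lemma X_hist: assumes "e \<in> {0<..1}" "t < 0" shows "X e t = \<xi> t"
proof -
  have "\<Psi> e t < 0" using \<Psi>_ge_iff[OF assms(1), where s = 0 and t = t] assms(2) by (simp add: \<Phi>e_0 not_le[symmetric])
  then show ?thesis using ye[of e] assms \<Phi>e_\<Psi>[OF assms(1), of t] by (simp add: X_def solves_def)
qed

lemma X_integral:
  assumes e: "e \<in> {0<..1}" and t: "t \<in> {0..T}"
  shows "X e t = x0 + (LBINT s:{0..\<Psi> e t}. G e s (delayed lag S (ye e) s))"
  using ye[of e] e \<Psi>_range[OF e t] by (auto simp: X_def solves_def)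

text \<open>The equation in the parameter \<open>s\<close> transforms into the classical one since \<open>\<Psi>\<close> turns the delay \<open>h\<close> into \<open>S\<close>.\<close>
lemma X_equation:
  assumes e: "e \<in> {0<..1}" and t: "t \<in> {0..T}"
  shows "X e t = x0 + (LBINT t':{0..t}. f (t', delayed lag h (X e) t')
        + (\<Sum>j\<in>UNIV. (W e t' $ j) *\<^sub>R g j (t', delayed lag h (X e) t')))"
proof -
  have e': "e \<in> {0..1}" using e by auto
  have [measurable]: "ye e \<in> borel_measurable borel" using ye[OF e'] by (simp add: solves_def)
  define H where "H s = f (\<Phi>e e s, delayed lag S (ye e) s) + (\<Sum>j\<in>UNIV. (1 / pe e s * w s $ j) *\<^sub>R g j (\<Phi>e e s, delayed lag S (ye e) s))" for s
  note [measurable] = field_along_measurable[OF C1_map_continuous[OF f(2)] \<Phi>e_measurable[OF e'], where z = "ye e" and lag = lag and S = S]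
    field_along_measurable[OF C1_map_continuous[OF g(2)] \<Phi>e_measurable[OF e'], where z = "ye e" and lag = lag and S = S]
  have Hm: "H \<in> borel_measurable borel" unfolding H_def[abs_def] by measurable
  have del: "delayed lag S (ye e) (\<Psi> e r) = delayed lag h (X e) r" for r
    by (simp add: delayed_def X_def \<Psi>_shift[OF e])
  have 1: "H (\<Psi> e r) = f (r, delayed lag h (X e) r) + (\<Sum>j\<in>UNIV. (W e r $ j) *\<^sub>R g j (r, delayed lag h (X e) r))" for r
    by (simp add: H_def del \<Phi>e_\<Psi>[OF e] W_def)
  have 2: "pe e s *\<^sub>R H s = G e s (delayed lag S (ye e) s)" if "s \<in> {0..\<Psi> e t}" for s
    using that \<Psi>_range[OF e t] pe_pos(3)[OF e, of s] by (auto simp: H_def G_def scaleR_add_right scaleR_sum_right)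
  have "(LBINT s:{0..\<Psi> e t}. G e s (delayed lag S (ye e) s)) = (LBINT s:{0..\<Psi> e t}. pe e s *\<^sub>R H s)"
    using 2 by (intro set_lebesgue_integral_cong) auto
  also have "\<dots> = (LBINT r:{0..t}. H (\<Psi> e r))" by (rule substitution_\<Psi>[OF e t Hm, symmetric])
  finally show ?thesis unfolding X_integral[OF e t] 1 by simp
qed

definition u :: "real \<Rightarrow> real \<Rightarrow> real ^ 'm" where "u e t = (LBINT s:{0..t}. W e s)"
definition v :: "real \<Rightarrow> real \<Rightarrow> real" where "v e t = (LBINT s:{0..t}. norm1 (W e s))"

lemma u_eq: assumes e: "e \<in> {0<..1}" and t: "t \<in> {0..T}" shows "u e t = (LBINT s:{0..\<Psi> e t}. w s)"
proof -
  have "u e t = (LBINT r:{0..t}. (\<lambda>s. (1 / pe e s) *\<^sub>R w s) (\<Psi> e r))" by (simp add: u_def W_def)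
  also have "\<dots> = (LBINT s:{0..\<Psi> e t}. pe e s *\<^sub>R ((1 / pe e s) *\<^sub>R w s))" by (rule substitution_\<Psi>[OF e t]) measurable
  also have "\<dots> = (LBINT s:{0..\<Psi> e t}. w s)" using pe_pos(3)[OF e] by (simp add: less_imp_neq[symmetric])
  finally show ?thesis .
qed

lemma v_eq: assumes e: "e \<in> {0<..1}" and t: "t \<in> {0..T}" shows "v e t = (LBINT s:{0..\<Psi> e t}. norm1 (w s))"
proof -
  have "v e t = (LBINT r:{0..t}. (\<lambda>s. (1 / pe e s) * norm1 (w s)) (\<Psi> e r))" by (simp add: v_def W_props(4)[OF e])
  also have "\<dots> = (LBINT s:{0..\<Psi> e t}. pe e s *\<^sub>R ((1 / pe e s) * norm1 (w s)))" by (rule substitution_\<Psi>[OF e t]) measurable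
  also have "\<dots> = (LBINT s:{0..\<Psi> e t}. norm1 (w s))" using pe_pos(3)[OF e] by (simp add: less_imp_neq[symmetric])
  finally show ?thesis .
qed

lemma X_strict_sense:
  assumes e: "e \<in> {0<..1}" and BV: "bounded_variation_on (- real M * h) T x"
    and x: "\<And>t. t \<in> {- real M * h..<0} \<Longrightarrow> x t = \<xi>0 t" and \<xi>0: "\<And>t. t \<in> {- real M * h..<0} \<Longrightarrow> \<xi>0 t = \<xi> t"
  shows "strict_sense_process K N M h lag f g x0 \<xi>0 (u e) (X e) (v e)"
    "\<And>A. A \<in> sets (borel_upto T) \<Longrightarrow> measure (total_variation T (stieltjes T (u e))) A = stieltjes T (v e) A"
    "finite_measure (total_variation T (stieltjes T (u e)))"
proof -
  let ?F = "\<lambda>t'. f (t', delayed lag h (X e) t') + (\<Sum>j\<in>UNIV. (W e t' $ j) *\<^sub>R g j (t', delayed lag h (X e) t'))"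
  have lip: "norm (X e t - X e s) \<le> (Bf + (\<Sum>j\<in>UNIV. c / (e * \<kappa>) * Bg j)) * (t - s)" if st: "0 \<le> s" "s \<le> t" "t \<le> T" for s t
  proof -
    note [measurable] = X_measurable[OF e] W_props(1)[OF e]
      field_along_measurable[OF C1_map_continuous[OF f(2)], where z = "X e" and lag = lag and S = h and \<Phi> = "\<lambda>t. t"]
      field_along_measurable[OF C1_map_continuous[OF g(2)], where z = "X e" and lag = lag and S = h and \<Phi> = "\<lambda>t. t"]
    have "?F \<in> borel_measurable borel" by measurable
    moreover have "norm (?F r) \<le> Bf + (\<Sum>j\<in>UNIV. c / (e * \<kappa>) * Bg j)" for r
    proof (intro norm_triangle_mono Bf sum_norm_le)
      fix j
      have "\<bar>W e r $ j\<bar> \<le> c / (e * \<kappa>)" using norm1_component_le[of "W e r" j] W_props(2)[OF e, of r] by linarith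
      then show "norm ((W e r $ j) *\<^sub>R g j (r, delayed lag h (X e) r)) \<le> c / (e * \<kappa>) * Bg j"
        using Bg[of j "(r, delayed lag h (X e) r)"] unfolding norm_scaleR by (intro mult_mono) auto
    qed
    ultimately show ?thesis
      using indefinite_integral_Lipschitz[of ?F "Bf + (\<Sum>j\<in>UNIV. c / (e * \<kappa>) * Bg j)" s t] X_equation[OF e, of s] X_equation[OF e, of t] st by simp
  qed
  have nn: "0 \<le> Bf + (\<Sum>j\<in>UNIV. c / (e * \<kappa>) * Bg j)"
    using Bf[of 0] Bg[of _ 0] c_nonneg pe_pos(1)[OF e]
    by (intro add_nonneg_nonneg sum_nonneg mult_nonneg_nonneg) (auto intro: order_trans[OF norm_ge_zero])
  have BVX: "bounded_variation_on (- real M * h) T (X e)"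
    by (rule bounded_variation_glue[OF BV _ _ lip nn, where d = "SUP t. norm (\<xi> t)"])
      (use X_hist[OF e] x \<xi>0 \<xi>B T_pos order_trans[OF norm_ge_zero \<xi>B] in auto)
  have hist: "X e t = \<xi>0 t" if "t \<in> {- real M * h..<0}" for t
    using X_hist[OF e] \<xi>0 that by auto
  note I = strict_sense_processI[OF N h T f(1) C1_map_continuous[OF f(2)] g(1) C1_map_continuous[OF g(2)]
      W_props(1)[OF e] W_props(2)[OF e] W_props(3)[OF e] X_measurable[OF e] hist BVX X_equation[OF e], folded u_def v_def]
  have uv: "(\<lambda>t. LBINT s:{0..t}. W e s) = u e" "(\<lambda>t. LBINT s:{0..t}. norm1 (W e s)) = v e"
    by (auto simp: u_def v_def)
  show "strict_sense_process K N M h lag f g x0 \<xi>0 (u e) (X e) (v e)"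
    "\<And>A. A \<in> sets (borel_upto T) \<Longrightarrow> measure (total_variation T (stieltjes T (u e))) A = stieltjes T (v e) A"
    using I(1,3) unfolding uv by blast+
  have TV: "total_variation T (stieltjes T (u e)) = density (restrict_space lborel {0..T}) (\<lambda>t. ennreal (norm1 (W e t)))"
    using I(2) unfolding uv .
  show "finite_measure (total_variation T (stieltjes T (u e)))"
  proof (rule finite_measureI)
    have [measurable]: "W e \<in> borel_measurable borel" by (rule W_props(1)[OF e])
    have "emeasure (total_variation T (stieltjes T (u e))) {0..T} = (\<integral>\<^sup>+t. ennreal (norm1 (W e t)) * indicator {0..T} t \<partial>restrict_space lborel {0..T})"
      unfolding TV by (rule emeasure_density) (auto simp: sets_restrict_lborel sets_borel_upto intro!: measurable_restrict_space1)
    also have "\<dots> \<le> (\<integral>\<^sup>+t. ennreal (c / (e * \<kappa>)) \<partial>restrict_space lborel {0..T})"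
      using W_props(2)[OF e] by (intro nn_integral_mono) (auto simp: indicator_def intro!: ennreal_leI)
    also have "\<dots> = ennreal (c / (e * \<kappa>)) * ennreal T"
      using T_pos by (simp add: emeasure_restrict_space space_restrict_space)
    also have "\<dots> < \<infinity>" by (simp add: ennreal_mult_less_top)
    finally show "emeasure (total_variation T (stieltjes T (u e))) (space (total_variation T (stieltjes T (u e)))) \<noteq> \<infinity>"
      using sets_eq_imp_space_eq[OF sets_total_variation, of T "stieltjes T (u e)"] by simp
  qed
qed

lemma pf_component:
  fixes q :: "real \<Rightarrow> real ^ 'd"
  assumes [measurable]: "\<Theta> \<in> borel_measurable borel" "q \<in> borel_measurable borel" and q: "\<And>s. norm (q s) \<le> b"
    and A: "A \<in> sets (borel_upto T)"
  shows "pf \<Theta> L q A $ j = pf \<Theta> L (\<lambda>s. q s $ j) A"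
proof -
  have [measurable]: "A \<in> sets borel" using A by (simp add: sets_borel_upto)
  have "set_integrable lborel {s\<in>{0..L}. \<Theta> s \<in> A} q"
    using q by (intro set_integrable_subset[OF set_integrable_bounded[where a = 0 and b = L and B = b]]) auto
  then show ?thesis
    unfolding pf_def set_lebesgue_integral_def set_integrable_def
    by (subst integral_bounded_linear[OF bounded_linear_vec_nth, symmetric]) auto
qed

lemma \<Phi>e_tendsto: "es \<longlonglongrightarrow> 0 \<Longrightarrow> (\<lambda>i. \<Phi>e (es i) s) \<longlonglongrightarrow> \<Phi> s"
proof -
  assume "es \<longlonglongrightarrow> 0"
  then have "(\<lambda>i. (1 - es i) * \<Phi> s + es i * \<kappa> * s) \<longlonglongrightarrow> (1 - 0) * \<Phi> s + 0 * \<kappa> * s"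
    by (intro tendsto_add tendsto_mult tendsto_diff tendsto_const)
  then show ?thesis by (simp add: \<Phi>e_def)
qed

lemma sublevel_\<Phi>e:
  assumes e: "e \<in> {0<..1}" and t: "t \<in> {0..T}" shows "{s\<in>{0..L}. \<Phi>e e s \<in> {0..t}} = {0..\<Psi> e t}"
proof -
  have 1: "\<Phi>e e s \<ge> 0 \<longleftrightarrow> s \<ge> 0" for s using \<Phi>e_le_iff[OF e, of 0 s] by (simp add: \<Phi>e_0)
  have 2: "\<Psi> e t \<le> L" using \<Psi>_range[OF e t] by simp
  show ?thesis
  proof (rule set_eqI)
    fix s
    show "s \<in> {s\<in>{0..L}. \<Phi>e e s \<in> {0..t}} \<longleftrightarrow> s \<in> {0..\<Psi> e t}"
      using 1[of s] 2 \<Psi>_ge_iff[OF e, of s t] by auto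
  qed
qed

text \<open>The Stieltjes measures of control, variation and path are images of \<open>w\<close>, \<open>norm1 w\<close> and of the right-hand side of the delay equation
  under the time changes, and all these converge pointwise and boundedly on \<open>[0, L]\<close>. For the values at \<open>t\<close> the preimages
  \<open>\<Psi> e t\<close> have to converge to the last preimage of \<open>t\<close> under \<open>\<Phi>\<close>; this is so if that preimage is unique.\<close>
theorem approximation:
  assumes BV: "bounded_variation_on (- real M * h) T x"
    and x_hist: "\<And>t. t \<in> {- real M * h..<0} \<Longrightarrow> x t = \<xi>0 t" and \<xi>0: "\<And>t. t \<in> {- real M * h..<0} \<Longrightarrow> \<xi>0 t = \<xi> t"
    and x_0: "x 0 = x0" and x_rep: "\<And>t. t \<in> {0<..T} \<Longrightarrow> \<exists>s\<in>{0..L}. {r\<in>{0..L}. \<Phi> r \<le> t} = {0..s} \<and> x t = y s"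
    and \<mu>: "\<And>A. A \<in> sets (borel_upto T) \<Longrightarrow> \<mu> A = pf \<Phi> L w A"
    and \<nu>: "sets \<nu> = sets (borel_upto T)" "finite_measure \<nu>"
      "\<And>A. A \<in> sets (borel_upto T) \<Longrightarrow> measure \<nu> A = pf \<Phi> L (\<lambda>s. norm1 (w s)) A"
    and v_0: "v' 0 = 0" and v_rep: "\<And>t. t \<in> {0<..T} \<Longrightarrow> v' t = measure \<nu> {0..t}"
  shows "\<exists>(us :: nat \<Rightarrow> real \<Rightarrow> real ^ 'm) (xs :: nat \<Rightarrow> real \<Rightarrow> real ^ 'n) (vs :: nat \<Rightarrow> real \<Rightarrow> real).
    (\<forall>i. strict_sense_process K N M h lag f g x0 \<xi>0 (us i) (xs i) (vs i)) \<and>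
    vector_weak_star T (\<lambda>i. stieltjes T (us i)) \<mu> \<and>
    weak_star T (\<lambda>i. total_variation T (stieltjes T (us i))) \<nu> \<and>
    (\<forall>i. \<forall>A \<in> sets (borel_upto T).
       measure (total_variation T (stieltjes T (us i))) A = stieltjes T (vs i) A) \<and>
    vector_weak_star T (\<lambda>i. stieltjes T (xs i)) (stieltjes T x) \<and>
    (\<exists>E \<subseteq> {0..T}. {0..T} - E \<in> null_sets lebesgue \<and> 0 \<in> E \<and> T \<in> E \<and>
       (\<forall>t\<in>E. (\<lambda>i. xs i t) \<longlonglongrightarrow> x t \<and> (\<lambda>i. vs i t) \<longlonglongrightarrow> v' t))"
proof -
  define es :: "nat \<Rightarrow> real" where "es i = 1 / real (Suc i)" for i
  have es: "\<And>i. es i \<in> {0<..1}" and es0: "es \<longlonglongrightarrow> 0"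
    using LIMSEQ_inverse_real_of_nat by (auto simp: es_def[abs_def] inverse_eq_divide)
  have es': "es i \<in> {0..1}" for i using es[of i] by auto
  have \<Phi>m: "\<Phi> \<in> borel_measurable borel" using \<Phi>e_measurable[of 0] by (simp add: \<Phi>e_zero)
  have \<Phi>r: "\<Phi> s \<in> {0..T}" if "s \<in> {0..L}" for s using \<Phi>e_range[OF _ that, of 0] by (simp add: \<Phi>e_zero)
  have \<Phi>em: "\<Phi>e (es i) \<in> borel_measurable borel" for i by (rule \<Phi>e_measurable[OF es'])
  define D where "D e s = G e s (delayed lag S (if e = 0 then y else ye e) s)" for e s
  have Dm: "D e \<in> borel_measurable borel" if "e \<in> {0..1}" for e
    unfolding D_def[abs_def] using that ye[OF that] y_meas by (intro G_measurable) (auto simp: solves_def)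
  have DB: "norm (D e s) \<le> B" if "e \<in> {0..1}" for e s unfolding D_def by (rule G_bound[OF that])
  have D_es: "D (es i) s = G (es i) s (delayed lag S (ye (es i)) s)" for i s using es[of i] by (simp add: D_def)
  have wB: "norm (w s) \<le> c" for s using norm_le_norm1[of "w s"] w(1)[of s] by linarith
  have nm: "(\<lambda>s. norm1 (w s)) \<in> borel_measurable borel" by measurable
  have nB: "norm (norm1 (w s)) \<le> c" for s using w(1)[of s] by simp
  have iw: "set_integrable lborel {0..L} w" using wB by (intro set_integrable_bounded) auto
  have inw: "set_integrable lborel {0..L} (\<lambda>s. norm1 (w s))" using nB by (intro set_integrable_bounded nm) auto
  have iD: "set_integrable lborel {0..L} (D e)" if "e \<in> {0..1}" for e
    using DB[OF that] by (intro set_integrable_bounded[OF Dm[OF that]]) auto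
  \<comment> \<open>all four Stieltjes measures are images of densities\<close>
  have st_u: "stieltjes T (u (es i)) A = pf (\<Phi>e (es i)) L w A"
    and st_v: "stieltjes T (v (es i)) A = pf (\<Phi>e (es i)) L (\<lambda>s. norm1 (w s)) A"
    and st_X: "stieltjes T (X (es i)) A = pf (\<Phi>e (es i)) L (D (es i)) A" if A: "A \<in> sets (borel_upto T)" for i A
  proof -
    have z: "u (es i) 0 = 0" "v (es i) 0 = 0" "X (es i) 0 = x0"
      using u_eq[OF es, of 0 i] v_eq[OF es, of 0 i] X_integral[OF es, of 0 i] T_pos by (simp_all add: \<Psi>_0[OF es])
    have sub: "{s\<in>{0..L}. \<Phi>e (es i) s \<in> {0..t}} = {0..\<Psi> (es i) t}" if "t \<in> {0<..T}" for t
      using that by (intro sublevel_\<Phi>e es) auto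
    show "stieltjes T (u (es i)) A = pf (\<Phi>e (es i)) L w A"
      by (rule stieltjes_eq(2)[OF pf_vector_measures[OF \<Phi>em iw] T_pos _ A]) (simp add: pf_def sub[simplified] z u_eq[OF es])
    show "stieltjes T (v (es i)) A = pf (\<Phi>e (es i)) L (\<lambda>s. norm1 (w s)) A"
      by (rule stieltjes_eq(2)[OF pf_vector_measures[OF \<Phi>em inw] T_pos _ A]) (simp add: pf_def sub[simplified] z v_eq[OF es])
    show "stieltjes T (X (es i)) A = pf (\<Phi>e (es i)) L (D (es i)) A"
      by (rule stieltjes_eq(2)[OF pf_vector_measures[OF \<Phi>em iD[OF es']] T_pos _ A]) (simp add: pf_def sub[simplified] z X_integral[OF es] D_es)
  qed
  have y_int: "y s = x0 + (LBINT r:{0..s}. D 0 r)" if "s \<in> {0..L}" for s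
    using y_solves that by (simp add: solves_def D_def)
  have sublevel: "{r\<in>{0..L}. \<Phi> r \<in> {0..t}} = {r\<in>{0..L}. \<Phi> r \<le> t}" for t using \<Phi>r by auto
  have st_x: "stieltjes T x A = pf \<Phi> L (D 0) A" if A: "A \<in> sets (borel_upto T)" for A
  proof (rule stieltjes_eq(2)[OF pf_vector_measures[OF \<Phi>m iD] T_pos _ A])
    fix t assume "t \<in> {0<..T}"
    then obtain s where s: "s \<in> {0..L}" "{r\<in>{0..L}. \<Phi> r \<le> t} = {0..s}" "x t = y s" using x_rep by blast
    show "pf \<Phi> L (D 0) {0..t} = x t - x 0" unfolding pf_def sublevel s(2,3) x_0 y_int[OF s(1)] by simp
  qed simp
  have comp_conv: "vector_weak_star T \<mu>s \<mu>'"
    if \<mu>s: "\<And>i A. A \<in> sets (borel_upto T) \<Longrightarrow> \<mu>s i A = pf (\<Phi>e (es i)) L (qs i) A"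
      and \<mu>': "\<And>A. A \<in> sets (borel_upto T) \<Longrightarrow> \<mu>' A = pf \<Phi> L q A"
      and m: "\<And>i. qs i \<in> borel_measurable borel" "q \<in> borel_measurable borel"
      and b: "\<And>i s. norm (qs i s) \<le> b" "\<And>s. norm (q s) \<le> b"
      and conv: "\<And>s. s \<in> {0..L} \<Longrightarrow> (\<lambda>i. qs i s) \<longlonglongrightarrow> q s"
    for \<mu>s \<mu>' and qs :: "nat \<Rightarrow> real \<Rightarrow> real ^ 'd" and q b
    unfolding vector_weak_star_def
  proof (intro allI impI)
    fix \<psi> :: "real \<Rightarrow> real" and j assume \<psi>: "continuous_on {0..T} \<psi>"
    have cb: "\<bar>qs i s $ j\<bar> \<le> b" "\<bar>q s $ j\<bar> \<le> b" for i s
      using component_le_norm_cart[of "qs i s" j] component_le_norm_cart[of "q s" j] b(1)[of i s] b(2)[of s] by linarith+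
    have 1: "signed_integral T (\<lambda>A. \<mu>s i A $ j) {0..T} \<psi> = signed_integral T (pf (\<Phi>e (es i)) L (\<lambda>s. qs i s $ j)) {0..T} \<psi>" for i
      by (rule fun_cong[OF fun_cong[OF signed_integral_cong_measure]]) (simp add: \<mu>s pf_component[OF \<Phi>em m(1) b(1)])
    have 2: "signed_integral T (\<lambda>A. \<mu>' A $ j) {0..T} \<psi> = signed_integral T (pf \<Phi> L (\<lambda>s. q s $ j)) {0..T} \<psi>"
      by (rule fun_cong[OF fun_cong[OF signed_integral_cong_measure]]) (simp add: \<mu>' pf_component[OF \<Phi>m m(2) b(2)])
    show "(\<lambda>i. signed_integral T (\<lambda>A. \<mu>s i A $ j) {0..T} \<psi>) \<longlonglongrightarrow> signed_integral T (\<lambda>A. \<mu>' A $ j) {0..T} \<psi>"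
      unfolding 1 2
    proof (rule signed_integral_pf_tendsto[OF \<Phi>m _ \<Phi>em _ \<Phi>r _ cb(2) cb(1) \<Phi>e_tendsto[OF es0] _ \<psi>])
      show "(\<lambda>i. qs i s $ j) \<longlonglongrightarrow> q s $ j" if "s \<in> {0..L}" for s by (rule tendsto_vec_nth[OF conv[OF that]])
      show "\<Phi>e (es i) s \<in> {0..T}" if "s \<in> {0..L}" for i s by (rule \<Phi>e_range[OF es' that])
    qed (use m T_pos in auto)
  qed
  have conv_u: "vector_weak_star T (\<lambda>i. stieltjes T (u (es i))) \<mu>"
    by (rule comp_conv[OF st_u \<mu> w_meas w_meas wB wB]) auto
  have conv_X: "vector_weak_star T (\<lambda>i. stieltjes T (X (es i))) (stieltjes T x)"
  proof (rule comp_conv[OF st_X st_x Dm[OF es'] Dm DB[OF es'] DB])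
    show "(\<lambda>i. D (es i) s) \<longlonglongrightarrow> D 0 s" if "s \<in> {0..L}" for s
      unfolding D_es using G_tendsto[OF es es0 that] by (simp add: D_def)
  qed auto
  note strict = X_strict_sense[OF es BV x_hist \<xi>0]
  have TV: "measure (total_variation T (stieltjes T (u (es i)))) A = stieltjes T (v (es i)) A" if "A \<in> sets (borel_upto T)" for i A
    by (rule strict(2)[OF _ _ that])
  have conv_TV: "weak_star T (\<lambda>i. total_variation T (stieltjes T (u (es i)))) \<nu>"
    unfolding weak_star_def
  proof (intro allI impI)
    fix \<psi> :: "real \<Rightarrow> real" assume \<psi>: "continuous_on {0..T} \<psi>"
    have 1: "(LINT t:{0..T}|total_variation T (stieltjes T (u (es i))). \<psi> t) = signed_integral T (pf (\<Phi>e (es i)) L (\<lambda>s. norm1 (w s))) {0..T} \<psi>" for i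
      by (rule signed_integral_of_measure[OF sets_total_variation strict(3) pf_vector_measures[OF \<Phi>em inw] _ \<psi>])
        (simp_all add: TV st_v)
    have 2: "(LINT t:{0..T}|\<nu>. \<psi> t) = signed_integral T (pf \<Phi> L (\<lambda>s. norm1 (w s))) {0..T} \<psi>"
      by (rule signed_integral_of_measure[OF \<nu>(1,2) pf_vector_measures[OF \<Phi>m inw] \<nu>(3) \<psi>])
    show "(\<lambda>i. LINT t:{0..T}|total_variation T (stieltjes T (u (es i))). \<psi> t) \<longlonglongrightarrow> (LINT t:{0..T}|\<nu>. \<psi> t)"
      unfolding 1 2
    proof (rule signed_integral_pf_tendsto[OF \<Phi>m nm \<Phi>em nm \<Phi>r _ _ _ \<Phi>e_tendsto[OF es0] _ \<psi>])
      show "\<Phi>e (es i) s \<in> {0..T}" if "s \<in> {0..L}" for i s by (rule \<Phi>e_range[OF es' that])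
      show "\<bar>norm1 (w s)\<bar> \<le> c" "\<bar>norm1 (w s)\<bar> \<le> c" for s using w(1)[of s] by auto
    qed (use T_pos in auto)
  qed
  \<comment> \<open>pointwise convergence away from the values that the time change takes on an interval\<close>
  define bad where "bad = {t. \<exists>s\<in>{0..L}. \<exists>s'\<in>{0..L}. s < s' \<and> \<Phi> s = t \<and> \<Phi> s' = t}"
  have \<Phi>mono: "\<Phi> a \<le> \<Phi> b" if "a \<le> b" for a b using \<Phi>_Lipschitz[OF that] by simp
  have "countable bad" unfolding bad_def
    by (rule countable_nontrivial_fibres) (auto simp: mono_on_def \<Phi>mono is_interval_cc)
  define E where "E = insert 0 (insert T ({0..T} - bad))"
  have "countable ({0..T} - E)" by (rule countable_subset[OF _ \<open>countable bad\<close>]) (auto simp: E_def)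
  then have null: "{0..T} - E \<in> null_sets lebesgue"
    by (intro null_sets_completionI countable_imp_null_set_lborel)
  have ycont: "continuous_on {0..L} y"
  proof -
    have "continuous_on {0..L} (\<lambda>s. x0 + (LBINT r:{0..s}. D 0 r))"
      using DB[of 0] by (intro continuous_intros continuous_on_subset[OF continuous_indefinite_integral[OF Dm, of 0 B]]) auto
    then show ?thesis by (rule continuous_on_eq) (simp add: y_int)
  qed
  have vcont: "continuous_on {0..L} (\<lambda>s. LBINT r:{0..s}. norm1 (w r))"
    using continuous_indefinite_integral[OF nm nB] by (rule continuous_on_subset) auto
  have \<nu>_sub: "measure \<nu> {0..t} = (LBINT r:{0..s}. norm1 (w r))"
    if "t \<in> {0<..T}" "{r\<in>{0..L}. \<Phi> r \<le> t} = {0..s}" for t s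
    using that by (subst \<nu>(3)) (auto simp: sets_borel_upto pf_def sublevel simp del: atLeastAtMost_iff)
  have pt: "(\<lambda>i. X (es i) t) \<longlonglongrightarrow> x t \<and> (\<lambda>i. v (es i) t) \<longlonglongrightarrow> v' t" if "t \<in> E" for t
  proof -
    consider "t = 0" | "t = T" | "0 < t" "t < T" "t \<notin> bad" using \<open>t \<in> E\<close> unfolding E_def by force
    then show ?thesis
    proof cases
      case 1
      have "X (es i) 0 = x0" "v (es i) 0 = 0" for i
        using v_eq[OF es, of 0 i] X_integral[OF es, of 0 i] T_pos by (simp_all add: \<Psi>_0[OF es])
      then show ?thesis using 1 x_0 v_0 by simp
    next
      case 2
      have T: "T \<in> {0<..T}" using T_pos by simp
      have sub: "{r\<in>{0..L}. \<Phi> r \<le> T} = {0..L}" using \<Phi>r by auto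
      obtain s where "s \<in> {0..L}" "{0..L} = {0..s}" "x T = y s" using x_rep[OF T] sub by auto
      then have xT: "x T = y L" using L_pos by auto
      have "X (es i) T = ye (es i) L" for i by (simp add: X_def \<Psi>_T[OF es])
      moreover have "(\<lambda>i. ye (es i) L) \<longlonglongrightarrow> y L" using L_pos S by (intro ye_tendsto es es0) (auto intro: order_trans[of _ 0])
      moreover have "v (es i) T = v' T" for i
        using v_eq[OF es, of T i] T_pos \<nu>_sub[OF T sub] v_rep[OF T] by (simp add: \<Psi>_T[OF es])
      ultimately show ?thesis using 2 xT by simp
    next
      case 3
      then have tT: "t \<in> {0<..T}" "t \<in> {0..T}" by auto
      obtain s where s: "s \<in> {0..L}" "{r\<in>{0..L}. \<Phi> r \<le> t} = {0..s}" "x t = y s" using x_rep[OF tT(1)] by blast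
      have below: "\<Phi> r \<le> t \<longleftrightarrow> r \<le> s" if "r \<in> {0..L}" for r
      proof -
        have "r \<in> {r\<in>{0..L}. \<Phi> r \<le> t} \<longleftrightarrow> r \<in> {0..s}" by (simp only: s(2))
        then show ?thesis using that by simp
      qed
      have "\<Phi> s \<le> t" using below[OF s(1)] by simp
      have "s < L" using below[of L] 3 L_pos by (simp add: \<Phi>_L)
      have "\<Phi> s = t"
      proof (rule ccontr)
        assume "\<Phi> s \<noteq> t"
        define d where "d = min (t - \<Phi> s) (L - s)"
        have d: "d > 0" "d \<le> t - \<Phi> s" "s + d \<in> {0..L}" using \<open>\<Phi> s \<noteq> t\<close> \<open>\<Phi> s \<le> t\<close> \<open>s < L\<close> s(1) by (auto simp: d_def)
        have "\<Phi> (s + d) \<le> \<Phi> s + d" using \<Phi>_Lipschitz[of s "s + d"] d(1) by simp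
        then show False using below[OF d(3)] d by simp
      qed
      have strict_below: "\<Phi> r < t" if "r \<in> {0..L}" "r < s" for r
        using below[OF that(1)] that 3(3) s(1) \<open>\<Phi> s = t\<close> unfolding bad_def by force
      have \<Psi>lim: "(\<lambda>i. \<Psi> (es i) t) \<longlonglongrightarrow> s"
      proof (rule order_tendstoI)
        fix a assume "a < s"
        show "\<forall>\<^sub>F i in sequentially. a < \<Psi> (es i) t"
        proof (cases "a < 0")
          case True
          then show ?thesis using \<Psi>_range[OF es tT(2)] by (intro always_eventually) (auto intro: less_le_trans)
        next
          case False
          then have "\<Phi> a < t" using \<open>a < s\<close> s(1) by (intro strict_below) auto
          from order_tendstoD(2)[OF \<Phi>e_tendsto[OF es0] this] show ?thesis
            by (rule eventually_mono) (simp add: \<Psi>_le_iff[OF es] not_le[symmetric])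
        qed
      next
        fix b assume "s < b"
        show "\<forall>\<^sub>F i in sequentially. \<Psi> (es i) t < b"
        proof (cases "b > L")
          case True
          then show ?thesis using \<Psi>_range[OF es tT(2)] by (intro always_eventually) (auto intro: le_less_trans)
        next
          case False
          then have "t < \<Phi> b" using \<open>s < b\<close> s(1) below[of b] by auto
          from order_tendstoD(1)[OF \<Phi>e_tendsto[OF es0] this] show ?thesis
            by (rule eventually_mono) (simp add: \<Psi>_ge_iff[OF es] not_le[symmetric])
        qed
      qed
      have \<Psi>in: "\<Psi> (es i) t \<in> {0..L}" for i by (rule \<Psi>_range[OF es tT(2)])
      have "(\<lambda>i. y (\<Psi> (es i) t)) \<longlonglongrightarrow> y s"
        by (rule continuous_on_tendsto_compose[OF ycont \<Psi>lim s(1)]) (simp add: \<Psi>in[simplified])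
      moreover have "(\<lambda>i. X (es i) t - y (\<Psi> (es i) t)) \<longlonglongrightarrow> 0"
      proof (rule LIMSEQ_I)
        fix r :: real assume "r > 0"
        then have "r / 2 > 0" by simp
        from ye_uniform[OF this] obtain e0 where "e0 > 0"
          and e0: "\<forall>e\<in>{0..1}. e < e0 \<longrightarrow> (\<forall>s\<in>{- (M * S)..L}. norm (ye e s - y s) \<le> r / 2)" by blast
        obtain n where n: "\<And>i. i \<ge> n \<Longrightarrow> norm (es i - 0) < e0" using LIMSEQ_D[OF es0 \<open>e0 > 0\<close>] by blast
        show "\<exists>no. \<forall>n\<ge>no. norm (X (es n) t - y (\<Psi> (es n) t) - 0) < r"
        proof (intro exI allI impI)
          fix i assume "i \<ge> n"
          then have "es i < e0" using n[of i] es[of i] by simp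
          moreover have "\<Psi> (es i) t \<in> {- (M * S)..L}" using \<Psi>in[of i] S by (auto intro: order_trans[of _ 0])
          ultimately have "norm (ye (es i) (\<Psi> (es i) t) - y (\<Psi> (es i) t)) \<le> r / 2" using e0 es'[of i] by blast
          then show "norm (X (es i) t - y (\<Psi> (es i) t) - 0) < r" using \<open>r > 0\<close> by (simp add: X_def)
        qed
      qed
      ultimately have "(\<lambda>i. (X (es i) t - y (\<Psi> (es i) t)) + y (\<Psi> (es i) t)) \<longlonglongrightarrow> 0 + y s" by (intro tendsto_add)
      then have Xc: "(\<lambda>i. X (es i) t) \<longlonglongrightarrow> x t" using s(3) by simp
      have "(\<lambda>i. LBINT r:{0..\<Psi> (es i) t}. norm1 (w r)) \<longlonglongrightarrow> (LBINT r:{0..s}. norm1 (w r))"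
        by (rule continuous_on_tendsto_compose[OF vcont \<Psi>lim s(1)]) (simp add: \<Psi>in[simplified])
      then have "(\<lambda>i. v (es i) t) \<longlonglongrightarrow> v' t"
        using v_rep[OF tT(1)] \<nu>_sub[OF tT(1) s(2)] by (simp add: v_eq[OF es tT(2)])
      then show ?thesis using Xc by simp
    qed
  qed
  show ?thesis
  proof (intro exI[of _ "\<lambda>i. u (es i)"] exI[of _ "\<lambda>i. X (es i)"] exI[of _ "\<lambda>i. v (es i)"] conjI allI ballI exI[of _ E])
    show "strict_sense_process K N M h lag f g x0 \<xi>0 (u (es i)) (X (es i)) (v (es i))" for i by (rule strict(1))
    show "E \<subseteq> {0..T}" "0 \<in> E" "T \<in> E" using T_pos by (auto simp: E_def)
  qed (use conv_u conv_X conv_TV TV null pt in blast)+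
qed

end

section \<open>Measures dominating Lebesgue measure\<close>

subsection \<open>Bounded densities\<close>

text \<open>Radon-Nikodym; domination bounds the density by 1, and truncation makes the bound hold everywhere.\<close>
lemma bounded_density:
  fixes M N :: "real measure"
  assumes M: "finite_measure M" and sets: "sets M = sets borel" "sets N = sets borel"
    and le: "\<And>A. A \<in> sets borel \<Longrightarrow> emeasure N A \<le> emeasure M A"
  shows "\<exists>k. k \<in> borel_measurable borel \<and> (\<forall>r. 0 \<le> k r \<and> k r \<le> 1) \<and> N = density M (\<lambda>r. ennreal (k r))"
proof -
  interpret M: finite_measure M by fact
  have "absolutely_continuous M N"
    unfolding absolutely_continuous_def
  proof
    fix A assume "A \<in> null_sets M"
    then have "A \<in> sets borel" "emeasure M A = 0" by (auto simp: sets)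
    then show "A \<in> null_sets N" using le[of A] by (auto simp: sets)
  qed
  then obtain F where F: "F \<in> borel_measurable M" "density M F = N"
    using M.Radon_Nikodym sets by metis
  have [measurable]: "F \<in> borel_measurable borel" using F(1) measurable_cong_sets[OF sets(1) refl] by blast
  have em: "emeasure N A = (\<integral>\<^sup>+r. F r * indicator A r \<partial>M)" if "A \<in> sets borel" for A
    using that unfolding F(2)[symmetric] by (intro emeasure_density F) (simp add: sets)
  have le1: "AE r in M. F r \<le> 1"
  proof (rule ccontr)
    assume *: "\<not> (AE r in M. F r \<le> 1)"
    let ?A = "{r. 1 < F r}"
    have A: "?A \<in> sets borel" by measurable
    have "(\<integral>\<^sup>+r. indicator ?A r \<partial>M) < (\<integral>\<^sup>+r. F r * indicator ?A r \<partial>M)"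
    proof (rule nn_integral_less)
      show "(\<integral>\<^sup>+r. indicator ?A r \<partial>M) \<noteq> \<infinity>" using A by (simp add: sets)
      show "AE r in M. indicator ?A r \<le> F r * indicator ?A r" by (intro AE_I2) (auto simp: indicator_def)
      show "\<not> (AE r in M. F r * indicator ?A r \<le> indicator ?A r)"
      proof
        assume "AE r in M. F r * indicator ?A r \<le> indicator ?A r"
        then have "AE r in M. F r \<le> 1" by (rule AE_mp) (intro AE_I2, auto simp: indicator_def split: if_splits)
        then show False using * by simp
      qed
    qed (use F A in \<open>auto simp: sets\<close>)
    then have "emeasure M ?A < emeasure N ?A" using A by (simp add: em sets)
    then show False using le[OF A] by simp
  qed
  define k where "k r = enn2real (min 1 (F r))" for r
  have k: "ennreal (k r) = min 1 (F r)" for r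
    unfolding k_def by (intro ennreal_enn2real) (auto simp: min_less_iff_disj)
  have "N = density M (\<lambda>r. ennreal (k r))"
    unfolding F(2)[symmetric]
    by (rule density_cong) (use F le1 in \<open>auto simp: k sets measurable_cong_sets[OF sets(1) refl] min_def\<close>)
  moreover have "0 \<le> k r \<and> k r \<le> 1" for r
    using enn2real_mono[of "min 1 (F r)" 1] by (auto simp: k_def)
  moreover have "k \<in> borel_measurable borel" unfolding k_def by measurable
  ultimately show ?thesis by blast
qed

subsection \<open>The quantile function\<close>

text \<open>The measure is concentrated on \<open>[0, h]\<close> and dominates Lebesgue measure there. Its distribution function \<open>\<sigma>\<close> is then strictly
  increasing with slope at least 1, which makes the inverse \<open>\<phi>\<close> a 1-Lipschitz function.\<close>
locale quantile =
  fixes lam :: "real measure" and h :: real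
  assumes h: "h > 0" and sets_lam [simp, measurable_cong]: "sets lam = sets borel" and fin: "finite_measure lam"
    and outside: "emeasure lam (- {0..h}) = 0"
    and ge_lborel: "\<And>A. A \<in> sets borel \<Longrightarrow> emeasure lborel (A \<inter> {0..h}) \<le> emeasure lam A"
begin

sublocale finite_measure lam by (rule fin)

lemma space_lam [simp]: "space lam = UNIV"
  using sets_eq_imp_space_eq[OF sets_lam] by simp

definition S where "S = measure lam UNIV"
definition \<sigma> where "\<sigma> r = measure lam {..r}"
definition \<sigma>m where "\<sigma>m r = measure lam {..<r}"

text \<open>The quantile function. The minimum with the total mass keeps the set nonempty for every real \<open>s\<close>.\<close>
definition \<phi> where "\<phi> s = Inf {r\<in>{0..h}. min S s \<le> \<sigma> r}"

lemma measure_mono': "A \<subseteq> B \<Longrightarrow> A \<in> sets borel \<Longrightarrow> B \<in> sets borel \<Longrightarrow> measure lam A \<le> measure lam B"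
  by (intro finite_measure_mono) auto

lemma outside': "A \<in> sets borel \<Longrightarrow> A \<inter> {0..h} = {} \<Longrightarrow> measure lam A = 0"
proof -
  assume A: "A \<in> sets borel" "A \<inter> {0..h} = {}"
  have "measure lam A \<le> measure lam (- {0..h})" using A by (intro measure_mono') auto
  then show ?thesis using outside by (simp add: measure_def measure_nonneg antisym)
qed

lemma \<sigma>_mono: "a \<le> b \<Longrightarrow> \<sigma> a \<le> \<sigma> b" and \<sigma>m_le: "\<sigma>m r \<le> \<sigma> r" and \<sigma>_le_\<sigma>m: "a < b \<Longrightarrow> \<sigma> a \<le> \<sigma>m b"
  unfolding \<sigma>_def \<sigma>m_def by (intro measure_mono'; auto)+

lemma \<sigma>_nonneg: "0 \<le> \<sigma> r" and \<sigma>m_nonneg: "0 \<le> \<sigma>m r" and \<sigma>_le_S: "\<sigma> r \<le> S"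
  unfolding \<sigma>_def \<sigma>m_def S_def by (auto intro: measure_mono')

lemma \<sigma>_h: "h \<le> r \<Longrightarrow> \<sigma> r = S"
proof -
  assume "h \<le> r"
  have "measure lam UNIV = measure lam {..r} + measure lam {r<..}"
    by (subst finite_measure_Union[symmetric]) (auto intro!: arg_cong[where f = "measure lam"])
  moreover have "measure lam {r<..} = 0" using \<open>h \<le> r\<close> by (intro outside') auto
  ultimately show ?thesis by (simp add: S_def \<sigma>_def)
qed

lemma \<sigma>m_0: "r \<le> 0 \<Longrightarrow> \<sigma>m r = 0"
  unfolding \<sigma>m_def by (intro outside') auto

lemma \<sigma>_atom: "\<sigma> r = \<sigma>m r + measure lam {r}"
proof -
  have "measure lam ({..<r} \<union> {r}) = measure lam {..<r} + measure lam {r}"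
    by (intro finite_measure_Union) auto
  moreover have "{..<r} \<union> {r} = {..r}" by auto
  ultimately show ?thesis by (simp add: \<sigma>_def \<sigma>m_def)
qed

lemma \<sigma>_gap: assumes "0 \<le> a" "a < b" "b \<le> h" shows "b - a \<le> \<sigma>m b - \<sigma> a"
proof -
  have "\<sigma>m b = \<sigma> a + measure lam {a<..<b}"
  proof -
    have "measure lam ({..a} \<union> {a<..<b}) = measure lam {..a} + measure lam {a<..<b}"
      by (intro finite_measure_Union) auto
    moreover have "{..a} \<union> {a<..<b} = {..<b}" using assms by auto
    ultimately show ?thesis by (simp add: \<sigma>_def \<sigma>m_def)
  qed
  moreover have "b - a \<le> measure lam {a<..<b}"
  proof -
    have "ennreal (b - a) = emeasure lborel ({a<..<b} \<inter> {0..h})"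
      using assms by (subst Int_absorb2) auto
    also have "\<dots> \<le> emeasure lam {a<..<b}" by (intro ge_lborel) auto
    finally show ?thesis by (simp add: emeasure_eq_measure ennreal_le_iff)
  qed
  ultimately show ?thesis by simp
qed

lemma S_ge_h: "h \<le> S"
  using \<sigma>_gap[of 0 h] \<sigma>_nonneg[of 0] \<sigma>m_le[of h] \<sigma>_h[of h] h by simp

lemma \<sigma>_right: "(\<lambda>n. \<sigma> (r + 1 / real (Suc n))) \<longlonglongrightarrow> \<sigma> r"
proof -
  have lim: "(\<lambda>n. r + 1 / real (Suc n)) \<longlonglongrightarrow> r"
    using tendsto_add[OF tendsto_const[of r] LIMSEQ_inverse_real_of_nat] by (simp add: inverse_eq_divide)
  have "(\<lambda>n. measure lam {..r + 1 / real (Suc n)}) \<longlonglongrightarrow> measure lam (\<Inter>n. {..r + 1 / real (Suc n)})"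
  proof (rule finite_Lim_measure_decseq)
    have "1 / real (Suc n) \<le> 1 / real (Suc m)" if "m \<le> n" for m n using that by (intro frac_le) auto
    then show "decseq (\<lambda>n. {..r + 1 / real (Suc n)})"
      unfolding decseq_def atMost_subset_iff by (metis add_left_mono)
  qed auto
  moreover have "(\<Inter>n. {..r + 1 / real (Suc n)}) = {..r}"
  proof (intro set_eqI iffI)
    fix x assume "x \<in> (\<Inter>n. {..r + 1 / real (Suc n)})"
    then show "x \<in> {..r}" using LIMSEQ_le_const[OF lim, of x] by auto
  next
    fix x assume "x \<in> {..r}"
    then show "x \<in> (\<Inter>n. {..r + 1 / real (Suc n)})" by (auto intro: add_increasing2)
  qed
  ultimately show ?thesis by (simp add: \<sigma>_def)
qed

lemma \<sigma>m_left: "(\<lambda>n. \<sigma> (r - 1 / real (Suc n))) \<longlonglongrightarrow> \<sigma>m r"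
proof -
  have lim: "(\<lambda>n. r - 1 / real (Suc n)) \<longlonglongrightarrow> r"
    using tendsto_diff[OF tendsto_const[of r] LIMSEQ_inverse_real_of_nat] by (simp add: inverse_eq_divide)
  have "(\<lambda>n. measure lam {..r - 1 / real (Suc n)}) \<longlonglongrightarrow> measure lam (\<Union>n. {..r - 1 / real (Suc n)})"
  proof (rule finite_Lim_measure_incseq)
    have "1 / real (Suc n) \<le> 1 / real (Suc m)" if "m \<le> n" for m n using that by (intro frac_le) auto
    then show "incseq (\<lambda>n. {..r - 1 / real (Suc n)})"
      unfolding incseq_def atMost_subset_iff by (metis diff_left_mono)
  qed auto
  moreover have "(\<Union>n. {..r - 1 / real (Suc n)}) = {..<r}"
  proof (intro set_eqI iffI)
    fix x assume "x \<in> {..<r}"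
    then have "\<forall>\<^sub>F n in sequentially. x < r - 1 / real (Suc n)" using order_tendstoD(1)[OF lim, of x] by simp
    then obtain n where "x < r - 1 / real (Suc n)" by (auto dest: eventually_happens)
    then show "x \<in> (\<Union>n. {..r - 1 / real (Suc n)})" by (auto intro: less_imp_le)
  next
    fix x assume "x \<in> (\<Union>n. {..r - 1 / real (Suc n)})"
    then obtain n where "x \<le> r - 1 / real (Suc n)" by auto
    moreover have "0 < 1 / real (Suc n)" by simp
    ultimately show "x \<in> {..<r}" unfolding lessThan_iff by linarith
  qed
  ultimately show ?thesis by (simp add: \<sigma>_def \<sigma>m_def)
qed

lemma \<phi>_range: "\<phi> s \<in> {0..h}"
  and \<phi>_le_iff: "s \<in> {0..S} \<Longrightarrow> r \<in> {0..h} \<Longrightarrow> \<phi> s \<le> r \<longleftrightarrow> s \<le> \<sigma> r"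
proof -
  let ?A = "\<lambda>s. {r\<in>{0..h}. min S s \<le> \<sigma> r}"
  have h_in: "h \<in> ?A s" for s using h \<sigma>_h[of h] by auto
  have bdd: "bdd_below (?A s)" for s by (intro bdd_belowI[of _ 0]) auto
  have low: "\<phi> s \<le> r" if "r \<in> ?A s" for r s unfolding \<phi>_def by (rule cInf_lower[OF that bdd])
  have "0 \<le> \<phi> s" for s unfolding \<phi>_def using h_in by (intro cInf_greatest) auto
  then show range: "\<phi> s \<in> {0..h}" for s using low[OF h_in, of s] by auto
  have attained: "min S s \<le> \<sigma> (\<phi> s)" for s
  proof -
    have "min S s \<le> \<sigma> (\<phi> s + 1 / real (Suc n))" for n
    proof -
      have "\<phi> s < \<phi> s + 1 / real (Suc n)" by simp
      then obtain r where "r \<in> ?A s" "r < \<phi> s + 1 / real (Suc n)"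
        using cInf_lessD[of "?A s" "\<phi> s + 1 / real (Suc n)"] h_in unfolding \<phi>_def by blast
      then show ?thesis using \<sigma>_mono[of r "\<phi> s + 1 / real (Suc n)"] by auto
    qed
    then show ?thesis by (intro LIMSEQ_le_const[OF \<sigma>_right]) auto
  qed
  show "\<phi> s \<le> r \<longleftrightarrow> s \<le> \<sigma> r" if "s \<in> {0..S}" "r \<in> {0..h}"
    using low[of r s] attained[of s] \<sigma>_mono[of "\<phi> s" r] that by auto
qed

lemma \<phi>_ge_iff: assumes s: "s \<in> {0..S}" and r: "r \<in> {0..h}" shows "r \<le> \<phi> s \<longleftrightarrow> \<sigma>m r \<le> s"
proof
  assume "\<sigma>m r \<le> s"
  show "r \<le> \<phi> s"
  proof (rule ccontr)
    assume "\<not> r \<le> \<phi> s"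
    then have "r - \<phi> s \<le> \<sigma>m r - \<sigma> (\<phi> s)" "0 < r - \<phi> s" using \<phi>_range[of s] r by (auto intro!: \<sigma>_gap)
    moreover have "s \<le> \<sigma> (\<phi> s)" using \<phi>_le_iff[OF s \<phi>_range] by auto
    ultimately show False using \<open>\<sigma>m r \<le> s\<close> by linarith
  qed
next
  assume "r \<le> \<phi> s"
  show "\<sigma>m r \<le> s"
  proof (cases "r = 0")
    case False
    have "\<forall>\<^sub>F n in sequentially. \<sigma> (r - 1 / real (Suc n)) \<le> s"
    proof -
      have "(\<lambda>n. r - 1 / real (Suc n)) \<longlonglongrightarrow> r"
        using tendsto_diff[OF tendsto_const[of r] LIMSEQ_inverse_real_of_nat] by (simp add: inverse_eq_divide)
      then have "\<forall>\<^sub>F n in sequentially. 0 < r - 1 / real (Suc n)" using r False by (intro order_tendstoD) auto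
      then show ?thesis
      proof (rule eventually_mono)
        fix n assume n: "0 < r - 1 / real (Suc n)"
        have pos: "0 < 1 / real (Suc n)" by simp
        have "r - 1 / real (Suc n) < \<phi> s" using pos \<open>r \<le> \<phi> s\<close> by linarith
        moreover have "r - 1 / real (Suc n) \<in> {0..h}" using n pos r unfolding atLeastAtMost_iff by linarith
        ultimately show "\<sigma> (r - 1 / real (Suc n)) \<le> s" using \<phi>_le_iff[OF s, of "r - 1 / real (Suc n)"] by auto
      qed
    qed
    then show ?thesis by (rule tendsto_upperbound[OF \<sigma>m_left]) simp
  qed (use s \<sigma>m_0 in auto)
qed

lemma \<phi>_eq_iff: "s \<in> {0..S} \<Longrightarrow> r \<in> {0..h} \<Longrightarrow> \<phi> s = r \<longleftrightarrow> s \<in> {\<sigma>m r..\<sigma> r}"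
  using \<phi>_le_iff[of s r] \<phi>_ge_iff[of s r] by auto

lemma \<phi>_0: "\<phi> 0 = 0" and \<phi>_S: "\<phi> S = h"
proof -
  have S: "0 \<le> S" using S_ge_h h by simp
  show "\<phi> 0 = 0" using \<phi>_eq_iff[of 0 0] S h \<sigma>m_0[of 0] \<sigma>_nonneg[of 0] by auto
  show "\<phi> S = h" using \<phi>_eq_iff[of S h] S h \<sigma>_h[of h] \<sigma>m_le[of h] by auto
qed

lemma \<phi>_Lipschitz: assumes "0 \<le> a" "a \<le> b" "b \<le> S" shows "0 \<le> \<phi> b - \<phi> a \<and> \<phi> b - \<phi> a \<le> b - a"
proof -
  have ab: "a \<in> {0..S}" "b \<in> {0..S}" using assms by auto
  have 1: "a \<le> \<sigma> (\<phi> a)" "b \<le> \<sigma> (\<phi> b)" "\<sigma>m (\<phi> b) \<le> b"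
    using \<phi>_le_iff[OF ab(1) \<phi>_range, of a] \<phi>_le_iff[OF ab(2) \<phi>_range, of b] \<phi>_ge_iff[OF ab(2) \<phi>_range, of b] by auto
  have "\<phi> a \<le> \<phi> b" using \<phi>_le_iff[OF ab(1) \<phi>_range, of b] 1 assms by simp
  moreover have "\<phi> b - \<phi> a \<le> b - a"
  proof (cases "\<phi> a = \<phi> b")
    case False
    then have "\<phi> b - \<phi> a \<le> \<sigma>m (\<phi> b) - \<sigma> (\<phi> a)"
      using \<open>\<phi> a \<le> \<phi> b\<close> \<phi>_range[of a] \<phi>_range[of b] by (intro \<sigma>_gap) auto
    then show ?thesis using 1 by linarith
  qed (use assms in auto)
  ultimately show ?thesis by simp
qed

lemma \<phi>_mono: "mono \<phi>"
proof (rule monoI)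
  fix a b :: real assume "a \<le> b"
  have h_in: "{r\<in>{0..h}. min S s \<le> \<sigma> r} \<noteq> {}" for s using h \<sigma>_h[of h] by auto
  show "\<phi> a \<le> \<phi> b" unfolding \<phi>_def
    by (rule cInf_superset_mono[OF h_in]) (use \<open>a \<le> b\<close> in \<open>auto intro!: bdd_belowI[of _ 0]\<close>)
qed

lemma \<phi>_measurable [measurable]: "\<phi> \<in> borel_measurable borel"
  by (rule borel_measurable_mono[OF \<phi>_mono])

text \<open>Both measures give the mass \<open>S - \<sigma> a\<close> to the half line beyond \<open>a\<close>, since \<open>\<phi> s > a\<close> means \<open>s > \<sigma> a\<close>.\<close>
lemma distr_\<phi>: "distr (density lborel (\<lambda>s. ennreal (indicator {0..S} s))) borel \<phi> = lam" (is "?M = lam")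
proof (rule measure_eqI_lessThan)
  have S0: "0 \<le> S" using S_ge_h h by simp
  have m: "emeasure ?M {a<..} = emeasure lborel {s\<in>{0..S}. a < \<phi> s}" for a
  proof -
    have "emeasure ?M {a<..} = emeasure (density lborel (\<lambda>s. ennreal (indicator {0..S} s))) {s. a < \<phi> s}"
      by (subst emeasure_distr) (auto simp: vimage_def)
    also have "\<dots> = (\<integral>\<^sup>+s. ennreal (indicator {0..S} s) * indicator {s. a < \<phi> s} s \<partial>lborel)"
      by (intro emeasure_density) measurable
    also have "\<dots> = (\<integral>\<^sup>+s. indicator {s\<in>{0..S}. a < \<phi> s} s \<partial>lborel)"
      by (intro nn_integral_cong) (auto simp: indicator_def)
    finally show ?thesis by simp
  qed
  have split: "measure lam {a<..} = S - \<sigma> a" for a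
  proof -
    have "measure lam UNIV = measure lam {..a} + measure lam {a<..}"
      by (subst finite_measure_Union[symmetric]) (auto intro!: arg_cong[where f = "measure lam"])
    then show ?thesis by (simp add: S_def \<sigma>_def)
  qed
  show "emeasure ?M {a<..} < \<infinity>" for a
  proof -
    have "emeasure ?M {a<..} \<le> emeasure lborel {0..S}" unfolding m by (intro emeasure_mono) auto
    also have "\<dots> < \<infinity>" by (rule emeasure_compact_finite) simp
    finally show ?thesis .
  qed
  show "emeasure ?M {a<..} = emeasure lam {a<..}" for a
  proof -
    consider "a < 0" | "a \<in> {0..h}" | "a > h" by force
    then show ?thesis
    proof cases
      case 1
      have "a < \<phi> s" for s using \<phi>_range[of s] 1 by simp
      then have "{s\<in>{0..S}. a < \<phi> s} = {0..S}" by auto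
      moreover have "\<sigma> a = 0" unfolding \<sigma>_def using 1 by (intro outside') auto
      ultimately show ?thesis using S0 by (simp add: m emeasure_eq_measure split)
    next
      case 2
      have "{s\<in>{0..S}. a < \<phi> s} = {\<sigma> a<..S}"
        using \<phi>_le_iff[OF _ 2] \<sigma>_nonneg[of a] by (auto simp: not_le[symmetric])
      then show ?thesis using \<sigma>_le_S[of a] by (simp add: m emeasure_eq_measure split)
    next
      case 3
      have "\<not> a < \<phi> s" for s using \<phi>_range[of s] 3 by simp
      then have e: "{s\<in>{0..S}. a < \<phi> s} = {}" by auto
      have "\<sigma> a = S" using 3 by (intro \<sigma>_h) auto
      then show ?thesis unfolding m e by (simp add: emeasure_eq_measure split)
    qed
  qed
qed simp_all

lemma integral_\<phi>:
  fixes F :: "real \<Rightarrow> 'e::{banach, second_countable_topology}"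
  assumes [measurable]: "F \<in> borel_measurable borel" "A \<in> sets borel"
  shows "(LBINT s:{s\<in>{0..S}. \<phi> s \<in> A}. F (\<phi> s)) = (LINT r:A|lam. F r)"
proof -
  let ?D = "density lborel (\<lambda>s. ennreal (indicator {0..S} s))"
  have "(LINT r:A|lam. F r) = (\<integral>s. indicator A (\<phi> s) *\<^sub>R F (\<phi> s) \<partial>?D)"
    unfolding set_lebesgue_integral_def by (subst distr_\<phi>[symmetric], rule integral_distr) simp_all
  also have "\<dots> = (\<integral>s. indicator {0..S} s *\<^sub>R (indicator A (\<phi> s) *\<^sub>R F (\<phi> s)) \<partial>lborel)"
    by (rule integral_density) simp_all
  also have "\<dots> = (LBINT s:{s\<in>{0..S}. \<phi> s \<in> A}. F (\<phi> s))"
    unfolding set_lebesgue_integral_def by (intro Bochner_Integration.integral_cong) (auto simp: indicator_def)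
  finally show ?thesis by simp
qed

definition R where "R = {r. measure lam {r} \<noteq> 0}"

lemma countable_R: "countable R"
  unfolding R_def by (rule countable_support)

lemma R_subset: "R \<subseteq> {0..h}"
proof
  fix r assume r: "r \<in> R"
  show "r \<in> {0..h}"
  proof (rule ccontr)
    assume "r \<notin> {0..h}"
    then have "measure lam {r} = 0" by (intro outside') auto
    then show False using r by (simp add: R_def)
  qed
qed

lemma R_borel [measurable]: "R \<in> sets borel"
  by (rule sets.countable[OF _ countable_R]) simp

lemma fibre: "r \<in> {0..h} \<Longrightarrow> {s\<in>{0..S}. \<phi> s = r} = {\<sigma>m r..\<sigma> r}"
proof (rule set_eqI)
  fix s assume "r \<in> {0..h}"
  then show "s \<in> {s\<in>{0..S}. \<phi> s = r} \<longleftrightarrow> s \<in> {\<sigma>m r..\<sigma> r}"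
    using \<phi>_eq_iff[of s r] \<sigma>m_nonneg[of r] \<sigma>_le_S[of r] by auto
qed

lemma sublevel: "r \<in> {0..h} \<Longrightarrow> {s\<in>{0..S}. \<phi> s \<le> r} = {0..\<sigma> r}"
proof (rule set_eqI)
  fix s assume "r \<in> {0..h}"
  then show "s \<in> {s\<in>{0..S}. \<phi> s \<le> r} \<longleftrightarrow> s \<in> {0..\<sigma> r}"
    using \<phi>_le_iff[of s r] \<sigma>_le_S[of r] by auto
qed

text \<open>The parameters spent at atoms form countably many disjoint intervals \<open>[\<sigma>m r, \<sigma> r]\<close>; for the other \<open>r\<close> these intervals are points.\<close>
lemma jump_sum:
  fixes H :: "real \<Rightarrow> 'e::{banach, second_countable_topology}"
  assumes H: "set_integrable lborel {0..S} H" and A: "A \<subseteq> {0..h}" "A \<in> sets borel"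
  shows "((\<lambda>r. LBINT s:{\<sigma>m r..\<sigma> r}. H s) has_sum (LBINT s:{s\<in>{0..S}. \<phi> s \<in> R \<inter> A}. H s)) A"
proof -
  have c: "countable (R \<inter> A)" using countable_R by (rule countable_subset[rotated]) auto
  define B where "B n = (if n \<in> to_nat_on (R \<inter> A) ` (R \<inter> A) then {s\<in>{0..S}. \<phi> s = from_nat_into (R \<inter> A) n} else {})" for n
  have "{s\<in>{0..S}. \<phi> s = r} \<in> sets borel" for r by measurable
  then have Bm: "B n \<in> sets borel" for n by (simp add: B_def)
  have Bto: "B (to_nat_on (R \<inter> A) r) = {s\<in>{0..S}. \<phi> s = r}" if "r \<in> R \<inter> A" for r
    using that c by (simp add: B_def)
  have disj: "disjoint_family B"
    unfolding disjoint_family_on_def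
  proof (intro ballI impI)
    fix m n :: nat assume "m \<noteq> n"
    then show "B m \<inter> B n = {}" using c by (auto simp: B_def)
  qed
  have UB: "(\<Union>n. B n) = {s\<in>{0..S}. \<phi> s \<in> R \<inter> A}"
  proof (intro set_eqI iffI)
    fix s assume "s \<in> {s\<in>{0..S}. \<phi> s \<in> R \<inter> A}"
    then have "s \<in> B (to_nat_on (R \<inter> A) (\<phi> s))" using Bto[of "\<phi> s"] by auto
    then show "s \<in> (\<Union>n. B n)" by blast
  qed (use c in \<open>auto simp: B_def split: if_splits\<close>)
  have "(\<Union>n. B n) \<in> sets lborel" using Bm by (intro sets.countable_UN) auto
  then have iU: "set_integrable lborel (\<Union>n. B n) H"
    by (rule set_integrable_subset[OF H]) (use UB in auto)
  have "(\<lambda>n. LBINT s:B n. H s) sums (LBINT s:(\<Union>n. B n). H s)"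
    by (rule set_integral_sums[OF _ disj iU]) (use Bm in simp)
  moreover have "summable (\<lambda>n. norm (LBINT s:B n. H s))"
  proof (rule summable_comparison_test')
    have "(\<lambda>n. LBINT s:B n. norm (H s)) sums (LBINT s:(\<Union>n. B n). norm (H s))"
      by (rule set_integral_sums[OF _ disj]) (use Bm iU in \<open>auto simp: set_integrable_def dest: integrable_norm\<close>)
    then show "summable (\<lambda>n. LBINT s:B n. norm (H s))" by (rule sums_summable)
    show "norm (norm (LBINT s:B n. H s)) \<le> (LBINT s:B n. norm (H s))" if "n \<ge> 0" for n
    proof -
      have "norm (LBINT s:B n. H s) \<le> (\<integral>s. norm (indicat_real (B n) s *\<^sub>R H s) \<partial>lborel)"
        unfolding set_lebesgue_integral_def by (rule integral_norm_bound)
      then show ?thesis by (simp add: set_lebesgue_integral_def)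
    qed
  qed
  ultimately have "((\<lambda>n. LBINT s:B n. H s) has_sum (LBINT s:(\<Union>n. B n). H s)) UNIV"
    by (rule norm_summable_imp_has_sum[rotated])
  then have "((\<lambda>n. LBINT s:B n. H s) has_sum (LBINT s:(\<Union>n. B n). H s)) (to_nat_on (R \<inter> A) ` (R \<inter> A))"
    by (rule has_sum_cong_neutral[THEN iffD1, rotated -1]) (auto simp: B_def set_lebesgue_integral_def)
  then have "((\<lambda>r. LBINT s:B (to_nat_on (R \<inter> A) r). H s) has_sum (LBINT s:(\<Union>n. B n). H s)) (R \<inter> A)"
    by (simp add: has_sum_reindex[OF inj_on_to_nat_on[OF c]] o_def)
  then have sumR: "((\<lambda>r. LBINT s:B (to_nat_on (R \<inter> A) r). H s) has_sum (LBINT s:{s\<in>{0..S}. \<phi> s \<in> R \<inter> A}. H s)) (R \<inter> A)"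
    by (simp only: UB)
  show ?thesis
  proof (rule has_sum_cong_neutral[THEN iffD1, OF _ _ _ sumR])
    fix r assume "r \<in> A - R \<inter> A"
    then have "\<sigma> r = \<sigma>m r" using \<sigma>_atom[of r] by (auto simp: R_def)
    then show "(LBINT s:{\<sigma>m r..\<sigma> r}. H s) = 0" by simp
  next
    fix r assume "r \<in> R \<inter> A \<inter> A"
    then show "(LBINT s:B (to_nat_on (R \<inter> A) r). H s) = (LBINT s:{\<sigma>m r..\<sigma> r}. H s)"
      using Bto[of r] fibre[of r] A(1) by auto
  qed auto
qed

end

section \<open>The completion of an impulse process\<close>

subsection \<open>The atomless component of a vector measure\<close>

lemma countable_vector_atoms:
  fixes \<mu> :: "real set \<Rightarrow> real ^ 'm"
  assumes \<mu>: "\<mu> \<in> vector_measures T"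
  shows "countable {t\<in>{0..T}. \<mu> {t} \<noteq> 0}"
proof (rule countable_subset)
  let ?P = "\<lambda>j. jordan_pos T (\<lambda>A. \<mu> A $ j)" and ?N = "\<lambda>j. jordan_neg T (\<lambda>A. \<mu> A $ j)"
  show "countable (\<Union>j. {t. measure (?P j) {t} \<noteq> 0} \<union> {t. measure (?N j) {t} \<noteq> 0})"
    using finite_measure.countable_support[OF finite_measure_jordan_pos[OF vector_measures_nth[OF \<mu>]]]
      finite_measure.countable_support[OF finite_measure_jordan_neg[OF vector_measures_nth[OF \<mu>]]]
    by auto
  show "{t\<in>{0..T}. \<mu> {t} \<noteq> 0} \<subseteq> (\<Union>j. {t. measure (?P j) {t} \<noteq> 0} \<union> {t. measure (?N j) {t} \<noteq> 0})"
  proof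
    fix t assume t: "t \<in> {t\<in>{0..T}. \<mu> {t} \<noteq> 0}"
    then obtain j where j: "\<mu> {t} $ j \<noteq> 0" by (auto simp: vec_eq_iff)
    have "{t} \<in> sets (borel_upto T)" using t by (simp add: sets_borel_upto)
    then have "measure (?P j) {t} \<noteq> 0 \<or> measure (?N j) {t} \<noteq> 0"
      using jordan_decomposition[OF vector_measures_nth[OF \<mu>], of "{t}" j] j by auto
    then show "t \<in> (\<Union>j. {t. measure (?P j) {t} \<noteq> 0} \<union> {t. measure (?N j) {t} \<noteq> 0})" by blast
  qed
qed

lemma vector_continuous_part_Diff:
  assumes "A \<in> sets (borel_upto T)"
  shows "vector_continuous_part \<mu> A = \<mu> (A - {t\<in>{0..T}. \<mu> {t} \<noteq> 0})"
proof -
  have "A - {t. \<mu> {t} \<noteq> 0} = A - {t\<in>{0..T}. \<mu> {t} \<noteq> 0}" using sets_borel_upto_subset[OF assms] by auto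
  then show ?thesis by (simp add: vector_continuous_part_def)
qed

lemma vector_continuous_part_measure:
  fixes \<mu> :: "real set \<Rightarrow> real ^ 'm"
  assumes \<mu>: "\<mu> \<in> vector_measures T"
  shows "vector_continuous_part \<mu> \<in> vector_measures T"
  unfolding vector_measures_def
proof (intro CollectI allI impI)
  fix A :: "nat \<Rightarrow> real set" assume A: "range A \<subseteq> sets (borel_upto T)" "disjoint_family A"
  let ?Z = "{t\<in>{0..T}. \<mu> {t} \<noteq> 0}"
  have Z: "?Z \<in> sets (borel_upto T)"
    by (rule sets.countable[OF _ countable_vector_atoms[OF \<mu>]]) (auto simp: sets_borel_upto)
  have "(\<lambda>i. \<mu> (A i - ?Z)) sums \<mu> (\<Union>i. A i - ?Z)"
    using A Z by (intro vector_measures_sums[OF \<mu>]) (auto simp: disjoint_family_on_def)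
  moreover have "(\<Union>i. A i - ?Z) = (\<Union>i. A i) - ?Z" by auto
  moreover have "A i \<in> sets (borel_upto T)" "(\<Union>i. A i) \<in> sets (borel_upto T)" for i using A(1) by auto
  ultimately show "(\<lambda>i. vector_continuous_part \<mu> (A i)) sums vector_continuous_part \<mu> (\<Union>i. A i)"
    by (simp add: vector_continuous_part_Diff[where T = T])
qed

lemma sets_continuous_part [simp, measurable_cong]: "sets (continuous_part \<nu>) = sets \<nu>"
  by (simp add: continuous_part_def)

lemma continuous_part_facts:
  assumes \<nu>: "sets \<nu> = sets (borel_upto T)" "finite_measure \<nu>" and A: "A \<in> sets (borel_upto T)"
  shows "emeasure (continuous_part \<nu>) A \<le> emeasure \<nu> A"
    and "countable A \<Longrightarrow> emeasure (continuous_part \<nu>) A = 0"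
    and "(\<And>t. t \<in> A \<Longrightarrow> emeasure \<nu> {t} = 0) \<Longrightarrow> emeasure (continuous_part \<nu>) A = emeasure \<nu> A"
proof -
  interpret finite_measure \<nu> by fact
  let ?C = "{t. emeasure \<nu> {t} = 0}"
  have "countable ({0..T} - ?C)"
    by (rule countable_subset[OF _ countable_support]) (auto simp: emeasure_eq_measure)
  then have "{0..T} - ({0..T} - ?C) \<in> sets (borel_upto T)"
    by (intro sets.Diff sets.countable[of "{0..T} - ?C"]) (auto simp: sets_borel_upto)
  moreover have "{0..T} - ({0..T} - ?C) = ?C \<inter> space \<nu>" using sets_eq_imp_space_eq[OF \<nu>(1)] by auto
  ultimately have C: "?C \<inter> space \<nu> \<in> sets \<nu>" by (simp add: \<nu>)
  have ind: "indicator ?C \<in> borel_measurable \<nu>"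
    by (rule measurable_cong[THEN iffD1, OF _ borel_measurable_indicator[OF C]]) (auto simp: indicator_def)
  have em: "emeasure (continuous_part \<nu>) B = (\<integral>\<^sup>+t. indicator ?C t * indicator B t \<partial>\<nu>)" if "B \<in> sets (borel_upto T)" for B
    unfolding continuous_part_def using that ind by (intro emeasure_density) (auto simp: \<nu>)
  have A': "A \<in> sets \<nu>" using A by (simp add: \<nu>)
  show "emeasure (continuous_part \<nu>) A \<le> emeasure \<nu> A"
  proof -
    have "emeasure (continuous_part \<nu>) A \<le> (\<integral>\<^sup>+t. indicator A t \<partial>\<nu>)"
      unfolding em[OF A] by (intro nn_integral_mono) (auto simp: indicator_def)
    then show ?thesis using A' by simp
  qed
  show "emeasure (continuous_part \<nu>) A = emeasure \<nu> A" if "\<And>t. t \<in> A \<Longrightarrow> emeasure \<nu> {t} = 0"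
  proof -
    have "emeasure (continuous_part \<nu>) A = (\<integral>\<^sup>+t. indicator A t \<partial>\<nu>)"
      unfolding em[OF A] using that by (intro nn_integral_cong) (auto simp: indicator_def)
    then show ?thesis using A' by simp
  qed
  show "emeasure (continuous_part \<nu>) A = 0" if "countable A"
  proof -
    have s: "{t} \<in> sets (borel_upto T)" if "t \<in> A" for t using that sets_borel_upto_subset[OF A] by (auto simp: sets_borel_upto)
    have "emeasure (continuous_part \<nu>) {t} = 0" if "t \<in> A" for t
    proof (cases "emeasure \<nu> {t} = 0")
      case True
      have "emeasure (continuous_part \<nu>) {t} \<le> (\<integral>\<^sup>+r. indicator {t} r \<partial>\<nu>)"
        unfolding em[OF s[OF that]] by (intro nn_integral_mono) (auto simp: indicator_def)
      also have "\<dots> = 0" using True s[OF that] by (simp add: \<nu>)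
      finally show ?thesis by simp
    next
      case False
      have "emeasure (continuous_part \<nu>) {t} = (\<integral>\<^sup>+r. 0 \<partial>\<nu>)"
        unfolding em[OF s[OF that]] using False by (intro nn_integral_cong) (auto simp: indicator_def)
      then show ?thesis by simp
    qed
    then have "{t} \<in> null_sets (continuous_part \<nu>)" if "t \<in> A" for t using that s by (simp add: null_sets_def \<nu>)
    then have "(\<Union>t\<in>A. {t}) \<in> null_sets (continuous_part \<nu>)" using \<open>countable A\<close> by (intro null_sets_UN') auto
    then show ?thesis by auto
  qed
qed

subsection \<open>Impulse processes\<close>

text \<open>The data of an impulse process, with the auxiliary arcs made explicit.\<close>
locale impulse =
  fixes N M :: nat and h T :: real
    and K :: "(real ^ 'm::finite) set"
    and lag :: "'k::finite \<Rightarrow> nat"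
    and f :: "real \<times> ((real ^ 'n::finite) ^ 'k) \<Rightarrow> real ^ 'n"
    and g :: "'m \<Rightarrow> real \<times> ((real ^ 'n) ^ 'k) \<Rightarrow> real ^ 'n"
    and x0 :: "real ^ 'n" and \<xi>0 :: "real \<Rightarrow> real ^ 'n"
    and \<mu> :: "real set \<Rightarrow> real ^ 'm" and \<nu> :: "real measure"
    and \<omega> :: "real \<Rightarrow> nat \<Rightarrow> real \<Rightarrow> real ^ 'm"
    and x :: "real \<Rightarrow> real ^ 'n" and v :: "real \<Rightarrow> real"
    and \<zeta> :: "real \<Rightarrow> int \<Rightarrow> real \<Rightarrow> real ^ 'n" and \<theta> :: "real \<Rightarrow> int \<Rightarrow> real \<Rightarrow> real"
  assumes N: "N \<ge> 1" and h_pos: "h > 0" and T: "T = real N * h"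
    and K_closed: "closed K" and K_cone: "cone K" and lag: "\<And>k. lag k \<le> M"
    and f: "bounded (range f)" "C1_map f" and g: "\<And>j. bounded (range (g j))" "\<And>j. C1_map (g j)"
    and \<xi>0: "continuous_on {- real M * h..0} \<xi>0"
    and control: "impulse_control K N h \<mu> \<nu> \<omega>"
    and BV: "bounded_variation_on (- real M * h) T x"
    and x_hist: "\<And>t. t \<in> {- real M * h..<0} \<Longrightarrow> x t = \<xi>0 t" and x_0: "x 0 = x0" and v_0: "v 0 = 0"
    and arcs: "attached_arcs N M h lag g x0 \<xi>0 \<omega> x v \<zeta> \<theta>"
    and x_node: "\<And>l. l \<in> {2..N} \<Longrightarrow> x (node h l) = \<zeta> 0 (int l) 1"
    and v_node: "\<And>l. l \<in> {2..N} \<Longrightarrow> v (node h l) = \<theta> 0 (int l) 1"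
    and x_T: "x T = \<zeta> h (int N) 1" and v_T: "v T = \<theta> h (int N) 1"
    and x_piece: "\<And>l t. l \<in> {1..N} \<Longrightarrow> t \<in> {node h l<..<real l * h} \<Longrightarrow> x t = \<zeta> 0 (int l) 1
            + (LINT t':{node h l..t}|lebesgue. f (t', delayed lag h x t'))
            + (\<Sum>j\<in>UNIV. signed_integral T (\<lambda>A. vector_continuous_part \<mu> A $ j) {node h l..t}
                           (\<lambda>t'. g j (t', delayed lag h x t')))
            + (\<Sum>\<^sub>\<infinity>r\<in>{0<..t - node h l}. \<zeta> r (int l) 1 - left_lim x (r + node h l))"
    and v_piece: "\<And>l t. l \<in> {1..N} \<Longrightarrow> t \<in> {node h l<..<real l * h} \<Longrightarrow> v t = \<theta> 0 (int l) 1
            + measure (continuous_part \<nu>) {node h l..t}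
            + (\<Sum>\<^sub>\<infinity>r\<in>{0<..t - node h l}. \<theta> r (int l) 1 - left_lim v (r + node h l))"
begin

lemmas control_conj = control[unfolded impulse_control_def Let_def T[symmetric]]
lemmas control_1 = control_conj[THEN conjunct1] and control_2 = control_conj[THEN conjunct2, THEN conjunct1]
  and control_3 = control_conj[THEN conjunct2, THEN conjunct2, THEN conjunct1]
  and control_4 = control_conj[THEN conjunct2, THEN conjunct2, THEN conjunct2, THEN conjunct1]
  and control_5 = control_conj[THEN conjunct2, THEN conjunct2, THEN conjunct2, THEN conjunct2, THEN conjunct1]
  and control_6 = control_conj[THEN conjunct2, THEN conjunct2, THEN conjunct2, THEN conjunct2, THEN conjunct2]

lemma \<mu>: "\<mu> \<in> vector_measures T" and \<mu>_K: "A \<in> sets (borel_upto T) \<Longrightarrow> \<mu> A \<in> K"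
  using control_1 by (simp_all add: vector_measures_in_def)

lemma \<nu>_sets: "sets \<nu> = sets (borel_upto T)" and \<nu>_finite: "finite_measure \<nu>"
  and \<nu>_c: "continuous_part \<nu> = total_variation T (vector_continuous_part \<mu>)"
  using control_2 by (simp_all add: V\<^sub>c_def nonneg_measures_def)

lemmas \<omega>_meas = control_3[THEN bspec, THEN bspec, THEN conjunct1]
  and \<omega>_K = control_3[THEN bspec, THEN bspec, THEN conjunct2, THEN conjunct2, THEN bspec]
  and \<omega>_const = control_4[THEN bspec]
  and \<omega>_\<nu> = control_5[THEN bspec, THEN bspec, THEN conjunct1]
  and \<omega>_\<mu> = control_5[THEN bspec, THEN bspec, THEN conjunct2]
  and \<omega>_\<nu>_node = control_6[THEN bspec, THEN conjunct1]
  and \<omega>_\<mu>_node = control_6[THEN bspec, THEN conjunct2]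

lemma zero_in_K: "0 \<in> K"
  using \<mu>_K[of "{}"] vector_measures_empty[OF \<mu>] by simp

text \<open>The total strength of the jump with upper index \<open>r\<close>. By the first condition on attached controls it also bounds their speeds.\<close>
definition \<Delta> where "\<Delta> r = (\<Sum>l=1..N. LINT s:{0..1}|lebesgue. norm1 (\<omega> r l s))"

lemma \<Delta>_nonneg: "0 \<le> \<Delta> r"
  unfolding \<Delta>_def set_lebesgue_integral_def by (intro sum_nonneg integral_nonneg_AE) auto

definition \<mu>c where "\<mu>c = vector_continuous_part \<mu>"
definition \<nu>c where "\<nu>c = continuous_part \<nu>"

lemma \<mu>c: "\<mu>c \<in> vector_measures T"
  unfolding \<mu>c_def by (rule vector_continuous_part_measure[OF \<mu>])

lemma \<mu>c_K: assumes "A \<in> sets (borel_upto T)" shows "\<mu>c A \<in> K"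
proof -
  have "{t\<in>{0..T}. \<mu> {t} \<noteq> 0} \<in> sets (borel_upto T)"
    by (rule sets.countable[OF _ countable_vector_atoms[OF \<mu>]]) (auto simp: sets_borel_upto)
  then show ?thesis using assms by (simp add: \<mu>c_def vector_continuous_part_Diff[OF assms] \<mu>_K)
qed

definition \<pi> where "\<pi> b j = (if b then jordan_pos T (\<lambda>A. \<mu>c A $ j) else jordan_neg T (\<lambda>A. \<mu>c A $ j))"

lemma \<pi>_sets [simp]: "sets (\<pi> b j) = sets (borel_upto T)" and \<pi>_finite: "finite_measure (\<pi> b j)"
  using finite_measure_jordan_pos[OF vector_measures_nth[OF \<mu>c]] finite_measure_jordan_neg[OF vector_measures_nth[OF \<mu>c]]
  by (simp_all add: \<pi>_def)

lemma \<nu>c_sets: "sets \<nu>c = sets (borel_upto T)"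
  by (simp add: \<nu>c_def \<nu>_sets)

lemma \<nu>c_eq: "A \<in> sets (borel_upto T) \<Longrightarrow> emeasure \<nu>c A = (\<Sum>j\<in>UNIV. emeasure (\<pi> True j) A + emeasure (\<pi> False j) A)"
  unfolding \<nu>c_def \<nu>_c by (simp add: emeasure_total_variation \<pi>_def \<mu>c_def)

lemma \<pi>_le_\<nu>c: assumes "A \<in> sets (borel_upto T)" shows "emeasure (\<pi> b j) A \<le> emeasure \<nu>c A"
proof -
  have "emeasure (\<pi> b j) A \<le> emeasure (\<pi> True j) A + emeasure (\<pi> False j) A"
    by (cases b) (auto intro: add_increasing add_increasing2)
  also have "\<dots> \<le> emeasure \<nu>c A"
    unfolding \<nu>c_eq[OF assms] by (rule member_le_sum) auto
  finally show ?thesis .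
qed

lemmas \<nu>c_le_\<nu> = continuous_part_facts(1)[OF \<nu>_sets \<nu>_finite, folded \<nu>c_def]
  and \<nu>c_countable = continuous_part_facts(2)[OF \<nu>_sets \<nu>_finite, folded \<nu>c_def]
  and \<nu>c_eq_\<nu> = continuous_part_facts(3)[OF \<nu>_sets \<nu>_finite, folded \<nu>c_def]

lemma \<pi>_countable: "A \<in> sets (borel_upto T) \<Longrightarrow> countable A \<Longrightarrow> emeasure (\<pi> b j) A = 0"
  using \<pi>_le_\<nu>c[of A b j] \<nu>c_countable[of A] by simp

lemma \<mu>c_\<pi>: "A \<in> sets (borel_upto T) \<Longrightarrow> \<mu>c A $ j = measure (\<pi> True j) A - measure (\<pi> False j) A"
  unfolding \<pi>_def using jordan_decomposition[OF vector_measures_nth[OF \<mu>c]] by simp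

subsection \<open>Folding the time interval\<close>

text \<open>The translate of \<open>A\<close> into the open piece \<open>](l-1)h, lh[\<close>. The nodes \<open>lh\<close> are left out, since their atoms are shared by the two adjacent pieces.\<close>
definition up where "up l A = {t\<in>{node h l<..<real l * h}. t - node h l \<in> A}"
definition fold_measure where
  "fold_measure P l = distr (density P (\<lambda>t. ennreal (indicator {node h l<..<real l * h} t))) borel (\<lambda>t. t - node h l)"

lemma node_range: assumes "l \<in> {1..N}" shows "0 \<le> node h l" "real l * h \<le> T" "real l * h = h + node h l"
  using assms h_pos by (auto simp: T algebra_simps)

lemma up_sets: assumes "l \<in> {1..N}" "A \<in> sets borel" shows "up l A \<in> sets (borel_upto T)" "up l A \<in> sets borel"
proof -
  show 1: "up l A \<in> sets borel" unfolding up_def using assms(2) by measurable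
  have "up l A \<subseteq> {0..T}" unfolding up_def using node_range[OF assms(1)] by auto
  then show "up l A \<in> sets (borel_upto T)" using 1 by (simp add: sets_borel_upto)
qed

lemma fold_measure_measurable:
  assumes P: "sets P = sets (borel_upto T)"
  shows "(\<lambda>t. t - a) \<in> borel_measurable P" "(\<lambda>t. indicator {b<..<c} t :: real) \<in> borel_measurable P"
  unfolding measurable_cong_sets[OF P refl] by (auto intro!: measurable_restrict_space1)

lemma emeasure_fold_measure:
  assumes P: "sets P = sets (borel_upto T)" and l: "l \<in> {1..N}" and A: "A \<in> sets borel"
  shows "emeasure (fold_measure P l) A = emeasure P (up l A)"
proof -
  let ?I = "{node h l<..<real l * h}" and ?s = "\<lambda>t. t - node h l"
  have sp: "space P = {0..T}" using sets_eq_imp_space_eq[OF P] by simp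
  have pre: "?s -` A \<inter> {0..T} \<in> sets P"
    using measurable_sets[OF fold_measure_measurable(1)[OF P] A] by (simp add: sp)
  have "emeasure (fold_measure P l) A = emeasure (density P (\<lambda>t. ennreal (indicator ?I t))) (?s -` A \<inter> {0..T})"
    unfolding fold_measure_def using fold_measure_measurable[OF P] A by (subst emeasure_distr) (simp_all add: sp)
  also have "\<dots> = (\<integral>\<^sup>+t. ennreal (indicator ?I t) * indicator (?s -` A \<inter> {0..T}) t \<partial>P)"
    using fold_measure_measurable[OF P] pre by (intro emeasure_density) auto
  also have "\<dots> = (\<integral>\<^sup>+t. indicator (up l A) t \<partial>P)"
    by (intro nn_integral_cong) (auto simp: up_def indicator_def sp)
  also have "\<dots> = emeasure P (up l A)" using up_sets[OF l A] by (intro nn_integral_indicator) (simp add: P)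
  finally show ?thesis .
qed

lemma integral_fold_measure:
  fixes F :: "real \<Rightarrow> 'e::{banach, second_countable_topology}"
  assumes P: "sets P = sets (borel_upto T)" and l: "l \<in> {1..N}" and A: "A \<in> sets borel" and F[measurable]: "F \<in> borel_measurable borel"
  shows "(LINT r:A|fold_measure P l. F (r + node h l)) = (LINT t:up l A|P. F t)"
proof -
  let ?I = "{node h l<..<real l * h}" and ?s = "\<lambda>t. t - node h l"
  have [measurable]: "A \<in> sets borel" by (rule A)
  have FP: "(\<lambda>t. indicator A (?s t) *\<^sub>R F t) \<in> borel_measurable P"
    unfolding measurable_cong_sets[OF P refl] by (intro measurable_restrict_space1) measurable
  have "(LINT r:A|fold_measure P l. F (r + node h l)) = (\<integral>t. indicator A (?s t) *\<^sub>R F t \<partial>density P (\<lambda>t. ennreal (indicator ?I t)))"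
    unfolding set_lebesgue_integral_def fold_measure_def using fold_measure_measurable[OF P] by (subst integral_distr) simp_all
  also have "\<dots> = (\<integral>t. indicator ?I t *\<^sub>R (indicator A (?s t) *\<^sub>R F t) \<partial>P)"
    using fold_measure_measurable[OF P] FP by (intro integral_density) auto
  also have "\<dots> = (LINT t:up l A|P. F t)"
    unfolding set_lebesgue_integral_def by (intro Bochner_Integration.integral_cong) (auto simp: up_def indicator_def)
  finally show ?thesis .
qed

text \<open>Lebesgue measure (index 0), the folded copies of \<open>\<nu>\<close>, and point masses at \<open>0\<close> and \<open>h\<close> (index \<open>N + 1\<close>) that leave room for
  the attached controls at the nodes. Thus every \<open>r\<close> in \<open>[0, h]\<close> has mass \<open>\<Delta> r\<close>.\<close>
definition lam :: "real measure" where
  "lam = sum_measure borel {0..N + 1} (\<lambda>l. if l = 0 then density lborel (\<lambda>r. ennreal (indicator {0..h} r))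
     else if l \<le> N then fold_measure \<nu> l else distr (point_measure {0, h} (\<lambda>r. ennreal (\<Delta> r))) borel id)"

lemma emeasure_point: "A \<in> sets borel \<Longrightarrow> emeasure (distr (point_measure {0, h} (\<lambda>r. ennreal (\<Delta> r))) borel id) A = (\<Sum>r\<in>A \<inter> {0, h}. ennreal (\<Delta> r))"
  by (subst emeasure_distr) (auto simp: measurable_point_measure_eq1 space_point_measure emeasure_point_measure_finite)

lemma emeasure_lborel_part: "A \<in> sets borel \<Longrightarrow> emeasure (density lborel (\<lambda>r. ennreal (indicator {0..h} r))) A = emeasure lborel (A \<inter> {0..h})"
proof -
  assume A: "A \<in> sets borel"
  then have "emeasure (density lborel (\<lambda>r. ennreal (indicator {0..h} r))) A = (\<integral>\<^sup>+r. ennreal (indicator {0..h} r) * indicator A r \<partial>lborel)"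
    by (intro emeasure_density) auto
  also have "\<dots> = (\<integral>\<^sup>+r. indicator (A \<inter> {0..h}) r \<partial>lborel)" by (intro nn_integral_cong) (auto simp: indicator_def)
  finally show ?thesis using A by simp
qed

lemma emeasure_lam: assumes A: "A \<in> sets borel"
  shows "emeasure lam A = emeasure lborel (A \<inter> {0..h}) + (\<Sum>l=1..N. emeasure \<nu> (up l A)) + (\<Sum>r\<in>A \<inter> {0, h}. ennreal (\<Delta> r))"
proof -
  let ?m = "\<lambda>l. if l = 0 then density lborel (\<lambda>r. ennreal (indicator {0..h} r))
     else if l \<le> N then fold_measure \<nu> l else distr (point_measure {0, h} (\<lambda>r. ennreal (\<Delta> r))) borel id"
  have "emeasure lam A = (\<Sum>l\<in>{0..N + 1}. emeasure (?m l) A)"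
    unfolding lam_def using A by (intro emeasure_sum_measure) (auto simp: fold_measure_def)
  also have "{0..N + 1} = insert 0 (insert (N + 1) {1..N})" by auto
  finally show ?thesis
    using A emeasure_lborel_part[OF A] emeasure_point[OF A] by (simp add: emeasure_fold_measure[OF \<nu>_sets] ac_simps)
qed

sublocale quantile lam h
proof (rule quantile.intro)
  show "h > 0" by (rule h_pos)
  show "sets lam = sets borel" by (simp add: lam_def)
  show "finite_measure lam"
  proof (rule finite_measureI)
    interpret \<nu>: finite_measure \<nu> by (rule \<nu>_finite)
    have sp: "space lam = UNIV" by (simp add: lam_def)
    have "emeasure lborel (UNIV \<inter> {0..h}) < \<infinity>" using h_pos by (simp add: emeasure_lborel_Icc_eq)
    moreover have "(\<Sum>l=1..N. emeasure \<nu> (up l UNIV)) < top" by (rule sum_less_top_ennreal) (simp_all add: \<nu>.emeasure_eq_measure)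
    moreover have "(\<Sum>r\<in>UNIV \<inter> {0, h}. ennreal (\<Delta> r)) < top" by (rule sum_less_top_ennreal) simp_all
    ultimately show "emeasure lam (space lam) \<noteq> \<infinity>" unfolding sp by (subst emeasure_lam) auto
  qed
  have "up l (- {0..h}) = {}" if "l \<in> {1..N}" for l unfolding up_def using node_range(3)[OF that] by auto
  moreover have "- {0..h} \<inter> {0, h} = {}" using h_pos by auto
  ultimately show "emeasure lam (- {0..h}) = 0" by (subst emeasure_lam) auto
  show "emeasure lborel (A \<inter> {0..h}) \<le> emeasure lam A" if "A \<in> sets borel" for A
    using that by (subst emeasure_lam) (auto simp: add.assoc intro: add_increasing2)
qed

lemma fold_le_lam:
  assumes P: "sets P = sets (borel_upto T)" "\<And>A. A \<in> sets (borel_upto T) \<Longrightarrow> emeasure P A \<le> emeasure \<nu> A"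
    and l: "l \<in> {1..N}" and A: "A \<in> sets borel"
  shows "emeasure (fold_measure P l) A \<le> emeasure lam A"
proof -
  have "emeasure (fold_measure P l) A \<le> emeasure \<nu> (up l A)"
    using up_sets[OF l A] by (simp add: emeasure_fold_measure[OF P(1) l A] P(2))
  also have "\<dots> \<le> (\<Sum>l=1..N. emeasure \<nu> (up l A))" using l by (intro member_le_sum) auto
  also have "\<dots> \<le> emeasure lam A" using A by (subst emeasure_lam) (auto intro: add_increasing add_increasing2)
  finally show ?thesis .
qed

lemma up_singleton: assumes "l \<in> {1..N}" shows "up l {r} = (if r \<in> {0<..<h} then {r + node h l} else {})"
  unfolding up_def using node_range(3)[OF assms] by auto

lemma lam_atom: assumes r: "r \<in> {0..h}" shows "measure lam {r} = \<Delta> r"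
proof -
  interpret \<nu>: finite_measure \<nu> by (rule \<nu>_finite)
  have "emeasure lam {r} = ennreal (\<Delta> r)"
  proof (cases "r \<in> {0<..<h}")
    case True
    have "emeasure lam {r} = (\<Sum>l=1..N. ennreal (measure \<nu> {r + node h l}))"
      using True by (subst emeasure_lam) (auto simp: up_singleton \<nu>.emeasure_eq_measure)
    also have "\<dots> = ennreal (\<Sum>l=1..N. measure \<nu> {r + node h l})" by (rule sum_ennreal) simp
    finally show ?thesis using True by (simp add: \<Delta>_def \<omega>_\<nu>)
  next
    case False
    then have "r \<in> {0, h}" using r by auto
    then have "{r} \<inter> {0, h} = {r}" "{r} \<inter> {0..h} = {r}" using r by auto
    moreover have "up l {r} = {}" if "l \<in> {1..N}" for l using up_singleton[OF that, of r] False by simp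
    ultimately show ?thesis by (subst emeasure_lam) simp_all
  qed
  then show ?thesis by (simp add: measure_def \<Delta>_nonneg)
qed

lemma R_iff: "r \<in> {0..h} \<Longrightarrow> r \<in> R \<longleftrightarrow> \<Delta> r > 0"
  using lam_atom[of r] \<Delta>_nonneg[of r] by (auto simp: R_def)

subsection \<open>Densities of the atomless parts\<close>

lemma integral_density_lam:
  fixes F :: "real \<Rightarrow> 'e::{banach, second_countable_topology}"
  assumes P: "P = density lam (\<lambda>r. ennreal (k r))" and k: "k \<in> borel_measurable borel" "\<And>r. 0 \<le> k r"
    and [measurable]: "F \<in> borel_measurable borel" "A \<in> sets borel"
  shows "(LINT r:A|P. F r) = (LINT r:A|lam. k r *\<^sub>R F r)"
proof -
  have "(\<integral>r. indicator A r *\<^sub>R F r \<partial>P) = (\<integral>r. k r *\<^sub>R (indicator A r *\<^sub>R F r) \<partial>lam)"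
    unfolding P using k by (intro integral_density) auto
  then show ?thesis by (simp add: set_lebesgue_integral_def mult_ac)
qed

lemma set_integrable_lam:
  fixes F :: "real \<Rightarrow> 'e::{banach, second_countable_topology}"
  assumes [measurable]: "F \<in> borel_measurable borel" "A \<in> sets borel" and B: "\<And>r. norm (F r) \<le> B"
  shows "set_integrable lam A F"
  unfolding set_integrable_def
proof (rule integrable_const_bound)
  have "0 \<le> B" using B[of 0] norm_ge_zero order_trans by blast
  then show "AE r in lam. norm (indicat_real A r *\<^sub>R F r) \<le> B" using B by (intro AE_I2) (auto simp: indicator_def)
qed measurable

definition unit_density :: "real measure \<Rightarrow> (real \<Rightarrow> real) \<Rightarrow> bool" where
  "unit_density P k \<longleftrightarrow> k \<in> borel_measurable borel \<and> (\<forall>r. 0 \<le> k r \<and> k r \<le> 1) \<and> P = density lam (\<lambda>r. ennreal (k r))"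

lemma bounded_jordan_density_exists:
  assumes "l \<in> {1..N}"
  shows "\<exists>k. unit_density (fold_measure (\<pi> b j) l) k"
  unfolding unit_density_def
proof (rule bounded_density[OF fin])
  show "emeasure (fold_measure (\<pi> b j) l) A \<le> emeasure lam A" if "A \<in> sets borel" for A
    by (rule fold_le_lam[OF \<pi>_sets _ assms that]) (use \<pi>_le_\<nu>c \<nu>c_le_\<nu> order_trans in blast)
qed (simp_all add: fold_measure_def)

definition jdens where "jdens l b j = (SOME k. unit_density (fold_measure (\<pi> b j) l) k)"

lemmas jdens_spec = someI_ex[OF bounded_jordan_density_exists, folded jdens_def, unfolded unit_density_def]

lemma jdens_measurable: "l \<in> {1..N} \<Longrightarrow> jdens l b j \<in> borel_measurable borel"
  and jdens_bounds: "l \<in> {1..N} \<Longrightarrow> 0 \<le> jdens l b j r" "l \<in> {1..N} \<Longrightarrow> jdens l b j r \<le> 1"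
  using jdens_spec by simp_all

lemma jdens_density: "l \<in> {1..N} \<Longrightarrow> fold_measure (\<pi> b j) l = density lam (\<lambda>r. ennreal (jdens l b j r))"
  using jdens_spec by simp

lemma jdens_integral:
  fixes F :: "real \<Rightarrow> 'e::{banach, second_countable_topology}"
  assumes l: "l \<in> {1..N}" and A: "A \<in> sets borel" and F: "F \<in> borel_measurable borel"
  shows "(LINT t:up l A|\<pi> b j. F t) = (LINT r:A|lam. jdens l b j r *\<^sub>R F (r + node h l))"
proof -
  have "(\<lambda>r. F (r + node h l)) \<in> borel_measurable borel" using F by measurable
  then show ?thesis
    unfolding integral_fold_measure[OF \<pi>_sets l A F, symmetric]
    by (intro integral_density_lam[OF jdens_density[OF l] jdens_measurable[OF l] jdens_bounds(1)[OF l] _ A])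
qed

lemma jdens_measure:
  assumes l: "l \<in> {1..N}" and A: "A \<in> sets borel"
  shows "measure (\<pi> b j) (up l A) = (LINT r:A|lam. jdens l b j r)"
proof -
  interpret P: finite_measure "\<pi> b j" by (rule \<pi>_finite)
  have "(LINT t:up l A|\<pi> b j. (1::real)) = measure (\<pi> b j) (up l A)"
    using up_sets[OF l A] by (simp add: set_lebesgue_integral_def)
  then show ?thesis using jdens_integral[OF l A, of "\<lambda>_. 1::real" b j] by simp
qed

lemma jdens_on_atoms: assumes l: "l \<in> {1..N}" and r: "r \<in> R" shows "jdens l b j r = 0"
proof -
  have "emeasure (\<pi> b j) (up l {r}) = 0"
    by (rule \<pi>_countable[OF up_sets(1)[OF l]]) (simp_all add: up_singleton[OF l])
  then have "(LINT s:{r}|lam. jdens l b j s) = 0" using jdens_measure[OF l, of "{r}" b j] by (simp add: measure_def)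
  moreover have "(LINT s:{r}|lam. jdens l b j s) = jdens l b j r * measure lam {r}"
    using jdens_bounds[OF l] by (intro set_integral_at_point set_integrable_lam[where B = 1] jdens_measurable[OF l]) (auto simp: emeasure_eq_measure)
  ultimately show ?thesis using r by (simp add: R_def)
qed

text \<open>\<open>\<kappa>0\<close> is the density of the folded atomless part of \<open>\<mu>\<close>, \<open>\<kappa>\<close> a version with all values in \<open>K\<close>.\<close>
definition \<kappa>0 :: "nat \<Rightarrow> real \<Rightarrow> real ^ 'm" where "\<kappa>0 l r = (\<chi> j. jdens l True j r - jdens l False j r)"
definition \<kappa> :: "nat \<Rightarrow> real \<Rightarrow> real ^ 'm" where "\<kappa> l r = (if \<kappa>0 l r \<in> K then \<kappa>0 l r else 0)"

lemma \<kappa>0_meas: "l \<in> {1..N} \<Longrightarrow> \<kappa>0 l \<in> borel_measurable borel"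
  unfolding \<kappa>0_def[abs_def] using jdens_measurable by (intro borel_measurable_vec_lambda borel_measurable_diff)

lemma \<kappa>_meas: assumes "l \<in> {1..N}" shows "\<kappa> l \<in> borel_measurable borel"
proof -
  note [measurable] = \<kappa>0_meas[OF assms] borel_closed[OF K_closed]
  show ?thesis unfolding \<kappa>_def[abs_def] by measurable
qed

lemma \<kappa>_K: "\<kappa> l r \<in> K"
  by (simp add: \<kappa>_def zero_in_K)

lemma \<kappa>0_bound: assumes "l \<in> {1..N}" shows "norm1 (\<kappa>0 l r) \<le> CARD('m)"
proof -
  have "\<bar>\<kappa>0 l r $ j\<bar> \<le> 1" for j
    using jdens_bounds[OF assms, of True j r] jdens_bounds[OF assms, of False j r] by (simp add: \<kappa>0_def)
  then have "norm1 (\<kappa>0 l r) \<le> (\<Sum>j\<in>(UNIV::'m set). 1)" unfolding norm1_def by (intro sum_mono)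
  then show ?thesis by simp
qed

lemma \<kappa>_bound: "l \<in> {1..N} \<Longrightarrow> norm1 (\<kappa> l r) \<le> CARD('m)"
  using \<kappa>0_bound by (simp add: \<kappa>_def) (simp add: norm1_def)

lemma \<kappa>_R: "l \<in> {1..N} \<Longrightarrow> r \<in> R \<Longrightarrow> \<kappa> l r = 0"
  by (simp add: \<kappa>_def \<kappa>0_def jdens_on_atoms vec_eq_iff)

lemma \<kappa>0_integral: assumes l: "l \<in> {1..N}" and A: "A \<in> sets borel"
  shows "(LINT r:A|lam. \<kappa>0 l r $ j) = \<mu>c (up l A) $ j" and "(LINT r:A|lam. \<kappa>0 l r) = \<mu>c (up l A)"
proof -
  have i: "set_integrable lam A (jdens l b j)" for b j
    using jdens_bounds[OF l] by (intro set_integrable_lam[where B = 1] jdens_measurable[OF l] A) auto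
  have *: "(LINT r:A|lam. \<kappa>0 l r $ j) = \<mu>c (up l A) $ j" for j
    unfolding \<mu>c_\<pi>[OF up_sets(1)[OF l A]] jdens_measure[OF l A] using i by (simp add: \<kappa>0_def set_integral_diff)
  then show "(LINT r:A|lam. \<kappa>0 l r $ j) = \<mu>c (up l A) $ j" .
  have "set_integrable lam A (\<kappa>0 l)"
    using \<kappa>0_bound[OF l] norm_le_norm1 order_trans by (intro set_integrable_lam[where B = "CARD('m)"] \<kappa>0_meas[OF l] A) blast
  then have "(LINT r:A|lam. \<kappa>0 l r) $ j = (LINT r:A|lam. \<kappa>0 l r $ j)" for j
    unfolding set_lebesgue_integral_def set_integrable_def by (subst integral_bounded_linear[OF bounded_linear_vec_nth, symmetric]) auto
  then show "(LINT r:A|lam. \<kappa>0 l r) = \<mu>c (up l A)" by (simp add: vec_eq_iff *)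
qed

text \<open>All averages of \<open>\<kappa>0\<close> are positive multiples of values of \<open>\<mu>\<close>, hence in the closed cone \<open>K\<close>; the averaging theorem then gives the values.\<close>
lemma \<kappa>0_in_K: assumes l: "l \<in> {1..N}" shows "AE r in lam. \<kappa>0 l r \<in> K"
proof (rule averaging_theorem[OF _ K_closed])
  show "integrable lam (\<kappa>0 l)"
    using \<kappa>0_bound[OF l] norm_le_norm1 order_trans \<kappa>0_meas[OF l]
    by (intro integrable_const_bound[of _ "CARD('m)"] AE_I2) (blast, simp)
  show "(1 / measure lam A) *\<^sub>R (LINT r:A|lam. \<kappa>0 l r) \<in> K" if "A \<in> sets lam" "measure lam A > 0" for A
    using that \<mu>c_K[OF up_sets(1)[OF l]] by (intro K_cone[unfolded cone_def, rule_format]) (simp_all add: \<kappa>0_integral[OF l])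
qed

lemma \<kappa>_AE: "l \<in> {1..N} \<Longrightarrow> AE r in lam. \<kappa> l r = \<kappa>0 l r"
  using \<kappa>0_in_K[of l] by (auto simp: \<kappa>_def elim: AE_mp)

lemma \<kappa>_integral: assumes l: "l \<in> {1..N}" and A: "A \<in> sets borel"
  shows "(LINT r:A|lam. \<kappa> l r) = \<mu>c (up l A)"
proof -
  have "(LINT r:A|lam. \<kappa> l r) = (LINT r:A|lam. \<kappa>0 l r)"
    using \<kappa>_meas[OF l] \<kappa>0_meas[OF l] A \<kappa>_AE[OF l]
    by (intro set_lebesgue_integral_cong_AE) (auto simp: measurable_cong_sets[OF sets_lam refl] elim: AE_mp)
  then show ?thesis by (simp add: \<kappa>0_integral[OF l A])
qed

lemma up_image: assumes l: "l \<in> {1..N}" and A: "A \<in> sets borel"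
  shows "{B \<in> sets (borel_upto T). B \<subseteq> up l A} = up l ` {B \<in> sets borel. B \<subseteq> A}"
proof (intro set_eqI iffI)
  fix B assume "B \<in> up l ` {B \<in> sets borel. B \<subseteq> A}"
  then obtain B' where "B' \<in> sets borel" "B' \<subseteq> A" "B = up l B'" by auto
  then show "B \<in> {B \<in> sets (borel_upto T). B \<subseteq> up l A}" using up_sets[OF l] by (auto simp: up_def)
next
  fix B assume "B \<in> {B \<in> sets (borel_upto T). B \<subseteq> up l A}"
  then have B: "B \<in> sets borel" "B \<subseteq> up l A" by (auto simp: sets_borel_upto)
  let ?B = "{r. r + node h l \<in> B}"
  have "?B \<in> sets borel" using B(1) by measurable
  moreover have "?B \<subseteq> A" using B(2) by (auto simp: up_def)
  moreover have "B = up l ?B" using B(2) by (auto simp: up_def)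
  ultimately show "B \<in> up l ` {B \<in> sets borel. B \<subseteq> A}" by blast
qed

text \<open>The Jordan parts are determined by suprema over subsets, and the subsets of a folded set are the folded subsets.\<close>
lemma jordan_fold:
  assumes l: "l \<in> {1..N}" and A: "A \<in> sets borel"
  shows "emeasure (\<pi> True j) (up l A) = (\<integral>\<^sup>+r. ennreal (\<kappa>0 l r $ j) * indicator A r \<partial>lam)"
    and "emeasure (\<pi> False j) (up l A) = (\<integral>\<^sup>+r. ennreal (- (\<kappa>0 l r $ j)) * indicator A r \<partial>lam)"
proof -
  have [measurable]: "\<kappa>0 l \<in> borel_measurable borel" by (rule \<kappa>0_meas[OF l])
  have b: "\<bar>\<kappa>0 l r $ j\<bar> \<le> CARD('m)" for r using norm1_component_le[of "\<kappa>0 l r" j] \<kappa>0_bound[OF l, of r] by linarith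
  have i: "integrable lam (\<lambda>r. \<kappa>0 l r $ j)" using b by (intro integrable_const_bound[of _ "CARD('m)"] AE_I2) auto
  have S: "(SUP B\<in>{B \<in> sets (borel_upto T). B \<subseteq> up l A}. ennreal (F B)) = (SUP B\<in>{B \<in> sets lam. B \<subseteq> A}. ennreal (F (up l B)))" for F
    unfolding up_image[OF l A] by (simp add: image_comp o_def)
  show "emeasure (\<pi> True j) (up l A) = (\<integral>\<^sup>+r. ennreal (\<kappa>0 l r $ j) * indicator A r \<partial>lam)"
  proof -
    have "emeasure (\<pi> True j) (up l A) = (SUP B\<in>{B \<in> sets lam. B \<subseteq> A}. ennreal (\<mu>c (up l B) $ j))"
      by (simp add: \<pi>_def emeasure_jordan_pos[OF vector_measures_nth[OF \<mu>c] up_sets(1)[OF l A]] S del: sets_lam)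
    also have "\<dots> = (\<integral>\<^sup>+r. ennreal (\<kappa>0 l r $ j) * indicator A r \<partial>lam)"
      by (rule SUP_density[OF i]) (use A in \<open>simp_all add: \<kappa>0_integral[OF l]\<close>)
    finally show ?thesis .
  qed
  show "emeasure (\<pi> False j) (up l A) = (\<integral>\<^sup>+r. ennreal (- (\<kappa>0 l r $ j)) * indicator A r \<partial>lam)"
  proof -
    have "emeasure (\<pi> False j) (up l A) = (SUP B\<in>{B \<in> sets lam. B \<subseteq> A}. ennreal (- (\<mu>c (up l B) $ j)))"
      by (simp add: \<pi>_def jordan_neg_def emeasure_jordan_pos[OF vector_measures_uminus[OF vector_measures_nth[OF \<mu>c]] up_sets(1)[OF l A]] S del: sets_lam)
    also have "\<dots> = (\<integral>\<^sup>+r. ennreal (- (\<kappa>0 l r $ j)) * indicator A r \<partial>lam)"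
    proof (rule SUP_density)
      show "integrable lam (\<lambda>r. - (\<kappa>0 l r $ j))" using i by simp
      show "- (\<mu>c (up l B) $ j) = (LINT r:B|lam. - (\<kappa>0 l r $ j))" if "B \<in> sets lam" for B
      proof -
        have "(LINT r:B|lam. - (\<kappa>0 l r $ j)) = - (LINT r:B|lam. \<kappa>0 l r $ j)" by (simp add: set_lebesgue_integral_def)
        then show ?thesis using that by (simp add: \<kappa>0_integral[OF l])
      qed
    qed (use A in simp)
    finally show ?thesis .
  qed
qed

text \<open>By the definition of \<open>V\<^sub>c\<close> the atomless part of \<open>\<nu>\<close> is the sum of the Jordan parts of \<open>\<mu>c\<close>, and \<open>jordan_fold\<close> computes each of them.\<close>
lemma \<kappa>_norm: assumes l: "l \<in> {1..N}" and A: "A \<in> sets borel"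
  shows "measure \<nu>c (up l A) = (LINT r:A|lam. norm1 (\<kappa> l r))"
proof -
  note [measurable] = \<kappa>0_meas[OF l] \<kappa>_meas[OF l] A
  have "emeasure \<nu>c (up l A) = (\<Sum>j\<in>UNIV. (\<integral>\<^sup>+r. ennreal (\<kappa>0 l r $ j) * indicator A r \<partial>lam) + (\<integral>\<^sup>+r. ennreal (- (\<kappa>0 l r $ j)) * indicator A r \<partial>lam))"
    unfolding \<nu>c_eq[OF up_sets(1)[OF l A]] jordan_fold[OF l A] ..
  also have "\<dots> = (\<integral>\<^sup>+r. (\<Sum>j\<in>UNIV. ennreal (\<kappa>0 l r $ j) * indicator A r + ennreal (- (\<kappa>0 l r $ j)) * indicator A r) \<partial>lam)"
    by (simp add: nn_integral_sum nn_integral_add)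
  also have "\<dots> = (\<integral>\<^sup>+r. ennreal (indicator A r *\<^sub>R norm1 (\<kappa> l r)) \<partial>lam)"
  proof (rule nn_integral_cong_AE)
    show "AE r in lam. (\<Sum>j\<in>UNIV. ennreal (\<kappa>0 l r $ j) * indicator A r + ennreal (- (\<kappa>0 l r $ j)) * indicator A r) = ennreal (indicator A r *\<^sub>R norm1 (\<kappa> l r))"
    proof (rule AE_mp[OF \<kappa>_AE[OF l]], intro AE_I2 impI)
      fix r assume r: "\<kappa> l r = \<kappa>0 l r"
      have "ennreal (\<kappa>0 l r $ j) + ennreal (- (\<kappa>0 l r $ j)) = ennreal \<bar>\<kappa>0 l r $ j\<bar>" for j
        by (cases "\<kappa>0 l r $ j \<ge> 0") (auto simp: ennreal_neg)
      then have "(\<Sum>j\<in>UNIV. ennreal (\<kappa>0 l r $ j) + ennreal (- (\<kappa>0 l r $ j))) = ennreal (norm1 (\<kappa> l r))"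
        by (simp add: norm1_def r)
      then show "(\<Sum>j\<in>UNIV. ennreal (\<kappa>0 l r $ j) * indicator A r + ennreal (- (\<kappa>0 l r $ j)) * indicator A r) = ennreal (indicator A r *\<^sub>R norm1 (\<kappa> l r))"
        by (cases "r \<in> A") simp_all
    qed
  qed
  also have "\<dots> = ennreal (LINT r:A|lam. norm1 (\<kappa> l r))"
  proof -
    have "set_integrable lam A (\<lambda>r. norm1 (\<kappa> l r))"
      using \<kappa>_bound[OF l] by (intro set_integrable_lam[where B = "CARD('m)"]) auto
    then show ?thesis unfolding set_lebesgue_integral_def set_integrable_def by (intro nn_integral_eq_integral) auto
  qed
  finally show ?thesis
    unfolding measure_def by (simp add: set_lebesgue_integral_def Bochner_Integration.integral_nonneg)
qed

lemma piece_up: assumes l: "l \<in> {1..N}" and t: "t \<in> {node h l<..<real l * h}"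
  shows "{node h l..t} = {node h l} \<union> up l {0..t - node h l}"
  using t by (auto simp: up_def)

text \<open>Integration against the atomless part in the folded variable. The left endpoint of the piece may be dropped as it carries no mass.\<close>
lemma signed_integral_\<mu>c:
  fixes F :: "real \<Rightarrow> 'e::{banach, second_countable_topology}"
  assumes l: "l \<in> {1..N}" and t: "t \<in> {node h l<..<real l * h}"
    and [measurable]: "F \<in> borel_measurable borel" and B: "\<And>r. norm (F r) \<le> B"
  shows "signed_integral T (\<lambda>A. \<mu>c A $ j) {node h l..t} F =
    (LINT r:{0..t - node h l}|lam. (\<kappa> l r $ j) *\<^sub>R F (r + node h l))"
proof -
  let ?a = "node h l" and ?A = "{0..t - node h l}"
  note [measurable] = \<kappa>0_meas[OF l] \<kappa>_meas[OF l] jdens_measurable[OF l]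
  have A: "?A \<in> sets borel" by simp
  have P: "(LINT t:{?a..t}|\<pi> b j. F t) = (LINT r:?A|lam. jdens l b j r *\<^sub>R F (r + ?a))" for b
  proof -
    interpret P: finite_measure "\<pi> b j" by (rule \<pi>_finite)
    have F: "F \<in> borel_measurable (\<pi> b j)" unfolding measurable_cong_sets[OF \<pi>_sets refl] by (intro measurable_restrict_space1) simp
    have a: "{?a} \<in> sets (borel_upto T)" "{?a..t} \<in> sets (borel_upto T)" using node_range[OF l] t by (auto simp: sets_borel_upto)
    have ae: "AE r in \<pi> b j. r \<noteq> ?a"
      by (rule AE_I'[of "{?a}"]) (use \<pi>_countable[OF a(1)] a(1) in \<open>auto simp: null_sets_def\<close>)
    have "(LINT t:{?a..t}|\<pi> b j. F t) = (LINT t:up l ?A|\<pi> b j. F t)"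
    proof (rule set_integral_cong_set)
      show "set_borel_measurable (\<pi> b j) {?a..t} F" "set_borel_measurable (\<pi> b j) (up l ?A) F"
        unfolding set_borel_measurable_def using F a(2) up_sets(1)[OF l A] by (auto intro!: borel_measurable_scaleR borel_measurable_indicator)
      show "AE r in \<pi> b j. (r \<in> up l ?A) = (r \<in> {?a..t})"
        by (rule AE_mp[OF ae]) (use piece_up[OF l t] in \<open>auto intro!: AE_I2\<close>)
    qed
    then show ?thesis by (simp add: jdens_integral[OF l A])
  qed
  have Fb: "norm (jdens l b j r *\<^sub>R F (r + ?a)) \<le> 1 * B" for b r
    unfolding norm_scaleR using jdens_bounds[OF l, of b j r] B[of "r + ?a"] by (intro mult_mono) auto
  have i: "set_integrable lam ?A (\<lambda>r. jdens l b j r *\<^sub>R F (r + ?a))" for b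
    using Fb by (intro set_integrable_lam[where B = "1 * B"]) auto
  have "signed_integral T (\<lambda>A. \<mu>c A $ j) {?a..t} F = (LINT t:{?a..t}|\<pi> True j. F t) - (LINT t:{?a..t}|\<pi> False j. F t)"
    by (simp add: signed_integral_def \<pi>_def)
  also have "\<dots> = (LINT r:?A|lam. (\<kappa>0 l r $ j) *\<^sub>R F (r + ?a))"
    unfolding P \<kappa>0_def vec_lambda_beta scaleR_left_diff_distrib
    by (rule set_integral_diff(2)[symmetric]) (rule i)+
  also have "\<dots> = (LINT r:?A|lam. (\<kappa> l r $ j) *\<^sub>R F (r + ?a))"
  proof (rule set_lebesgue_integral_cong_AE)
    show "AE r\<in>?A in lam. (\<kappa>0 l r $ j) *\<^sub>R F (r + ?a) = (\<kappa> l r $ j) *\<^sub>R F (r + ?a)"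
      by (rule AE_mp[OF \<kappa>_AE[OF l]]) (auto intro!: AE_I2)
  qed measurable
  finally show ?thesis .
qed

lemma lborel_density_exists: "\<exists>k. unit_density (density lborel (\<lambda>r. ennreal (indicator {0..h} r))) k"
  unfolding unit_density_def by (rule bounded_density[OF fin]) (simp_all add: emeasure_lborel_part ge_lborel)

text \<open>The speed at which time runs in the new parameter.\<close>
definition p0 where "p0 = (SOME k. unit_density (density lborel (\<lambda>r. ennreal (indicator {0..h} r))) k)"

lemmas p0_spec = someI_ex[OF lborel_density_exists, folded p0_def, unfolded unit_density_def]

lemma p0_meas [measurable]: "p0 \<in> borel_measurable borel" and p0_bounds: "0 \<le> p0 r" "p0 r \<le> 1"
  using p0_spec by simp_all

lemma p0_integral:
  fixes F :: "real \<Rightarrow> 'e::{banach, second_countable_topology}"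
  assumes [measurable]: "F \<in> borel_measurable borel" "A \<in> sets borel" and A: "A \<subseteq> {0..h}"
  shows "(LBINT r:A. F r) = (LINT r:A|lam. p0 r *\<^sub>R F r)"
proof -
  have "(LINT r:A|density lborel (\<lambda>r. ennreal (indicator {0..h} r)). F r) = (\<integral>r. indicator {0..h} r *\<^sub>R (indicator A r *\<^sub>R F r) \<partial>lborel)"
    unfolding set_lebesgue_integral_def by (rule integral_density) simp_all
  also have "\<dots> = (LBINT r:A. F r)"
    unfolding set_lebesgue_integral_def using A by (intro Bochner_Integration.integral_cong) (auto simp: indicator_def)
  finally show ?thesis using integral_density_lam[OF conjunct2[OF conjunct2[OF p0_spec]] p0_meas p0_bounds(1) assms(1,2)] by simp
qed

lemma p0_R: assumes "r \<in> R" shows "p0 r = 0"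
proof -
  have r: "r \<in> {0..h}" using assms R_subset by auto
  have "(LINT s:{r}|lam. p0 s *\<^sub>R (1::real)) = 0" using p0_integral[of "\<lambda>_. 1::real" "{r}"] r by simp
  moreover have "(LINT s:{r}|lam. p0 s *\<^sub>R (1::real)) = (p0 r *\<^sub>R 1) * measure lam {r}"
    using p0_bounds by (intro set_integral_at_point set_integrable_lam[where B = 1]) (auto simp: emeasure_eq_measure)
  ultimately show ?thesis using assms by (simp add: R_def)
qed

lemma integral_piece_lborel:
  fixes F :: "real \<Rightarrow> 'e::{banach, second_countable_topology}"
  assumes [measurable]: "F \<in> borel_measurable borel" and r: "r \<in> {0..h}"
  shows "(LBINT t:{a..a + r}. F t) = (LINT s:{0..r}|lam. p0 s *\<^sub>R F (s + a))"
proof -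
  have "(LBINT t:{a..a + r}. F t) = (\<integral>s. indicator {a..a + r} (a + 1 * s) *\<^sub>R F (a + 1 * s) \<partial>lborel)"
    unfolding set_lebesgue_integral_def by (subst lborel_integral_real_affine[of 1 _ a]) simp_all
  also have "\<dots> = (LBINT s:{0..r}. F (s + a))"
    unfolding set_lebesgue_integral_def by (intro Bochner_Integration.integral_cong) (auto simp: indicator_def add.commute)
  also have "\<dots> = (LINT s:{0..r}|lam. p0 s *\<^sub>R F (s + a))" using r by (intro p0_integral) auto
  finally show ?thesis .
qed

end

subsection \<open>Borel versions and paths with jumps\<close>

text \<open>Each component is a difference of two nondecreasing functions: the variation \<open>V\<close> up to \<open>t\<close>, and \<open>V\<close> minus the component.\<close>
lemma bounded_variation_borel:
  fixes z :: "real \<Rightarrow> real ^ 'n"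
  assumes "bounded_variation_on a b z"
  shows "(\<lambda>t. if t \<in> {a..b} then z t else 0) \<in> borel_measurable borel"
proof -
  obtain C where C: "\<And>(n::nat) (p :: nat \<Rightarrow> real). mono p \<Longrightarrow> range p \<subseteq> {a..b} \<Longrightarrow>
       (\<Sum>i<n. norm (z (p (Suc i)) - z (p i))) \<le> C"
    using assms unfolding bounded_variation_on_def by blast
  have comp: "(\<lambda>t. z t $ j) \<in> borel_measurable (restrict_space borel {a..b})" for j
  proof -
    let ?P = "\<lambda>t. {(n, p :: nat \<Rightarrow> real). mono p \<and> range p \<subseteq> {a..t}}"
    let ?s = "\<lambda>(n, p :: nat \<Rightarrow> real). (\<Sum>i<n. \<bar>z (p (Suc i)) $ j - z (p i) $ j\<bar>)"
    define V where "V t = (SUP np\<in>?P t. ?s np)" for t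
    have bdd: "bdd_above (?s ` ?P t)" if "t \<le> b" for t
    proof (rule bdd_aboveI2)
      fix np :: "nat \<times> (nat \<Rightarrow> real)" assume "np \<in> ?P t"
      moreover obtain n p where "np = (n, p)" by (cases np)
      ultimately have np': "np = (n, p)" "mono p" "range p \<subseteq> {a..t}" by simp_all
      have "{a..t} \<subseteq> {a..b}" using that by (simp add: atLeastatMost_subset_iff)
      with np'(3) have np3: "range p \<subseteq> {a..b}" by (rule subset_trans)
      note np = np'(1,2) np3
      have "\<bar>z (p (Suc i)) $ j - z (p i) $ j\<bar> \<le> norm (z (p (Suc i)) - z (p i))" for i
        using component_le_norm_cart[of "z (p (Suc i)) - z (p i)" j] by simp
      then have "(\<Sum>i<n. \<bar>z (p (Suc i)) $ j - z (p i) $ j\<bar>) \<le> (\<Sum>i<n. norm (z (p (Suc i)) - z (p i)))"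
        by (rule sum_mono)
      then have "?s np \<le> (\<Sum>i<n. norm (z (p (Suc i)) - z (p i)))" by (simp only: np(1) prod.case)
      then show "?s np \<le> C" using C[OF np(2,3), of n] by linarith
    qed
    have step: "V s + \<bar>z t $ j - z s $ j\<bar> \<le> V t" if st: "a \<le> s" "s \<le> t" "t \<le> b" for s t
    proof -
      have "V s \<le> V t - \<bar>z t $ j - z s $ j\<bar>"
        unfolding V_def[of s]
      proof (rule cSUP_least)
        have "(0, \<lambda>_. a) \<in> ?P s" using st by (auto simp: mono_def)
        then show "?P s \<noteq> {}" by blast
        fix np :: "nat \<times> (nat \<Rightarrow> real)" assume "np \<in> ?P s"
        moreover obtain n p where "np = (n, p)" by (cases np)
      ultimately have np: "np = (n, p)" "mono p" "range p \<subseteq> {a..s}" by simp_all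
        have pr: "a \<le> p i" "p i \<le> s" for i using np(3) by (auto simp: image_subset_iff)
        \<comment> \<open>extend the partition by the points \<open>s\<close> and \<open>t\<close>\<close>
        define q where "q i = (if i \<le> n then p i else if i = Suc n then s else t)" for i
        have "mono q"
          unfolding mono_iff_le_Suc
        proof
          fix i
          have "p i \<le> p (Suc i)" using np(2) by (simp add: mono_iff_le_Suc)
          then show "q i \<le> q (Suc i)" using pr(2)[of n] st(2) by (auto simp: q_def)
        qed
        moreover have "a \<le> q i" "q i \<le> t" for i using pr[of i] st by (simp_all add: q_def)
        then have "range q \<subseteq> {a..t}" by (simp add: image_subset_iff)
        ultimately have "(n + 2, q) \<in> ?P t" by simp
        then have "?s (n + 2, q) \<le> V t"
          unfolding V_def by (rule cSUP_upper[OF _ bdd[OF st(3)]])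
        moreover have "?s (n + 2, q) = (\<Sum>i<n. \<bar>z (q (Suc i)) $ j - z (q i) $ j\<bar>) + \<bar>z s $ j - z (p n) $ j\<bar> + \<bar>z t $ j - z s $ j\<bar>"
          by (simp add: q_def)
        moreover have "(\<Sum>i<n. \<bar>z (q (Suc i)) $ j - z (q i) $ j\<bar>) = ?s np"
          unfolding np(1) prod.case by (intro sum.cong) (auto simp: q_def)
        moreover have "0 \<le> \<bar>z s $ j - z (p n) $ j\<bar>" by simp
        ultimately show "?s np \<le> V t - \<bar>z t $ j - z s $ j\<bar>" by linarith
      qed
      then show ?thesis by linarith
    qed
    have "mono_on {a..b} V" "mono_on {a..b} (\<lambda>t. V t - z t $ j)"
    proof -
      have *: "V s \<le> V t" "V s - z s $ j \<le> V t - z t $ j" if "s \<in> {a..b}" "t \<in> {a..b}" "s \<le> t" for s t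
        using step[of s t] that by (simp_all add: abs_if split: if_splits)
      show "mono_on {a..b} V" "mono_on {a..b} (\<lambda>t. V t - z t $ j)" by (intro mono_onI *; simp)+
    qed
    then have "V \<in> borel_measurable (restrict_space borel {a..b})" "(\<lambda>t. V t - z t $ j) \<in> borel_measurable (restrict_space borel {a..b})"
      by (auto intro: borel_measurable_mono_on_fnc)
    then have "(\<lambda>t. V t - (V t - z t $ j)) \<in> borel_measurable (restrict_space borel {a..b})" by (rule borel_measurable_diff)
    then show ?thesis by simp
  qed
  have "(\<lambda>t. (\<chi> j. z t $ j) :: real ^ 'n) \<in> borel_measurable (restrict_space borel {a..b})"
    by (rule borel_measurable_vec_lambda) (rule comp)
  then have "z \<in> borel_measurable (restrict_space borel {a..b})" by simp
  then have "(\<lambda>t. indicator {a..b} t *\<^sub>R z t) \<in> borel_measurable borel"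
    by (subst (asm) borel_measurable_restrict_space_iff) auto
  moreover have "(\<lambda>t. indicator {a..b} t *\<^sub>R z t) = (\<lambda>t. if t \<in> {a..b} then z t else 0)" by (auto simp: fun_eq_iff)
  ultimately show ?thesis by simp
qed

lemma borel_version:
  fixes F :: "real \<Rightarrow> real ^ 'm"
  assumes "F \<in> borel_measurable (lebesgue_on A)" and A: "A \<in> sets borel"
  shows "\<exists>F'. F' \<in> borel_measurable borel \<and> (AE s in lebesgue. s \<in> A \<longrightarrow> F s = F' s)"
proof -
  have m: "(\<lambda>s. indicator A s *\<^sub>R F s) \<in> borel_measurable lebesgue"
    using assms by (subst (asm) borel_measurable_restrict_space_iff) auto
  have "\<exists>q. q \<in> borel_measurable lborel \<and> (AE s in lborel. (indicator A s *\<^sub>R F s) $ j = q s)" for j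
    using completion_ex_borel_measurable_real[OF component_measurable[OF m, of j]] by blast
  then obtain q where q: "\<And>j. q j \<in> borel_measurable lborel" "\<And>j. AE s in lborel. (indicator A s *\<^sub>R F s) $ j = q j s" by metis
  have "(\<lambda>s. (\<chi> j. q j s) :: real ^ 'm) \<in> borel_measurable borel"
    using q(1) by (intro borel_measurable_vec_lambda) simp
  moreover have "AE s in lborel. \<forall>j. (indicator A s *\<^sub>R F s) $ j = q j s" using q(2) by (simp add: AE_all_countable)
  then have "AE s in lebesgue. \<forall>j. (indicator A s *\<^sub>R F s) $ j = q j s" by (rule AE_completion)
  then have "AE s in lebesgue. s \<in> A \<longrightarrow> F s = (\<chi> j. q j s)"
    by (rule AE_mp) (auto intro!: AE_I2 simp: vec_eq_iff)
  ultimately show ?thesis by blast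
qed

lemma set_integral_lebesgue_AE:
  fixes F F' :: "real \<Rightarrow> 'e::{banach, second_countable_topology}"
  assumes F: "F \<in> borel_measurable (lebesgue_on A)" and A: "A \<in> sets borel" and F'[measurable]: "F' \<in> borel_measurable borel"
    and ae: "AE s in lebesgue. s \<in> A \<longrightarrow> F s = F' s"
  shows "(LINT s:A|lebesgue. F s) = (LBINT s:A. F' s)"
proof -
  have "(\<lambda>s. indicator A s *\<^sub>R F s) \<in> borel_measurable lebesgue"
    using F A by (subst (asm) borel_measurable_restrict_space_iff) auto
  moreover have "(\<lambda>s. indicator A s *\<^sub>R F' s) \<in> borel_measurable lebesgue"
    using A by (intro measurable_completion) simp
  ultimately have "(LINT s:A|lebesgue. F s) = (LINT s:A|lebesgue. F' s)"
    unfolding set_lebesgue_integral_def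
    by (rule Bochner_Integration.integral_cong_AE) (rule AE_mp[OF ae], auto intro!: AE_I2 simp: indicator_def)
  then show ?thesis using set_integral_lebesgue_lborel[OF F' A] by simp
qed

lemma integral_affine_Icc:
  fixes F :: "real \<Rightarrow> 'e::{banach, second_countable_topology}"
  assumes d: "d > 0"
  shows "(LBINT s:{a..a + \<tau> * d}. (1 / d) *\<^sub>R F ((s - a) / d)) = (LBINT s:{0..\<tau>}. F s)"
proof -
  have "(LBINT s:{a..a + \<tau> * d}. (1 / d) *\<^sub>R F ((s - a) / d)) =
    \<bar>d\<bar> *\<^sub>R (\<integral>s. indicator {a..a + \<tau> * d} (a + d * s) *\<^sub>R ((1 / d) *\<^sub>R F ((a + d * s - a) / d)) \<partial>lborel)"
    unfolding set_lebesgue_integral_def using d by (intro lborel_integral_real_affine) simp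
  also have "\<dots> = (\<integral>s. d *\<^sub>R (indicator {a..a + \<tau> * d} (a + d * s) *\<^sub>R ((1 / d) *\<^sub>R F s)) \<partial>lborel)"
    unfolding integral_scaleR_right using d by simp
  also have "\<dots> = (LBINT s:{0..\<tau>}. F s)"
    unfolding set_lebesgue_integral_def
  proof (intro Bochner_Integration.integral_cong refl)
    fix s
    have "a + d * s \<in> {a..a + \<tau> * d} \<longleftrightarrow> s \<in> {0..\<tau>}" using d by (simp add: zero_le_mult_iff mult.commute[of \<tau>])
    then show "d *\<^sub>R (indicat_real {a..a + \<tau> * d} (a + d * s) *\<^sub>R ((1 / d) *\<^sub>R F s)) = indicat_real {0..\<tau>} s *\<^sub>R F s"
      using d by (simp add: indicator_def)
  qed
  finally show ?thesis .
qed

context quantile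
begin

lemma set_integrable_bounded_S:
  fixes H :: "real \<Rightarrow> 'e::{banach, second_countable_topology}"
  assumes "H \<in> borel_measurable borel" "\<And>s. norm (H s) \<le> B"
  shows "set_integrable lborel {a..b} H"
  using assms by (intro set_integrable_bounded) auto

lemma \<sigma>_at_left: "(\<sigma> \<longlongrightarrow> \<sigma>m r) (at_left r)"
proof (rule order_tendstoI)
  fix a assume "a < \<sigma>m r"
  then have "\<forall>\<^sub>F n in sequentially. a < \<sigma> (r - 1 / real (Suc n))" by (rule order_tendstoD(1)[OF \<sigma>m_left])
  then obtain n where n: "a < \<sigma> (r - 1 / real (Suc n))" by (auto dest: eventually_happens)
  have "r - 1 / real (Suc n) < r" by simp
  then have "\<forall>\<^sub>F r' in at_left r. r - 1 / real (Suc n) < r'" by (rule order_tendstoD(1)[OF tendsto_ident_at])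
  then show "\<forall>\<^sub>F r' in at_left r. a < \<sigma> r'"
    by (rule eventually_mono) (rule less_le_trans[OF n \<sigma>_mono], simp)
next
  fix a assume "\<sigma>m r < a"
  have "\<forall>\<^sub>F r' in at_left r. r' < r" by (simp add: eventually_at_filter)
  then show "\<forall>\<^sub>F r' in at_left r. \<sigma> r' < a"
    by (rule eventually_mono) (rule le_less_trans[OF \<sigma>_le_\<sigma>m \<open>\<sigma>m r < a\<close>])
qed

text \<open>The atom at \<open>0\<close> is listed separately, because the corresponding jump is performed at the node, before the interior jumps are summed.\<close>
lemma split_atoms:
  fixes H :: "real \<Rightarrow> 'e::{banach, second_countable_topology}"
  assumes H: "H \<in> borel_measurable borel" "\<And>s. norm (H s) \<le> B" and r: "r \<in> {0..h}"
  shows "(LBINT s:{0..\<sigma> r}. H s) =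
    (LBINT s:{s\<in>{0..S}. \<phi> s \<in> {0..r} - R}. H s) + (LBINT s:{\<sigma>m 0..\<sigma> 0}. H s)
    + (\<Sum>\<^sub>\<infinity>r'\<in>{0<..r}. LBINT s:{\<sigma>m r'..\<sigma> r'}. H s)"
proof -
  have i: "set_integrable lborel {0..S} H" using H by (rule set_integrable_bounded_S)
  let ?J = "\<lambda>r. LBINT s:{\<sigma>m r..\<sigma> r}. H s"
  have m: "{s\<in>{0..S}. \<phi> s \<in> A} \<in> sets lborel" if "A \<in> sets borel" for A using that by measurable
  have "{0..\<sigma> r} = {s\<in>{0..S}. \<phi> s \<in> {0..r} - R} \<union> {s\<in>{0..S}. \<phi> s \<in> R \<inter> {0..r}}"
    unfolding sublevel[OF r, symmetric] using \<phi>_range by auto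
  moreover have "(LBINT s:{s\<in>{0..S}. \<phi> s \<in> {0..r} - R} \<union> {s\<in>{0..S}. \<phi> s \<in> R \<inter> {0..r}}. H s) =
     (LBINT s:{s\<in>{0..S}. \<phi> s \<in> {0..r} - R}. H s) + (LBINT s:{s\<in>{0..S}. \<phi> s \<in> R \<inter> {0..r}}. H s)"
    by (rule set_integral_Un) (auto intro!: set_integrable_subset[OF i] m)
  moreover have "(LBINT s:{s\<in>{0..S}. \<phi> s \<in> R \<inter> {0..r}}. H s) = ?J 0 + (\<Sum>\<^sub>\<infinity>r'\<in>{0<..r}. ?J r')"
  proof (rule has_sum_unique)
    show "(?J has_sum (LBINT s:{s\<in>{0..S}. \<phi> s \<in> R \<inter> {0..r}}. H s)) {0..r}"
      using r by (intro jump_sum i) auto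
    have "(?J has_sum (LBINT s:{s\<in>{0..S}. \<phi> s \<in> R \<inter> {0<..r}}. H s)) {0<..r}"
      using r by (intro jump_sum i) auto
    from this this[THEN infsumI] have "(?J has_sum (\<Sum>\<^sub>\<infinity>r'\<in>{0<..r}. ?J r')) {0<..r}" by (simp only:)
    then have "(?J has_sum (?J 0 + (\<Sum>\<^sub>\<infinity>r'\<in>{0<..r}. ?J r'))) (insert 0 {0<..r})"
      by (intro has_sum_insert) auto
    moreover have "insert 0 {0<..r} = {0..r}" using r by auto
    ultimately show "(?J has_sum (?J 0 + (\<Sum>\<^sub>\<infinity>r'\<in>{0<..r}. ?J r'))) {0..r}" by simp
  qed
  ultimately show ?thesis by (simp add: add.assoc)
qed

text \<open>A path given as an integral over the non-atoms plus a sum of jumps is an integral of one function \<open>H\<close> in the parameter of the quantile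
  function. Here \<open>A0 r\<close> and \<open>A1 r\<close> are the values before and after the jump at \<open>r\<close>, and \<open>H\<close> performs this jump on
  \<open>[\<sigma>m r, \<sigma> r]\<close>. The values \<open>A0 r\<close> follow by passing to the left limit, as \<open>\<sigma>\<close> has the left limit \<open>\<sigma>m r\<close>.\<close>
lemma path_representation:
  fixes H :: "real \<Rightarrow> 'e::{banach, second_countable_topology}" and z :: "real \<Rightarrow> 'e" and A0 A1 :: "real \<Rightarrow> 'e"
  assumes H: "H \<in> borel_measurable borel" "\<And>s. norm (H s) \<le> B"
    and J: "\<And>r. r \<in> {0..h} \<Longrightarrow> A1 r - A0 r = (LBINT s:{\<sigma>m r..\<sigma> r}. H s)"
    and left: "\<And>r. r \<in> {0<..h} \<Longrightarrow> A0 r = left_lim z (r + a)"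
    and z: "\<And>r. r \<in> {0<..<h} \<Longrightarrow> z (r + a) = A1 0 + (LBINT s:{s\<in>{0..S}. \<phi> s \<in> {0..r} - R}. H s)
      + (\<Sum>\<^sub>\<infinity>r'\<in>{0<..r}. A1 r' - left_lim z (r' + a))"
  shows "\<And>r. r \<in> {0<..<h} \<Longrightarrow> z (r + a) = A0 0 + (LBINT s:{0..\<sigma> r}. H s)"
    and "\<And>r. r \<in> {0..h} \<Longrightarrow> A0 r = A0 0 + (LBINT s:{0..\<sigma>m r}. H s)"
    and "\<And>r. r \<in> {0..h} \<Longrightarrow> A1 r = A0 0 + (LBINT s:{0..\<sigma> r}. H s)"
proof -
  show 1: "z (r + a) = A0 0 + (LBINT s:{0..\<sigma> r}. H s)" if r: "r \<in> {0<..<h}" for r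
  proof -
    have "(\<Sum>\<^sub>\<infinity>r'\<in>{0<..r}. A1 r' - left_lim z (r' + a)) = (\<Sum>\<^sub>\<infinity>r'\<in>{0<..r}. LBINT s:{\<sigma>m r'..\<sigma> r'}. H s)"
    proof (rule infsum_cong)
      fix r' assume "r' \<in> {0<..r}"
      then have "r' \<in> {0<..h}" "r' \<in> {0..h}" using r by auto
      then show "A1 r' - left_lim z (r' + a) = (LBINT s:{\<sigma>m r'..\<sigma> r'}. H s)" using J[of r'] left[of r'] by metis
    qed
    moreover have "A1 0 = A0 0 + (LBINT s:{\<sigma>m 0..\<sigma> 0}. H s)" using J[of 0] h by (simp add: algebra_simps)
    ultimately show ?thesis using r by (subst z[OF r], subst split_atoms[OF H]) auto
  qed
  show 2: "A0 r = A0 0 + (LBINT s:{0..\<sigma>m r}. H s)" if r: "r \<in> {0..h}" for r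
  proof (cases "r = 0")
    case False
    then have r': "0 < r" "r \<le> h" using r by auto
    let ?I = "\<lambda>s. A0 0 + (LBINT s:{0..s}. H s)"
    have cont: "continuous_on {0..} ?I" by (intro continuous_intros continuous_indefinite_integral[OF H])
    have "((\<lambda>r. ?I (\<sigma> r)) \<longlongrightarrow> ?I (\<sigma>m r)) (at_left r)"
      by (rule continuous_on_tendsto_compose[OF cont \<sigma>_at_left]) (simp_all add: \<sigma>m_nonneg \<sigma>_nonneg)
    moreover have "\<forall>\<^sub>F r'' in at_left r. ?I (\<sigma> r'') = z (r'' + a)"
    proof -
      have "\<forall>\<^sub>F r'' in at_left r. 0 < r''" using r'(1) by (rule order_tendstoD(1)[OF tendsto_ident_at])
      moreover have "\<forall>\<^sub>F r'' in at_left r. r'' < r" by (simp add: eventually_at_filter)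
      ultimately show ?thesis by eventually_elim (use 1 r' in simp)
    qed
    ultimately have lim: "((\<lambda>r''. z (r'' + a)) \<longlongrightarrow> ?I (\<sigma>m r)) (at_left r)" by (rule Lim_transform_eventually)
    have "(z \<longlongrightarrow> ?I (\<sigma>m r)) (at_left (r + a))"
    proof -
      have "((\<lambda>t. t - a) \<longlongrightarrow> (r + a) - a) (at_left (r + a))" by (intro tendsto_intros)
      then have "filterlim (\<lambda>t. t - a) (at_left r) (at_left (r + a))"
        unfolding filterlim_at by (simp add: eventually_at_filter)
      from filterlim_compose[OF lim this] show ?thesis by simp
    qed
    then have "left_lim z (r + a) = ?I (\<sigma>m r)" unfolding left_lim_def by (intro tendsto_Lim) auto
    then show ?thesis using left[of r] r' by simp
  qed (simp add: \<sigma>m_0)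
  show "A1 r = A0 0 + (LBINT s:{0..\<sigma> r}. H s)" if r: "r \<in> {0..h}" for r
  proof -
    have "(LBINT s:{0..\<sigma> r}. H s) = (LBINT s:{0..\<sigma>m r}. H s) + (LBINT s:{\<sigma>m r..\<sigma> r}. H s)"
      by (rule set_integral_Icc_add[OF set_integrable_bounded_S[OF H]]) (simp_all add: \<sigma>m_nonneg \<sigma>m_le)
    then show ?thesis using J[OF r] 2[OF r] by (simp add: algebra_simps)
  qed
qed

end

lemma set_integral_cong_on:
  "(\<And>s. s \<in> A \<Longrightarrow> F s = G s) \<Longrightarrow> (LINT s:A|M. F s) = (LINT s:A|M. G s)"
  unfolding set_lebesgue_integral_def by (rule Bochner_Integration.integral_cong) (auto simp: indicator_def)

context impulse
begin

subsection \<open>Borel versions of the attached controls\<close>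

definition control_version where
  "control_version r l F \<longleftrightarrow> F \<in> borel_measurable borel \<and> (\<forall>s. F s \<in> K) \<and> (\<forall>s. norm1 (F s) \<le> \<Delta> r) \<and>
    (AE s in lebesgue. s \<in> {0..1} \<longrightarrow> \<omega> r l s = F s)"

lemma borel_control_exists:
  assumes r: "r \<in> {0..h}" and l: "l \<in> {1..N}"
  shows "\<exists>F. control_version r l F"
proof -
  obtain F where F[measurable]: "F \<in> borel_measurable borel" and ae: "AE s in lebesgue. s \<in> {0..1} \<longrightarrow> \<omega> r l s = F s"
    using borel_version[OF \<omega>_meas[OF r l]] by auto
  define F' where "F' s = (if F s \<in> K \<and> norm1 (F s) \<le> \<Delta> r then F s else 0)" for s
  note [measurable] = borel_closed[OF K_closed]
  have "F' \<in> borel_measurable borel" unfolding F'_def[abs_def] by measurable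
  moreover have "F' s \<in> K" for s by (simp add: F'_def zero_in_K)
  moreover have "norm1 (F' s) \<le> \<Delta> r" for s using \<Delta>_nonneg[of r] by (simp add: F'_def) (simp add: norm1_def)
  moreover have "AE s in lebesgue. s \<in> {0..1} \<longrightarrow> (\<Sum>l=1..N. norm1 (\<omega> r l s)) = \<Delta> r"
    using \<omega>_const[OF r] by (simp add: AE_restrict_space_iff \<Delta>_def)
  then have "AE s in lebesgue. s \<in> {0..1} \<longrightarrow> \<omega> r l s = F' s"
    using ae
  proof eventually_elim
    case (elim s)
    show ?case
    proof
      assume s: "s \<in> {0..1}"
      have "norm1 (\<omega> r l s) \<le> (\<Sum>l=1..N. norm1 (\<omega> r l s))" using l by (intro member_le_sum) auto
      then show "\<omega> r l s = F' s" using elim s \<omega>_K[OF r l s] by (simp add: F'_def)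
    qed
  qed
  ultimately show ?thesis unfolding control_version_def by blast
qed

text \<open>The Borel version of the attached control \<open>\<omega> r l\<close> on the whole line, with values in \<open>K\<close> and bounded by \<open>\<Delta> r\<close> everywhere. It is zero for \<open>l\<close>
  outside \<open>[1, N]\<close>, which agrees with the padding in the conditions at the nodes.\<close>
definition om where "om r l = (if r \<in> {0..h} \<and> l \<in> {1..N} then SOME F. control_version r l F else (\<lambda>_. 0))"

lemma om_spec: assumes "r \<in> {0..h}" "l \<in> {1..N}" shows "control_version r l (om r l)"
  using someI_ex[OF borel_control_exists[OF assms]] assms by (simp add: om_def)

lemma om_meas [measurable]: "om r l \<in> borel_measurable borel" and om_K: "om r l s \<in> K" and om_bound: "norm1 (om r l s) \<le> \<Delta> r"
proof -
  show "om r l \<in> borel_measurable borel"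
    using om_spec[of r l, unfolded control_version_def] by (cases "r \<in> {0..h} \<and> l \<in> {1..N}") (auto simp: om_def)
  show "om r l s \<in> K"
    using om_spec[of r l, unfolded control_version_def] by (cases "r \<in> {0..h} \<and> l \<in> {1..N}") (auto simp: om_def zero_in_K)
  have "norm1 (0 :: real ^ 'm) = 0" by (simp add: norm1_def)
  then show "norm1 (om r l s) \<le> \<Delta> r"
    using om_spec[of r l, unfolded control_version_def] \<Delta>_nonneg[of r] by (cases "r \<in> {0..h} \<and> l \<in> {1..N}") (auto simp: om_def)
qed

lemmas om_AE = om_spec[unfolded control_version_def, THEN conjunct2, THEN conjunct2, THEN conjunct2]

lemma om_trivial: assumes "r \<in> {0..h}" "r \<notin> R" shows "om r l s = 0"
proof -
  have "\<Delta> r = 0" using assms R_iff[of r] \<Delta>_nonneg[of r] by simp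
  then have "norm (om r l s) \<le> 0" using om_bound[of r l s] norm_le_norm1[of "om r l s"] by linarith
  then show ?thesis by simp
qed

lemma om_integral:
  fixes c :: "real ^ 'm \<Rightarrow> 'e::{banach, second_countable_topology}"
  assumes r: "r \<in> {0..h}" and l: "l \<in> {1..N}" and c: "continuous_on UNIV c"
  shows "(LINT s:{0..1}|lebesgue. c (\<omega> r l s)) = (LBINT s:{0..1}. c (om r l s))"
proof (rule set_integral_lebesgue_AE)
  show "(\<lambda>s. c (\<omega> r l s)) \<in> borel_measurable (lebesgue_on {0..1})"
    by (rule borel_measurable_continuous_on[OF c \<omega>_meas[OF r l]])
  show "(\<lambda>s. c (om r l s)) \<in> borel_measurable borel"
    by (rule borel_measurable_continuous_on[OF c om_meas])
  show "AE s in lebesgue. s \<in> {0..1} \<longrightarrow> c (\<omega> r l s) = c (om r l s)"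
    by (rule AE_mp[OF om_AE[OF r l]]) (auto intro!: AE_I2)
qed simp

lemma norm1_continuous: "continuous_on UNIV (norm1 :: real ^ 'm \<Rightarrow> real)"
  unfolding norm1_def by (intro continuous_intros)

lemmas om_norm_integral = om_integral[OF _ _ norm1_continuous]
  and om_vector_integral = om_integral[OF _ _ continuous_on_id]

subsection \<open>The attached arcs\<close>

lemmas arcs_conj = arcs[unfolded attached_arcs_def]
lemmas arcs_past = arcs_conj[THEN conjunct1, THEN bspec, THEN bspec]
  and arcs_pos = arcs_conj[THEN conjunct2, THEN bspec, THEN bspec]
lemmas \<theta>_past = arcs_past[THEN conjunct1]
  and \<zeta>_past0 = arcs_past[THEN conjunct2, THEN conjunct1]
  and \<zeta>_past = arcs_past[THEN conjunct2, THEN conjunct2, THEN bspec]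
  and \<zeta>_init = arcs_pos[THEN conjunct1]
  and \<theta>_init = arcs_pos[THEN conjunct2, THEN conjunct1]
  and \<zeta>_W11 = arcs_pos[THEN conjunct2, THEN conjunct2, THEN conjunct1]
  and \<theta>_eq = arcs_pos[THEN conjunct2, THEN conjunct2, THEN conjunct2, THEN bspec]

text \<open>The history, continued by constants.\<close>
definition \<xi> where "\<xi> t = \<xi>0 (max (- real M * h) (min t 0))"

lemma \<xi>_eq: "t \<in> {- real M * h..0} \<Longrightarrow> \<xi> t = \<xi>0 t"
  by (simp add: \<xi>_def)

lemma Mh: "0 \<le> real M * h" using h_pos by simp

lemma \<xi>_continuous: "continuous_on UNIV \<xi>"
  unfolding \<xi>_def[abs_def]
  by (rule continuous_on_compose2[OF \<xi>0]) (use Mh in \<open>auto intro!: continuous_intros\<close>)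

lemma \<xi>_uniformly_continuous: "uniformly_continuous_on UNIV \<xi>"
proof -
  have u: "uniformly_continuous_on {- real M * h..0} \<xi>0" by (rule compact_uniformly_continuous[OF \<xi>0]) simp
  show ?thesis
    unfolding uniformly_continuous_on_def
  proof (intro allI impI)
    fix e :: real assume "e > 0"
    then obtain d where d: "d > 0" "\<And>t t'. t \<in> {- real M * h..0} \<Longrightarrow> t' \<in> {- real M * h..0} \<Longrightarrow> dist t' t < d \<Longrightarrow> dist (\<xi>0 t') (\<xi>0 t) < e"
      using u unfolding uniformly_continuous_on_def by meson
    have "dist (\<xi> t') (\<xi> t) < e" if "dist t' t < d" for t t'
      unfolding \<xi>_def using Mh that by (intro d(2)) (auto simp: dist_real_def max_def min_def abs_if split: if_splits)
    then show "\<exists>d>0. \<forall>t\<in>UNIV. \<forall>t'\<in>UNIV. dist t' t < d \<longrightarrow> dist (\<xi> t') (\<xi> t) < e" using d(1) by blast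
  qed
qed

lemma \<xi>_bounded: "bounded (range \<xi>)"
proof (rule bounded_subset)
  show "bounded (\<xi>0 ` {- real M * h..0})" by (intro compact_imp_bounded compact_continuous_image[OF \<xi>0]) simp
  show "range \<xi> \<subseteq> \<xi>0 ` {- real M * h..0}" unfolding \<xi>_def using Mh by auto
qed

text \<open>The attached arcs with a uniform meaning for indices \<open>l \<le> 0\<close>. They differ from the arcs of the definition only for \<open>r = h\<close>, \<open>l = 0\<close>
  at the parameter 1, where the prescribed value is the initial state instead of the end of the history.\<close>
definition arc where "arc r s l = (if l \<le> 0 then \<xi> (r + (real_of_int l - 1) * h) else \<zeta> r l (max 0 (min 1 s)))"

lemma \<zeta>_continuous: assumes r: "r \<in> {0..h}" and l: "l \<in> {1..N}" shows "continuous_on {0..1} (\<zeta> r (int l))"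
proof -
  let ?w = "\<lambda>s. \<Sum>j\<in>UNIV. (\<omega> r l s $ j) *\<^sub>R g j (r + node h l, shifted lag (\<lambda>l'. \<zeta> r l' s) (int l))"
  note W = \<zeta>_W11[OF r l, unfolded W11_deriv_def]
  have "?w absolutely_integrable_on {0..1}" using W by simp
  then have i: "?w integrable_on {0..1}" by (rule set_lebesgue_integral_eq_integral)
  have c: "continuous_on {0..1} (\<lambda>t. \<zeta> r (int l) 0 + integral {0..t} ?w)"
    by (intro continuous_intros indefinite_integral_continuous_1 i)
  have "\<zeta> r (int l) t = \<zeta> r (int l) 0 + integral {0..t} ?w" if "t \<in> {0..1}" for t
  proof -
    have "set_integrable lebesgue {0..t} ?w" by (rule set_integrable_subset[OF W[THEN conjunct1]]) (use that in auto)
    then have "(LINT s:{0..t}|lebesgue. ?w s) = integral {0..t} ?w" by (rule set_lebesgue_integral_eq_integral(2))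
    moreover have "\<zeta> r (int l) t = \<zeta> r (int l) 0 + (LINT s:{0..t}|lebesgue. ?w s)" by (rule W[THEN conjunct2, THEN bspec, OF that])
    ultimately show ?thesis by (simp only:)
  qed
  note eq = this
  show ?thesis by (rule continuous_on_eq[OF c]) (simp only: eq)
qed

lemma arc_continuous: assumes r: "r \<in> {0..h}" and l: "l \<le> int N" shows "continuous_on UNIV (\<lambda>s. arc r s l)"
proof (cases "l \<le> 0")
  case False
  then have n: "nat l \<in> {1..N}" "int (nat l) = l" using l by auto
  have "continuous_on UNIV (\<lambda>s. \<zeta> r (int (nat l)) (max 0 (min 1 s)))"
    by (rule continuous_on_compose2[OF \<zeta>_continuous[OF r n(1)]]) (auto intro!: continuous_intros)
  then show ?thesis using False n(2) by (simp add: arc_def)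
qed (simp add: arc_def)

lemma arc_eq: assumes r: "r \<in> {0..h}" and s: "s \<in> {0..<1}" and l: "1 - int M \<le> l" shows "\<zeta> r l s = arc r s l"
proof (cases "l \<le> 0")
  case True
  then have M: "M \<ge> 1" using l by auto
  have s': "s \<in> {0..1}" "s < 1" using s by auto
  have "- real M * h \<le> (real_of_int l - 1) * h"
  proof (rule mult_right_mono)
    have "- int M \<le> l - 1" using l by simp
    then have "real_of_int (- int M) \<le> real_of_int (l - 1)" by (simp only: of_int_le_iff)
    then show "- real M \<le> real_of_int l - 1" by simp
  qed (use h_pos in simp)
  moreover have "(real_of_int l - 1) * h \<le> - 1 * h" using True h_pos by (intro mult_right_mono) auto
  ultimately have "r + (real_of_int l - 1) * h \<in> {- real M * h..0}" using r by auto
  then have x: "\<xi> (r + (real_of_int l - 1) * h) = \<xi>0 (r + (real_of_int l - 1) * h)" by (rule \<xi>_eq)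
  show ?thesis
  proof (cases "l = 0")
    case True
    then show ?thesis using x s'(2) \<zeta>_past0[OF r s'(1)] by (simp add: arc_def)
  next
    case False
    then have "nat (- l) \<in> {1..M - 1}" and l': "l = - int (nat (- l))" using True l by auto
    from \<zeta>_past[OF r s'(1) this(1)] have "\<zeta> r l s = \<xi>0 (r - (real_of_int (- l) + 1) * h)" using True by simp
    also have "r - (real_of_int (- l) + 1) * h = r + (real_of_int l - 1) * h" by (simp add: algebra_simps)
    finally show ?thesis using x True by (simp add: arc_def)
  qed
qed (use s in \<open>simp add: arc_def min_def\<close>)

lemma lag_range: "l \<in> {1..N} \<Longrightarrow> 1 - int M \<le> int l - int (lag k)" "l \<in> {1..N} \<Longrightarrow> int l - int (lag k) \<le> int N"
  using lag[of k] by auto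

definition jump_field where
  "jump_field r l s = (\<Sum>j\<in>UNIV. (om r l s $ j) *\<^sub>R g j (r + node h l, shifted lag (arc r s) (int l)))"

lemma jump_field_measurable: assumes r: "r \<in> {0..h}" and l: "l \<in> {1..N}" shows "jump_field r l \<in> borel_measurable borel"
proof -
  have "continuous_on UNIV (\<lambda>s. (r + node h l, shifted lag (arc r s) (int l)))"
    unfolding shifted_def using arc_continuous[OF r lag_range(2)[OF l]] by (intro continuous_intros)
  then have "continuous_on UNIV (\<lambda>s. g j (r + node h l, shifted lag (arc r s) (int l)))" for j
    by (rule continuous_on_compose2[OF C1_map_continuous[OF g(2)]]) simp
  then have "(\<lambda>s. g j (r + node h l, shifted lag (arc r s) (int l))) \<in> borel_measurable borel" for j
    by (rule borel_measurable_continuous_onI)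
  then show ?thesis unfolding jump_field_def[abs_def]
    by (intro borel_measurable_sum borel_measurable_scaleR component_measurable om_meas)
qed

text \<open>The exceptional parameter 1 and the change to Borel versions affect null sets only.\<close>
lemma \<zeta>_integral:
  assumes r: "r \<in> {0..h}" and l: "l \<in> {1..N}" and \<tau>: "\<tau> \<in> {0..1}"
  shows "\<zeta> r (int l) \<tau> = \<zeta> r (int l) 0 + (LBINT s:{0..\<tau>}. jump_field r l s)"
proof -
  let ?w = "\<lambda>s. \<Sum>j\<in>UNIV. (\<omega> r l s $ j) *\<^sub>R g j (r + node h l, shifted lag (\<lambda>l'. \<zeta> r l' s) (int l))"
  note W = \<zeta>_W11[OF r l, unfolded W11_deriv_def]
  have "(LINT s:{0..\<tau>}|lebesgue. ?w s) = (LBINT s:{0..\<tau>}. jump_field r l s)"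
  proof (rule set_integral_lebesgue_AE)
    have "set_integrable lebesgue {0..\<tau>} ?w" by (rule set_integrable_subset[OF W[THEN conjunct1]]) (use \<tau> in auto)
    then show "?w \<in> borel_measurable (lebesgue_on {0..\<tau>})"
      by (subst borel_measurable_restrict_space_iff) (auto simp: set_integrable_def)
    have "AE s in lborel. s \<noteq> 1" by (rule AE_lborel_singleton)
    then have "AE s in lebesgue. s \<noteq> (1::real)" by (rule AE_completion)
    then show "AE s in lebesgue. s \<in> {0..\<tau>} \<longrightarrow> ?w s = jump_field r l s"
      using om_AE[OF r l]
    proof eventually_elim
      case (elim s)
      show ?case
      proof
        assume "s \<in> {0..\<tau>}"
        then have s: "s \<in> {0..<1}" "s \<in> {0..1}" using elim(1) \<tau> by auto
        have "shifted lag (\<lambda>l'. \<zeta> r l' s) (int l) = shifted lag (arc r s) (int l)"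
          unfolding shifted_def using arc_eq[OF r s(1) lag_range(1)[OF l]] by simp
        then show "?w s = jump_field r l s" using elim(2) s(2) by (simp add: jump_field_def)
      qed
    qed
  qed (use jump_field_measurable[OF r l] in auto)
  moreover have "\<zeta> r (int l) \<tau> = \<zeta> r (int l) 0 + (LINT s:{0..\<tau>}|lebesgue. ?w s)" by (rule W[THEN conjunct2, THEN bspec, OF \<tau>])
  ultimately show ?thesis by (simp only:)
qed

lemma \<theta>_integral:
  assumes r: "r \<in> {0..h}" and l: "l \<in> {1..N}"
  shows "\<theta> r (int l) 1 = \<theta> r (int l) 0 + (LBINT s:{0..1}. norm1 (om r l s))"
  using \<theta>_eq[OF r l, of 1] om_norm_integral[OF r l] by simp

end

context quantile
begin

text \<open>A countable partition into the fibres of the atoms and the rest.\<close>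
lemma fibrewise_measurable:
  fixes F :: "real \<Rightarrow> real \<Rightarrow> 'e::topological_space"
  assumes F: "\<And>r. r \<in> R \<Longrightarrow> F r \<in> borel_measurable borel" and G: "G \<in> borel_measurable borel"
  shows "(\<lambda>s. if \<phi> s \<in> R then F (\<phi> s) s else G s) \<in> borel_measurable borel"
proof (rule measurable_piecewise_restrict)
  let ?C = "insert {s. \<phi> s \<notin> R} ((\<lambda>r. {s. \<phi> s = r}) ` R)"
  show "countable ?C" using countable_R by simp
  have "{s. \<phi> s \<notin> R} \<in> sets borel" "{s. \<phi> s = r} \<in> sets borel" for r by measurable
  then show "\<Omega> \<inter> space borel \<in> sets borel" if "\<Omega> \<in> ?C" for \<Omega> using that by auto
  show "space borel \<subseteq> \<Union> ?C" by auto
  fix \<Omega> assume \<Omega>: "\<Omega> \<in> ?C"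
  show "(\<lambda>s. if \<phi> s \<in> R then F (\<phi> s) s else G s) \<in> borel_measurable (restrict_space borel \<Omega>)"
  proof (cases "\<Omega> = {s. \<phi> s \<notin> R}")
    case True
    have "G \<in> borel_measurable (restrict_space borel \<Omega>)" by (rule measurable_restrict_space1[OF G])
    then show ?thesis
      by (rule measurable_cong[THEN iffD2, rotated]) (simp add: space_restrict_space True)
  next
    case False
    then obtain r where r: "r \<in> R" "\<Omega> = {s. \<phi> s = r}" using \<Omega> by auto
    have "F r \<in> borel_measurable (restrict_space borel \<Omega>)" by (rule measurable_restrict_space1[OF F[OF r(1)]])
    then show ?thesis
      by (rule measurable_cong[THEN iffD2, rotated]) (use r in \<open>simp add: space_restrict_space\<close>)
  qed
qed

end

context impulse
begin

subsection \<open>The completed control and path on one delay interval\<close>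

text \<open>The impulse path, set to zero outside its domain so as to be Borel on the line.\<close>
definition xh where "xh t = (if t \<in> {- real M * h..T} then x t else 0)"

lemma xh_measurable [measurable]: "xh \<in> borel_measurable borel"
  using bounded_variation_borel[OF BV] by (simp add: xh_def[abs_def])

text \<open>At an atom \<open>r\<close> the interval \<open>[\<sigma>m r, \<sigma> r]\<close> has length \<open>\<Delta> r\<close>, and \<open>loc\<close> maps it onto \<open>[0, 1]\<close>. There the completed control \<open>w\<close>
  and path \<open>yl\<close> on piece \<open>l\<close> follow the attached controls and arcs; elsewhere they are given by the density \<open>\<kappa>\<close> and by the
  impulse path. \<open>H\<close> is the resulting velocity.\<close>
definition loc where "loc s = (s - \<sigma>m (\<phi> s)) / \<Delta> (\<phi> s)"
definition w where "w l s = (if \<phi> s \<in> R then (1 / \<Delta> (\<phi> s)) *\<^sub>R om (\<phi> s) l (loc s) else \<kappa> l (\<phi> s))"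
definition yl where "yl l s = (if \<phi> s \<in> R then arc (\<phi> s) (loc s) l
  else if l \<le> 0 then \<xi> (\<phi> s + (real_of_int l - 1) * h) else xh (\<phi> s + (real_of_int l - 1) * h))"
definition H where "H l s = p0 (\<phi> s) *\<^sub>R f (\<phi> s + node h l, shifted lag (\<lambda>l'. yl l' s) (int l))
  + (\<Sum>j\<in>UNIV. (w l s $ j) *\<^sub>R g j (\<phi> s + node h l, shifted lag (\<lambda>l'. yl l' s) (int l)))"

lemma yl_past: "l \<le> 0 \<Longrightarrow> yl l s = \<xi> (\<phi> s + (real_of_int l - 1) * h)"
  by (simp add: yl_def arc_def)

lemma R_Icc: "r \<in> R \<Longrightarrow> r \<in> {0..h}" using R_subset by blast

lemma w_measurable: assumes l: "l \<in> {1..N}" shows "w l \<in> borel_measurable borel"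
proof -
  note [measurable] = \<kappa>_meas[OF l]
  show ?thesis
    unfolding w_def[abs_def] loc_def
    by (rule fibrewise_measurable[where F = "\<lambda>r s. (1 / \<Delta> r) *\<^sub>R om r l ((s - \<sigma>m r) / \<Delta> r)" and G = "\<lambda>s. \<kappa> l (\<phi> s)"]) measurable
qed

lemma yl_measurable: assumes l: "l \<le> int N" shows "yl l \<in> borel_measurable borel"
  unfolding yl_def[abs_def] loc_def
proof (rule fibrewise_measurable[where F = "\<lambda>r s. arc r ((s - \<sigma>m r) / \<Delta> r) l"])
  fix r assume "r \<in> R"
  then have "continuous_on UNIV (\<lambda>s. arc r s l)" by (intro arc_continuous[OF R_Icc l])
  then show "(\<lambda>s. arc r ((s - \<sigma>m r) / \<Delta> r) l) \<in> borel_measurable borel"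
    by (rule borel_measurable_continuous_on) simp
next
  have [measurable]: "\<xi> \<in> borel_measurable borel" by (rule borel_measurable_continuous_onI[OF \<xi>_continuous])
  show "(\<lambda>s. if l \<le> 0 then \<xi> (\<phi> s + (real_of_int l - 1) * h) else xh (\<phi> s + (real_of_int l - 1) * h)) \<in> borel_measurable borel"
    by measurable
qed

lemma shifted_measurable: assumes l: "l \<in> {1..N}" shows "(\<lambda>s. shifted lag (\<lambda>l'. yl l' s) (int l)) \<in> borel_measurable borel"
  unfolding shifted_def using yl_measurable[OF lag_range(2)[OF l]] by (intro borel_measurable_vec_lambda)

lemma field_measurable:
  assumes F: "C1_map F" and l: "l \<in> {1..N}"
  shows "(\<lambda>s. F (\<phi> s + node h l, shifted lag (\<lambda>l'. yl l' s) (int l))) \<in> borel_measurable borel"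
proof -
  note [measurable] = shifted_measurable[OF l]
  have "(\<lambda>s. (\<phi> s + node h l, shifted lag (\<lambda>l'. yl l' s) (int l))) \<in> borel_measurable borel"
    by (intro borel_measurable_Pair) measurable
  then show ?thesis by (rule borel_measurable_continuous_on[OF C1_map_continuous[OF F]])
qed

lemma H_measurable: assumes l: "l \<in> {1..N}" shows "H l \<in> borel_measurable borel"
proof -
  note [measurable] = field_measurable[OF f(2) l] field_measurable[OF g(2) l] w_measurable[OF l]
  show ?thesis unfolding H_def[abs_def] by measurable
qed

lemma w_K: "w l s \<in> K"
  using \<Delta>_nonneg[of "\<phi> s"] om_K \<kappa>_K K_cone by (auto simp: w_def cone_def)

lemma w_bound: assumes l: "l \<in> {1..N}" shows "norm1 (w l s) \<le> CARD('m)"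
proof (cases "\<phi> s \<in> R")
  case True
  then have "\<Delta> (\<phi> s) > 0" using R_iff[OF R_Icc] by blast
  then have "norm1 (w l s) = (1 / \<Delta> (\<phi> s)) * norm1 (om (\<phi> s) l (loc s))"
    using True by (simp add: w_def norm1_def abs_mult sum_distrib_left sum_divide_distrib)
  also have "\<dots> \<le> (1 / \<Delta> (\<phi> s)) * \<Delta> (\<phi> s)"
    using \<open>\<Delta> (\<phi> s) > 0\<close> om_bound by (intro mult_left_mono) auto
  also have "\<dots> = 1" using \<open>\<Delta> (\<phi> s) > 0\<close> by simp
  also have "1 \<le> real CARD('m)" by (simp add: Suc_leI)
  finally show ?thesis .
qed (use \<kappa>_bound[OF l] in \<open>simp add: w_def\<close>)

lemma H_bound: "\<exists>B. \<forall>l\<in>{1..N}. \<forall>s. norm (H l s) \<le> B"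
proof -
  obtain Bf where Bf: "\<And>z. norm (f z) \<le> Bf" using f(1) unfolding bounded_iff by auto
  have "\<forall>j. \<exists>Bg. \<forall>z. norm (g j z) \<le> Bg" using g(1) unfolding bounded_iff by auto
  then obtain Bg where Bg: "\<And>j z. norm (g j z) \<le> Bg j" by metis
  have "norm (H l s) \<le> Bf + (\<Sum>j\<in>UNIV. real CARD('m) * Bg j)" if l: "l \<in> {1..N}" for l s
    unfolding H_def
  proof (intro norm_triangle_mono order_trans[OF norm_sum] sum_mono)
    let ?z = "(\<phi> s + node h l, shifted lag (\<lambda>l'. yl l' s) (int l))"
    have "norm (p0 (\<phi> s) *\<^sub>R f ?z) \<le> 1 * Bf"
      unfolding norm_scaleR using p0_bounds[of "\<phi> s"] Bf[of ?z] by (intro mult_mono) auto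
    then show "norm (p0 (\<phi> s) *\<^sub>R f ?z) \<le> Bf" by simp
    have "\<bar>w l s $ j\<bar> \<le> CARD('m)" for j using norm1_component_le[of "w l s" j] w_bound[OF l, of s] by linarith
    then show "norm ((w l s $ j) *\<^sub>R g j ?z) \<le> CARD('m) * Bg j" for j
      unfolding norm_scaleR using Bg[of j ?z] by (intro mult_mono) auto
  qed
  then show ?thesis by blast
qed

lemma \<sigma>_\<Delta>: "r \<in> {0..h} \<Longrightarrow> \<sigma> r = \<sigma>m r + \<Delta> r"
  by (simp add: \<sigma>_atom lam_atom)

text \<open>Both sides are zero if \<open>r\<close> is no atom; otherwise this is an affine change of variables.\<close>
lemma jump_integral:
  fixes F :: "real \<Rightarrow> 'e::{banach, second_countable_topology}"
  assumes r: "r \<in> {0..h}" and \<tau>: "\<tau> \<in> {0..1}"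
    and F: "\<And>s. r \<in> R \<Longrightarrow> s \<in> {0..S} \<Longrightarrow> \<phi> s = r \<Longrightarrow> F s = (1 / \<Delta> r) *\<^sub>R Q ((s - \<sigma>m r) / \<Delta> r)"
    and Q: "\<And>s. r \<notin> R \<Longrightarrow> Q s = 0"
  shows "(LBINT s:{\<sigma>m r..\<sigma>m r + \<tau> * \<Delta> r}. F s) = (LBINT s:{0..\<tau>}. Q s)"
proof (cases "r \<in> R")
  case True
  then have \<Delta>: "\<Delta> r > 0" using R_iff[OF r] by simp
  have "(LBINT s:{\<sigma>m r..\<sigma>m r + \<tau> * \<Delta> r}. F s) = (LBINT s:{\<sigma>m r..\<sigma>m r + \<tau> * \<Delta> r}. (1 / \<Delta> r) *\<^sub>R Q ((s - \<sigma>m r) / \<Delta> r))"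
  proof (rule set_integral_cong_on)
    fix s assume s: "s \<in> {\<sigma>m r..\<sigma>m r + \<tau> * \<Delta> r}"
    moreover have "\<tau> * \<Delta> r \<le> 1 * \<Delta> r" using \<tau> \<Delta> by (intro mult_right_mono) auto
    ultimately have "s \<in> {\<sigma>m r..\<sigma> r}" using \<sigma>_\<Delta>[OF r] by auto
    moreover from this have S: "s \<in> {0..S}" using \<sigma>m_nonneg[of r] \<sigma>_le_S[of r] by simp
    ultimately have "\<phi> s = r" using \<phi>_eq_iff[OF S r] by simp
    with S show "F s = (1 / \<Delta> r) *\<^sub>R Q ((s - \<sigma>m r) / \<Delta> r)" by (rule F[OF True])
  qed
  then show ?thesis using integral_affine_Icc[OF \<Delta>, of "\<sigma>m r" \<tau> Q] by simp
next
  case False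
  then have "\<Delta> r = 0" using R_iff[OF r] \<Delta>_nonneg[of r] by simp
  then show ?thesis using Q[OF False] by (simp add: set_lebesgue_integral_def[of _ "{0..\<tau>}"])
qed

lemma H_jump:
  assumes l: "l \<in> {1..N}" and r: "r \<in> {0..h}" and \<tau>: "\<tau> \<in> {0..1}"
  shows "\<zeta> r (int l) \<tau> = \<zeta> r (int l) 0 + (LBINT s:{\<sigma>m r..\<sigma>m r + \<tau> * \<Delta> r}. H l s)"
proof -
  have "(LBINT s:{\<sigma>m r..\<sigma>m r + \<tau> * \<Delta> r}. H l s) = (LBINT s:{0..\<tau>}. jump_field r l s)"
  proof (rule jump_integral[OF r \<tau>])
    show "H l s = (1 / \<Delta> r) *\<^sub>R jump_field r l ((s - \<sigma>m r) / \<Delta> r)" if "r \<in> R" "s \<in> {0..S}" "\<phi> s = r" for s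
      using that by (simp add: H_def p0_R w_def loc_def jump_field_def yl_def scaleR_sum_right)
    show "jump_field r l s = 0" if "r \<notin> R" for s by (simp add: jump_field_def om_trivial[OF r that])
  qed
  then show ?thesis using \<zeta>_integral[OF r l \<tau>] by simp
qed

lemma w_jump:
  assumes l: "l \<in> {1..N}" and r: "r \<in> {0..h}"
  shows "(LBINT s:{\<sigma>m r..\<sigma> r}. w l s) = (LBINT s:{0..1}. om r l s)"
    and "(LBINT s:{\<sigma>m r..\<sigma> r}. norm1 (w l s)) = (LBINT s:{0..1}. norm1 (om r l s))"
proof -
  have n0: "norm1 (0 :: real ^ 'm) = 0" by (simp add: norm1_def)
  have 1: "\<sigma> r = \<sigma>m r + 1 * \<Delta> r" using \<sigma>_\<Delta>[OF r] by simp
  show "(LBINT s:{\<sigma>m r..\<sigma> r}. w l s) = (LBINT s:{0..1}. om r l s)"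
    unfolding 1 by (rule jump_integral[OF r]) (simp_all add: w_def loc_def om_trivial[OF r])
  show "(LBINT s:{\<sigma>m r..\<sigma> r}. norm1 (w l s)) = (LBINT s:{0..1}. norm1 (om r l s))"
    unfolding 1
  proof (rule jump_integral[OF r])
    have "norm1 (a *\<^sub>R q) = \<bar>a\<bar> * norm1 q" for a :: real and q :: "real ^ 'm" by (simp add: norm1_def abs_mult sum_distrib_left)
    then show "norm1 (w l s) = (1 / \<Delta> r) *\<^sub>R norm1 (om r l ((s - \<sigma>m r) / \<Delta> r))" if "r \<in> R" "s \<in> {0..S}" "\<phi> s = r" for s
      using that \<Delta>_nonneg[of r] by (simp add: w_def loc_def)
  qed (simp_all add: om_trivial[OF r] n0)
qed

lemma history:
  assumes l: "l \<in> {1..N}" and r: "r \<in> {0..<h}"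
  shows "r + node h l - real (lag k) * h = r + (real_of_int (int l - int (lag k)) - 1) * h"
    and "r + node h l - real (lag k) * h \<in> {- real M * h..T}"
    and "int l - int (lag k) \<le> 0 \<Longrightarrow> \<xi> (r + (real_of_int (int l - int (lag k)) - 1) * h) = xh (r + (real_of_int (int l - int (lag k)) - 1) * h)"
proof -
  let ?l = "int l - int (lag k)"
  show 1: "r + node h l - real (lag k) * h = r + (real_of_int ?l - 1) * h"
    by (simp add: algebra_simps)
  have "- int M \<le> ?l - 1" using lag_range(1)[OF l, of k] by simp
  then have "real_of_int (- int M) \<le> real_of_int (?l - 1)" by (simp only: of_int_le_iff)
  then have a: "(- real M) * h \<le> (real_of_int ?l - 1) * h" using h_pos by (intro mult_right_mono) auto
  have "real_of_int ?l \<le> real N" using lag_range(2)[OF l, of k] by linarith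
  then have "(real_of_int ?l - 1) * h \<le> (real N - 1) * h" using h_pos by (intro mult_right_mono) auto
  then show 2: "r + node h l - real (lag k) * h \<in> {- real M * h..T}"
    unfolding 1 using a r by (auto simp: T algebra_simps)
  assume l0: "?l \<le> 0"
  then have "real_of_int ?l - 1 \<le> - 1" by linarith
  then have "(real_of_int ?l - 1) * h \<le> (- 1) * h" using h_pos by (intro mult_right_mono) auto
  then have t: "r + (real_of_int ?l - 1) * h \<in> {- real M * h..<0}" using a r by auto
  then show "\<xi> (r + (real_of_int ?l - 1) * h) = xh (r + (real_of_int ?l - 1) * h)"
    using 2[unfolded 1] x_hist[OF t] by (simp add: xh_def \<xi>_eq)
qed

lemma shifted_off_atoms:
  assumes l: "l \<in> {1..N}" and s: "\<phi> s \<in> {0..<h} - R"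
  shows "shifted lag (\<lambda>l'. yl l' s) (int l) = delayed lag h xh (\<phi> s + node h l)"
proof -
  have r: "\<phi> s \<in> {0..<h}" using s by blast
  have "yl (int l - int (lag k)) s = xh (\<phi> s + node h l - real (lag k) * h)" for k
    unfolding history(1)[OF l r] using s history(3)[OF l r, of k] by (simp add: yl_def)
  then show ?thesis by (simp add: shifted_def delayed_def)
qed

definition path_field where
  "path_field l r = p0 r *\<^sub>R f (r + node h l, delayed lag h xh (r + node h l))
    + (\<Sum>j\<in>UNIV. (\<kappa> l r $ j) *\<^sub>R g j (r + node h l, delayed lag h xh (r + node h l)))"

lemma delayed_field_measurable:
  fixes F :: "real \<times> ((real ^ 'n) ^ 'k) \<Rightarrow> real ^ 'n"
  assumes "C1_map F" shows "(\<lambda>t. F (t, delayed lag h xh t)) \<in> borel_measurable borel"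
  by (rule field_along_measurable[OF C1_map_continuous[OF assms]]) simp_all

lemma bounded_range: "bounded (range F) \<Longrightarrow> \<exists>B. \<forall>z. norm (F z) \<le> B"
  unfolding bounded_iff by auto

text \<open>Off the atoms the velocity depends on \<open>s\<close> through \<open>\<phi> s\<close> only, so it may be integrated against \<open>lam\<close>. The densities \<open>p0\<close> and \<open>\<kappa>\<close> vanish at
  atoms, so the atoms may be added again, which leaves the integrals in the definition of an impulse solution.\<close>
lemma off_atoms_integral:
  assumes l: "l \<in> {1..N}" and r: "r \<in> {0<..<h}"
  defines "a \<equiv> node h l"
  shows "(LBINT s:{s\<in>{0..S}. \<phi> s \<in> {0..r} - R}. H l s) = (LINT t:{a..r + a}|lebesgue. f (t, delayed lag h x t))
    + (\<Sum>j\<in>UNIV. signed_integral T (\<lambda>A. vector_continuous_part \<mu> A $ j) {a..r + a} (\<lambda>t. g j (t, delayed lag h x t)))"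
proof -
  let ?f = "\<lambda>t. f (t, delayed lag h xh t)" and ?g = "\<lambda>j t. g j (t, delayed lag h xh t)"
  note [measurable] = delayed_field_measurable[OF f(2)] delayed_field_measurable[OF g(2)] \<kappa>_meas[OF l]
  obtain Bf where Bf: "\<And>z. norm (f z) \<le> Bf" using bounded_range[OF f(1)] by auto
  have "\<forall>j. \<exists>Bg. \<forall>z. norm (g j z) \<le> Bg" using bounded_range[OF g(1)] by auto
  then obtain Bg where Bg: "\<And>j z. norm (g j z) \<le> Bg j" by metis
  have pf: "path_field l = (\<lambda>r. p0 r *\<^sub>R ?f (r + a) + (\<Sum>j\<in>UNIV. (\<kappa> l r $ j) *\<^sub>R ?g j (r + a)))"
    by (simp add: path_field_def a_def fun_eq_iff)
  have m: "path_field l \<in> borel_measurable borel" unfolding pf by measurable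
  have "(LBINT s:{s\<in>{0..S}. \<phi> s \<in> {0..r} - R}. H l s) = (LBINT s:{s\<in>{0..S}. \<phi> s \<in> {0..r} - R}. path_field l (\<phi> s))"
  proof (rule set_integral_cong_on)
    fix s assume "s \<in> {s\<in>{0..S}. \<phi> s \<in> {0..r} - R}"
    then have s: "\<phi> s \<in> {0..<h} - R" using r by auto
    then show "H l s = path_field l (\<phi> s)" using shifted_off_atoms[OF l s] by (simp add: H_def path_field_def w_def)
  qed
  also have "\<dots> = (LINT r':{0..r} - R|lam. path_field l r')" by (rule integral_\<phi>[OF m]) simp
  also have "\<dots> = (LINT r':{0..r}|lam. path_field l r')"
    unfolding set_lebesgue_integral_def
  proof (intro Bochner_Integration.integral_cong refl)
    fix r'
    have "path_field l r' = 0" if "r' \<in> R" using that by (simp add: path_field_def p0_R \<kappa>_R[OF l])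
    then show "indicat_real ({0..r} - R) r' *\<^sub>R path_field l r' = indicat_real {0..r} r' *\<^sub>R path_field l r'"
      by (auto simp: indicator_def)
  qed
  finally have c: "(LBINT s:{s\<in>{0..S}. \<phi> s \<in> {0..r} - R}. H l s) = (LINT r':{0..r}|lam. path_field l r')" .
  have A: "(LINT r':{0..r}|lam. path_field l r') = (LINT r':{0..r}|lam. p0 r' *\<^sub>R ?f (r' + a)) + (LINT r':{0..r}|lam. \<Sum>j\<in>UNIV. (\<kappa> l r' $ j) *\<^sub>R ?g j (r' + a))"
    and B: "(LINT r':{0..r}|lam. \<Sum>j\<in>UNIV. (\<kappa> l r' $ j) *\<^sub>R ?g j (r' + a)) = (\<Sum>j\<in>UNIV. LINT r':{0..r}|lam. (\<kappa> l r' $ j) *\<^sub>R ?g j (r' + a))"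
  proof -
    have "norm (p0 r' *\<^sub>R ?f (r' + a)) \<le> 1 * Bf" for r'
      unfolding norm_scaleR using p0_bounds[of r'] Bf by (intro mult_mono) auto
    then have i1: "set_integrable lam {0..r} (\<lambda>r'. p0 r' *\<^sub>R ?f (r' + a))" by (intro set_integrable_lam) measurable
    have "\<bar>\<kappa> l r' $ j\<bar> \<le> CARD('m)" for j r' using norm1_component_le[of "\<kappa> l r'" j] \<kappa>_bound[OF l, of r'] by linarith
    then have b: "norm ((\<kappa> l r' $ j) *\<^sub>R ?g j (r' + a)) \<le> CARD('m) * Bg j" for j r'
      unfolding norm_scaleR using Bg by (intro mult_mono) auto
    have i2: "set_integrable lam {0..r} (\<lambda>r'. (\<kappa> l r' $ j) *\<^sub>R ?g j (r' + a))" for j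
      by (rule set_integrable_lam[OF _ _ b]) measurable
    show e: "(LINT r':{0..r}|lam. \<Sum>j\<in>UNIV. (\<kappa> l r' $ j) *\<^sub>R ?g j (r' + a)) = (\<Sum>j\<in>UNIV. LINT r':{0..r}|lam. (\<kappa> l r' $ j) *\<^sub>R ?g j (r' + a))"
      using i2 unfolding set_lebesgue_integral_def set_integrable_def scaleR_sum_right by (rule Bochner_Integration.integral_sum)
    have i3: "set_integrable lam {0..r} (\<lambda>r'. \<Sum>j\<in>UNIV. (\<kappa> l r' $ j) *\<^sub>R ?g j (r' + a))"
      using i2 unfolding set_integrable_def scaleR_sum_right by (rule Bochner_Integration.integrable_sum)
    show "(LINT r':{0..r}|lam. path_field l r') = (LINT r':{0..r}|lam. p0 r' *\<^sub>R ?f (r' + a)) + (LINT r':{0..r}|lam. \<Sum>j\<in>UNIV. (\<kappa> l r' $ j) *\<^sub>R ?g j (r' + a))"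
      unfolding pf by (rule set_integral_add(2)[OF i1 i3])
  qed
  have 1: "(LBINT s:{s\<in>{0..S}. \<phi> s \<in> {0..r} - R}. H l s) =
    (LINT r':{0..r}|lam. p0 r' *\<^sub>R ?f (r' + a)) + (\<Sum>j\<in>UNIV. LINT r':{0..r}|lam. (\<kappa> l r' $ j) *\<^sub>R ?g j (r' + a))"
    by (simp only: c A B)
  have d: "delayed lag h xh t = delayed lag h x t" if "t \<in> {a..r + a}" for t
  proof -
    have "t - a \<in> {0..<h}" using that r by auto
    from history(2)[OF l this] have "t - real (lag k) * h \<in> {- real M * h..T}" for k by (simp add: a_def)
    then show ?thesis by (simp add: delayed_def xh_def)
  qed
  have "(LINT r':{0..r}|lam. p0 r' *\<^sub>R ?f (r' + a)) = (LBINT t:{a..a + r}. ?f t)"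
    by (rule integral_piece_lborel[symmetric]) (use r in auto)
  also have "\<dots> = (LINT t:{a..r + a}|lebesgue. ?f t)" by (subst set_integral_lebesgue_lborel) (simp_all add: add.commute)
  also have "\<dots> = (LINT t:{a..r + a}|lebesgue. f (t, delayed lag h x t))" by (rule set_integral_cong_on) (simp add: d)
  finally have 2: "(LINT r':{0..r}|lam. p0 r' *\<^sub>R ?f (r' + a)) = (LINT t:{a..r + a}|lebesgue. f (t, delayed lag h x t))" .
  have t: "r + a \<in> {node h l<..<real l * h}" using r by (auto simp: a_def algebra_simps)
  have 3: "(LINT r':{0..r}|lam. (\<kappa> l r' $ j) *\<^sub>R ?g j (r' + a)) =
    signed_integral T (\<lambda>A. vector_continuous_part \<mu> A $ j) {a..r + a} (\<lambda>t. g j (t, delayed lag h x t))" for j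
  proof -
    have "signed_integral T (\<lambda>A. \<mu>c A $ j) {a..r + a} (?g j) = (LINT r':{0..r}|lam. (\<kappa> l r' $ j) *\<^sub>R ?g j (r' + a))"
      using signed_integral_\<mu>c[OF l t, of "?g j" "Bg j" j] Bg by (simp add: a_def)
    moreover have "signed_integral T (\<lambda>A. \<mu>c A $ j) {a..r + a} (?g j) = signed_integral T (\<lambda>A. \<mu>c A $ j) {a..r + a} (\<lambda>t. g j (t, delayed lag h x t))"
      unfolding signed_integral_def by (intro arg_cong2[where f = minus] set_integral_cong_on) (simp_all add: d)
    ultimately show ?thesis by (simp add: \<mu>c_def)
  qed
  show ?thesis unfolding 1 2 3 ..
qed

end

subsection \<open>Gluing functions on consecutive intervals\<close>

text \<open>A sum with indicators instead of a case distinction makes measurability immediate. Blocks are numbered from 0, pieces from 1.\<close>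
definition glue :: "real \<Rightarrow> nat \<Rightarrow> (nat \<Rightarrow> real \<Rightarrow> 'e::real_vector) \<Rightarrow> real \<Rightarrow> 'e" where
  "glue S N F s = (\<Sum>k<N. indicator {real k * S..<real k * S + S} s *\<^sub>R F (k + 1) (s - real k * S))"

lemma block_unique:
  assumes "s \<in> {real k * S..<real k * S + S}" "s \<in> {real k' * S..<real k' * S + S}"
  shows "k = k'"
proof (rule ccontr)
  have *: "False" if "k < k'" "s \<in> {real k * S..<real k * S + S}" "s \<in> {real k' * S..<real k' * S + S}" for k k' :: nat
  proof -
    have "0 < S" using that(2) by auto
    have "real k + 1 \<le> real k'" using that(1) by simp
    then have "(real k + 1) * S \<le> real k' * S" using \<open>0 < S\<close> by (intro mult_right_mono) auto
    then show False using that by (simp add: algebra_simps)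
  qed
  assume "k \<noteq> k'"
  then show False using *[of k k'] *[of k' k] assms by linarith
qed

lemma glue_eq:
  assumes "k < N" "s \<in> {0..<S}" shows "glue S N F (real k * S + s) = F (k + 1) s"
proof -
  let ?s = "real k * S + s"
  have k: "?s \<in> {real k * S..<real k * S + S}" using assms by simp
  have "glue S N F ?s = (\<Sum>k'<N. if k' = k then F (k + 1) s else 0)"
    unfolding glue_def
  proof (rule sum.cong[OF refl])
    fix k'
    show "indicator {real k' * S..<real k' * S + S} ?s *\<^sub>R F (k' + 1) (?s - real k' * S) = (if k' = k then F (k + 1) s else 0)"
    proof (cases "k' = k")
      case False
      then have "?s \<notin> {real k' * S..<real k' * S + S}" using block_unique[OF k] by blast
      then show ?thesis using False by simp
    qed (use k in simp)
  qed
  then show ?thesis using assms by simp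
qed

lemma glue_cases:
  obtains "glue S N F s = 0" | k s' where "k < N" "s' \<in> {0..<S}" "s = real k * S + s'" "glue S N F s = F (k + 1) s'"
proof (cases "\<exists>k<N. s \<in> {real k * S..<real k * S + S}")
  case True
  then obtain k where k: "k < N" "s \<in> {real k * S..<real k * S + S}" by blast
  then have s': "s - real k * S \<in> {0..<S}" by auto
  from glue_eq[OF k(1) s', of F] show thesis using that(2)[OF k(1) s'] by simp
next
  case False
  then have "glue S N F s = 0" unfolding glue_def by (intro sum.neutral) auto
  then show thesis by (rule that(1))
qed

lemma glue_measurable:
  fixes F :: "nat \<Rightarrow> real \<Rightarrow> 'e::{banach, second_countable_topology}"
  assumes F: "\<And>l. l \<in> {1..N} \<Longrightarrow> F l \<in> borel_measurable borel"
  shows "glue S N F \<in> borel_measurable borel"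
  unfolding glue_def[abs_def]
proof (rule borel_measurable_sum)
  fix k assume "k \<in> {..<N}"
  then have [measurable]: "F (k + 1) \<in> borel_measurable borel" by (intro F) simp
  show "(\<lambda>s. indicator {real k * S..<real k * S + S} s *\<^sub>R F (k + 1) (s - real k * S)) \<in> borel_measurable borel"
    by measurable
qed

lemma glue_bound:
  assumes "\<And>l s. l \<in> {1..N} \<Longrightarrow> norm (F l s) \<le> B" "0 \<le> B"
  shows "norm (glue S N F s) \<le> B"
  by (rule glue_cases[of S N F s]) (use assms in auto)

lemma glue_block_integral:
  fixes F :: "nat \<Rightarrow> real \<Rightarrow> 'e::{banach, second_countable_topology}"
  assumes F: "\<And>l. l \<in> {1..N} \<Longrightarrow> F l \<in> borel_measurable borel" and k: "k < N" and \<tau>: "\<tau> \<in> {0..S}"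
  shows "(LBINT s:{real k * S..real k * S + \<tau>}. glue S N F s) = (LBINT s:{0..\<tau>}. F (k + 1) s)"
proof -
  let ?a = "real k * S"
  note [measurable] = glue_measurable[OF F]
  have [measurable]: "F (k + 1) \<in> borel_measurable borel" by (intro F) (use k in simp)
  have "(LBINT s:{?a..?a + \<tau>}. glue S N F s) = (\<integral>s. indicator {?a..?a + \<tau>} (?a + 1 * s) *\<^sub>R glue S N F (?a + 1 * s) \<partial>lborel)"
    unfolding set_lebesgue_integral_def by (subst lborel_integral_real_affine[of 1 _ ?a]) simp_all
  also have "\<dots> = (LBINT s:{0..\<tau>}. F (k + 1) s)"
    unfolding set_lebesgue_integral_def
  proof (rule Bochner_Integration.integral_cong_AE)
    show "AE s in lborel. indicator {?a..?a + \<tau>} (?a + 1 * s) *\<^sub>R glue S N F (?a + 1 * s) = indicat_real {0..\<tau>} s *\<^sub>R F (k + 1) s"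
    proof (rule AE_mp[OF AE_lborel_singleton[of S]], intro AE_I2 impI)
      fix s assume "s \<noteq> S"
      then show "indicator {?a..?a + \<tau>} (?a + 1 * s) *\<^sub>R glue S N F (?a + 1 * s) = indicat_real {0..\<tau>} s *\<^sub>R F (k + 1) s"
        using glue_eq[OF k, of s S F] \<tau> by (cases "s \<in> {0..\<tau>}") auto
    qed
  qed measurable
  finally show ?thesis .
qed

lemma glue_integral:
  fixes F :: "nat \<Rightarrow> real \<Rightarrow> 'e::{banach, second_countable_topology}"
  assumes F: "\<And>l. l \<in> {1..N} \<Longrightarrow> F l \<in> borel_measurable borel" and B: "\<And>l s. l \<in> {1..N} \<Longrightarrow> norm (F l s) \<le> B" "0 \<le> B"
    and S: "0 \<le> S"
  shows "k \<le> N \<Longrightarrow> (LBINT s:{0..real k * S}. glue S N F s) = (\<Sum>l=1..k. LBINT s:{0..S}. F l s)"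
    and "k < N \<Longrightarrow> \<tau> \<in> {0..S} \<Longrightarrow> (LBINT s:{0..real k * S + \<tau>}. glue S N F s) =
      (LBINT s:{0..real k * S}. glue S N F s) + (LBINT s:{0..\<tau>}. F (k + 1) s)"
proof -
  have i: "set_integrable lborel {a..b} (glue S N F)" for a b
    by (rule set_integrable_bounded[OF glue_measurable[OF F] glue_bound[OF B]])
  show 2: "(LBINT s:{0..real k * S + \<tau>}. glue S N F s) =
      (LBINT s:{0..real k * S}. glue S N F s) + (LBINT s:{0..\<tau>}. F (k + 1) s)" if "k < N" "\<tau> \<in> {0..S}" for k \<tau>
  proof -
    have "(LBINT s:{0..real k * S + \<tau>}. glue S N F s) =
      (LBINT s:{0..real k * S}. glue S N F s) + (LBINT s:{real k * S..real k * S + \<tau>}. glue S N F s)"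
      by (rule set_integral_Icc_add[OF i]) (use that S in auto)
    moreover have "(LBINT s:{real k * S..real k * S + \<tau>}. glue S N F s) = (LBINT s:{0..\<tau>}. F (k + 1) s)"
      by (rule glue_block_integral[OF F that])
    ultimately show ?thesis by (simp only:)
  qed
  show "(LBINT s:{0..real k * S}. glue S N F s) = (\<Sum>l=1..k. LBINT s:{0..S}. F l s)" if "k \<le> N"
    using that
  proof (induction k)
    case (Suc k)
    have "real (Suc k) * S = real k * S + S" by (simp add: algebra_simps)
    then show ?case using 2[of k S] Suc S by simp
  qed simp
qed

context impulse
begin

lemma H_bounded: obtains B where "0 \<le> B" "\<And>l s. l \<in> {1..N} \<Longrightarrow> norm (H l s) \<le> B"
proof -
  obtain B where B: "\<And>l s. l \<in> {1..N} \<Longrightarrow> norm (H l s) \<le> B" using H_bound by blast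
  have "0 \<le> norm (H 1 0)" by simp
  also have "norm (H 1 0) \<le> B" using N by (intro B) simp
  finally show thesis using that B by blast
qed

lemma path_on_interval:
  assumes l: "l \<in> {1..N}"
  shows "r \<in> {0<..<h} \<Longrightarrow> x (r + node h l) = \<zeta> 0 (int l) 0 + (LBINT s:{0..\<sigma> r}. H l s)"
    and "r \<in> {0..h} \<Longrightarrow> \<zeta> r (int l) 0 = \<zeta> 0 (int l) 0 + (LBINT s:{0..\<sigma>m r}. H l s)"
    and "r \<in> {0..h} \<Longrightarrow> \<zeta> r (int l) 1 = \<zeta> 0 (int l) 0 + (LBINT s:{0..\<sigma> r}. H l s)"
proof -
  obtain B where B: "\<And>s. norm (H l s) \<le> B" using H_bounded l by metis
  let ?a = "node h l"
  have J: "\<zeta> r (int l) 1 - \<zeta> r (int l) 0 = (LBINT s:{\<sigma>m r..\<sigma> r}. H l s)" if "r \<in> {0..h}" for r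
    using H_jump[OF l that, of 1] \<sigma>_\<Delta>[OF that] by simp
  have left: "\<zeta> r (int l) 0 = left_lim x (r + ?a)" if "r \<in> {0<..h}" for r
    using \<zeta>_init[of r l] l that by simp
  have z: "x (r + ?a) = \<zeta> 0 (int l) 1 + (LBINT s:{s\<in>{0..S}. \<phi> s \<in> {0..r} - R}. H l s)
      + (\<Sum>\<^sub>\<infinity>r'\<in>{0<..r}. \<zeta> r' (int l) 1 - left_lim x (r' + ?a))" if r: "r \<in> {0<..<h}" for r
  proof -
    have t: "r + ?a \<in> {?a<..<real l * h}" using r by (auto simp: algebra_simps)
    show ?thesis using x_piece[OF l t] unfolding off_atoms_integral[OF l r] by (simp add: add.assoc)
  qed
  note P = path_representation[where ?A0.0 = "\<lambda>r. \<zeta> r (int l) 0" and ?A1.0 = "\<lambda>r. \<zeta> r (int l) 1", OF H_measurable[OF l] B J left z]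
  show "r \<in> {0<..<h} \<Longrightarrow> x (r + ?a) = \<zeta> 0 (int l) 0 + (LBINT s:{0..\<sigma> r}. H l s)" by (rule P(1))
  show "r \<in> {0..h} \<Longrightarrow> \<zeta> r (int l) 0 = \<zeta> 0 (int l) 0 + (LBINT s:{0..\<sigma>m r}. H l s)" by (rule P(2))
  show "r \<in> {0..h} \<Longrightarrow> \<zeta> r (int l) 1 = \<zeta> 0 (int l) 0 + (LBINT s:{0..\<sigma> r}. H l s)" by (rule P(3))
qed

lemma norm1_0: "norm1 (0 :: real ^ 'm) = 0" by (simp add: norm1_def)

lemma variation_off_atoms:
  assumes l: "l \<in> {1..N}" and B: "B \<in> sets borel" "B \<subseteq> {0..<h}"
  shows "(LBINT s:{s\<in>{0..S}. \<phi> s \<in> B - R}. norm1 (w l s)) = measure \<nu>c (up l B)"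
    and "(LBINT s:{s\<in>{0..S}. \<phi> s \<in> B - R}. w l s) = \<mu>c (up l B)"
proof -
  note [measurable] = \<kappa>_meas[OF l] B(1)
  have "(LBINT s:{s\<in>{0..S}. \<phi> s \<in> B - R}. norm1 (w l s)) = (LBINT s:{s\<in>{0..S}. \<phi> s \<in> B - R}. norm1 (\<kappa> l (\<phi> s)))"
    by (rule set_integral_cong_on) (simp add: w_def)
  also have "\<dots> = (LINT r:B - R|lam. norm1 (\<kappa> l r))" by (rule integral_\<phi>) measurable
  also have "\<dots> = (LINT r:B|lam. norm1 (\<kappa> l r))"
    unfolding set_lebesgue_integral_def by (intro Bochner_Integration.integral_cong) (auto simp: indicator_def \<kappa>_R[OF l] norm1_0)
  finally show "(LBINT s:{s\<in>{0..S}. \<phi> s \<in> B - R}. norm1 (w l s)) = measure \<nu>c (up l B)"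
    by (simp add: \<kappa>_norm[OF l B(1)])
  have "(LBINT s:{s\<in>{0..S}. \<phi> s \<in> B - R}. w l s) = (LBINT s:{s\<in>{0..S}. \<phi> s \<in> B - R}. \<kappa> l (\<phi> s))"
    by (rule set_integral_cong_on) (simp add: w_def)
  also have "\<dots> = (LINT r:B - R|lam. \<kappa> l r)" by (rule integral_\<phi>) measurable
  also have "\<dots> = (LINT r:B|lam. \<kappa> l r)"
    unfolding set_lebesgue_integral_def by (intro Bochner_Integration.integral_cong) (auto simp: indicator_def \<kappa>_R[OF l])
  finally show "(LBINT s:{s\<in>{0..S}. \<phi> s \<in> B - R}. w l s) = \<mu>c (up l B)"
    by (simp add: \<kappa>_integral[OF l B(1)])
qed

lemma variation_on_interval:
  assumes l: "l \<in> {1..N}"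
  shows "r \<in> {0<..<h} \<Longrightarrow> v (r + node h l) = \<theta> 0 (int l) 0 + (LBINT s:{0..\<sigma> r}. norm1 (w l s))"
    and "r \<in> {0..h} \<Longrightarrow> \<theta> r (int l) 1 = \<theta> 0 (int l) 0 + (LBINT s:{0..\<sigma> r}. norm1 (w l s))"
proof -
  let ?a = "node h l"
  have m: "(\<lambda>s. norm1 (w l s)) \<in> borel_measurable borel" using w_measurable[OF l] by measurable
  have B: "norm (norm1 (w l s)) \<le> CARD('m)" for s using w_bound[OF l, of s] norm1_nonneg[of "w l s"] by simp
  have J: "\<theta> r (int l) 1 - \<theta> r (int l) 0 = (LBINT s:{\<sigma>m r..\<sigma> r}. norm1 (w l s))" if "r \<in> {0..h}" for r
    using \<theta>_integral[OF that l] w_jump(2)[OF l that] by simp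
  have left: "\<theta> r (int l) 0 = left_lim v (r + ?a)" if "r \<in> {0<..h}" for r
    using \<theta>_init[of r l] l that by simp
  have z: "v (r + ?a) = \<theta> 0 (int l) 1 + (LBINT s:{s\<in>{0..S}. \<phi> s \<in> {0..r} - R}. norm1 (w l s))
      + (\<Sum>\<^sub>\<infinity>r'\<in>{0<..r}. \<theta> r' (int l) 1 - left_lim v (r' + ?a))" if r: "r \<in> {0<..<h}" for r
  proof -
    have t: "r + ?a \<in> {?a<..<real l * h}" using r by (auto simp: algebra_simps)
    have s: "{?a} \<in> sets (borel_upto T)" "up l {0..r} \<in> sets (borel_upto T)"
      using node_range[OF l] h_pos up_sets(1)[OF l, of "{0..r}"] by (auto simp: sets_borel_upto)
    have "emeasure \<nu>c {?a..r + ?a} = emeasure \<nu>c {?a} + emeasure \<nu>c (up l {0..r})"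
      using piece_up[OF l t] s by (subst plus_emeasure) (auto simp: \<nu>c_sets up_def)
    then have "measure \<nu>c {?a..r + ?a} = measure \<nu>c (up l {0..r})"
      using \<nu>c_countable[OF s(1)] by (simp add: measure_def)
    moreover have "{0..r} \<subseteq> {0..<h}" using r by auto
    ultimately show ?thesis using v_piece[OF l t] variation_off_atoms(1)[OF l, of "{0..r}"] by (simp add: \<nu>c_def)
  qed
  note P = path_representation[where ?A0.0 = "\<lambda>r. \<theta> r (int l) 0" and ?A1.0 = "\<lambda>r. \<theta> r (int l) 1", OF m B J left z]
  show "r \<in> {0<..<h} \<Longrightarrow> v (r + ?a) = \<theta> 0 (int l) 0 + (LBINT s:{0..\<sigma> r}. norm1 (w l s))" by (rule P(1))
  show "r \<in> {0..h} \<Longrightarrow> \<theta> r (int l) 1 = \<theta> 0 (int l) 0 + (LBINT s:{0..\<sigma> r}. norm1 (w l s))" by (rule P(3))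
qed

lemma chain_start: "\<zeta> 0 (int 1) 0 = x0" "\<theta> 0 (int 1) 0 = 0"
  using \<zeta>_init[of 0 1] \<theta>_init[of 0 1] \<zeta>_past0[of h 1] \<theta>_past[of h 1] h_pos N by simp_all

lemma chain_step:
  assumes "l \<in> {1..<N}"
  shows "\<zeta> 0 (int (Suc l)) 0 = \<zeta> 0 (int l) 0 + (LBINT s:{0..S}. H l s)"
    and "\<theta> 0 (int (Suc l)) 0 = \<theta> 0 (int l) 0 + (LBINT s:{0..S}. norm1 (w l s))"
proof -
  have l: "l \<in> {1..N}" "Suc l \<in> {1..N}" "0 \<in> {0..h}" "h \<in> {0..h}" using assms h_pos by auto
  show "\<zeta> 0 (int (Suc l)) 0 = \<zeta> 0 (int l) 0 + (LBINT s:{0..S}. H l s)"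
    using \<zeta>_init[OF l(3,2)] path_on_interval(3)[OF l(1,4)] \<sigma>_h[of h] by simp
  show "\<theta> 0 (int (Suc l)) 0 = \<theta> 0 (int l) 0 + (LBINT s:{0..S}. norm1 (w l s))"
    using \<theta>_init[OF l(3,2)] variation_on_interval(2)[OF l(1,4)] \<sigma>_h[of h] by simp
qed

text \<open>The end value of one piece is the initial value of the next, because the attached control at a node is split between \<open>(h, l)\<close> and \<open>(0, l + 1)\<close>.\<close>
lemma chain:
  assumes "l \<in> {1..N}"
  shows "\<zeta> 0 (int l) 0 = x0 + (\<Sum>i=1..l - 1. LBINT s:{0..S}. H i s)"
    and "\<theta> 0 (int l) 0 = (\<Sum>i=1..l - 1. LBINT s:{0..S}. norm1 (w i s))"
proof -
  have "\<zeta> 0 (int l) 0 = x0 + (\<Sum>i=1..l - 1. LBINT s:{0..S}. H i s) \<and>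
    \<theta> 0 (int l) 0 = (\<Sum>i=1..l - 1. LBINT s:{0..S}. norm1 (w i s))"
    using assms
  proof (induction l)
    case (Suc l)
    show ?case
    proof (cases "l = 0")
      case True
      then show ?thesis using chain_start by simp
    next
      case False
      then have l: "l \<in> {1..<N}" "l \<in> {1..N}" using Suc.prems by auto
      obtain k where "l = Suc k" using False by (cases l) auto
      then show ?thesis using Suc.IH[OF l(2)] chain_step[OF l(1)] by simp
    qed
  qed simp
  then show "\<zeta> 0 (int l) 0 = x0 + (\<Sum>i=1..l - 1. LBINT s:{0..S}. H i s)"
    "\<theta> 0 (int l) 0 = (\<Sum>i=1..l - 1. LBINT s:{0..S}. norm1 (w i s))" by simp_all
qed

text \<open>At an atom this is the equation of the attached arc. Elsewhere the parameter determines an interior time, because only the endpoints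
  \<open>0\<close> and \<open>S\<close> of the parameter interval can be mapped to a node that is no atom.\<close>
lemma completed_path:
  assumes l: "l \<in> {1..N}" and s: "s \<in> {0<..<S}"
  shows "yl (int l) s = \<zeta> 0 (int l) 0 + (LBINT s:{0..s}. H l s)"
proof -
  define r where "r = \<phi> s"
  have r: "r \<in> {0..h}" unfolding r_def by (rule \<phi>_range)
  have sS: "s \<in> {0..S}" using s by auto
  have sr: "s \<in> {\<sigma>m r..\<sigma> r}" using \<phi>_eq_iff[OF sS r] by (simp add: r_def)
  obtain B where B: "\<And>s. norm (H l s) \<le> B" using H_bounded l by metis
  show ?thesis
  proof (cases "r \<in> R")
    case True
    then have \<Delta>: "\<Delta> r > 0" using R_iff[OF r] by simp
    define \<tau> where "\<tau> = (s - \<sigma>m r) / \<Delta> r"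
    have \<tau>: "\<tau> \<in> {0..1}" "\<sigma>m r + \<tau> * \<Delta> r = s" using sr \<sigma>_\<Delta>[OF r] \<Delta> by (auto simp: \<tau>_def field_simps)
    have "yl (int l) s = \<zeta> r (int l) \<tau>"
    proof -
      have "max 0 (min 1 \<tau>) = \<tau>" using \<tau>(1) by auto
      then show ?thesis using True l by (simp add: yl_def arc_def loc_def r_def[symmetric] \<tau>_def[symmetric])
    qed
    also have "\<dots> = \<zeta> r (int l) 0 + (LBINT s:{\<sigma>m r..s}. H l s)" using H_jump[OF l r \<tau>(1)] \<tau>(2) by simp
    also have "\<dots> = \<zeta> 0 (int l) 0 + ((LBINT s:{0..\<sigma>m r}. H l s) + (LBINT s:{\<sigma>m r..s}. H l s))"
      using path_on_interval(2)[OF l r] by simp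
    also have "(LBINT s:{0..\<sigma>m r}. H l s) + (LBINT s:{\<sigma>m r..s}. H l s) = (LBINT s:{0..s}. H l s)"
      by (rule set_integral_Icc_add[symmetric, OF set_integrable_bounded_S[OF H_measurable[OF l] B]]) (use sr \<sigma>m_nonneg in auto)
    finally show ?thesis .
  next
    case False
    then have "\<Delta> r = 0" using R_iff[OF r] \<Delta>_nonneg[of r] by simp
    then have e: "s = \<sigma> r" "s = \<sigma>m r" using sr \<sigma>_\<Delta>[OF r] by auto
    have "r \<noteq> 0" using e(2) \<sigma>m_0[of r] s by auto
    moreover have "r \<noteq> h" using e(1) \<sigma>_h[of r] s by auto
    ultimately have r': "r \<in> {0<..<h}" using r by auto
    have "r + node h l \<in> {- real M * h..T}"
    proof -
      have "- real M * h \<le> 0" using Mh by simp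
      then show ?thesis using r' node_range[OF l] unfolding atLeastAtMost_iff greaterThanLessThan_iff by linarith
    qed
    then have "yl (int l) s = x (r + node h l)" using False l by (simp add: yl_def r_def[symmetric] xh_def)
    then show ?thesis using path_on_interval(1)[OF l r'] e(1) by simp
  qed
qed

lemma path_values:
  assumes l: "l \<in> {1..N}" and r: "r \<in> {0..h}" "0 < r + node h l" "r < h \<or> l = N"
  shows "x (r + node h l) = \<zeta> 0 (int l) 0 + (LBINT s:{0..\<sigma> r}. H l s)"
    and "v (r + node h l) = \<theta> 0 (int l) 0 + (LBINT s:{0..\<sigma> r}. norm1 (w l s))"
proof -
  consider "r \<in> {0<..<h}" | "r = 0" "l \<in> {2..N}" | "r = h" "l = N"
  proof (cases "r = 0")
    case True
    then have "l \<noteq> 1" using r(2) by auto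
    then have "l \<in> {2..N}" using l by auto
    then show thesis using that True by blast
  next
    case False
    then show thesis using that r by (cases "r = h") auto
  qed
  then have "x (r + node h l) = \<zeta> 0 (int l) 0 + (LBINT s:{0..\<sigma> r}. H l s) \<and>
    v (r + node h l) = \<theta> 0 (int l) 0 + (LBINT s:{0..\<sigma> r}. norm1 (w l s))"
  proof cases
    case 1
    then show ?thesis using path_on_interval(1)[OF l 1] variation_on_interval(1)[OF l 1] by simp
  next
    case 2
    then show ?thesis using path_on_interval(3)[OF l r(1)] variation_on_interval(2)[OF l r(1)] x_node v_node by simp
  next
    case 3
    then have "r + node h l = T" by (simp add: T algebra_simps)
    then show ?thesis using path_on_interval(3)[OF l r(1)] variation_on_interval(2)[OF l r(1)] x_T v_T 3 by simp
  qed
  then show "x (r + node h l) = \<zeta> 0 (int l) 0 + (LBINT s:{0..\<sigma> r}. H l s)"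
    "v (r + node h l) = \<theta> 0 (int l) 0 + (LBINT s:{0..\<sigma> r}. norm1 (w l s))" by simp_all
qed

end

lemma vector_measures_UN:
  assumes \<mu>: "\<mu> \<in> vector_measures T" and "finite I" "disjoint_family_on A I" "\<And>i. i \<in> I \<Longrightarrow> A i \<in> sets (borel_upto T)"
  shows "\<mu> (\<Union>i\<in>I. A i) = (\<Sum>i\<in>I. \<mu> (A i))"
  using assms(2-)
proof (induction I rule: finite_induct)
  case (insert i I)
  have "\<mu> (A i \<union> (\<Union>i\<in>I. A i)) = \<mu> (A i) + \<mu> (\<Union>i\<in>I. A i)"
    using insert by (intro vector_measures_Un[OF \<mu>]) (auto simp: disjoint_family_on_def)
  moreover have "disjoint_family_on A I" using insert.prems(1) by (auto simp: disjoint_family_on_def)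
  ultimately show ?case using insert by simp
qed (simp add: vector_measures_empty[OF \<mu>])

text \<open>Lets atoms and the rest be treated separately.\<close>
lemma vector_measures_eq_off_countable:
  assumes \<mu>: "\<mu>1 \<in> vector_measures T" "\<mu>2 \<in> vector_measures T" and Z: "countable Z" "Z \<subseteq> {0..T}"
    and atom: "\<And>z. z \<in> Z \<Longrightarrow> \<mu>1 {z} = \<mu>2 {z}"
    and off: "\<And>A. A \<in> sets (borel_upto T) \<Longrightarrow> A \<inter> Z = {} \<Longrightarrow> \<mu>1 A = \<mu>2 A"
    and A: "A \<in> sets (borel_upto T)"
  shows "\<mu>1 A = \<mu>2 A"
proof -
  let ?C = "A \<inter> Z"
  have C: "countable ?C" "?C \<subseteq> {0..T}" using Z by auto
  have cs: "B \<in> sets (borel_upto T)" if "B \<subseteq> ?C" for B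
    using that C by (intro sets.countable[OF _ countable_subset[OF that C(1)]]) (auto simp: sets_borel_upto)
  define D where "D i = {z \<in> ?C. to_nat_on ?C z = i}" for i
  have D: "D i = {} \<or> (\<exists>z\<in>Z. D i = {z})" for i
  proof (cases "D i = {}")
    case False
    then obtain z where z: "z \<in> ?C" "to_nat_on ?C z = i" by (auto simp: D_def)
    have "z' = z" if "z' \<in> D i" for z'
      using that z inj_on_to_nat_on[OF C(1)] by (auto simp: D_def inj_on_def)
    moreover have "z \<in> D i" using z by (simp add: D_def)
    ultimately show ?thesis using z(1) by blast
  qed simp
  have eq: "\<mu>1 (D i) = \<mu>2 (D i)" for i using D[of i] atom vector_measures_empty[OF \<mu>(1)] vector_measures_empty[OF \<mu>(2)] by auto
  have U: "(\<Union>i. D i) = ?C" by (auto simp: D_def)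
  have r: "range D \<subseteq> sets (borel_upto T)" "disjoint_family D" by (auto simp: D_def disjoint_family_on_def intro!: cs)
  have "(\<lambda>i. \<mu>1 (D i)) sums \<mu>1 ?C" using vector_measures_sums[OF \<mu>(1) r] by (simp only: U)
  moreover have "(\<lambda>i. \<mu>1 (D i)) sums \<mu>2 ?C" using vector_measures_sums[OF \<mu>(2) r] by (simp only: U eq)
  ultimately have 1: "\<mu>1 ?C = \<mu>2 ?C" by (rule sums_unique2)
  have AC: "A - ?C \<in> sets (borel_upto T)" "?C \<in> sets (borel_upto T)" using A cs[of ?C] by auto
  have "\<mu>1 (A - ?C) = \<mu>2 (A - ?C)" by (rule off[OF AC(1)]) auto
  moreover have "\<mu>1 ((A - ?C) \<union> ?C) = \<mu>1 (A - ?C) + \<mu>1 ?C" "\<mu>2 ((A - ?C) \<union> ?C) = \<mu>2 (A - ?C) + \<mu>2 ?C"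
    by (rule vector_measures_Un[OF \<mu>(1) AC], blast) (rule vector_measures_Un[OF \<mu>(2) AC], blast)
  moreover have "(A - ?C) \<union> ?C = A" by blast
  ultimately show ?thesis using 1 by simp
qed

lemma finite_measure_vector_measures:
  assumes \<nu>: "sets \<nu> = sets (borel_upto T)" "finite_measure \<nu>"
  shows "measure \<nu> \<in> vector_measures T"
  unfolding vector_measures_def using finite_measure.finite_measure_UNION[OF \<nu>(2)] \<nu>(1) by simp

context impulse
begin

subsection \<open>The completion of the whole process\<close>

lemma S_pos: "0 < S" using S_ge_h h_pos by simp

definition \<Phi> where "\<Phi> s = real_of_int \<lfloor>s / S\<rfloor> * h + \<phi> (s - real_of_int \<lfloor>s / S\<rfloor> * S)"
definition L where "L = real N * S"

lemma \<Phi>_measurable [measurable]: "\<Phi> \<in> borel_measurable borel"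
  unfolding \<Phi>_def[abs_def] by measurable

lemma \<Phi>_block: assumes "s \<in> {0..S}" shows "\<Phi> (real_of_int k * S + s) = real_of_int k * h + \<phi> s"
proof -
  have *: "\<Phi> (real_of_int k * S + s) = real_of_int k * h + \<phi> s" if "0 \<le> s" "s < S" for k s
  proof -
    have "(real_of_int k * S + s) / S = real_of_int k + s / S" using S_pos by (simp add: add_divide_distrib)
    moreover have "0 \<le> s / S" "s / S < 1" using that S_pos by auto
    ultimately have "\<lfloor>(real_of_int k * S + s) / S\<rfloor> = k" by (intro floor_unique) linarith+
    then show ?thesis by (simp add: \<Phi>_def)
  qed
  show ?thesis
  proof (cases "s = S")
    case True
    have "\<Phi> (real_of_int (k + 1) * S + 0) = real_of_int (k + 1) * h + \<phi> 0" by (rule *) (use S_pos in auto)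
    then show ?thesis using True by (simp add: \<phi>_0 \<phi>_S algebra_simps)
  qed (use * assms in auto)
qed

lemma \<Phi>_nat_block: "s \<in> {0..S} \<Longrightarrow> \<Phi> (real k * S + s) = real k * h + \<phi> s"
  using \<Phi>_block[of s "int k"] by simp

lemma block: assumes "s \<in> {0..L}" obtains k \<tau> where "k < N" "\<tau> \<in> {0..S}" "s = real k * S + \<tau>" "\<tau> < S \<or> s = L"
proof (cases "s = L")
  case True
  have "real (N - 1) = real N - 1" using N by simp
  then have "s = real (N - 1) * S + S" using True by (simp add: L_def algebra_simps)
  then show thesis using that[of "N - 1" S] N S_pos True by auto
next
  case False
  let ?k = "nat \<lfloor>s / S\<rfloor>"
  have s: "0 \<le> s / S" "s / S < real N" using assms False S_pos by (auto simp: L_def divide_less_eq)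
  then have k: "real ?k \<le> s / S" "s / S < real ?k + 1" by linarith+
  have "real ?k * S \<le> s" "s < (real ?k + 1) * S" using k S_pos by (simp_all add: le_divide_eq divide_less_eq)
  moreover have "?k < N" using k(1) s(2) by linarith
  ultimately show thesis using that[of ?k "s - real ?k * S"] by (auto simp: algebra_simps)
qed

definition p where "p = glue S N (\<lambda>l s. p0 (\<phi> s))"
definition wg where "wg = glue S N w"
definition y where "y s = (if s < 0 then \<xi> (\<Phi> s) else x0 + (LBINT r:{0..min s L}. glue S N H r))"

text \<open>On the fibre of an atom \<open>p0\<close> vanishes, so the integral may be extended to the right end of the fibre.\<close>
lemma p0_\<phi>_integral: assumes \<tau>: "\<tau> \<in> {0..S}" shows "(LBINT s:{0..\<tau>}. p0 (\<phi> s)) = \<phi> \<tau>"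
proof -
  let ?r = "\<phi> \<tau>"
  have r: "?r \<in> {0..h}" by (rule \<phi>_range)
  have \<tau>r: "\<tau> \<in> {\<sigma>m ?r..\<sigma> ?r}" using \<phi>_eq_iff[OF \<tau> r] by simp
  have "(LBINT s:{0..\<sigma> ?r}. p0 (\<phi> s)) = (LBINT s:{0..\<tau>}. p0 (\<phi> s)) + (LBINT s:{\<tau>..\<sigma> ?r}. p0 (\<phi> s))"
    by (rule set_integral_Icc_add[OF set_integrable_bounded_S[where B = 1]]) (use p0_bounds \<tau>r \<tau> in \<open>auto simp: abs_of_nonneg\<close>)
  moreover have "(LBINT s:{\<tau>..\<sigma> ?r}. p0 (\<phi> s)) = 0"
  proof (cases "?r \<in> R")
    case True
    have "(LBINT s:{\<tau>..\<sigma> ?r}. p0 (\<phi> s)) = (LBINT s:{\<tau>..\<sigma> ?r}. (0::real))"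
    proof (rule set_integral_cong_on)
      fix s assume s: "s \<in> {\<tau>..\<sigma> ?r}"
      then have sS: "s \<in> {0..S}" using \<tau> \<sigma>_le_S[of ?r] by auto
      have "\<phi> s = ?r" using \<phi>_eq_iff[OF sS r] s \<tau>r by auto
      then show "p0 (\<phi> s) = 0" using p0_R[OF True] by simp
    qed
    then show ?thesis by simp
  next
    case False
    then have "\<Delta> ?r = 0" using R_iff[OF r] \<Delta>_nonneg[of ?r] by simp
    then have "\<tau> = \<sigma> ?r" using \<sigma>_\<Delta>[OF r] \<tau>r by auto
    moreover have "(LBINT s:{a..b}. p0 (\<phi> s)) = 0" if "a = b" for a b using that by simp
    ultimately show ?thesis by blast
  qed
  moreover have "(LBINT s:{0..\<sigma> ?r}. p0 (\<phi> s)) = ?r"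
  proof -
    have "{0..\<sigma> ?r} = {s\<in>{0..S}. \<phi> s \<in> {0..?r}}"
      unfolding sublevel[OF r, symmetric] using \<phi>_range by simp
    then have "(LBINT s:{0..\<sigma> ?r}. p0 (\<phi> s)) = (LBINT s:{s\<in>{0..S}. \<phi> s \<in> {0..?r}}. p0 (\<phi> s))" by (rule arg_cong)
    also have "\<dots> = (LINT r:{0..?r}|lam. p0 r)" by (rule integral_\<phi>) simp_all
    also have "\<dots> = (LBINT t:{0..0 + ?r}. (1::real))" using integral_piece_lborel[of "\<lambda>_. 1::real" ?r 0] r by simp
    also have "\<dots> = ?r" using r by (simp add: set_lebesgue_integral_def)
    finally show ?thesis .
  qed
  ultimately show ?thesis by simp
qed

lemma p_measurable: "p \<in> borel_measurable borel" and p_bounds: "0 \<le> p s" "p s \<le> 1"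
proof -
  show "p \<in> borel_measurable borel" unfolding p_def by (rule glue_measurable) measurable
  have "0 \<le> p s \<and> p s \<le> 1" unfolding p_def by (rule glue_cases[of S N "\<lambda>l s. p0 (\<phi> s)" s]) (use p0_bounds in auto)
  then show "0 \<le> p s" "p s \<le> 1" by auto
qed

lemma p_integral: assumes s: "s \<in> {0..L}" shows "\<Phi> s = (LBINT r:{0..s}. p r)"
proof -
  obtain k \<tau> where k: "k < N" "\<tau> \<in> {0..S}" "s = real k * S + \<tau>" using block[OF s] by metis
  note G = glue_integral[where F = "\<lambda>l s. p0 (\<phi> s)" and S = S and N = N and B = 1]
  have m: "(\<lambda>s. p0 (\<phi> s)) \<in> borel_measurable borel" by measurable
  have b: "norm (p0 (\<phi> s)) \<le> 1" for s using p0_bounds[of "\<phi> s"] by simp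
  have S0: "0 \<le> S" "S \<in> {0..S}" using S_pos by auto
  have "(LBINT r:{0..real k * S}. p r) = (\<Sum>l=1..k. LBINT s:{0..S}. p0 (\<phi> s))"
    unfolding p_def by (rule G(1)) (use m b S0 k in auto)
  also have "\<dots> = real k * h" by (simp add: p0_\<phi>_integral[OF S0(2)] \<phi>_S)
  finally have 1: "(LBINT r:{0..real k * S}. p r) = real k * h" .
  have "(LBINT r:{0..real k * S + \<tau>}. p r) = (LBINT r:{0..real k * S}. p r) + (LBINT s:{0..\<tau>}. p0 (\<phi> s))"
    unfolding p_def by (rule G(2)) (use m b S0 k in auto)
  then show ?thesis using k(3) 1 \<Phi>_nat_block[OF k(2), of k] by (simp add: p0_\<phi>_integral[OF k(2)])
qed

lemma wg_measurable: "wg \<in> borel_measurable borel" and wg_K: "wg s \<in> K" and wg_bound: "norm1 (wg s) \<le> CARD('m)"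
proof -
  show "wg \<in> borel_measurable borel" unfolding wg_def by (rule glue_measurable) (rule w_measurable)
  have "wg s \<in> K \<and> norm1 (wg s) \<le> CARD('m)"
    unfolding wg_def by (rule glue_cases[of S N w s]) (use w_K w_bound zero_in_K in \<open>auto simp: norm1_0\<close>)
  then show "wg s \<in> K" "norm1 (wg s) \<le> CARD('m)" by auto
qed

lemma y_block: assumes k: "k < N" and \<tau>: "\<tau> \<in> {0..S}"
  shows "y (real k * S + \<tau>) = \<zeta> 0 (int (k + 1)) 0 + (LBINT s:{0..\<tau>}. H (k + 1) s)"
proof -
  obtain B where B: "0 \<le> B" "\<And>l s. l \<in> {1..N} \<Longrightarrow> norm (H l s) \<le> B" by (rule H_bounded) (rule that)
  have l: "k + 1 \<in> {1..N}" using k by simp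
  have "real k + 1 \<le> real N" using k by simp
  then have "(real k + 1) * S \<le> L" unfolding L_def using S_pos by (intro mult_right_mono) auto
  then have s: "0 \<le> real k * S + \<tau>" "min (real k * S + \<tau>) L = real k * S + \<tau>" using \<tau> S_pos by (auto simp: algebra_simps)
  then have "y (real k * S + \<tau>) = x0 + (LBINT r:{0..real k * S + \<tau>}. glue S N H r)" by (simp add: y_def)
  also have "(LBINT r:{0..real k * S + \<tau>}. glue S N H r) = (LBINT r:{0..real k * S}. glue S N H r) + (LBINT s:{0..\<tau>}. H (k + 1) s)"
    by (rule glue_integral(2)[OF H_measurable B(2,1) less_imp_le[OF S_pos] k \<tau>])
  also have "(LBINT r:{0..real k * S}. glue S N H r) = (\<Sum>l=1..k. LBINT s:{0..S}. H l s)"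
    by (rule glue_integral(1)[OF H_measurable B(2,1) less_imp_le[OF S_pos] less_imp_le[OF k]])
  finally show ?thesis using chain(1)[OF l] by (simp add: add.assoc)
qed

lemma y_measurable: "y \<in> borel_measurable borel"
proof -
  obtain B where B: "0 \<le> B" "\<And>l s. l \<in> {1..N} \<Longrightarrow> norm (H l s) \<le> B" by (rule H_bounded) (rule that)
  have c: "continuous_on {0..} (\<lambda>b. LBINT s:{0..b}. glue S N H s)"
    by (rule continuous_indefinite_integral[OF glue_measurable[OF H_measurable] glue_bound[OF B(2,1)]])
  have "continuous_on UNIV (\<lambda>s. LBINT r:{0..max 0 (min s L)}. glue S N H r)"
    by (rule continuous_on_compose2[OF c]) (auto intro!: continuous_intros)
  then have [measurable]: "(\<lambda>s. LBINT r:{0..max 0 (min s L)}. glue S N H r) \<in> borel_measurable borel"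
    by (rule borel_measurable_continuous_onI)
  have [measurable]: "\<xi> \<in> borel_measurable borel" by (rule borel_measurable_continuous_onI[OF \<xi>_continuous])
  have L0: "0 \<le> L" using S_pos by (simp add: L_def)
  have "y = (\<lambda>s. if s < 0 then \<xi> (\<Phi> s) else x0 + (LBINT r:{0..max 0 (min s L)}. glue S N H r))"
    using L0 by (simp add: y_def fun_eq_iff)
  then show ?thesis by (simp only:) measurable
qed

text \<open>Delays beyond the initial time lead into the history, where both sides are \<open>\<xi>\<close> at the delayed time.\<close>
lemma y_delayed: assumes k: "k < N" and \<tau>: "\<tau> \<in> {0<..<S}"
  shows "delayed lag S y (real k * S + \<tau>) = shifted lag (\<lambda>l'. yl l' \<tau>) (int (k + 1))"
proof -
  have \<tau>': "\<tau> \<in> {0..S}" using \<tau> by auto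
  have "y (real k * S + \<tau> - real (lag i) * S) = yl (int (k + 1) - int (lag i)) \<tau>" for i
  proof (cases "lag i \<le> k")
    case True
    let ?k = "k - lag i"
    have "real k * S + \<tau> - real (lag i) * S = real ?k * S + \<tau>" using True by (simp add: of_nat_diff algebra_simps)
    moreover have "int (k + 1) - int (lag i) = int (?k + 1)" using True by simp
    moreover have k': "?k < N" "?k + 1 \<in> {1..N}" using k by auto
    have "y (real ?k * S + \<tau>) = yl (int (?k + 1)) \<tau>"
      by (rule trans[OF y_block[OF k'(1) \<tau>'] completed_path[OF k'(2) \<tau>, symmetric]])
    ultimately show ?thesis by (simp only:)
  next
    case False
    let ?k = "int k - int (lag i)"
    have e: "real k * S + \<tau> - real (lag i) * S = real_of_int ?k * S + \<tau>" by (simp add: algebra_simps)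
    have "real_of_int ?k \<le> - 1" using False by linarith
    then have "real_of_int ?k * S \<le> - 1 * S" using S_pos by (intro mult_right_mono) auto
    then have "real_of_int ?k * S + \<tau> < 0" using \<tau> by auto
    then have "y (real_of_int ?k * S + \<tau>) = \<xi> (real_of_int ?k * h + \<phi> \<tau>)" using \<Phi>_block[OF \<tau>', of ?k] by (simp add: y_def)
    moreover have "yl (int (k + 1) - int (lag i)) \<tau> = \<xi> (\<phi> \<tau> + (real_of_int (int (k + 1) - int (lag i)) - 1) * h)"
      by (rule yl_past) (use False in simp)
    ultimately show ?thesis unfolding e by (simp add: algebra_simps)
  qed
  then show ?thesis by (simp add: delayed_def shifted_def)
qed

lemma y_equation: assumes s: "s \<in> {0..L}"
  shows "y s = x0 + (LBINT r:{0..s}. p r *\<^sub>R f (\<Phi> r, delayed lag S y r) + (\<Sum>j\<in>UNIV. (wg r $ j) *\<^sub>R g j (\<Phi> r, delayed lag S y r)))"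
proof -
  have "y s = x0 + (LBINT r:{0..s}. glue S N H r)" using s by (simp add: y_def)
  also have "(LBINT r:{0..s}. glue S N H r) = (LBINT r:{0..s}. p r *\<^sub>R f (\<Phi> r, delayed lag S y r) + (\<Sum>j\<in>UNIV. (wg r $ j) *\<^sub>R g j (\<Phi> r, delayed lag S y r)))"
  proof (rule set_lebesgue_integral_cong_AE)
    note [measurable] = p_measurable wg_measurable field_along_measurable[OF C1_map_continuous[OF f(2)] \<Phi>_measurable y_measurable]
      field_along_measurable[OF C1_map_continuous[OF g(2)] \<Phi>_measurable y_measurable]
    show "glue S N H \<in> borel_measurable lborel" using glue_measurable[OF H_measurable] by simp
    show "(\<lambda>r. p r *\<^sub>R f (\<Phi> r, delayed lag S y r) + (\<Sum>j\<in>UNIV. (wg r $ j) *\<^sub>R g j (\<Phi> r, delayed lag S y r))) \<in> borel_measurable lborel"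
      by measurable
    have "range (\<lambda>k. real k * S) \<in> null_sets lborel" by (rule countable_imp_null_set_lborel) simp
    then have "AE r in lborel. r \<notin> range (\<lambda>k. real k * S)" by (rule AE_not_in)
    then show "AE r\<in>{0..s} in lborel. glue S N H r = p r *\<^sub>R f (\<Phi> r, delayed lag S y r) + (\<Sum>j\<in>UNIV. (wg r $ j) *\<^sub>R g j (\<Phi> r, delayed lag S y r))"
    proof (rule AE_mp, intro AE_I2 impI)
      fix r assume r: "r \<notin> range (\<lambda>k. real k * S)" "r \<in> {0..s}"
      then have "r \<in> {0..L}" using s by auto
      then obtain k \<tau> where k: "k < N" "\<tau> \<in> {0..S}" "r = real k * S + \<tau>" using block by metis
      have "\<tau> \<noteq> 0" using r(1) k(3) by auto
      moreover have "\<tau> \<noteq> S"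
      proof
        assume "\<tau> = S"
        then have "r = real (k + 1) * S" using k(3) by (simp add: algebra_simps)
        then show False using r(1) by blast
      qed
      ultimately have \<tau>: "\<tau> \<in> {0<..<S}" "\<tau> \<in> {0..<S}" using k(2) by auto
      note e = glue_eq[OF k(1) \<tau>(2)]
      show "glue S N H r = p r *\<^sub>R f (\<Phi> r, delayed lag S y r) + (\<Sum>j\<in>UNIV. (wg r $ j) *\<^sub>R g j (\<Phi> r, delayed lag S y r))"
        unfolding k(3) p_def wg_def e y_delayed[OF k(1) \<tau>(1)] \<Phi>_nat_block[OF k(2)] H_def by (simp add: add.commute)
    qed
  qed simp
  finally show ?thesis .
qed

lemma \<Phi>_sublevel:
  assumes l: "l \<in> {1..N}" and r: "r \<in> {0..h}" "r < h \<or> l = N"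
  shows "{s\<in>{0..L}. \<Phi> s \<le> r + node h l} = {0..(real l - 1) * S + \<sigma> r}" and "(real l - 1) * S + \<sigma> r \<in> {0..L}"
proof -
  have l1: "0 \<le> (real l - 1) * S" "(real l - 1) * S + S \<le> L"
  proof -
    have "1 \<le> real l" "real l \<le> real N" using l by auto
    then have "real l * S \<le> L" "0 \<le> (real l - 1) * S" unfolding L_def using S_pos by (auto intro: mult_right_mono)
    moreover have "real l * S = (real l - 1) * S + S" by (simp add: algebra_simps)
    ultimately show "0 \<le> (real l - 1) * S" "(real l - 1) * S + S \<le> L" by simp_all
  qed
  show 2: "(real l - 1) * S + \<sigma> r \<in> {0..L}" using l1 \<sigma>_nonneg[of r] \<sigma>_le_S[of r] by auto
  have "\<Phi> s \<le> r + node h l \<longleftrightarrow> s \<le> (real l - 1) * S + \<sigma> r" if s: "s \<in> {0..L}" for s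
  proof -
    obtain k \<tau> where k: "k < N" "\<tau> \<in> {0..S}" "s = real k * S + \<tau>" "\<tau> < S \<or> s = L" using block[OF s] by metis
    have \<Phi>: "\<Phi> s = real k * h + \<phi> \<tau>" using \<Phi>_nat_block[OF k(2)] k(3) by simp
    have \<phi>: "0 \<le> \<phi> \<tau>" "\<phi> \<tau> \<le> h" using \<phi>_range[of \<tau>] by auto
    consider "k + 1 = l" | "k + 1 < l" | "l < k + 1" by linarith
    then show ?thesis
    proof cases
      case 1
      then have "real l - 1 = real k" by linarith
      then show ?thesis using \<Phi> k(3) \<phi>_le_iff[OF k(2) r(1)] by simp
    next
      case 2
      then have "real k + 1 \<le> real l - 1" by linarith
      then have "(real k + 1) * h \<le> node h l" "(real k + 1) * S \<le> (real l - 1) * S" using h_pos S_pos by (auto intro: mult_right_mono)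
      moreover have "(real k + 1) * h = real k * h + h" "(real k + 1) * S = real k * S + S" by (simp_all add: algebra_simps)
      ultimately have "\<Phi> s \<le> r + node h l" "s \<le> (real l - 1) * S + \<sigma> r" using \<Phi> \<phi> k(2,3) r(1) \<sigma>_nonneg[of r] unfolding atLeastAtMost_iff by linarith+
      then show ?thesis by simp
    next
      case 3
      then have "r < h" using r(2) k(1) by auto
      have "real l \<le> real k" using 3 by linarith
      then have "real l * h \<le> real k * h" "real l * S \<le> real k * S" using h_pos S_pos by (auto intro: mult_right_mono)
      moreover have "real l * h = node h l + h" "real l * S = (real l - 1) * S + S" by (simp_all add: algebra_simps)
      ultimately have gt: "\<not> \<Phi> s \<le> r + node h l" and ge: "(real l - 1) * S + S \<le> s"
        using \<Phi> \<phi> k(2,3) \<open>r < h\<close> unfolding atLeastAtMost_iff by linarith+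
      have "\<sigma> r < S"
        using \<sigma>_gap[of r h] \<sigma>m_le[of h] \<sigma>_le_S[of h] \<open>r < h\<close> r(1) by auto
      then show ?thesis using gt ge by linarith
    qed
  qed
  then show "{s\<in>{0..L}. \<Phi> s \<le> r + node h l} = {0..(real l - 1) * S + \<sigma> r}" using 2 by auto
qed

lemma time_block:
  assumes t: "t \<in> {0<..T}"
  obtains l r where "l \<in> {1..N}" "r \<in> {0..h}" "r < h \<or> l = N" "t = r + node h l"
proof (cases "t = T")
  case True
  then show thesis using that[of N h] N h_pos by (auto simp: T algebra_simps)
next
  case False
  let ?k = "nat \<lfloor>t / h\<rfloor>"
  have s: "0 \<le> t / h" "t / h < real N" using t False h_pos by (auto simp: T divide_less_eq)
  then have k: "real ?k \<le> t / h" "t / h < real ?k + 1" by linarith+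
  have "real ?k * h \<le> t" "t < (real ?k + 1) * h" using k h_pos by (simp_all add: le_divide_eq divide_less_eq)
  moreover have "?k < N" using k(1) s(2) by linarith
  ultimately show thesis using that[of "?k + 1" "t - real ?k * h"] by (auto simp: algebra_simps)
qed

lemma pf_glue:
  fixes q :: "nat \<Rightarrow> real \<Rightarrow> 'e::{banach, second_countable_topology}"
  assumes q: "\<And>l. l \<in> {1..N} \<Longrightarrow> q l \<in> borel_measurable borel" "\<And>l s. l \<in> {1..N} \<Longrightarrow> norm (q l s) \<le> B" "0 \<le> B"
    and A[measurable]: "A \<in> sets borel"
  shows "pf \<Phi> L (glue S N q) A = (\<Sum>l=1..N. LBINT s:{s\<in>{0..S}. \<phi> s + node h l \<in> A}. q l s)"
proof -
  let ?q = "\<lambda>l s. indicator A (\<phi> s + node h l) *\<^sub>R q l s"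
  have "indicator A (\<Phi> s) *\<^sub>R glue S N q s = glue S N ?q s" for s
    unfolding glue_def scaleR_sum_right
  proof (rule sum.cong[OF refl])
    fix k
    show "indicator A (\<Phi> s) *\<^sub>R (indicat_real {real k * S..<real k * S + S} s *\<^sub>R q (k + 1) (s - real k * S)) =
      indicat_real {real k * S..<real k * S + S} s *\<^sub>R ?q (k + 1) (s - real k * S)"
    proof (cases "s \<in> {real k * S..<real k * S + S}")
      case True
      then have "s - real k * S \<in> {0..S}" by auto
      from \<Phi>_nat_block[OF this, of k] have "\<Phi> s = \<phi> (s - real k * S) + (real (k + 1) - 1) * h" by simp
      then show ?thesis using True by simp
    qed simp
  qed
  then have "pf \<Phi> L (glue S N q) A = (LBINT s:{0..real N * S}. glue S N ?q s)"
    unfolding pf_def set_lebesgue_integral_def L_def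
    by (intro Bochner_Integration.integral_cong refl) (auto simp: indicator_def)
  also have "\<dots> = (\<Sum>l=1..N. LBINT s:{0..S}. ?q l s)"
  proof (rule glue_integral(1)[where B = B])
    fix l assume l: "l \<in> {1..N}"
    note [measurable] = q(1)[OF l]
    show "?q l \<in> borel_measurable borel" by measurable
    show "norm (?q l s) \<le> B" for s using q(2)[OF l, of s] q(3) by (auto simp: indicator_def)
  qed (use q(3) S_pos in auto)
  also have "\<dots> = (\<Sum>l=1..N. LBINT s:{s\<in>{0..S}. \<phi> s + node h l \<in> A}. q l s)"
    unfolding set_lebesgue_integral_def
    by (intro sum.cong Bochner_Integration.integral_cong refl) (auto simp: indicator_def)
  finally show ?thesis .
qed

text \<open>Off this countable set neither the attached controls nor the nodes contribute.\<close>
definition Z where "Z = (\<lambda>l. real l * h) ` {0..N} \<union> (\<Union>l\<in>{1..N}. (\<lambda>r. r + node h l) ` (R \<inter> {0<..<h}))"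

lemma node_in_Z: "l \<le> N \<Longrightarrow> real l * h \<in> Z"
  unfolding Z_def by auto

text \<open>A set function \<open>m\<close> is recognised as an image under \<open>\<Phi>\<close> by three tests: away from the atoms, at interior atoms, and at the nodes \<open>l h\<close>, where the
  end of piece \<open>l\<close> and the beginning of piece \<open>l + 1\<close> contribute.\<close>
lemma pf_identity:
  fixes q :: "nat \<Rightarrow> real \<Rightarrow> 'e::{banach, second_countable_topology}"
  assumes q: "\<And>l. l \<in> {1..N} \<Longrightarrow> q l \<in> borel_measurable borel" "\<And>l s. l \<in> {1..N} \<Longrightarrow> norm (q l s) \<le> B" "0 \<le> B"
    and m: "m \<in> vector_measures T"
    and off: "\<And>l B. l \<in> {1..N} \<Longrightarrow> B \<in> sets borel \<Longrightarrow> B \<subseteq> {0<..<h} \<Longrightarrow> B \<inter> R = {} \<Longrightarrow>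
      (LBINT s:{s\<in>{0..S}. \<phi> s \<in> B}. q l s) = m (up l B)"
    and atom: "\<And>l r. l \<in> {1..N} \<Longrightarrow> r \<in> {0<..<h} \<Longrightarrow> (LBINT s:{\<sigma>m r..\<sigma> r}. q l s) = m {r + node h l}"
    and node: "\<And>l. l \<in> {0..N} \<Longrightarrow> (if l \<in> {1..N} then LBINT s:{\<sigma>m h..\<sigma> h}. q l s else 0)
      + (if l + 1 \<in> {1..N} then LBINT s:{\<sigma>m 0..\<sigma> 0}. q (l + 1) s else 0) = m {real l * h}"
    and A: "A \<in> sets (borel_upto T)"
  shows "m A = pf \<Phi> L (glue S N q) A"
proof (rule vector_measures_eq_off_countable[OF m])
  show "pf \<Phi> L (glue S N q) \<in> vector_measures T"
    by (rule pf_vector_measures[OF \<Phi>_measurable set_integrable_bounded[OF glue_measurable[OF q(1)] glue_bound[OF q(2,3)]]])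
  show "countable Z" unfolding Z_def using countable_R by (intro countable_Un countable_UN countable_image countable_Int1) auto
  show "Z \<subseteq> {0..T}"
  proof -
    have "real l * h \<in> {0..T}" if "l \<in> {0..N}" for l using that h_pos by (auto simp: T intro: mult_right_mono)
    moreover have "r + node h l \<in> {0..T}" if "l \<in> {1..N}" "r \<in> {0<..<h}" for l r
      using node_range[OF that(1)] that(2) unfolding atLeastAtMost_iff greaterThanLessThan_iff by linarith
    ultimately show ?thesis by (auto simp: Z_def)
  qed
  have pfA: "pf \<Phi> L (glue S N q) A = (\<Sum>l=1..N. LBINT s:{s\<in>{0..S}. \<phi> s + node h l \<in> A}. q l s)" if "A \<in> sets borel" for A
    by (rule pf_glue[OF q that])
  show "m A = pf \<Phi> L (glue S N q) A" if A: "A \<in> sets (borel_upto T)" "A \<inter> Z = {}" for A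
  proof -
    have Ab[measurable]: "A \<in> sets borel" using A(1) by (simp add: sets_borel_upto)
    define D where "D l = {r\<in>{0<..<h}. r + node h l \<in> A}" for l
    have D: "D l \<in> sets borel" "D l \<subseteq> {0<..<h}" for l unfolding D_def by (measurable, blast)
    have DR: "D l \<inter> R = {}" if "l \<in> {1..N}" for l
    proof -
      have "r + node h l \<in> Z" if "r \<in> R" "r \<in> {0<..<h}" for r
        unfolding Z_def using that \<open>l \<in> {1..N}\<close> by blast
      then show ?thesis using A(2) by (auto simp: D_def)
    qed
    have "pf \<Phi> L (glue S N q) A = (\<Sum>l=1..N. m (up l (D l)))"
      unfolding pfA[OF Ab]
    proof (rule sum.cong[OF refl])
      fix l assume l: "l \<in> {1..N}"
      have "{s\<in>{0..S}. \<phi> s + node h l \<in> A} = {s\<in>{0..S}. \<phi> s \<in> D l}"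
      proof -
        have "\<phi> s \<in> {0<..<h}" if "\<phi> s + node h l \<in> A" for s
        proof -
          have "\<phi> s \<noteq> 0"
          proof
            assume "\<phi> s = 0"
            then have "\<phi> s + node h l = real (l - 1) * h" using l by (simp add: of_nat_diff)
            moreover have "real (l - 1) * h \<in> Z" by (rule node_in_Z) (use l in auto)
            ultimately show False using A(2) that by auto
          qed
          moreover have "\<phi> s \<noteq> h"
          proof
            assume "\<phi> s = h"
            then have "\<phi> s + node h l = real l * h" by (simp add: algebra_simps)
            moreover have "real l * h \<in> Z" by (rule node_in_Z) (use l in auto)
            ultimately show False using A(2) that by auto
          qed
          ultimately show ?thesis using \<phi>_range[of s] by auto
        qed
        then show ?thesis by (auto simp: D_def)
      qed
      then show "(LBINT s:{s\<in>{0..S}. \<phi> s + node h l \<in> A}. q l s) = m (up l (D l))"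
        using off[OF l D DR[OF l]] by simp
    qed
    also have "\<dots> = m (\<Union>l\<in>{1..N}. up l (D l))"
    proof (rule vector_measures_UN[OF m, symmetric])
      have False if "l < l'" "t < real l * h" "(real l' - 1) * h < t" for l l' t
      proof -
        have "real l \<le> real l' - 1" using that(1) by linarith
        then have "real l * h \<le> (real l' - 1) * h" using h_pos by (intro mult_right_mono) auto
        then show False using that by linarith
      qed
      then show "disjoint_family_on (\<lambda>l. up l (D l)) {1..N}"
        unfolding disjoint_family_on_def up_def
        by (intro ballI impI, elim linorder_neqE_nat) force+
      show "up l (D l) \<in> sets (borel_upto T)" if "l \<in> {1..N}" for l by (rule up_sets(1)[OF that D(1)])
    qed simp
    also have "(\<Union>l\<in>{1..N}. up l (D l)) = A"
    proof (intro equalityI subsetI)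
      fix t assume "t \<in> (\<Union>l\<in>{1..N}. up l (D l))"
      then show "t \<in> A" by (auto simp: up_def D_def)
    next
      fix t assume t: "t \<in> A"
      have "t \<noteq> 0" using t A(2) node_in_Z[of 0] by auto
      then have "t \<in> {0<..T}" using t sets_borel_upto_subset[OF A(1)] by force
      then obtain l r where l: "l \<in> {1..N}" "r \<in> {0..h}" "t = r + node h l" using time_block by metis
      have "r \<noteq> 0"
      proof
        assume "r = 0"
        then have "t = real (l - 1) * h" using l by (simp add: of_nat_diff)
        moreover have "real (l - 1) * h \<in> Z" by (rule node_in_Z) (use l in auto)
        ultimately show False using t A(2) by auto
      qed
      moreover have "r \<noteq> h"
      proof
        assume "r = h"
        then have "t = real l * h" using l by (simp add: algebra_simps)
        moreover have "real l * h \<in> Z" by (rule node_in_Z) (use l in auto)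
        ultimately show False using t A(2) by auto
      qed
      ultimately have r: "r \<in> {0<..<h}" using l(2) by auto
      then have "r \<in> D l" using t l(3) by (simp add: D_def)
      moreover have "t \<in> {node h l<..<real l * h}" using r l(3) by (auto simp: algebra_simps)
      ultimately have "t \<in> up l (D l)" using l(3) by (simp add: up_def)
      then show "t \<in> (\<Union>l\<in>{1..N}. up l (D l))" using l(1) by blast
    qed
    finally show ?thesis by simp
  qed
  have far: "\<phi> s + node h l \<noteq> r + (real l' - 1) * h" if "l \<noteq> l'" "r \<in> {0<..<h}" for s l l' r
  proof
    assume e: "\<phi> s + node h l = r + (real l' - 1) * h"
    have "real l + 1 \<le> real l' \<or> real l' + 1 \<le> real l" using that(1) by linarith
    then have "(real l + 1) * h \<le> real l' * h \<or> (real l' + 1) * h \<le> real l * h" using h_pos by (auto intro: mult_right_mono)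
    then show False using e \<phi>_range[of s] that(2) by (auto simp: algebra_simps)
  qed
  show "m {z} = pf \<Phi> L (glue S N q) {z}" if "z \<in> Z" for z
  proof -
    have "z \<in> (\<lambda>l. real l * h) ` {0..N} \<or> z \<in> (\<Union>l\<in>{1..N}. (\<lambda>r. r + node h l) ` (R \<inter> {0<..<h}))"
      using that unfolding Z_def by (rule UnE) blast+
    then show ?thesis
    proof
      assume "z \<in> (\<Union>l\<in>{1..N}. (\<lambda>r. r + node h l) ` (R \<inter> {0<..<h}))"
      then obtain l0 r where z: "l0 \<in> {1..N}" "r \<in> {0<..<h}" "z = r + (real l0 - 1) * h" by blast
      have r: "r \<in> {0..h}" using z(2) by auto
      have "pf \<Phi> L (glue S N q) {z} = (\<Sum>l=1..N. if l = l0 then m {z} else 0)"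
        unfolding pfA[OF borel_singleton[OF sets.empty_sets]]
      proof (rule sum.cong[OF refl])
        fix l assume l: "l \<in> {1..N}"
        show "(LBINT s:{s\<in>{0..S}. \<phi> s + node h l \<in> {z}}. q l s) = (if l = l0 then m {z} else 0)"
        proof (cases "l = l0")
          case True
          then have "{s\<in>{0..S}. \<phi> s + node h l \<in> {z}} = {\<sigma>m r..\<sigma> r}" unfolding fibre[OF r, symmetric] z(3) by simp
          then show ?thesis using atom[OF l z(2)] True z(3) by simp
        next
          case False
          then have "{s\<in>{0..S}. \<phi> s + node h l \<in> {z}} = {}" using far[OF False z(2)] z(3) by simp
          then show ?thesis using False by (simp add: set_lebesgue_integral_def)
        qed
      qed
      then show ?thesis using z(1) by simp
    next
      assume "z \<in> (\<lambda>l. real l * h) ` {0..N}"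
      then obtain l0 where z: "l0 \<in> {0..N}" "z = real l0 * h" by blast
      have hh: "0 \<in> {0..h}" "h \<in> {0..h}" using h_pos by auto
      have "pf \<Phi> L (glue S N q) {z} = (\<Sum>l=1..N. (if l = l0 then LBINT s:{\<sigma>m h..\<sigma> h}. q l s else 0)
          + (if l = l0 + 1 then LBINT s:{\<sigma>m 0..\<sigma> 0}. q l s else 0))"
        unfolding pfA[OF borel_singleton[OF sets.empty_sets]]
      proof (rule sum.cong[OF refl])
        fix l assume l: "l \<in> {1..N}"
        consider "l = l0" | "l = l0 + 1" | "l + 1 \<le> l0" | "l0 + 2 \<le> l" by linarith
        then show "(LBINT s:{s\<in>{0..S}. \<phi> s + node h l \<in> {z}}. q l s) =
           (if l = l0 then LBINT s:{\<sigma>m h..\<sigma> h}. q l s else 0) + (if l = l0 + 1 then LBINT s:{\<sigma>m 0..\<sigma> 0}. q l s else 0)"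
        proof cases
          case 1
          have "\<phi> s + node h l = z \<longleftrightarrow> \<phi> s = h" for s unfolding z(2) 1 by (simp add: algebra_simps)
          then have "{s\<in>{0..S}. \<phi> s + node h l \<in> {z}} = {\<sigma>m h..\<sigma> h}" unfolding fibre[OF hh(2), symmetric] by simp
          then show ?thesis using 1 by simp
        next
          case 2
          then have "real l - 1 = real l0" by simp
          then have "{s\<in>{0..S}. \<phi> s + node h l \<in> {z}} = {\<sigma>m 0..\<sigma> 0}" unfolding fibre[OF hh(1), symmetric] z(2) by simp
          then show ?thesis using 2 by simp
        next
          case 3
          then have "real l + 1 \<le> real l0" by linarith
          then have "(real l + 1) * h \<le> real l0 * h" using h_pos by (intro mult_right_mono) auto
          then have "\<phi> s + node h l \<noteq> z" for s using \<phi>_range[of s] h_pos unfolding z(2) by (auto simp: algebra_simps)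
          then show ?thesis using 3 by (simp add: set_lebesgue_integral_def)
        next
          case 4
          then have "real l0 + 2 \<le> real l" by linarith
          then have "(real l0 + 2) * h \<le> real l * h" using h_pos by (intro mult_right_mono) auto
          then have "\<phi> s + node h l \<noteq> z" for s using \<phi>_range[of s] h_pos unfolding z(2) by (auto simp: algebra_simps)
          then show ?thesis using 4 by (simp add: set_lebesgue_integral_def)
        qed
      qed
      also have "\<dots> = m {z}"
        unfolding z(2) node[OF z(1), symmetric] sum.distrib by simp
      finally show ?thesis by simp
    qed
  qed
qed (rule A)

lemma om_integral_trivial: "r \<in> {0..h} \<Longrightarrow> r \<notin> R \<Longrightarrow> (LBINT s:{0..1}. om r l s) = 0 \<and> (LBINT s:{0..1}. norm1 (om r l s)) = 0"
  by (simp add: om_trivial norm1_0 set_lebesgue_integral_def)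

lemma interior_atom:
  assumes l: "l \<in> {1..N}" and r: "r \<in> {0<..<h}"
  shows "(LBINT s:{0..1}. om r l s) = \<mu> {r + node h l}"
    and "(LBINT s:{0..1}. norm1 (om r l s)) = measure \<nu> {r + node h l}"
  using om_vector_integral[of r l] om_norm_integral[of r l] \<omega>_\<mu>[OF r l] \<omega>_\<nu>[OF r l] l r by simp_all

lemma norm1_bound: "norm (norm1 (om r l s)) \<le> \<Delta> r" "norm (om r l s) \<le> \<Delta> r"
  using om_bound[of r l s] norm_le_norm1[of "om r l s"] by auto

lemma padded_om:
  assumes "r \<in> {0..h}" shows "AE s in lebesgue. s \<in> {0..1} \<longrightarrow> padded N \<omega> r l s = om r l s"
  using om_AE[OF assms, of l] by (cases "l \<in> {1..N}") (auto simp: padded_def om_def)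

lemma padded_measurable:
  assumes "r \<in> {0..h}" shows "padded N \<omega> r l \<in> borel_measurable (lebesgue_on {0..1})"
  using \<omega>_meas[OF assms, of l] by (cases "l \<in> {1..N}") (auto simp: padded_def[abs_def])

lemma node_atom:
  assumes l: "l \<in> {0..N}"
  shows "(LBINT s:{0..1}. om h l s) + (LBINT s:{0..1}. om 0 (l + 1) s) = \<mu> {real l * h}"
    and "(LBINT s:{0..1}. norm1 (om h l s)) + (LBINT s:{0..1}. norm1 (om 0 (l + 1) s)) = measure \<nu> {real l * h}"
proof -
  have hh: "0 \<in> {0..h}" "h \<in> {0..h}" using h_pos by auto
  note pm[measurable] = padded_measurable[OF hh(2), of l] padded_measurable[OF hh(1), of "l + 1"]
  have ae: "AE s in lebesgue. s \<in> {0..1} \<longrightarrow> padded N \<omega> h l s = om h l s \<and> padded N \<omega> 0 (l + 1) s = om 0 (l + 1) s"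
    using padded_om[OF hh(2), of l] padded_om[OF hh(1), of "l + 1"] by eventually_elim auto
  have ae1: "AE s in lebesgue. s \<in> {0..1} \<longrightarrow> padded N \<omega> h l s + padded N \<omega> 0 (l + 1) s = om h l s + om 0 (l + 1) s"
    by (rule AE_mp[OF ae]) (auto intro!: AE_I2)
  have ae2: "AE s in lebesgue. s \<in> {0..1} \<longrightarrow> norm1 (padded N \<omega> h l s) + norm1 (padded N \<omega> 0 (l + 1) s) = norm1 (om h l s) + norm1 (om 0 (l + 1) s)"
    by (rule AE_mp[OF ae]) (auto intro!: AE_I2)
  have i: "set_integrable lborel {0..1} (om r l)" "set_integrable lborel {0..1} (\<lambda>s. norm1 (om r l s))" for r l
    using norm1_bound[of r l] by (auto intro!: set_integrable_bounded[where B = "\<Delta> r"])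
  have "(LINT s:{0..1}|lebesgue. padded N \<omega> h l s + padded N \<omega> 0 (l + 1) s) = (LBINT s:{0..1}. om h l s + om 0 (l + 1) s)"
    by (rule set_integral_lebesgue_AE[OF borel_measurable_add[OF pm] _ _ ae1]) measurable
  also have "\<dots> = (LBINT s:{0..1}. om h l s) + (LBINT s:{0..1}. om 0 (l + 1) s)" by (rule set_integral_add(2)[OF i(1) i(1)])
  finally show "(LBINT s:{0..1}. om h l s) + (LBINT s:{0..1}. om 0 (l + 1) s) = \<mu> {real l * h}"
    using \<omega>_\<mu>_node[OF l] by simp
  have "(LINT s:{0..1}|lebesgue. norm1 (padded N \<omega> h l s) + norm1 (padded N \<omega> 0 (l + 1) s)) = (LBINT s:{0..1}. norm1 (om h l s) + norm1 (om 0 (l + 1) s))"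
    by (rule set_integral_lebesgue_AE[OF borel_measurable_add[OF pm[THEN norm1_measurable]] _ _ ae2]) measurable
  also have "\<dots> = (LBINT s:{0..1}. norm1 (om h l s)) + (LBINT s:{0..1}. norm1 (om 0 (l + 1) s))" by (rule set_integral_add(2)[OF i(2) i(2)])
  finally show "(LBINT s:{0..1}. norm1 (om h l s)) + (LBINT s:{0..1}. norm1 (om 0 (l + 1) s)) = measure \<nu> {real l * h}"
    using \<omega>_\<nu>_node[OF l] by simp
qed

lemma om_outside: "l \<notin> {1..N} \<Longrightarrow> om r l s = 0"
  by (auto simp: om_def)

lemma up_no_atoms:
  assumes l: "l \<in> {1..N}" and B: "B \<subseteq> {0<..<h}" "B \<inter> R = {}" and t: "t \<in> up l B"
  shows "\<mu> {t} = 0" "emeasure \<nu> {t} = 0"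
proof -
  interpret \<nu>: finite_measure \<nu> by (rule \<nu>_finite)
  define r where "r = t - node h l"
  have r: "r \<in> {0<..<h}" "r \<in> {0..h}" "r \<notin> R" "t = r + node h l" using t B by (auto simp: up_def r_def)
  show "\<mu> {t} = 0" "emeasure \<nu> {t} = 0"
    using interior_atom[OF l r(1)] om_integral_trivial[OF r(2,3), of l] r(4) by (simp_all add: \<nu>.emeasure_eq_measure)
qed

lemma \<mu>_pf: assumes "A \<in> sets (borel_upto T)" shows "\<mu> A = pf \<Phi> L wg A"
  unfolding wg_def
proof (rule pf_identity[OF w_measurable _ _ \<mu> _ _ _ assms])
  show "norm (w l s) \<le> CARD('m)" if "l \<in> {1..N}" for l s using w_bound[OF that, of s] norm_le_norm1[of "w l s"] by linarith
  show "(LBINT s:{s\<in>{0..S}. \<phi> s \<in> B}. w l s) = \<mu> (up l B)"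
    if l: "l \<in> {1..N}" and B: "B \<in> sets borel" "B \<subseteq> {0<..<h}" "B \<inter> R = {}" for l B
  proof -
    have "B - R = B" "B \<subseteq> {0..<h}" using B(2,3) by auto
    then have "(LBINT s:{s\<in>{0..S}. \<phi> s \<in> B}. w l s) = \<mu>c (up l B)" using variation_off_atoms(2)[OF l B(1)] by simp
    also have "up l B - {t. \<mu> {t} \<noteq> 0} = up l B" using up_no_atoms(1)[OF l B(2,3)] by blast
    then have "\<mu>c (up l B) = \<mu> (up l B)" by (simp add: \<mu>c_def vector_continuous_part_def)
    finally show ?thesis .
  qed
  show "(LBINT s:{\<sigma>m r..\<sigma> r}. w l s) = \<mu> {r + node h l}" if "l \<in> {1..N}" "r \<in> {0<..<h}" for l r
    using w_jump(1)[OF that(1), of r] interior_atom(1)[OF that] that(2) by simp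
  show "(if l \<in> {1..N} then LBINT s:{\<sigma>m h..\<sigma> h}. w l s else 0)
      + (if l + 1 \<in> {1..N} then LBINT s:{\<sigma>m 0..\<sigma> 0}. w (l + 1) s else 0) = \<mu> {real l * h}" if l: "l \<in> {0..N}" for l
  proof -
    have "(if l \<in> {1..N} then LBINT s:{\<sigma>m h..\<sigma> h}. w l s else 0) = (LBINT s:{0..1}. om h l s)"
      using w_jump(1)[of l h] h_pos om_outside[of l h] by (simp add: set_lebesgue_integral_def)
    moreover have "(if l + 1 \<in> {1..N} then LBINT s:{\<sigma>m 0..\<sigma> 0}. w (l + 1) s else 0) = (LBINT s:{0..1}. om 0 (l + 1) s)"
      using w_jump(1)[of "l + 1" 0] h_pos om_outside[of "l + 1" 0] by (simp add: set_lebesgue_integral_def)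
    ultimately show ?thesis using node_atom(1)[OF l] by simp
  qed
qed simp_all

lemma norm1_glue:
  fixes F :: "nat \<Rightarrow> real \<Rightarrow> real ^ 'm"
  shows "norm1 (glue S N F s) = glue S N (\<lambda>l s. norm1 (F l s)) s"
proof (rule glue_cases[of S N F s])
  assume 0: "glue S N F s = 0"
  show ?thesis
  proof (rule glue_cases[of S N "\<lambda>l s. norm1 (F l s)" s])
    fix k s' assume k: "k < N" "s' \<in> {0..<S}" "s = real k * S + s'" "glue S N (\<lambda>l s. norm1 (F l s)) s = norm1 (F (k + 1) s')"
    then have "F (k + 1) s' = 0" using 0 glue_eq[OF k(1,2), of F] by simp
    then show ?thesis using 0 k(4) by simp
  qed (simp add: 0 norm1_0)
next
  fix k s' assume k: "k < N" "s' \<in> {0..<S}" "s = real k * S + s'" "glue S N F s = F (k + 1) s'"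
  show ?thesis unfolding k(4) unfolding k(3) by (simp add: glue_eq[OF k(1,2)])
qed

lemma \<nu>_pf: assumes "A \<in> sets (borel_upto T)" shows "measure \<nu> A = pf \<Phi> L (\<lambda>s. norm1 (wg s)) A"
  unfolding wg_def norm1_glue
proof (rule pf_identity[OF _ _ _ finite_measure_vector_measures[OF \<nu>_sets \<nu>_finite] _ _ _ assms])
  interpret \<nu>: finite_measure \<nu> by (rule \<nu>_finite)
  show "(\<lambda>s. norm1 (w l s)) \<in> borel_measurable borel" if "l \<in> {1..N}" for l
    by (rule norm1_measurable[OF w_measurable[OF that]])
  show "norm (norm1 (w l s)) \<le> CARD('m)" if "l \<in> {1..N}" for l s using w_bound[OF that, of s] by simp
  show "(LBINT s:{s\<in>{0..S}. \<phi> s \<in> B}. norm1 (w l s)) = measure \<nu> (up l B)"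
    if l: "l \<in> {1..N}" and B: "B \<in> sets borel" "B \<subseteq> {0<..<h}" "B \<inter> R = {}" for l B
  proof -
    have "B - R = B" "B \<subseteq> {0..<h}" using B(2,3) by auto
    then have "(LBINT s:{s\<in>{0..S}. \<phi> s \<in> B}. norm1 (w l s)) = measure \<nu>c (up l B)" using variation_off_atoms(1)[OF l B(1)] by simp
    also have "\<dots> = measure \<nu> (up l B)"
      using \<nu>c_eq_\<nu>[OF up_sets(1)[OF l B(1)]] up_no_atoms(2)[OF l B(2,3)] by (simp add: measure_def)
    finally show ?thesis .
  qed
  show "(LBINT s:{\<sigma>m r..\<sigma> r}. norm1 (w l s)) = measure \<nu> {r + node h l}" if "l \<in> {1..N}" "r \<in> {0<..<h}" for l r
    using w_jump(2)[OF that(1), of r] interior_atom(2)[OF that] that(2) by simp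
  show "(if l \<in> {1..N} then LBINT s:{\<sigma>m h..\<sigma> h}. norm1 (w l s) else 0)
      + (if l + 1 \<in> {1..N} then LBINT s:{\<sigma>m 0..\<sigma> 0}. norm1 (w (l + 1) s) else 0) = measure \<nu> {real l * h}" if l: "l \<in> {0..N}" for l
  proof -
    have "(if l \<in> {1..N} then LBINT s:{\<sigma>m h..\<sigma> h}. norm1 (w l s) else 0) = (LBINT s:{0..1}. norm1 (om h l s))"
      using w_jump(2)[of l h] h_pos om_outside[of l h] by (simp add: set_lebesgue_integral_def norm1_0)
    moreover have "(if l + 1 \<in> {1..N} then LBINT s:{\<sigma>m 0..\<sigma> 0}. norm1 (w (l + 1) s) else 0) = (LBINT s:{0..1}. norm1 (om 0 (l + 1) s))"
      using w_jump(2)[of "l + 1" 0] h_pos om_outside[of "l + 1" 0] by (simp add: set_lebesgue_integral_def norm1_0)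
    ultimately show ?thesis using node_atom(2)[OF l] by simp
  qed
qed simp_all

text \<open>The value at \<open>t = r + (l - 1) h\<close> is taken at the parameter \<open>(l - 1) S + \<sigma> r\<close>, the last one that \<open>\<Phi>\<close> maps to a time not after \<open>t\<close>.\<close>
lemma values_from_completion:
  assumes t: "t \<in> {0<..T}"
  shows "\<exists>s\<in>{0..L}. {r\<in>{0..L}. \<Phi> r \<le> t} = {0..s} \<and> x t = y s" and "v t = measure \<nu> {0..t}"
proof -
  obtain l r where l: "l \<in> {1..N}" "r \<in> {0..h}" "r < h \<or> l = N" "t = r + node h l" using time_block[OF t] by metis
  let ?s = "(real l - 1) * S + \<sigma> r"
  obtain k where k: "l = k + 1" "k < N" using l(1) by (cases l) auto
  have kl: "real l - 1 = real k" using k(1) by simp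
  have \<sigma>r: "\<sigma> r \<in> {0..S}" using \<sigma>_nonneg[of r] \<sigma>_le_S[of r] by simp
  have t0: "0 < r + node h l" using t l(4) by simp
  note sub = \<Phi>_sublevel[OF l(1-3), folded l(4)]
  note val = path_values[OF l(1,2) t0 l(3), folded l(4)]
  have "x t = y ?s" using val(1) y_block[OF k(2) \<sigma>r] unfolding kl k(1)[symmetric] by (simp only:)
  then show "\<exists>s\<in>{0..L}. {r\<in>{0..L}. \<Phi> r \<le> t} = {0..s} \<and> x t = y s" using sub by blast
  let ?n = "\<lambda>l s. norm1 (w l s)"
  have m: "?n l \<in> borel_measurable borel" if "l \<in> {1..N}" for l by (rule norm1_measurable[OF w_measurable[OF that]])
  have b: "norm (?n l s) \<le> CARD('m)" if "l \<in> {1..N}" for l s using w_bound[OF that, of s] by simp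
  have b0: "(0::real) \<le> CARD('m)" by simp
  have "{0..t} \<in> sets (borel_upto T)" using t by (auto simp: sets_borel_upto)
  then have "measure \<nu> {0..t} = pf \<Phi> L (glue S N ?n) {0..t}" using \<nu>_pf[of "{0..t}"] by (simp add: wg_def norm1_glue)
  also have "\<dots> = (LBINT s:{0..?s}. glue S N ?n s)"
  proof -
    have "0 \<le> \<Phi> s" if s: "s \<in> {0..L}" for s
    proof -
      obtain k \<tau> where "\<tau> \<in> {0..S}" "s = real k * S + \<tau>" using block[OF s] by metis
      then show ?thesis using \<Phi>_nat_block[of \<tau> k] \<phi>_range[of \<tau>] h_pos by simp
    qed
    then have "{s\<in>{0..L}. \<Phi> s \<in> {0..t}} = {s\<in>{0..L}. \<Phi> s \<le> t}" by auto
    then show ?thesis by (simp only: pf_def sub(1))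
  qed
  also have "\<dots> = (LBINT s:{0..real k * S}. glue S N ?n s) + (LBINT s:{0..\<sigma> r}. ?n (k + 1) s)"
    unfolding kl by (rule glue_integral(2)[OF m b b0 less_imp_le[OF S_pos] k(2) \<sigma>r])
  also have "(LBINT s:{0..real k * S}. glue S N ?n s) = (\<Sum>i=1..k. LBINT s:{0..S}. ?n i s)"
    by (rule glue_integral(1)[OF m b b0 less_imp_le[OF S_pos] less_imp_le[OF k(2)]])
  finally show "v t = measure \<nu> {0..t}" using val(2) chain(2)[OF l(1)] by (simp add: k(1))
qed

lemma graph_completion: "graph_completion N M h T S L (real CARD('m)) K lag f g x0 \<xi> \<Phi> p wg y"
proof (rule graph_completion.intro)
  have \<Phi>\<phi>: "\<Phi> s = \<phi> s" if "s \<in> {0..S}" for s using \<Phi>_nat_block[OF that, of 0] by simp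
  show "\<Phi> (s + S) = \<Phi> s + h" for s
  proof -
    have "(s + S) / S = s / S + 1" using S_pos by (simp add: add_divide_distrib)
    then show ?thesis by (simp add: \<Phi>_def algebra_simps)
  qed
  show "\<Phi> 0 = 0" using \<Phi>\<phi>[of 0] S_pos \<phi>_0 by simp
  show "0 \<le> \<Phi> b - \<Phi> a \<and> \<Phi> b - \<Phi> a \<le> b - a" if "0 \<le> a" "a \<le> b" "b \<le> S" for a b
    using \<phi>_Lipschitz[OF that] \<Phi>\<phi>[of a] \<Phi>\<phi>[of b] that by simp
  have L0: "0 \<le> L" using S_pos by (simp add: L_def)
  show "y s = \<xi> (\<Phi> s)" if "s < 0" for s using that by (simp add: y_def)
  show "y s = y L" if "L < s" for s using that L0 by (simp add: y_def)
qed (fact N h_pos T S_pos L_def lag K_cone f g \<xi>_uniformly_continuous \<xi>_bounded p_measurable p_bounds p_integral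
  wg_measurable wg_bound wg_K y_measurable y_equation)+

end

theorem proposition2p5:
  fixes N M :: nat and h T :: real
    and K :: "(real ^ 'm::finite) set"
    and lag :: "'k::finite \<Rightarrow> nat"
    and f :: "real \<times> ((real ^ 'n::finite) ^ 'k) \<Rightarrow> real ^ 'n"
    and g :: "'m \<Rightarrow> real \<times> ((real ^ 'n) ^ 'k) \<Rightarrow> real ^ 'n"
    and x0 :: "real ^ 'n" and \<xi>0 :: "real \<Rightarrow> real ^ 'n"
    and \<mu> :: "real set \<Rightarrow> real ^ 'm" and \<nu> :: "real measure"
    and \<omega> :: "real \<Rightarrow> nat \<Rightarrow> real \<Rightarrow> real ^ 'm"
    and x :: "real \<Rightarrow> real ^ 'n" and v :: "real \<Rightarrow> real"
  assumes "N \<ge> 1" and "N \<ge> M" and "h > 0" and "T = real N * h"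
    and "closed K" and "cone K"
    and "bij_betw lag UNIV {0..M}"
    and "bounded (range f)" and "C1_map f"
    and "\<And>j. bounded (range (g j))" and "\<And>j. C1_map (g j)"
    and "continuous_on {- real M * h..0} \<xi>0"
    and "impulse_process K N M h lag f g x0 \<xi>0 \<mu> \<nu> \<omega> x v"
  shows "\<exists>(us :: nat \<Rightarrow> real \<Rightarrow> real ^ 'm) (xs :: nat \<Rightarrow> real \<Rightarrow> real ^ 'n) (vs :: nat \<Rightarrow> real \<Rightarrow> real).
    (\<forall>i. strict_sense_process K N M h lag f g x0 \<xi>0 (us i) (xs i) (vs i)) \<and>
    vector_weak_star T (\<lambda>i. stieltjes T (us i)) \<mu> \<and>
    weak_star T (\<lambda>i. total_variation T (stieltjes T (us i))) \<nu> \<and>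
    (\<forall>i. \<forall>A \<in> sets (borel_upto T).
       measure (total_variation T (stieltjes T (us i))) A = stieltjes T (vs i) A) \<and>
    vector_weak_star T (\<lambda>i. stieltjes T (xs i)) (stieltjes T x) \<and>
    (\<exists>E \<subseteq> {0..T}. {0..T} - E \<in> null_sets lebesgue \<and> 0 \<in> E \<and> T \<in> E \<and>
       (\<forall>t\<in>E. (\<lambda>i. xs i t) \<longlonglongrightarrow> x t \<and> (\<lambda>i. vs i t) \<longlonglongrightarrow> v t))"
proof -
  have control: "impulse_control K N h \<mu> \<nu> \<omega>" and sol: "impulse_solution N M h lag f g x0 \<xi>0 \<mu> \<nu> \<omega> x v"
    using assms(13) by (simp_all add: impulse_process_def)
  note sol' = sol[unfolded impulse_solution_def Let_def assms(4)[symmetric]]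
  have lag: "lag k \<le> M" for k using bij_betwE[OF assms(7)] by auto
  have "\<exists>\<zeta> \<theta>. impulse N M h T K lag f g x0 \<xi>0 \<mu> \<nu> \<omega> x v \<zeta> \<theta>"
    using sol' by (elim conjE exE, intro exI, intro impulse.intro[OF assms(1,3-6) lag assms(8-12) control]) blast+
  then obtain \<zeta> \<theta> where "impulse N M h T K lag f g x0 \<xi>0 \<mu> \<nu> \<omega> x v \<zeta> \<theta>" by blast
  then interpret impulse N M h T K lag f g x0 \<xi>0 \<mu> \<nu> \<omega> x v \<zeta> \<theta> .
  show ?thesis
  proof (rule graph_completion.approximation[OF graph_completion BV x_hist _ x_0 values_from_completion(1) \<mu>_pf \<nu>_sets \<nu>_finite \<nu>_pf v_0 values_from_completion(2)])
    show "\<xi>0 t = \<xi> t" if "t \<in> {- real M * h..<0}" for t using \<xi>_eq[of t] that by simp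
  qed
qed

end
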